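(* Let $\Omega$ be a domain in $\mathbb{C}$ containing $0$ and bounded by an analytic Jordan curve, and let $u$ be a negative, continuous, subharmonic exhaustion function for $\Omega$ with finite Monge-Ampère mass. Then the algebra $A(\Omega)$ is dense in $H^{p}_{u}(\Omega)$ for every $1\le p<\infty$.
   Context: $A(\Omega)$ is the algebra of functions holomorphic on $\Omega$ and continuous up to the boundary, i.e. on $\overline\Omega$. $u:\Omega\to[-\infty,0)$ is continuous as an extended-real-valued function; exhaustion means $B_u(r)=\{u<r\}$ is relatively compact in $\Omega$ for all $r<0$. For subharmonic $v$, $dd^c v$ denotes the positive Borel measure given by a fixed positive constant multiple of the distributional Laplacian $\Delta v$ (the choice of constant is immaterial). Finite Monge-Ampère mass means $\int_\Omega dd^c u<\infty$. For $r\in(-\infty,0)$ put $u_r=\max\{u,r\}$ and $\mu_{u,r}=dd^c u_r-\chi_{\Omega\setminus B_u(r)}\,dd^c u$, a positive measure supported on $S_u(r)=\{u=r\}$. $H^p_u(\Omega)$ is the Banach space of holomorphic $f$ on $\Omega$ with $\limsup_{r\to0^-}\int_{S_u(r)}|f|^p\,d\mu_{u,r}<\infty$, with norm $\|f\|_{H^p_u(\Omega)}=\left(\lim_{r\to0^-}\int_{S_u(r)}|f|^p\,d\mu_{u,r}\right)^{1/p}$. *)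

theory Defs
  imports "HOL-Complex_Analysis.Complex_Analysis"
begin

section \<open>Domains bounded by an analytic Jordan curve\<close>

text \<open>An analytic Jordan curve is the image of the unit circle under a map that is holomorphic and
  injective (hence conformal) on a neighbourhood of the circle.\<close>

definition analytic_Jordan_curve :: "complex set \<Rightarrow> bool" where
  "analytic_Jordan_curve C \<longleftrightarrow>
     (\<exists>V \<phi>. open V \<and> sphere 0 1 \<subseteq> V \<and> \<phi> holomorphic_on V \<and> inj_on \<phi> V \<and> C = \<phi> ` sphere 0 1)"

definition domain_bounded_by_analytic_Jordan_curve :: "complex set \<Rightarrow> bool" where
  "domain_bounded_by_analytic_Jordan_curve \<Omega> \<longleftrightarrow>
     open \<Omega> \<and> connected \<Omega> \<and> (\<exists>C. analytic_Jordan_curve C \<and> \<Omega> = inside C)"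

definition holo_continuous_algebra :: "complex set \<Rightarrow> (complex \<Rightarrow> complex) set" where
  "holo_continuous_algebra \<Omega> = {f. f holomorphic_on \<Omega> \<and> continuous_on (closure \<Omega>) f}"


section \<open>Subharmonic functions\<close>

text \<open>Mean over the circle of radius \<open>r\<close> about \<open>z\<close>, as the difference of the integrals of the
  positive part (\<open>e2ennreal\<close> sends negative values to 0) and of the negative part. It is used only
  for functions bounded above on the circle, so the first integral is finite and the value
  \<open>-\<infinity>\<close> is allowed.\<close>

definition circle_mean :: "(complex \<Rightarrow> ereal) \<Rightarrow> complex \<Rightarrow> real \<Rightarrow> ereal" where
  "circle_mean u z r =
     (enn2ereal (\<integral>\<^sup>+\<theta>\<in>{0..2*pi}. e2ennreal (u (z + rcis r \<theta>)) \<partial>lborel)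
      - enn2ereal (\<integral>\<^sup>+\<theta>\<in>{0..2*pi}. e2ennreal (- u (z + rcis r \<theta>)) \<partial>lborel)) / ereal (2*pi)"

text \<open>The function that is identically \<open>-\<infinity>\<close> is not counted as subharmonic (relevant for connected
  \<open>\<Omega>\<close>); it has no distributional Laplacian.\<close>

definition subharmonic_on :: "(complex \<Rightarrow> ereal) \<Rightarrow> complex set \<Rightarrow> bool" where
  "subharmonic_on u \<Omega> \<longleftrightarrow>
     (\<forall>z\<in>\<Omega>. u z < \<infinity>) \<and>
     (\<forall>c. openin (top_of_set \<Omega>) {z\<in>\<Omega>. u z < c}) \<and>
     (\<forall>z\<in>\<Omega>. \<forall>r>0. cball z r \<subseteq> \<Omega> \<longrightarrow> u z \<le> circle_mean u z r) \<and>
     (\<exists>z\<in>\<Omega>. u z \<noteq> -\<infinity>)"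


section \<open>The measure \<open>dd\<^sup>c v\<close>\<close>

primrec C_k :: "nat \<Rightarrow> (complex \<Rightarrow> real) \<Rightarrow> bool" where
  "C_k 0 f \<longleftrightarrow> continuous_on UNIV f"
| "C_k (Suc k) f \<longleftrightarrow>
     (\<forall>z. f differentiable (at z)) \<and> (\<forall>v. C_k k (\<lambda>z. frechet_derivative f (at z) v))"

definition test_function :: "complex set \<Rightarrow> (complex \<Rightarrow> real) \<Rightarrow> bool" where
  "test_function \<Omega> \<phi> \<longleftrightarrow>
     (\<forall>k. C_k k \<phi>) \<and> compact (closure {z. \<phi> z \<noteq> 0}) \<and> closure {z. \<phi> z \<noteq> 0} \<subseteq> \<Omega>"

definition dir_deriv :: "complex \<Rightarrow> (complex \<Rightarrow> real) \<Rightarrow> complex \<Rightarrow> real" where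
  "dir_deriv v f z = frechet_derivative f (at z) v"

definition laplacian :: "(complex \<Rightarrow> real) \<Rightarrow> complex \<Rightarrow> real" where
  "laplacian f z = dir_deriv 1 (dir_deriv 1 f) z + dir_deriv \<i> (dir_deriv \<i> f) z"

text \<open>\<open>M\<close> is a Radon measure on \<open>\<Omega>\<close> that represents \<open>\<kappa>\<close> times the distributional Laplacian of \<open>v\<close>.
  \<open>real_of_ereal\<close> changes \<open>v\<close> only where it is infinite, for subharmonic \<open>v\<close> a Lebesgue null set.
  Such an \<open>M\<close> is unique, and it exists for subharmonic \<open>v\<close>.\<close>

definition represents_ddc :: "real \<Rightarrow> complex set \<Rightarrow> (complex \<Rightarrow> ereal) \<Rightarrow> complex measure \<Rightarrow> bool" where
  "represents_ddc \<kappa> \<Omega> v M \<longleftrightarrow>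
     sets M = sets (restrict_space borel \<Omega>) \<and>
     (\<forall>K. compact K \<and> K \<subseteq> \<Omega> \<longrightarrow> emeasure M K < \<infinity>) \<and>
     (\<forall>\<phi>. test_function \<Omega> \<phi> \<longrightarrow>
        (LINT z|M. \<phi> z) = \<kappa> * (LINT z:\<Omega>|lborel. real_of_ereal (v z) * laplacian \<phi> z))"

definition ddc :: "real \<Rightarrow> complex set \<Rightarrow> (complex \<Rightarrow> ereal) \<Rightarrow> complex measure" where
  "ddc \<kappa> \<Omega> v = (THE M. represents_ddc \<kappa> \<Omega> v M)"


section \<open>Exhaustion functions and Poletsky--Stessin Hardy spaces\<close>

definition sublevel :: "complex set \<Rightarrow> (complex \<Rightarrow> ereal) \<Rightarrow> real \<Rightarrow> complex set" where
  "sublevel \<Omega> u r = {z\<in>\<Omega>. u z < ereal r}"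

definition level :: "complex set \<Rightarrow> (complex \<Rightarrow> ereal) \<Rightarrow> real \<Rightarrow> complex set" where
  "level \<Omega> u r = {z\<in>\<Omega>. u z = ereal r}"

definition exhaustion :: "complex set \<Rightarrow> (complex \<Rightarrow> ereal) \<Rightarrow> bool" where
  "exhaustion \<Omega> u \<longleftrightarrow>
     (\<forall>r<0. compact (closure (sublevel \<Omega> u r)) \<and> closure (sublevel \<Omega> u r) \<subseteq> \<Omega>)"

definition finite_MA_mass :: "real \<Rightarrow> complex set \<Rightarrow> (complex \<Rightarrow> ereal) \<Rightarrow> bool" where
  "finite_MA_mass \<kappa> \<Omega> u \<longleftrightarrow> emeasure (ddc \<kappa> \<Omega> u) \<Omega> < \<infinity>"

definition MA_level_measure ::
    "real \<Rightarrow> complex set \<Rightarrow> (complex \<Rightarrow> ereal) \<Rightarrow> real \<Rightarrow> complex measure" where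
  "MA_level_measure \<kappa> \<Omega> u r =
     diff_measure (ddc \<kappa> \<Omega> (\<lambda>z. max (u z) (ereal r)))
                  (density (ddc \<kappa> \<Omega> u) (indicator (\<Omega> - sublevel \<Omega> u r)))"

definition level_integral ::
    "real \<Rightarrow> complex set \<Rightarrow> (complex \<Rightarrow> ereal) \<Rightarrow> real \<Rightarrow> (complex \<Rightarrow> complex) \<Rightarrow> real \<Rightarrow> ennreal" where
  "level_integral \<kappa> \<Omega> u p f r =
     (\<integral>\<^sup>+z\<in>level \<Omega> u r. ennreal (cmod (f z) powr p) \<partial>MA_level_measure \<kappa> \<Omega> u r)"

text \<open>Elements of the space are represented by functions on \<open>\<complex>\<close>; only their values on \<open>\<Omega>\<close> matter.\<close>

definition hardy_space ::
    "real \<Rightarrow> complex set \<Rightarrow> (complex \<Rightarrow> ereal) \<Rightarrow> real \<Rightarrow> (complex \<Rightarrow> complex) set" where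
  "hardy_space \<kappa> \<Omega> u p =
     {f. f holomorphic_on \<Omega> \<and> Limsup (at_left 0) (level_integral \<kappa> \<Omega> u p f) < \<infinity>}"

definition hardy_norm ::
    "real \<Rightarrow> complex set \<Rightarrow> (complex \<Rightarrow> ereal) \<Rightarrow> real \<Rightarrow> (complex \<Rightarrow> complex) \<Rightarrow> real" where
  "hardy_norm \<kappa> \<Omega> u p f = enn2real (Lim (at_left 0) (level_integral \<kappa> \<Omega> u p f)) powr (1 / p)"

end

theory Submission
  imports Defs
begin

text \<open>Write \<open>\<mu>\<^sub>r\<close> for the level measures, \<open>N = dd\<^sup>c u\<close>, and let \<open>\<phi>\<close> be the Riemann map of \<open>\<Omega>\<close> with \<open>\<phi> 0 = 0\<close> and
  inverse \<open>\<psi>\<close>. For continuous subharmonic \<open>w\<close> the difference of the integrals of \<open>w\<close> against \<open>\<mu>\<^sub>r\<close> and of \<open>w\<close>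
  against \<open>N\<close> over \<open>u < r\<close> is nonnegative and increasing in \<open>r\<close>, and it vanishes for harmonic \<open>w\<close>. Hence a
  harmonic majorant of \<open>\<bar>f\<bar> powr p\<close> bounds the level integrals by its \<open>N\<close>-mass. Conversely every \<open>f\<close> in the Hardy
  space has a harmonic majorant \<open>Re E\<close> of finite \<open>N\<close>-mass, a limit of Poisson modifications of \<open>\<bar>f\<bar> powr p\<close>.
  By Harnack's inequality the level integrals of any \<open>F\<close> with \<open>\<bar>F\<bar> powr p \<le> Re E\<close> are therefore uniformly small
  as soon as the means of \<open>\<bar>F \<circ> \<psi>\<bar> powr p\<close> over the circles about 0 are, which reduces the theorem to two
  approximations on the disc. First, \<open>f\<close> is replaced by the bounded function \<open>f / (1 + \<delta> E)\<close>. Second, a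
  bounded \<open>F = T \<circ> \<phi>\<close> is replaced by \<open>z \<mapsto> T (s * \<theta> z)\<close>, where \<open>s < 1\<close> and \<open>\<theta>\<close> is holomorphic near the
  closure of \<open>\<Omega>\<close>, maps it into the disc, and is close to \<open>\<phi>\<close>.\<close>

section \<open>Smooth cutoff functions\<close>

text \<open>The level measures are never computed. They enter through integrals against
  \<open>M r\<close>, the measures of the truncations \<open>vr r\<close>, which are limits of the
  second differences \<open>J\<close>. These are linear in \<open>vr r\<close>; as
  \<open>vr r\<close> grows with \<open>r\<close> and the second differences of a subharmonic
  function are nonnegative, positivity and monotonicity in \<open>r\<close> follow for arbitrary
  level sets. Since \<open>u\<close> may be -\<infinity>, its local integrability has to be proved
  before its measure can be formed. The obstacle in the density proof lies near the boundary: a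
  small value at 0 controls a positive harmonic function on compact sets only, and beyond them the
  only control is domination by one fixed function of finite mass. A dilate of \<open>f\<close>
  would be dominated by a dilate of \<open>Re E\<close>, not by \<open>Re E\<close> itself. Hence
  the two stages, the first dominated by \<open>Re E\<close> and the second by a constant. In the
  second stage the factor \<open>s\<close> keeps the argument of \<open>T\<close> in a compact part
  of the disc, where \<open>T\<close> is Lipschitz, so that a crude closeness of \<theta> to \<phi>
  suffices.\<close>

lemma C_k_Suc_D: "C_k (Suc k) f \<Longrightarrow> C_k k f"
proof (induction k arbitrary: f)
  case 0
  then show ?case
    by (auto intro!: differentiable_imp_continuous_on simp: differentiable_on_def differentiable_at_withinI)
next
  case (Suc k)
  then show ?case by (metis C_k.simps(2))
qed

lemma C_k_const: "C_k k (\<lambda>z. c)"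
  by (induction k arbitrary: c) auto

lemma C_k_add: "C_k k f \<Longrightarrow> C_k k g \<Longrightarrow> C_k k (\<lambda>z. f z + g z)"
proof (induction k arbitrary: f g)
  case 0 then show ?case by (auto intro!: continuous_intros)
next
  case (Suc k)
  have "frechet_derivative (\<lambda>z. f z + g z) (at z) v
      = frechet_derivative f (at z) v + frechet_derivative g (at z) v" for z v
    by (rule fun_cong[OF frechet_derivative_at[symmetric]])
      (use Suc.prems in \<open>intro has_derivative_add; auto simp: frechet_derivative_works[symmetric]\<close>)
  with Suc show ?case by (auto intro: differentiable_add)
qed

lemma C_k_mult: "C_k k f \<Longrightarrow> C_k k g \<Longrightarrow> C_k k (\<lambda>z. f z * g z)"
proof (induction k arbitrary: f g)
  case 0 then show ?case by (auto intro!: continuous_intros)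
next
  case (Suc k)
  have d: "((\<lambda>z. f z * g z) has_derivative
      (\<lambda>v. f z * frechet_derivative g (at z) v + frechet_derivative f (at z) v * g z)) (at z)" for z
    using Suc.prems by (intro has_derivative_mult) (auto simp: frechet_derivative_works[symmetric])
  have e: "frechet_derivative (\<lambda>z. f z * g z) (at z)
      = (\<lambda>v. f z * frechet_derivative g (at z) v + frechet_derivative f (at z) v * g z)" for z
    using frechet_derivative_at[OF d] by simp
  have "C_k k f" "C_k k g" using Suc.prems C_k_Suc_D by blast+
  then show ?case
    using Suc d by (auto simp: e differentiable_def intro!: C_k_add)
qed

lemma C_k_minus: "C_k k f \<Longrightarrow> C_k k (\<lambda>z. - f z)"
  using C_k_mult[OF C_k_const[of k "-1"]] by simp

lemma C_k_diff: "C_k k f \<Longrightarrow> C_k k g \<Longrightarrow> C_k k (\<lambda>z. f z - g z)"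
  using C_k_add[OF _ C_k_minus] by fastforce

lemma C_k_sum: "(\<And>i. i \<in> I \<Longrightarrow> C_k k (f i)) \<Longrightarrow> C_k k (\<lambda>z. \<Sum>i\<in>I. f i z)"
  by (induction I rule: infinite_finite_induct) (auto intro: C_k_const C_k_add)

lemma C_k_bounded_linear:
  assumes "bounded_linear f" shows "C_k k f"
proof (cases k)
  case 0
  with assms show ?thesis by (simp add: linear_continuous_on)
next
  case (Suc k')
  have "frechet_derivative f (at z) = f" for z
    using bounded_linear_imp_has_derivative[OF assms] frechet_derivative_at by metis
  with assms Suc show ?thesis
    by (auto simp: C_k_const intro: bounded_linear_imp_differentiable)
qed

lemma C_k_real_polynomial: "real_polynomial_function p \<Longrightarrow> C_k k p"
  by (induction rule: real_polynomial_function.induct)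
    (auto intro: C_k_const C_k_add C_k_mult C_k_bounded_linear)

text \<open>Induction on \<open>k\<close> for a single \<open>F j\<close> breaks down because its
  derivative involves other members of the family. The induction therefore runs over all
  \<open>j\<close> at once: the chain rule returns a derivative of \<open>q\<close> times a finite
  linear combination of the same family.\<close>

lemma C_k_compose:
  assumes d: "\<And>j x. (F j has_real_derivative (G j x)) (at x)"
    and G: "\<And>j. G j = (\<lambda>x. \<Sum>i\<in>I j. c j i * F i x)"
    and q: "\<And>k. C_k k q"
  shows "C_k k (\<lambda>z. F j (q z))"
proof (induction k arbitrary: j)
  case 0
  have "continuous_on UNIV (F j)"
    using d by (auto intro!: DERIV_isCont continuous_at_imp_continuous_on)
  moreover have "continuous_on UNIV q" using q[of 0] by simp
  ultimately show ?case
    by (auto intro: continuous_on_compose2)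
next
  case (Suc k)
  have dq: "(q has_derivative frechet_derivative q (at z)) (at z)" for z
    using q[of "Suc k"] by (simp add: frechet_derivative_works[symmetric])
  have dF: "(F j has_derivative (\<lambda>h. h * G j x)) (at x)" for x
    using d[of j x] by (simp add: has_field_derivative_def mult.commute[of _ "G _ _"])
  have D: "((\<lambda>z. F j (q z)) has_derivative
      (\<lambda>v. frechet_derivative q (at z) v * G j (q z))) (at z)" for z
    using has_derivative_compose[OF dq dF] .
  have e: "frechet_derivative (\<lambda>z. F j (q z)) (at z) = (\<lambda>v. frechet_derivative q (at z) v * G j (q z))" for z
    using frechet_derivative_at[OF D] by simp
  have "C_k k (\<lambda>z. frechet_derivative q (at z) v)" for v
    using q[of "Suc k"] by simp
  moreover have "C_k k (\<lambda>z. G j (q z))"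
    unfolding G by (intro C_k_sum C_k_mult C_k_const Suc)
  ultimately show ?case
    using D by (auto simp: e differentiable_def intro!: C_k_mult)
qed

lemma C_k_inverse:
  assumes "C_k k g" and nz: "\<And>z. g z \<noteq> 0"
  shows "C_k k (\<lambda>z. inverse (g z))"
  using assms(1)
proof (induction k)
  case 0
  with nz show ?case by (auto intro!: continuous_intros)
next
  case (Suc k)
  have D: "((\<lambda>z. inverse (g z)) has_derivative
      (\<lambda>v. - (inverse (g z) * frechet_derivative g (at z) v * inverse (g z)))) (at z)" for z
    using Suc.prems by (intro Deriv.has_derivative_inverse nz) (auto simp: frechet_derivative_works[symmetric])
  have e: "frechet_derivative (\<lambda>z. inverse (g z)) (at z)
     = (\<lambda>v. - (inverse (g z) * frechet_derivative g (at z) v * inverse (g z)))" for z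
    using frechet_derivative_at[OF D] by simp
  have "C_k k g" using Suc.prems C_k_Suc_D by blast
  with Suc D show ?case
    by (auto simp: e differentiable_def intro!: C_k_mult C_k_minus)
qed

text \<open>The factor \<open>1 / x ^ j\<close> makes this family closed under differentiation up to linear combinations.\<close>

definition flat_exp :: "nat \<Rightarrow> real \<Rightarrow> real" where
  "flat_exp j x = (if x > 0 then inverse x ^ j * exp (- inverse x) else 0)"

text \<open>The substitution \<open>y = inverse h\<close> turns the right-hand limit into that of
  \<open>y ^ Suc j / exp y\<close>. Since \<open>flat_exp j 0 = 0\<close>, this is the difference
  quotient at 0 in \<open>flat_exp_deriv\<close>.\<close>

lemma flat_exp_div_tendsto: "((\<lambda>h. flat_exp j h / h) \<longlongrightarrow> 0) (at 0)"
proof (rule filterlim_split_at)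
  have "((\<lambda>y::real. y ^ Suc j / exp y) \<longlongrightarrow> 0) at_top" by (rule tendsto_power_div_exp_0)
  then have "((\<lambda>h::real. inverse h ^ Suc j / exp (inverse h)) \<longlongrightarrow> 0) (at_right 0)"
    by (rule filterlim_compose[OF _ filterlim_inverse_at_top_right])
  then show "((\<lambda>h. flat_exp j h / h) \<longlongrightarrow> 0) (at_right 0)"
    by (rule Lim_transform_eventually)
      (auto simp: eventually_at_right_field flat_exp_def exp_minus field_simps intro!: exI[of _ 1])
  show "((\<lambda>h. flat_exp j h / h) \<longlongrightarrow> 0) (at_left 0)"
    by (rule Lim_transform_eventually[OF tendsto_const])
      (auto simp: eventually_at_left_field flat_exp_def intro!: exI[of _ "-1"])
qed

lemma flat_exp_deriv:
  "(flat_exp j has_real_derivative (- real j * flat_exp (Suc j) x + flat_exp (j + 2) x)) (at x)"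
proof (cases x "0::real" rule: linorder_cases)
  case greater
  have "((\<lambda>x. inverse x ^ j * exp (- inverse x)) has_real_derivative
      (- real j * flat_exp (Suc j) x + flat_exp (j + 2) x)) (at x)"
  proof (cases j)
    case 0
    with greater show ?thesis
      by (auto intro!: derivative_eq_intros simp: flat_exp_def field_simps power2_eq_square)
  next
    case (Suc i)
    have "((\<lambda>x. inverse x ^ Suc i) has_real_derivative
       (real (Suc i) * inverse x ^ i * (- (inverse x * 1 * inverse x)))) (at x)"
      using DERIV_power[OF DERIV_inverse', of "\<lambda>x. x" 1 x UNIV "Suc i"] greater
      by (simp add: mult_ac)
    moreover have "((\<lambda>x. exp (- inverse x)) has_real_derivative exp (- inverse x) * (inverse x * inverse x)) (at x)"
      using greater by (auto intro!: derivative_eq_intros simp: field_simps power2_eq_square)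
    ultimately show ?thesis
      unfolding Suc using greater
      by (rule_tac DERIV_cong[OF DERIV_mult]) (auto simp: flat_exp_def field_simps)
  qed
  moreover have "\<forall>\<^sub>F y in nhds x. inverse y ^ j * exp (- inverse y) = flat_exp j y"
    using eventually_nhds_in_open[of "{0<..}" x] greater by (auto simp: flat_exp_def elim!: eventually_mono)
  ultimately show ?thesis
    using DERIV_cong_ev[OF refl _ refl] by force
next
  case less
  have "\<forall>\<^sub>F y in nhds x. 0 = flat_exp j y"
    using eventually_nhds_in_open[of "{..<0}" x] less by (auto simp: flat_exp_def elim!: eventually_mono)
  then show ?thesis
    using DERIV_cong_ev[of x x "\<lambda>_. 0" "flat_exp j" 0] less by (simp add: flat_exp_def)
next
  case equal
  have "flat_exp j 0 = 0" for j by (simp add: flat_exp_def)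
  then show ?thesis
    using flat_exp_div_tendsto[of j] equal by (simp add: DERIV_def)
qed

lemma C_k_flat_exp:
  assumes "\<And>k. C_k k q" shows "C_k k (\<lambda>z. flat_exp j (q z))"
proof (rule C_k_compose[where F=flat_exp and I="\<lambda>j. {Suc j, j+2}"
      and c="\<lambda>j i. if i = Suc j then - real j else 1", OF flat_exp_deriv])
qed (use assms in \<open>auto simp: fun_eq_iff\<close>)

lemma flat_exp_nonneg: "flat_exp j x \<ge> 0" and flat_exp_pos_iff: "flat_exp j x > 0 \<longleftrightarrow> x > 0"
  by (auto simp: flat_exp_def)

lemma flat_exp_eq_0_iff: "flat_exp j x = 0 \<longleftrightarrow> x \<le> 0"
  by (auto simp: flat_exp_def)

section \<open>Test functions and smooth cutoffs\<close>

abbreviation supp :: "(complex \<Rightarrow> real) \<Rightarrow> complex set" where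
  "supp \<phi> \<equiv> closure {z. \<phi> z \<noteq> 0}"

lemma not_in_suppD: "z \<notin> supp \<phi> \<Longrightarrow> \<phi> z = 0"
  using closure_subset[of "{z. \<phi> z \<noteq> 0}"] by blast

text \<open>Bumps over a finite cover of \<open>K\<close> add up to a smooth \<open>B\<close>
  bounded below on \<open>K\<close>, and a smooth step between two heights of \<open>B\<close>
  flattens it. The value 1 is attained on a whole neighbourhood \<open>V\<close>, so that a product
  with \<open>\<eta>\<close> agrees with its other factor near \<open>K\<close> and has the same
  means over small circles there.\<close>

lemma smooth_Urysohn:
  assumes "compact K" "open U" "K \<subseteq> U"
  obtains \<eta> V where "test_function U \<eta>" "\<And>z. 0 \<le> \<eta> z" "\<And>z. \<eta> z \<le> 1"
    "open V" "K \<subseteq> V" "\<And>z. z \<in> V \<Longrightarrow> \<eta> z = 1"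
proof -
  have "\<forall>a\<in>K. \<exists>R>0. cball a R \<subseteq> U"
    using assms by (metis in_mono open_contains_cball)
  then obtain R where R: "\<And>a. a \<in> K \<Longrightarrow> R a > 0 \<and> cball a (R a) \<subseteq> U"
    by (metis bchoice)
  obtain F where F: "F \<subseteq> K" "finite F" "K \<subseteq> (\<Union>a\<in>F. ball a (R a))"
  proof (rule compactE_image[OF \<open>compact K\<close>, of K "\<lambda>a. ball a (R a)"])
    show "K \<subseteq> (\<Union>a\<in>K. ball a (R a))" using R by force
  qed auto
  \<comment> \<open>A polynomial in the coordinates that is positive exactly on the ball about
    \<open>a\<close>; the flat exponential turns it into a smooth bump.\<close>
  define q where "q a z = (R a)\<^sup>2 - (Re (z - a) * Re (z - a) + Im (z - a) * Im (z - a))" for a z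
  have q: "C_k k (q a)" for k a
    unfolding q_def minus_complex.sel
    by (intro C_k_diff C_k_add C_k_mult C_k_const C_k_bounded_linear bounded_linear_Re bounded_linear_Im)
  have q_eq: "q a z = (R a)\<^sup>2 - (dist a z)\<^sup>2" for a z
    unfolding q_def dist_norm norm_minus_commute[of a z] cmod_power2 by (simp add: power2_eq_square)
  have q_pos: "q a z > 0 \<longleftrightarrow> z \<in> ball a (R a)" if "a \<in> K" for a z
    using R[OF that] abs_le_square_iff[of "R a" "dist a z"] by (auto simp: q_eq not_le[symmetric])
  define B where "B z = (\<Sum>a\<in>F. flat_exp 0 (q a z))" for z
  have CB: "C_k k B" for k
    unfolding B_def by (intro C_k_sum C_k_flat_exp q)
  then have contB: "continuous_on UNIV B" using C_k.simps(1) by blast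
  have B_pos: "B z > 0" if "z \<in> K" for z
  proof -
    have "z \<in> (\<Union>a\<in>F. ball a (R a))" using F(3) that by blast
    then obtain a where "a \<in> F" "z \<in> ball a (R a)" by blast
    then show ?thesis unfolding B_def using F q_pos
      by (intro sum_pos2[where i=a]) (auto simp: flat_exp_pos_iff flat_exp_nonneg)
  qed
  \<comment> \<open>The heights are \<open>c\<close>, below which \<open>\<eta>\<close> vanishes,
    \<open>2 * c\<close>, above which it is 1, and \<open>3 * c\<close>, which \<open>B\<close>
    reaches on \<open>K\<close>. The last gap makes \<open>{z. B z > 2 * c}\<close> an open set
    around \<open>K\<close>.\<close>
  have "\<exists>c>0. \<forall>z\<in>K. 3 * c \<le> B z"
  proof (cases "K = {}")
    case False
    then obtain x where "x \<in> K" "\<forall>z\<in>K. B x \<le> B z"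
      using continuous_attains_inf[of K B] assms contB continuous_on_subset by blast
    then show ?thesis using B_pos by (intro exI[of _ "B x / 3"]) auto
  qed (auto intro: exI[of _ 1])
  then obtain c where c: "c > 0" "\<And>z. z \<in> K \<Longrightarrow> 3 * c \<le> B z" by blast
  \<comment> \<open>The summands vanish for \<open>B z \<le> c\<close> and for
    \<open>B z \<ge> 2 * c\<close> respectively, never both at once, so the quotient in
    \<open>\<eta>\<close> is smooth.\<close>
  define D where "D z = flat_exp 0 (B z - c) + flat_exp 0 (2 * c - B z)" for z
  have "D z > 0" for z
  proof (cases "B z > c")
    case True
    then show ?thesis unfolding D_def by (intro add_pos_nonneg) (auto simp: flat_exp_pos_iff flat_exp_nonneg)
  next
    case False
    then show ?thesis using c(1) unfolding D_def
      by (intro add_nonneg_pos) (auto simp: flat_exp_pos_iff flat_exp_nonneg)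
  qed
  then have Dnz: "D z \<noteq> 0" and Dpos: "D z > 0" for z by (metis less_irrefl)+
  define \<eta> where "\<eta> z = flat_exp 0 (B z - c) * inverse (D z)" for z
  have C_eta: "C_k k \<eta>" for k
    unfolding \<eta>_def
    by (intro C_k_mult C_k_inverse Dnz) (auto simp: D_def intro!: C_k_add C_k_flat_exp C_k_diff C_k_const CB)
  have sub: "{z. \<eta> z \<noteq> 0} \<subseteq> (\<Union>a\<in>F. cball a (R a))"
  proof clarify
    fix z assume "\<eta> z \<noteq> 0"
    then have "B z > c" by (auto simp: \<eta>_def flat_exp_eq_0_iff)
    then have "B z \<noteq> 0" using c by auto
    then obtain a where "a \<in> F" "flat_exp 0 (q a z) \<noteq> 0"
      unfolding B_def by (meson sum.neutral)
    then have "z \<in> ball a (R a)" using q_pos F by (force simp: flat_exp_eq_0_iff)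
    with \<open>a \<in> F\<close> show "z \<in> (\<Union>a\<in>F. cball a (R a))" by (intro UN_I[of a]) auto
  qed
  have comp: "compact (\<Union>a\<in>F. cball a (R a))" using F by auto
  have suppsub: "supp \<eta> \<subseteq> (\<Union>a\<in>F. cball a (R a))"
    by (rule closure_minimal[OF sub compact_imp_closed[OF comp]])
  have "test_function U \<eta>"
    unfolding test_function_def
  proof (intro conjI allI)
    show "compact (supp \<eta>)"
      using compact_Int_closed[OF comp closed_closure, of "{z. \<eta> z \<noteq> 0}"] suppsub by (simp add: Int_absorb1)
    show "supp \<eta> \<subseteq> U" using suppsub F R by blast
  qed (use C_eta in auto)
  moreover have "0 \<le> \<eta> z" "\<eta> z \<le> 1" for z
    using Dpos[of z] flat_exp_nonneg[of 0 "2*c - B z"] by (auto simp: \<eta>_def flat_exp_nonneg D_def field_simps)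
  moreover have "open {z. B z > 2 * c}"
    using contB by (intro open_Collect_less) (auto intro: continuous_intros)
  moreover have "K \<subseteq> {z. B z > 2 * c}" using c by force
  moreover have "\<eta> z = 1" if "z \<in> {z. B z > 2 * c}" for z
  proof -
    have "flat_exp 0 (2 * c - B z) = 0" using that by (auto simp: flat_exp_eq_0_iff)
    then show ?thesis using Dnz[of z] by (simp add: \<eta>_def D_def)
  qed
  ultimately show thesis using that by blast
qed

lemma test_functionI:
  assumes "\<And>k. C_k k f" "compact K" "K \<subseteq> U" "\<And>z. z \<notin> K \<Longrightarrow> f z = 0"
  shows "test_function U f"
proof -
  have "supp f \<subseteq> K" using assms compact_imp_closed by (intro closure_minimal) auto
  moreover from this have "compact (supp f)"
    using compact_Int_closed[OF assms(2) closed_closure, of "{z. f z \<noteq> 0}"] by (simp add: Int_absorb1)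
  ultimately show ?thesis
    using assms(1,3) by (auto simp: test_function_def)
qed

lemma test_functionD:
  assumes "test_function U f"
  shows "C_k k f" "compact (supp f)" "supp f \<subseteq> U" "continuous_on UNIV f"
proof -
  show "C_k k f" for k using assms by (simp add: test_function_def)
  from this[of 0] show "continuous_on UNIV f" by simp
qed (use assms in \<open>auto simp: test_function_def\<close>)

lemma test_function_mono: "test_function U f \<Longrightarrow> U \<subseteq> W \<Longrightarrow> test_function W f"
  unfolding test_function_def by (meson order_trans)

lemma test_function_0: "test_function U (\<lambda>z. 0)"
  by (rule test_functionI[of _ "{}"]) (simp_all add: C_k_const)

lemma test_function_add:
  assumes "test_function U f" "test_function U g" shows "test_function U (\<lambda>z. f z + g z)"
proof (rule test_functionI[of _ "supp f \<union> supp g"])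
  show "C_k k (\<lambda>z. f z + g z)" for k
    by (rule C_k_add[OF test_functionD(1)[OF assms(1)] test_functionD(1)[OF assms(2)]])
  show "compact (supp f \<union> supp g)"
    by (rule compact_Un[OF test_functionD(2)[OF assms(1)] test_functionD(2)[OF assms(2)]])
  show "supp f \<union> supp g \<subseteq> U"
    using test_functionD(3)[OF assms(1)] test_functionD(3)[OF assms(2)] by (rule Un_least)
  show "f z + g z = 0" if "z \<notin> supp f \<union> supp g" for z
    by (metis UnI1 UnI2 add_0 not_in_suppD that)
qed

lemma test_function_mult_smooth:
  assumes "test_function U f" "\<And>k. C_k k g" shows "test_function U (\<lambda>z. f z * g z)"
proof (rule test_functionI[of _ "supp f"])
  show "C_k k (\<lambda>z. f z * g z)" for k
    by (rule C_k_mult[OF test_functionD(1)[OF assms(1)] assms(2)])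
  show "f z * g z = 0" if "z \<notin> supp f" for z
    by (metis mult_zero_left not_in_suppD that)
qed (fact test_functionD(2)[OF assms(1)] test_functionD(3)[OF assms(1)])+

lemma test_function_scale: "test_function U f \<Longrightarrow> test_function U (\<lambda>z. c * f z)"
  using test_function_mult_smooth[OF _ C_k_const, of U f c] by (simp add: mult.commute)

lemma test_function_diff:
  assumes "test_function U f" "test_function U g" shows "test_function U (\<lambda>z. f z - g z)"
  using test_function_add[OF assms(1) test_function_scale[OF assms(2), of "-1"]] by simp

lemma test_function_sum:
  "(\<And>i. i \<in> I \<Longrightarrow> test_function U (f i)) \<Longrightarrow> test_function U (\<lambda>z. \<Sum>i\<in>I. f i z)"
proof (induction I rule: infinite_finite_induct)
  case (insert i I)
  then have "test_function U (\<lambda>z. f i z + (\<Sum>j\<in>I. f j z))"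
    by (intro test_function_add) auto
  with insert.hyps show ?case by simp
qed (simp_all add: test_function_0)

lemma test_function_bounded:
  assumes "test_function U f" obtains B where "\<And>z. \<bar>f z\<bar> \<le> B" "B \<ge> 0"
proof -
  have "compact (f ` supp f)"
    by (rule compact_continuous_image[OF continuous_on_subset[OF test_functionD(4)[OF assms] subset_UNIV]
          test_functionD(2)[OF assms]])
  from compact_imp_bounded[OF this] obtain B where "\<forall>x\<in>f ` supp f. norm x \<le> B"
    unfolding bounded_iff by blast
  then have "\<bar>f z\<bar> \<le> B" if "z \<in> supp f" for z using that by auto
  then have "\<bar>f z\<bar> \<le> max B 0" for z using not_in_suppD[of z f] by force
  then show thesis using that[of "max B 0"] by auto
qed

lemma test_function_measurable [measurable_dest]: "test_function U f \<Longrightarrow> f \<in> borel_measurable borel"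
  using borel_measurable_continuous_onI[OF test_functionD(4)] .

text \<open>Equality with 1 from some index on, together with the bounds 0 and 1, is the form in
  which dominated convergence recovers the measure of \<open>U\<close> from integrals of test
  functions.\<close>

lemma open_compact_exhaustion_test:
  assumes "open U"
  obtains \<eta> where "\<And>n::nat. test_function U (\<eta> n)" "\<And>n z. 0 \<le> \<eta> n z" "\<And>n z. \<eta> n z \<le> 1"
    "\<And>z. z \<in> U \<Longrightarrow> \<forall>\<^sub>F n in sequentially. \<eta> n z = 1"
proof -
  obtain C where C: "\<And>n. compact (C n)" "\<And>n::nat. C n \<subseteq> U"
    "\<And>K. \<lbrakk>compact K; K \<subseteq> U\<rbrakk> \<Longrightarrow> \<exists>N. \<forall>n\<ge>N. K \<subseteq> C n"
    using open_Union_compact_subsets[OF assms] by metis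
  have "\<exists>\<eta>. test_function U \<eta> \<and> (\<forall>z. 0 \<le> \<eta> z) \<and> (\<forall>z. \<eta> z \<le> 1) \<and> (\<forall>z\<in>C n. \<eta> z = 1)" for n
  proof -
    obtain \<eta> V where "test_function U \<eta>" "\<And>z. 0 \<le> \<eta> z" "\<And>z. \<eta> z \<le> 1"
      "open V" "C n \<subseteq> V" "\<And>z. z \<in> V \<Longrightarrow> \<eta> z = 1"
      using smooth_Urysohn[OF C(1) assms C(2), of n] by blast
    then show ?thesis by blast
  qed
  then obtain \<eta> where \<eta>: "\<And>n. test_function U (\<eta> n) \<and> (\<forall>z. 0 \<le> \<eta> n z) \<and> (\<forall>z. \<eta> n z \<le> 1) \<and> (\<forall>z\<in>C n. \<eta> n z = 1)"
    by metis
  show thesis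
  proof (rule that[of \<eta>])
    show "\<forall>\<^sub>F n in sequentially. \<eta> n z = 1" if "z \<in> U" for z
    proof -
      obtain N where "\<forall>n\<ge>N. {z} \<subseteq> C n" using C(3)[of "{z}"] \<open>z \<in> U\<close> by auto
      then have "\<forall>n\<ge>N. \<eta> n z = 1" using \<eta> by simp
      then show ?thesis unfolding eventually_sequentially by blast
    qed
  qed (use \<eta> in auto)
qed

section \<open>The Riesz representation theorem for positive functionals on test functions\<close>

definition radon_on :: "complex set \<Rightarrow> complex measure \<Rightarrow> bool" where
  "radon_on \<Omega> M \<longleftrightarrow> sets M = sets (restrict_space borel \<Omega>) \<and>
     (\<forall>K. compact K \<and> K \<subseteq> \<Omega> \<longrightarrow> emeasure M K < \<infinity>)"

lemma radon_on_space: "radon_on \<Omega> M \<Longrightarrow> space M = \<Omega>"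
  using sets_eq_imp_space_eq[of M "restrict_space borel \<Omega>"] by (simp add: radon_on_def space_restrict_space)

lemma radon_on_measurable:
  assumes "radon_on \<Omega> M" "f \<in> borel_measurable borel" shows "f \<in> borel_measurable M"
proof -
  have "f \<in> borel_measurable (restrict_space borel \<Omega>)"
    by (rule measurable_restrict_space1[OF assms(2)])
  then show ?thesis
    using measurable_cong_sets[OF conjunct1[OF assms(1)[unfolded radon_on_def]] refl, of borel] by metis
qed

lemma radon_on_sets:
  assumes "radon_on \<Omega> M" "A \<in> sets borel" "A \<subseteq> \<Omega>" shows "A \<in> sets M"
proof -
  have "A = \<Omega> \<inter> A" using assms(3) by blast
  then show ?thesis using assms(1,2) by (auto simp: radon_on_def sets_restrict_space)
qed

lemma radon_on_integrable:
  fixes f :: "complex \<Rightarrow> real"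
  assumes M: "radon_on \<Omega> M" and f: "f \<in> borel_measurable borel" and K: "compact K" "K \<subseteq> \<Omega>"
    and "\<And>z. z \<in> K \<Longrightarrow> \<bar>f z\<bar> \<le> B" and "\<And>z. z \<in> \<Omega> \<Longrightarrow> z \<notin> K \<Longrightarrow> f z = 0"
  shows "integrable M f"
proof (rule integrableI_bounded_set[of K])
  show "K \<in> sets M" using radon_on_sets[OF M borel_compact[OF K(1)] K(2)] .
  show "emeasure M K < \<infinity>" using M K by (simp add: radon_on_def)
qed (use assms radon_on_measurable[OF M f] radon_on_space[OF M] in auto)

lemma radon_on_integrable_test:
  assumes "radon_on \<Omega> M" "test_function \<Omega> f" shows "integrable M f"
proof -
  obtain B where "\<And>z. \<bar>f z\<bar> \<le> B" using test_function_bounded[OF assms(2)] by blast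
  then show ?thesis
    by (intro radon_on_integrable[OF assms(1) test_function_measurable[OF assms(2)] test_functionD(2)[OF assms(2)]
          test_functionD(3)[OF assms(2)]])
       (auto simp del: closure_of_eq intro: not_in_suppD)
qed

lemma test_one_tendsto_measure:
  assumes M: "radon_on \<Omega> M" and U: "open U" "U \<subseteq> \<Omega>" "emeasure M U < \<infinity>"
    and \<eta>: "\<And>n::nat. test_function U (\<eta> n)" "\<And>n z. 0 \<le> \<eta> n z" "\<And>n z. \<eta> n z \<le> 1"
    "\<And>z. z \<in> U \<Longrightarrow> \<forall>\<^sub>F n in sequentially. \<eta> n z = 1"
  shows "(\<lambda>n. LINT z|M. \<eta> n z) \<longlonglongrightarrow> measure M U"
proof -
  have UM: "U \<in> sets M" using radon_on_sets[OF M _ U(2)] U(1) by simp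
  have out: "\<eta> n z = 0" if "z \<notin> U" for n z
    using that test_functionD(3)[OF \<eta>(1)] not_in_suppD by blast
  have "(\<lambda>n. LINT z|M. \<eta> n z) \<longlonglongrightarrow> (LINT z|M. indicator U z)"
  proof (rule integral_dominated_convergence[where w="indicator U"])
    show "\<eta> n \<in> borel_measurable M" for n
      by (rule radon_on_measurable[OF M test_function_measurable[OF \<eta>(1)]])
    show "AE z in M. (\<lambda>n. \<eta> n z) \<longlonglongrightarrow> indicator U z"
    proof (rule AE_I2)
      fix z
      show "(\<lambda>n. \<eta> n z) \<longlonglongrightarrow> indicator U z"
      proof (cases "z \<in> U")
        case True
        then have "\<forall>\<^sub>F n in sequentially. \<eta> n z = indicator U z" using \<eta>(4)[OF True] by simp
        then show ?thesis by (rule tendsto_eventually)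
      qed (simp add: out)
    qed
    show "AE z in M. norm (\<eta> n z) \<le> indicator U z" for n
      using \<eta>(2,3) out by (auto simp: indicator_def)
  qed (use UM U(3) in auto)
  then show ?thesis using UM by simp
qed

text \<open>Relatively compact open sets are stable under intersection and have finite mass for
  every Radon measure on \<Omega>, which is what the uniqueness theorem for measures asks of a
  generator. The sets where the functions of an exhausting sequence are positive cover \<Omega> and
  cut every open set into members of \<open>E\<close>, so these generate.\<close>

lemma restrict_borel_eq_sigma_sets:
  assumes "open \<Omega>"
  defines "E \<equiv> {U. open U \<and> (\<exists>K. compact K \<and> U \<subseteq> K \<and> K \<subseteq> \<Omega>)}"
  shows "sets (restrict_space borel \<Omega>) = sigma_sets \<Omega> E"
    and "\<exists>A :: nat \<Rightarrow> complex set. range A \<subseteq> E \<and> \<Union>(range A) = \<Omega>"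
proof -
  obtain \<eta> where \<eta>: "\<And>n::nat. test_function \<Omega> (\<eta> n)" "\<And>n z. 0 \<le> \<eta> n z" "\<And>n z. \<eta> n z \<le> 1"
    "\<And>z. z \<in> \<Omega> \<Longrightarrow> \<forall>\<^sub>F n in sequentially. \<eta> n z = 1"
    using open_compact_exhaustion_test[OF assms(1)] by blast
  define A where "A n = {z. \<eta> n z > 0}" for n
  have Aop: "open (A n)" for n
    unfolding A_def by (intro open_Collect_less test_functionD(4)[OF \<eta>(1)] continuous_on_const)
  have AE: "A n \<subseteq> supp (\<eta> n)" for n
    using closure_subset[of "{z. \<eta> n z \<noteq> 0}"] by (force simp: A_def)
  have A: "S \<inter> A n \<in> E" if "open S" for n S
  proof -
    have "open (S \<inter> A n)" "S \<inter> A n \<subseteq> supp (\<eta> n)" using that Aop[of n] AE[of n] by auto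
    then show ?thesis unfolding E_def
      using test_functionD(2)[OF \<eta>(1)[of n]] test_functionD(3)[OF \<eta>(1)[of n]] by blast
  qed
  have U: "\<Union>(range A) = \<Omega>"
  proof (intro equalityI subsetI)
    fix z assume "z \<in> \<Omega>"
    from eventually_happens'[OF _ \<eta>(4)[OF this]] obtain n where "\<eta> n z = 1" by auto
    then show "z \<in> \<Union>(range A)" by (auto simp: A_def intro!: exI[of _ n])
  next
    fix z assume "z \<in> \<Union>(range A)"
    then show "z \<in> \<Omega>" using AE test_functionD(3)[OF \<eta>(1)] by blast
  qed
  have EPow: "E \<subseteq> Pow \<Omega>" by (auto simp: E_def)
  have *: "S \<inter> \<Omega> \<in> sigma_sets \<Omega> E" if "S \<in> sigma_sets UNIV {S. open S}" for S
    using that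
  proof induction
    case (Basic S)
    have "S \<inter> \<Omega> = (\<Union>n. S \<inter> A n)" using U by blast
    also have "\<dots> \<in> sigma_sets \<Omega> E"
      using A Basic by (intro sigma_sets.Union sigma_sets.Basic) auto
    finally show ?case .
  next
    case (Compl S)
    have "(UNIV - S) \<inter> \<Omega> = \<Omega> - (S \<inter> \<Omega>)" by blast
    then show ?case using sigma_sets.Compl[OF Compl.IH] by simp
  next
    case (Union B)
    have "(\<Union>i. B i) \<inter> \<Omega> = (\<Union>i. B i \<inter> \<Omega>)" by blast
    then show ?case using sigma_sets.Union[of "\<lambda>i. B i \<inter> \<Omega>", OF Union.IH] by simp
  qed (simp add: sigma_sets.Empty)
  show "sets (restrict_space borel \<Omega>) = sigma_sets \<Omega> E"
  proof (intro equalityI subsetI)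
    fix X assume "X \<in> sets (restrict_space borel \<Omega>)"
    then obtain S where "S \<in> sets borel" "X = S \<inter> \<Omega>"
      by (auto simp: sets_restrict_space Int_commute)
    then show "X \<in> sigma_sets \<Omega> E" using * by (simp add: borel_def)
  next
    have "sigma_algebra \<Omega> (sets (restrict_space borel \<Omega>))"
      using sets.sigma_algebra_axioms[of "restrict_space borel \<Omega>"] by (simp add: space_restrict_space)
    moreover have "E \<subseteq> sets (restrict_space borel \<Omega>)"
      using assms(1) by (auto simp: E_def sets_restrict_space_iff)
    ultimately have "sigma_sets \<Omega> E \<subseteq> sets (restrict_space borel \<Omega>)"
      by (rule sigma_algebra.sigma_sets_subset)
    then show "X \<in> sets (restrict_space borel \<Omega>)" if "X \<in> sigma_sets \<Omega> E" for X using that by blast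
  qed
  have "range A \<subseteq> E" using A[of UNIV] by auto
  then show "\<exists>A :: nat \<Rightarrow> complex set. range A \<subseteq> E \<and> \<Union>(range A) = \<Omega>" using U by metis
qed

lemma radon_on_unique:
  assumes "open \<Omega>" and M: "radon_on \<Omega> M" and N: "radon_on \<Omega> N"
    and eq: "\<And>\<phi>. test_function \<Omega> \<phi> \<Longrightarrow> (LINT z|M. \<phi> z) = (LINT z|N. \<phi> z)"
  shows "M = N"
proof -
  let ?E = "{U. open U \<and> (\<exists>K. compact K \<and> U \<subseteq> K \<and> K \<subseteq> \<Omega>)}"
  note gen = restrict_borel_eq_sigma_sets[OF assms(1)]
  from gen(2) obtain A :: "nat \<Rightarrow> complex set" where A0: "range A \<subseteq> ?E \<and> \<Union>(range A) = \<Omega>"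
    by (rule exE)
  note A = conjunct1[OF A0] conjunct2[OF A0]
  have fin: "emeasure P U < \<infinity>" if "U \<in> ?E" "radon_on \<Omega> P" for U P
  proof -
    from that(1) obtain K where K: "compact K" "U \<subseteq> K" "K \<subseteq> \<Omega>" by blast
    have "emeasure P U \<le> emeasure P K"
      using radon_on_sets[OF that(2) borel_compact[OF K(1)] K(3)] K by (intro emeasure_mono) auto
    also have "\<dots> < \<infinity>" using K that(2) by (simp add: radon_on_def)
    finally show ?thesis .
  qed
  show ?thesis
  proof (rule measure_eqI_generator_eq)
    show "Int_stable ?E" unfolding Int_stable_def by blast
    show "?E \<subseteq> Pow \<Omega>" by blast
    show "sets M = sigma_sets \<Omega> ?E" "sets N = sigma_sets \<Omega> ?E" using gen(1) M N by (auto simp: radon_on_def)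
    show "range A \<subseteq> ?E" "\<Union>(range A) = \<Omega>" using A by auto
    show "emeasure M (A i) \<noteq> \<infinity>" for i
    proof -
      have "A i \<in> ?E" using A(1) by blast
      from fin[OF this M] show ?thesis by simp
    qed
    fix U assume U: "U \<in> ?E"
    then have Uo: "open U" "U \<subseteq> \<Omega>" by blast+
    obtain \<eta> where \<eta>: "\<And>n::nat. test_function U (\<eta> n)" "\<And>n z. 0 \<le> \<eta> n z" "\<And>n z. \<eta> n z \<le> 1"
      "\<And>z. z \<in> U \<Longrightarrow> \<forall>\<^sub>F n in sequentially. \<eta> n z = 1"
      using open_compact_exhaustion_test[OF Uo(1)] by blast
    have "(\<lambda>n. LINT z|M. \<eta> n z) \<longlonglongrightarrow> measure M U"
      by (rule test_one_tendsto_measure[OF M Uo fin[OF U M] \<eta>])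
    moreover have "(\<lambda>n. LINT z|N. \<eta> n z) \<longlonglongrightarrow> measure N U"
      by (rule test_one_tendsto_measure[OF N Uo fin[OF U N] \<eta>])
    moreover have "(LINT z|M. \<eta> n z) = (LINT z|N. \<eta> n z)" for n
      by (rule eq[OF test_function_mono[OF \<eta>(1) Uo(2)]])
    ultimately have "measure M U = measure N U"
      using LIMSEQ_unique by simp
    then show "emeasure M U = emeasure N U"
      using fin[OF U M] fin[OF U N] by (simp add: emeasure_eq_ennreal_measure)
  qed
qed

text \<open>Nonnegative test functions with nonpositive integral vanish almost everywhere; applied
  to a sequence that is eventually 1 at each point of \<open>U\<close>, this leaves no mass on
  \<open>U\<close>.\<close>

lemma radon_on_null_open:
  assumes M: "radon_on \<Omega> M" and U: "open U" "U \<subseteq> \<Omega>"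
    and z: "\<And>\<phi>. test_function U \<phi> \<Longrightarrow> (\<And>z. 0 \<le> \<phi> z) \<Longrightarrow> (LINT z|M. \<phi> z) \<le> 0"
  shows "emeasure M U = 0"
proof -
  obtain \<eta> where \<eta>: "\<And>n::nat. test_function U (\<eta> n)" "\<And>n z. 0 \<le> \<eta> n z" "\<And>n z. \<eta> n z \<le> 1"
    "\<And>z. z \<in> U \<Longrightarrow> \<forall>\<^sub>F n in sequentially. \<eta> n z = 1"
    using open_compact_exhaustion_test[OF U(1)] by blast
  have "AE z in M. \<eta> n z = 0" for n
  proof -
    have i: "integrable M (\<eta> n)"
      by (rule radon_on_integrable_test[OF M test_function_mono[OF \<eta>(1) U(2)]])
    have "(LINT z|M. \<eta> n z) = 0"
      using z[OF \<eta>(1) \<eta>(2), of n] Bochner_Integration.integral_nonneg[of M "\<eta> n"] \<eta>(2)[of n] by fastforce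
    then show ?thesis
      using integral_nonneg_eq_0_iff_AE[OF i] \<eta>(2) by simp
  qed
  then have "AE z in M. \<forall>n. \<eta> n z = 0" by (simp add: AE_all_countable)
  then have "AE z in M. z \<notin> U"
  proof (rule eventually_mono)
    fix z assume "\<forall>n. \<eta> n z = 0"
    then show "z \<notin> U" using eventually_happens'[OF _ \<eta>(4)[of z]] by auto
  qed
  then show ?thesis
    using AE_iff_measurable[of U M "\<lambda>z. z \<notin> U"] radon_on_sets[OF M _ U(2)] U radon_on_space[OF M] by auto
qed

section \<open>The measure of a positive functional\<close>

locale positive_functional =
  fixes \<Omega> :: "complex set" and L :: "(complex \<Rightarrow> real) \<Rightarrow> real"
  assumes op: "open \<Omega>"
    and L_add: "\<And>f g. test_function \<Omega> f \<Longrightarrow> test_function \<Omega> g \<Longrightarrow> L (\<lambda>z. f z + g z) = L f + L g"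
    and L_scale: "\<And>c f. test_function \<Omega> f \<Longrightarrow> L (\<lambda>z. c * f z) = c * L f"
    and L_pos: "\<And>f. test_function \<Omega> f \<Longrightarrow> (\<And>z. 0 \<le> f z) \<Longrightarrow> 0 \<le> L f"
begin

lemma L_diff: "test_function \<Omega> f \<Longrightarrow> test_function \<Omega> g \<Longrightarrow> L (\<lambda>z. f z - g z) = L f - L g"
  using L_add[OF _ test_function_scale[of \<Omega> g "-1"]] L_scale[of g "-1"] by simp

lemma L_mono:
  assumes "test_function \<Omega> f" "test_function \<Omega> g" "\<And>z. f z \<le> g z" shows "L f \<le> L g"
  using L_pos[OF test_function_diff[OF assms(2,1)]] L_diff[OF assms(2,1)] assms(3) by simp

lemma L_sum:
  "(\<And>i. i \<in> I \<Longrightarrow> test_function \<Omega> (f i)) \<Longrightarrow> L (\<lambda>z. \<Sum>i\<in>I. f i z) = (\<Sum>i\<in>I. L (f i))"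
proof (induction I rule: infinite_finite_induct)
  case (insert i I)
  have "L (\<lambda>z. f i z + (\<Sum>j\<in>I. f j z)) = L (f i) + L (\<lambda>z. \<Sum>j\<in>I. f j z)"
    using insert.prems by (intro L_add test_function_sum) auto
  with insert show ?case by simp
qed (use L_scale[OF test_function_0, of 0] in simp_all)

definition below :: "complex set \<Rightarrow> (complex \<Rightarrow> real) set" where
  "below U = {\<phi>. test_function U \<phi> \<and> (\<forall>z. 0 \<le> \<phi> z \<and> \<phi> z \<le> 1)}"

text \<open>The content of open sets in the Riesz construction; \<open>mu\<close> is the outer
  measure that it generates.\<close>

definition m :: "complex set \<Rightarrow> ennreal" where "m U = (SUP \<phi>\<in>below U. ennreal (L \<phi>))"

definition mu :: "complex set \<Rightarrow> ennreal" where
  "mu A = (INF U\<in>{U. open U \<and> A \<subseteq> U \<and> U \<subseteq> \<Omega>}. m U)"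

lemma belowD: assumes "\<phi> \<in> below U" shows "test_function U \<phi>" "0 \<le> \<phi> z" "\<phi> z \<le> 1" "U \<subseteq> \<Omega> \<Longrightarrow> test_function \<Omega> \<phi>"
  using assms test_function_mono by (auto simp: below_def)

lemma below_mono: "U \<subseteq> W \<Longrightarrow> below U \<subseteq> below W"
  using test_function_mono by (auto simp: below_def)

lemma m_mono: "U \<subseteq> W \<Longrightarrow> m U \<le> m W"
  unfolding m_def by (rule SUP_subset_mono[OF below_mono]) auto

lemma m_upper: "\<phi> \<in> below U \<Longrightarrow> ennreal (L \<phi>) \<le> m U"
  unfolding m_def by (rule SUP_upper)

lemma mu_open: "open U \<Longrightarrow> U \<subseteq> \<Omega> \<Longrightarrow> mu U = m U"
  unfolding mu_def by (rule antisym[OF INF_lower INF_greatest]) (auto intro: m_mono)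

lemma mu_mono: "A \<subseteq> B \<Longrightarrow> mu A \<le> mu B"
  unfolding mu_def by (rule INF_superset_mono) auto

lemma m_empty: "m {} = 0"
proof -
  have "\<phi> = (\<lambda>z. 0)" if "\<phi> \<in> below {}" for \<phi>
  proof
    fix z show "\<phi> z = 0"
      using test_functionD(3)[OF belowD(1)[OF that]] not_in_suppD[of z \<phi>] by blast
  qed
  then have "L \<phi> = 0" if "\<phi> \<in> below {}" for \<phi> using that L_scale[OF test_function_0, of 0] by simp
  then show ?thesis unfolding m_def by (intro antisym SUP_least) auto
qed

text \<open>A function supported in the union is split by a cutoff that is 1 near the part of its
  support outside \<open>W\<close>: the product lives in \<open>U\<close>, and the remainder
  vanishes near that part, hence lives in \<open>W\<close>.\<close>

lemma m_Un:
  assumes U: "open U" "U \<subseteq> \<Omega>" and W: "open W" "W \<subseteq> \<Omega>"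
  shows "m (U \<union> W) \<le> m U + m W"
  unfolding m_def[of "U \<union> W"]
proof (rule SUP_least)
  fix \<phi> assume \<phi>: "\<phi> \<in> below (U \<union> W)"
  note t = belowD(1)[OF \<phi>]
  have UWO: "U \<union> W \<subseteq> \<Omega>" using U W by blast
  have K: "compact (supp \<phi> - W)" "supp \<phi> - W \<subseteq> U"
    using test_functionD(2,3)[OF t] W by (auto intro: compact_diff)
  obtain \<eta> V where \<eta>: "test_function U \<eta>" "\<And>z. 0 \<le> \<eta> z" "\<And>z. \<eta> z \<le> 1"
    "open V" "supp \<phi> - W \<subseteq> V" "\<And>z. z \<in> V \<Longrightarrow> \<eta> z = 1"
    using smooth_Urysohn[OF K(1) U(1) K(2)] by blast
  have 1: "test_function U (\<lambda>z. \<eta> z * \<phi> z)"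
    by (rule test_function_mult_smooth[OF \<eta>(1) test_functionD(1)[OF t]])
  have 2: "test_function W (\<lambda>z. \<phi> z - \<eta> z * \<phi> z)"
  proof (rule test_functionI[of _ "supp \<phi> - V"])
    show "C_k k (\<lambda>z. \<phi> z - \<eta> z * \<phi> z)" for k
      by (intro C_k_diff C_k_mult test_functionD(1)[OF t] test_functionD(1)[OF \<eta>(1)])
    show "compact (supp \<phi> - V)" by (rule compact_diff[OF test_functionD(2)[OF t] \<eta>(4)])
    show "supp \<phi> - V \<subseteq> W" using \<eta>(5) by blast
    show "\<phi> z - \<eta> z * \<phi> z = 0" if "z \<notin> supp \<phi> - V" for z
    proof (cases "z \<in> V")
      case False
      then have "z \<notin> supp \<phi>" using that by blast
      from not_in_suppD[OF this] show ?thesis by simp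
    qed (simp add: \<eta>(6))
  qed
  have b1: "(\<lambda>z. \<eta> z * \<phi> z) \<in> below U"
    using 1 \<eta>(2,3) belowD(2,3)[OF \<phi>] by (auto simp: below_def mult_le_one)
  have b2: "(\<lambda>z. \<phi> z - \<eta> z * \<phi> z) \<in> below W"
  proof -
    have "0 \<le> \<phi> z - \<eta> z * \<phi> z \<and> \<phi> z - \<eta> z * \<phi> z \<le> 1" for z
    proof -
      have "\<eta> z * \<phi> z \<le> 1 * \<phi> z" by (rule mult_right_mono[OF \<eta>(3) belowD(2)[OF \<phi>]])
      moreover have "0 \<le> \<eta> z * \<phi> z" using \<eta>(2) belowD(2)[OF \<phi>] by simp
      ultimately show ?thesis using belowD(3)[OF \<phi>, of z] by auto
    qed
    with 2 show ?thesis by (auto simp: below_def)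
  qed
  have "L \<phi> = L (\<lambda>z. \<eta> z * \<phi> z + (\<phi> z - \<eta> z * \<phi> z))" by simp
  also have "\<dots> = L (\<lambda>z. \<eta> z * \<phi> z) + L (\<lambda>z. \<phi> z - \<eta> z * \<phi> z)"
    by (rule L_add[OF test_function_mono[OF 1 U(2)] test_function_mono[OF 2 W(2)]])
  finally have "ennreal (L \<phi>) \<le> ennreal (L (\<lambda>z. \<eta> z * \<phi> z)) + ennreal (L (\<lambda>z. \<phi> z - \<eta> z * \<phi> z))"
    using L_pos[OF belowD(4)[OF b1 U(2)] belowD(2)[OF b1]] L_pos[OF belowD(4)[OF b2 W(2)] belowD(2)[OF b2]]
    by (simp add: ennreal_plus)
  also have "\<dots> \<le> m U + m W" by (intro add_mono m_upper b1 b2)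
  finally show "ennreal (L \<phi>) \<le> m U + m W" .
qed

lemma m_finite_Un:
  "(\<And>i. open (U i) \<and> U i \<subseteq> \<Omega>) \<Longrightarrow> m (\<Union>i<n. U i) \<le> (\<Sum>i<n::nat. m (U i))"
proof (induction n)
  case (Suc n)
  have "m (\<Union>i<Suc n. U i) \<le> m (\<Union>i<n. U i) + m (U n)"
    using m_Un[of "\<Union>i<n. U i" "U n"] Suc.prems by (auto simp: lessThan_Suc Un_commute)
  also have "\<dots> \<le> (\<Sum>i<n. m (U i)) + m (U n)" by (intro add_right_mono Suc)
  finally show ?case by simp
qed (simp add: m_empty)

text \<open>The support of a competitor is compact, so finitely many of the sets cover it and finite
  subadditivity suffices.\<close>

lemma m_countable_Un:
  assumes "\<And>i. open (U i) \<and> U i \<subseteq> \<Omega>"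
  shows "m (\<Union>i. U i) \<le> (\<Sum>i::nat. m (U i))"
  unfolding m_def[of "\<Union>i. U i"]
proof (rule SUP_least)
  fix \<phi> assume \<phi>: "\<phi> \<in> below (\<Union>i. U i)"
  note t = belowD(1)[OF \<phi>]
  obtain C where C: "C \<subseteq> UNIV" "finite C" "supp \<phi> \<subseteq> (\<Union>i\<in>C. U i)"
    using compactE_image[OF test_functionD(2)[OF t], of UNIV U] assms test_functionD(3)[OF t] by blast
  obtain n where n: "C \<subseteq> {..<n}" using finite_nat_bounded[OF C(2)] by blast
  have "supp \<phi> \<subseteq> (\<Union>i<n. U i)" using C n by blast
  then have "\<phi> \<in> below (\<Union>i<n. U i)"
    using \<phi> by (auto simp: below_def test_function_def)
  then have "ennreal (L \<phi>) \<le> m (\<Union>i<n. U i)" by (rule m_upper)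
  also have "\<dots> \<le> (\<Sum>i<n. m (U i))" by (rule m_finite_Un[OF assms])
  also have "\<dots> \<le> (\<Sum>i. m (U i))" by (rule sum_le_suminf) auto
  finally show "ennreal (L \<phi>) \<le> (\<Sum>i. m (U i))" .
qed

lemma mu_outer: "outer_measure_space (Pow \<Omega>) mu"
  unfolding outer_measure_space_def
proof (intro conjI)
  show "positive (Pow \<Omega>) mu" by (simp add: positive_def mu_open m_empty)
  show "increasing (Pow \<Omega>) mu" by (auto simp: increasing_def intro: mu_mono)
  show "countably_subadditive (Pow \<Omega>) mu"
    unfolding countably_subadditive_def
  proof (intro allI impI)
    fix A :: "nat \<Rightarrow> complex set"
    assume A: "range A \<subseteq> Pow \<Omega>"
    show "mu (\<Union>i. A i) \<le> (\<Sum>i. mu (A i))"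
    proof (rule ennreal_le_epsilon)
      fix e :: real assume fin': "(\<Sum>i. mu (A i)) < top" and e: "0 < e"
      then have fin: "(\<Sum>i. mu (A i)) < \<infinity>" by simp
      have "\<exists>U. open U \<and> A i \<subseteq> U \<and> U \<subseteq> \<Omega> \<and> m U \<le> mu (A i) + ennreal (e * (1/2) ^ Suc i)" for i
      proof -
        have "mu (A i) \<noteq> \<infinity>"
          using fin by (metis ennreal_suminf_lessD less_irrefl infinity_ennreal_def)
        then have "mu (A i) < mu (A i) + ennreal (e * (1/2) ^ Suc i)"
          using e by (simp add: ennreal_add_left_cancel_less[of _ 0, simplified] less_top)
        then show ?thesis
          unfolding mu_def[of "A i"] INF_less_iff by (auto intro: less_imp_le simp: mu_def[symmetric])
      qed
      then obtain U where U: "\<And>i. open (U i) \<and> A i \<subseteq> U i \<and> U i \<subseteq> \<Omega> \<and> m (U i) \<le> mu (A i) + ennreal (e * (1/2) ^ Suc i)"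
        by metis
      have "mu (\<Union>i. A i) \<le> m (\<Union>i. U i)"
        unfolding mu_def
      proof (intro INF_lower CollectI conjI)
        show "open (\<Union>i. U i)" "(\<Union>i. U i) \<subseteq> \<Omega>" using U by auto
        show "(\<Union>i. A i) \<subseteq> (\<Union>i. U i)" using U by (intro UN_mono) auto
      qed
      also have "\<dots> \<le> (\<Sum>i. m (U i))" using U by (intro m_countable_Un) auto
      also have "\<dots> \<le> (\<Sum>i. mu (A i) + ennreal (e * (1/2) ^ Suc i))"
        using U by (intro suminf_le) auto
      also have "\<dots> = (\<Sum>i. mu (A i)) + (\<Sum>i. ennreal (e * (1/2) ^ Suc i))"
        by (intro suminf_add[symmetric]) auto
      also have "(\<Sum>i. ennreal (e * (1/2) ^ Suc i)) = ennreal e"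
      proof -
        have "(\<lambda>i. e * (1/2) ^ Suc i) sums (e * 1)"
          by (intro sums_mult power_half_series)
        then show ?thesis using e by (intro suminf_ennreal_eq) auto
      qed
      finally show "mu (\<Union>i. A i) \<le> (\<Sum>i. mu (A i)) + ennreal e" .
    qed
  qed
qed

lemma mu_subadd:
  assumes "A \<subseteq> \<Omega>" "B \<subseteq> \<Omega>" "A \<inter> B = {}" shows "mu (A \<union> B) \<le> mu A + mu B"
proof -
  interpret sigma_algebra \<Omega> "Pow \<Omega>" by (rule sigma_algebra_Pow)
  have "subadditive (Pow \<Omega>) mu"
    using mu_outer unfolding outer_measure_space_def by (intro countably_subadditive_subadditive) simp_all
  then show ?thesis
    using assms unfolding subadditive_def by simp
qed

text \<open>Caratheodory's condition is tested with open \<open>U\<close> around \<open>A\<close>.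
  To a competitor \<open>\<phi>\<close> for \<open>U \<inter> V\<close> every competitor for
  \<open>U - supp \<phi>\<close> can be added without exceeding 1, and
  \<open>U - supp \<phi>\<close> still contains \<open>A - V\<close>. Suprema over both competitors
  give the inequality that is not subadditivity.\<close>

lemma open_in_lambda:
  assumes V: "open V" "V \<subseteq> \<Omega>" shows "V \<in> lambda_system \<Omega> (Pow \<Omega>) mu"
proof -
  interpret sigma_algebra \<Omega> "Pow \<Omega>" by (rule sigma_algebra_Pow)
  have "mu (A \<inter> V) + mu (A - V) = mu A" if A: "A \<subseteq> \<Omega>" for A
  proof (rule antisym)
    show "mu A \<le> mu (A \<inter> V) + mu (A - V)"
      using mu_subadd[of "A \<inter> V" "A - V"] A by (auto simp: Int_Diff_Un)
    show "mu (A \<inter> V) + mu (A - V) \<le> mu A"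
      unfolding mu_def[of A]
    proof (rule INF_greatest)
      fix U assume "U \<in> {U. open U \<and> A \<subseteq> U \<and> U \<subseteq> \<Omega>}"
      then have U: "open U" "A \<subseteq> U" "U \<subseteq> \<Omega>" by auto
      have key: "ennreal (L \<phi>) + m (U - supp \<phi>) \<le> m U" if \<phi>: "\<phi> \<in> below (U \<inter> V)" for \<phi>
      proof -
        have ne: "below (U - supp \<phi>) \<noteq> {}"
          using test_function_0 by (auto simp: below_def intro!: exI[of _ "\<lambda>z. 0"])
        have "ennreal (L \<phi>) + ennreal (L \<psi>) \<le> m U" if \<psi>: "\<psi> \<in> below (U - supp \<phi>)" for \<psi>
        proof -
          have t: "test_function U \<phi>" "test_function U \<psi>"
            using test_function_mono[OF belowD(1)[OF \<phi>]] test_function_mono[OF belowD(1)[OF \<psi>]] by auto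
          have s: "0 \<le> \<phi> z + \<psi> z \<and> \<phi> z + \<psi> z \<le> 1" for z
          proof (cases "z \<in> supp \<phi>")
            case True
            then have "z \<notin> supp \<psi>" using test_functionD(3)[OF belowD(1)[OF \<psi>]] by blast
            from not_in_suppD[OF this] show ?thesis using belowD(2,3)[OF \<phi>] by simp
          next
            case False
            from not_in_suppD[OF this] show ?thesis using belowD(2,3)[OF \<psi>] by simp
          qed
          have "(\<lambda>z. \<phi> z + \<psi> z) \<in> below U"
            using test_function_add[OF t] s by (auto simp: below_def)
          from m_upper[OF this] show ?thesis
            using L_add[OF test_function_mono[OF t(1) U(3)] test_function_mono[OF t(2) U(3)]]
              L_pos[OF test_function_mono[OF t(1) U(3)] belowD(2)[OF \<phi>]]
              L_pos[OF test_function_mono[OF t(2) U(3)] belowD(2)[OF \<psi>]]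
            by (simp add: ennreal_plus)
        qed
        then have "(SUP \<psi>\<in>below (U - supp \<phi>). ennreal (L \<phi>) + ennreal (L \<psi>)) \<le> m U"
          by (intro SUP_least) auto
        then show ?thesis unfolding m_def[of "U - supp \<phi>"] using ennreal_SUP_add_right[OF ne] by simp
      qed
      have "mu (A \<inter> V) + mu (A - V) \<le> m (U \<inter> V) + mu (A - V)"
        using U V unfolding mu_def[of "A \<inter> V"] by (intro add_right_mono INF_lower) auto
      also have "\<dots> = (SUP \<phi>\<in>below (U \<inter> V). mu (A - V) + ennreal (L \<phi>))"
      proof -
        have ne: "below (U \<inter> V) \<noteq> {}"
          using test_function_0 by (auto simp: below_def intro!: exI[of _ "\<lambda>z. 0"])
        show ?thesis unfolding m_def using ennreal_SUP_add_right[OF ne] by (simp add: add.commute)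
      qed
      also have "\<dots> \<le> m U"
      proof (rule SUP_least)
        fix \<phi> assume \<phi>: "\<phi> \<in> below (U \<inter> V)"
        have "supp \<phi> \<subseteq> V" using test_functionD(3)[OF belowD(1)[OF \<phi>]] by blast
        then have "mu (A - V) \<le> m (U - supp \<phi>)"
          using U unfolding mu_def by (intro INF_lower) (auto intro: open_Diff)
        then have "mu (A - V) + ennreal (L \<phi>) \<le> ennreal (L \<phi>) + m (U - supp \<phi>)"
          by (simp add: add.commute add_left_mono)
        also have "\<dots> \<le> m U" by (rule key[OF \<phi>])
        finally show "mu (A - V) + ennreal (L \<phi>) \<le> m U" .
      qed
      finally show "mu (A \<inter> V) + mu (A - V) \<le> m U" .
    qed
  qed
  then show ?thesis using V by (auto simp: lambda_system_eq)
qed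

definition M :: "complex measure" where
  "M = measure_of \<Omega> (sets (restrict_space borel \<Omega>)) mu"

lemma sa: "sigma_algebra \<Omega> (sets (restrict_space borel \<Omega>))"
  using sets.sigma_algebra_axioms[of "restrict_space borel \<Omega>"] by (simp add: space_restrict_space)

lemma measure_space_mu: "measure_space \<Omega> (sets (restrict_space borel \<Omega>)) mu"
proof -
  interpret sigma_algebra \<Omega> "Pow \<Omega>" by (rule sigma_algebra_Pow)
  let ?L = "lambda_system \<Omega> (Pow \<Omega>) mu"
  have ms: "measure_space \<Omega> ?L mu" by (rule caratheodory_lemma[OF mu_outer])
  then interpret L: sigma_algebra \<Omega> ?L by (simp add: measure_space_def)
  have "sigma_sets \<Omega> {U. open U \<and> (\<exists>K. compact K \<and> U \<subseteq> K \<and> K \<subseteq> \<Omega>)} \<subseteq> ?L"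
    using open_in_lambda by (intro L.sigma_sets_subset) auto
  then have "sets (restrict_space borel \<Omega>) \<subseteq> ?L"
    using restrict_borel_eq_sigma_sets(1)[OF op] by simp
  then show ?thesis by (rule measure_down[OF ms sa])
qed

lemma sets_M: "sets M = sets (restrict_space borel \<Omega>)"
  unfolding M_def by (rule sigma_algebra.sets_measure_of_eq[OF sa])

lemma emeasure_M: "A \<in> sets (restrict_space borel \<Omega>) \<Longrightarrow> emeasure M A = mu A"
  unfolding M_def using measure_space_mu
  by (intro emeasure_measure_of_sigma) (auto simp: measure_space_def)

lemma emeasure_M_open: "open U \<Longrightarrow> U \<subseteq> \<Omega> \<Longrightarrow> emeasure M U = m U"
  using op by (simp add: emeasure_M mu_open sets_restrict_space_iff)

lemma m_le_one_on:
  assumes "test_function \<Omega> \<eta>" "\<And>z. 0 \<le> \<eta> z" "V \<subseteq> \<Omega>" "\<And>z. z \<in> V \<Longrightarrow> \<eta> z = 1"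
  shows "m V \<le> ennreal (L \<eta>)"
  unfolding m_def
proof (rule SUP_least)
  fix \<phi> assume \<phi>: "\<phi> \<in> below V"
  have "\<phi> z \<le> \<eta> z" for z
  proof (cases "z \<in> V")
    case False
    then have "z \<notin> supp \<phi>" using test_functionD(3)[OF belowD(1)[OF \<phi>]] by blast
    from not_in_suppD[OF this] show ?thesis using assms(2) by simp
  qed (use assms(4) belowD(3)[OF \<phi>] in simp)
  then show "ennreal (L \<phi>) \<le> ennreal (L \<eta>)"
    by (intro ennreal_leI L_mono belowD(4)[OF \<phi>] assms)
qed

lemma radon_M: "radon_on \<Omega> M"
  unfolding radon_on_def
proof (intro conjI allI impI sets_M)
  fix K assume K: "compact K \<and> K \<subseteq> \<Omega>"
  obtain \<eta> V where \<eta>: "test_function \<Omega> \<eta>" "\<And>z. 0 \<le> \<eta> z" "\<And>z. \<eta> z \<le> 1"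
    "open V" "K \<subseteq> V" "\<And>z. z \<in> V \<Longrightarrow> \<eta> z = 1"
    using smooth_Urysohn[OF _ op, of K] K by blast
  have V: "V \<subseteq> \<Omega>"
  proof
    fix z assume "z \<in> V"
    then have "z \<in> supp \<eta>" using \<eta>(6) closure_subset[of "{z. \<eta> z \<noteq> 0}"] by auto
    then show "z \<in> \<Omega>" using test_functionD(3)[OF \<eta>(1)] by blast
  qed
  have "emeasure M K = mu K"
    using K op by (intro emeasure_M) (auto simp: sets_restrict_space_iff borel_compact)
  also have "\<dots> \<le> m V" using \<eta>(4,5) V unfolding mu_def by (intro INF_lower) auto
  also have "\<dots> \<le> ennreal (L \<eta>)" by (rule m_le_one_on[OF \<eta>(1,2) V \<eta>(6)])
  finally show "emeasure M K < \<infinity>" by (simp add: order_le_less_trans)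
qed

lemma m_eq_measure:
  assumes "open U" "U \<subseteq> \<Omega>" "emeasure M U < \<infinity>" shows "m U = ennreal (measure M U)"
  using emeasure_eq_ennreal_measure[of M U] emeasure_M_open[OF assms(1,2)] assms(3)
  by (metis infinity_ennreal_def less_irrefl)

lemma L_le_measure:
  assumes "\<phi> \<in> below U" "open U" "U \<subseteq> \<Omega>" "emeasure M U < \<infinity>"
  shows "L \<phi> \<le> measure M U"
proof -
  have "ennreal (L \<phi>) \<le> ennreal (measure M U)"
    using m_upper[OF assms(1)] m_eq_measure[OF assms(2-4)] by metis
  then show ?thesis by (simp add: ennreal_le_iff)
qed

lemma measure_approx:
  assumes "open U" "U \<subseteq> \<Omega>" "emeasure M U < \<infinity>" "e > 0"
  obtains \<phi> where "\<phi> \<in> below U" "measure M U - e < L \<phi>"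
proof -
  have ne: "below U \<noteq> {}"
    using test_function_0 by (auto simp: below_def intro!: exI[of _ "\<lambda>z. 0"])
  have "\<exists>\<phi>\<in>below U. measure M U - e < L \<phi>"
  proof (rule ccontr)
    assume "\<not> ?thesis"
    then have *: "L \<phi> \<le> measure M U - e" if "\<phi> \<in> below U" for \<phi> using that by force
    obtain \<phi>0 where \<phi>0: "\<phi>0 \<in> below U" using ne by blast
    have "0 \<le> L \<phi>0" by (rule L_pos[OF belowD(4)[OF \<phi>0 assms(2)] belowD(2)[OF \<phi>0]])
    then have nn: "0 \<le> measure M U - e" using *[OF \<phi>0] by simp
    have "m U \<le> ennreal (measure M U - e)"
      unfolding m_def by (intro SUP_least ennreal_leI *)
    then have "ennreal (measure M U) \<le> ennreal (measure M U - e)"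
      using m_eq_measure[OF assms(1-3)] by metis
    then show False using nn assms(4) by simp
  qed
  then show thesis using that by blast
qed

text \<open>A decomposition into layers of height \<open>d\<close>. Testing the upper edge of each
  layer against \<open>t\<close> gives a lower bound, testing the lower edge an upper bound; the two
  sums differ by at most one layer, which reappears as an error in
  \<open>integral_le_L\<close>.\<close>

lemma slice_bounds:
  fixes t d :: real
  assumes "0 \<le> t" "0 < d"
  shows "(\<Sum>i<n. (if real (Suc i) * d < t then d else 0)) \<le> min t (real n * d)"
    and "min t (real n * d) \<le> (\<Sum>i<n. (if real i * d < t then d else 0))"
proof (induction n)
  case (Suc n)
  { case 1 show ?case using Suc.IH(1) by (auto simp: algebra_simps min_def split: if_splits) }
  { case 2 show ?case using Suc.IH(2) assms by (auto simp: algebra_simps min_def split: if_splits) }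
qed (use assms in auto)

text \<open>Each superlevel set of \<open>\<phi>\<close> is filled up to \<open>d\<close> by some
  \<open>g i\<close>. The lower layer sum keeps the combination of the \<open>g i\<close> below
  \<open>\<phi>\<close>, so its value under \<open>L\<close> is at most \<open>L \<phi>\<close>; the
  upper layer sum bounds the integral.\<close>

lemma integral_le_L:
  assumes \<phi>: "test_function \<Omega> \<phi>" and pos: "\<And>z. 0 \<le> \<phi> z"
  shows "(LINT z|M. \<phi> z) \<le> L \<phi>"
proof (rule field_le_epsilon)
  fix e :: real assume e: "e > 0"
  obtain B where B: "\<And>z. \<bar>\<phi> z\<bar> \<le> B" "B \<ge> 0" by (rule test_function_bounded[OF \<phi>]) blast
  define V where "V t = {z. t < \<phi> z}" for t
  have Vo: "open (V t)" for t
    unfolding V_def by (intro open_Collect_less test_functionD(4)[OF \<phi>] continuous_on_const)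
  have Vs: "V t \<subseteq> supp \<phi>" if "t \<ge> 0" for t
    using closure_subset[of "{z. \<phi> z \<noteq> 0}"] that by (force simp: V_def)
  have VO: "V t \<subseteq> \<Omega>" if "t \<ge> 0" for t using Vs[OF that] test_functionD(3)[OF \<phi>] by blast
  have VM: "V t \<in> sets M" if "t \<ge> 0" for t
    using radon_on_sets[OF radon_M _ VO[OF that]] Vo by simp
  have Vfin: "emeasure M (V t) < \<infinity>" if "t \<ge> 0" for t
  proof -
    have "emeasure M (V t) \<le> emeasure M (supp \<phi>)"
      using radon_on_sets[OF radon_M borel_compact[OF test_functionD(2)[OF \<phi>]] test_functionD(3)[OF \<phi>]]
      by (rule emeasure_mono[OF Vs[OF that]])
    also have "\<dots> < \<infinity>" using radon_M test_functionD(2,3)[OF \<phi>] by (simp add: radon_on_def)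
    finally show ?thesis .
  qed
  \<comment> \<open>The total loss is \<open>d * C\<close>: the extra bottom layer costs
    \<open>d * measure M (V 0)\<close>, and the \<open>n\<close> filling errors cost
    \<open>n * d * d\<close>, which is \<open>d * (B + 1)\<close>.\<close>
  define C where "C = measure M (V 0) + B + 1"
  have C: "C > 0" using B(2) unfolding C_def by (simp add: add_nonneg_pos)
  define b where "b = B + 1"
  have b: "b > 0" using B by (simp add: b_def)
  obtain n :: nat where n: "real n > b * C / e" "n > 0"
  proof -
    obtain n :: nat where n: "b * C / e < real n" using reals_Archimedean2 by blast
    moreover have "0 < b * C / e" using b C e by simp
    ultimately have "n > 0" by (metis of_nat_0_less_iff order_less_trans)
    with n show thesis using that by blast
  qed
  define d where "d = b / real n"
  have d: "d > 0" "real n * d = b" using n b by (auto simp: d_def)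
  have dC: "d * C < e" using n e b C by (simp add: d_def field_simps)
  have "\<exists>g. g \<in> below (V (real (Suc i) * d)) \<and> measure M (V (real (Suc i) * d)) - d < L g" for i
    using measure_approx[OF Vo VO Vfin d(1), of "real (Suc i) * d"] d by (metis mult_nonneg_nonneg of_nat_0_le_iff less_imp_le)
  then obtain g where g: "\<And>i. g i \<in> below (V (real (Suc i) * d))"
    "\<And>i. measure M (V (real (Suc i) * d)) - d < L (g i)" by metis
  have gt: "test_function \<Omega> (g i)" for i using belowD(4)[OF g(1) VO] d by simp
  have gle: "g i z \<le> of_bool (real (Suc i) * d < \<phi> z)" for i z
  proof (cases "z \<in> V (real (Suc i) * d)")
    case True then show ?thesis using belowD(3)[OF g(1)] by (simp add: V_def)
  next
    case False
    then have "z \<notin> supp (g i)" using test_functionD(3)[OF belowD(1)[OF g(1)]] by blast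
    from not_in_suppD[OF this] show ?thesis by simp
  qed
  have "(\<Sum>i<n. d * g i z) \<le> \<phi> z" for z
  proof -
    have "(\<Sum>i<n. d * g i z) \<le> (\<Sum>i<n. (if real (Suc i) * d < \<phi> z then d else 0))"
    proof (rule sum_mono)
      fix i show "d * g i z \<le> (if real (Suc i) * d < \<phi> z then d else 0)"
        using gle[of i z] d(1) by (cases "real (Suc i) * d < \<phi> z") (simp_all add: mult_le_0_iff)
    qed
    also have "\<dots> \<le> \<phi> z" using slice_bounds(1)[OF pos[of z] d(1), of n] by simp
    finally show ?thesis .
  qed
  then have "L (\<lambda>z. \<Sum>i<n. d * g i z) \<le> L \<phi>"
    by (intro L_mono test_function_sum test_function_scale gt \<phi>)
  moreover have "L (\<lambda>z. \<Sum>i<n. d * g i z) = (\<Sum>i<n. d * L (g i))"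
    by (subst L_sum) (auto intro!: test_function_scale gt sum.cong L_scale)
  ultimately have 1: "(\<Sum>i<n. d * L (g i)) \<le> L \<phi>" by simp
  have ind: "d * indicator (V t) z = (if t < \<phi> z then d else 0)" for t z
    by (simp add: V_def indicator_def)
  have "(LINT z|M. \<phi> z) \<le> (LINT z|M. (\<Sum>i<n. d * indicator (V (real i * d)) z))"
  proof (rule integral_mono)
    show "integrable M \<phi>" by (rule radon_on_integrable_test[OF radon_M \<phi>])
    show "integrable M (\<lambda>z. \<Sum>i<n. d * indicator (V (real i * d)) z)"
      using d Vfin VM by (intro Bochner_Integration.integrable_sum integrable_mult_right) auto
    show "\<phi> z \<le> (\<Sum>i<n. d * indicator (V (real i * d)) z)" for z
      using slice_bounds(2)[OF pos[of z] d(1), of n] B(1)[of z] unfolding d(2) ind b_def by simp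
  qed
  also have "\<dots> = (\<Sum>i<n. d * measure M (V (real i * d)))"
    using d Vfin VM by (subst Bochner_Integration.integral_sum) auto
  also have "\<dots> \<le> (\<Sum>i<Suc n. d * measure M (V (real i * d)))" using d by simp
  also have "\<dots> = d * measure M (V 0) + (\<Sum>i<n. d * measure M (V (real (Suc i) * d)))"
    unfolding sum.lessThan_Suc_shift by simp
  also have "\<dots> \<le> d * measure M (V 0) + (\<Sum>i<n. d * (L (g i) + d))"
    using d g(2) by (intro add_left_mono sum_mono mult_left_mono) (auto simp: algebra_simps less_imp_le)
  also have "\<dots> = d * measure M (V 0) + d * b + (\<Sum>i<n. d * L (g i))"
    using d(2) by (simp add: distrib_left sum.distrib algebra_simps)
  also have "\<dots> = d * C + (\<Sum>i<n. d * L (g i))" by (simp add: C_def b_def algebra_simps)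
  also have "\<dots> \<le> e + L \<phi>" using dC 1 by simp
  finally show "(LINT z|M. \<phi> z) \<le> L \<phi> + e" by simp
qed

text \<open>The inequality just proved is applied to \<open>B * \<xi> - \<phi>\<close>, which is
  nonnegative if \<open>\<xi>\<close> is 1 on the support of \<open>\<phi>\<close>. For
  \<open>\<xi>\<close> itself both sides almost agree once its integral is close to the measure of
  \<open>U\<close>, because \<open>L \<xi>\<close> cannot exceed that measure.\<close>

lemma L_le_integral:
  assumes \<phi>: "test_function \<Omega> \<phi>"
  shows "L \<phi> \<le> (LINT z|M. \<phi> z)"
proof (rule field_le_epsilon)
  fix e :: real assume e: "e > 0"
  obtain B where B: "\<And>z. \<bar>\<phi> z\<bar> \<le> B" "B \<ge> 0" by (rule test_function_bounded[OF \<phi>]) blast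
  note K = test_functionD(2,3)[OF \<phi>]
  obtain \<eta> U where \<eta>: "test_function \<Omega> \<eta>" "\<And>z. 0 \<le> \<eta> z" "\<And>z. \<eta> z \<le> 1"
    "open U" "supp \<phi> \<subseteq> U" "\<And>z. z \<in> U \<Longrightarrow> \<eta> z = 1"
    using smooth_Urysohn[OF K(1) op K(2)] by blast
  have Us: "U \<subseteq> supp \<eta>"
    using closure_subset[of "{z. \<eta> z \<noteq> 0}"] \<eta>(6) by force
  have UO: "U \<subseteq> \<Omega>" using Us test_functionD(3)[OF \<eta>(1)] by blast
  have "emeasure M U \<le> emeasure M (supp \<eta>)"
    using radon_on_sets[OF radon_M borel_compact[OF test_functionD(2)[OF \<eta>(1)]] test_functionD(3)[OF \<eta>(1)]]
    by (rule emeasure_mono[OF Us])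
  also have "\<dots> < \<infinity>" using radon_M test_functionD(2,3)[OF \<eta>(1)] by (simp add: radon_on_def)
  finally have fin: "emeasure M U < \<infinity>" .
  obtain \<zeta> where \<zeta>: "\<And>n::nat. test_function U (\<zeta> n)" "\<And>n z. 0 \<le> \<zeta> n z" "\<And>n z. \<zeta> n z \<le> 1"
    "\<And>z. z \<in> U \<Longrightarrow> \<forall>\<^sub>F n in sequentially. \<zeta> n z = 1"
    using open_compact_exhaustion_test[OF \<eta>(4)] by blast
  obtain \<theta> W where \<theta>: "test_function U \<theta>" "\<And>z. 0 \<le> \<theta> z" "\<And>z. \<theta> z \<le> 1"
    "open W" "supp \<phi> \<subseteq> W" "\<And>z. z \<in> W \<Longrightarrow> \<theta> z = 1"
    using smooth_Urysohn[OF K(1) \<eta>(4,5)] by blast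
  define \<xi> where "\<xi> n z = \<theta> z + \<zeta> n z - \<theta> z * \<zeta> n z" for n z
  have \<xi>U: "test_function U (\<xi> n)" for n
    unfolding \<xi>_def by (intro test_function_diff test_function_add test_function_mult_smooth \<zeta>(1) \<theta>(1) test_functionD(1)[OF \<zeta>(1)])
  have \<xi>b: "0 \<le> \<xi> n z" "\<xi> n z \<le> 1" for n z
  proof -
    have "0 \<le> (1 - \<theta> z) * (1 - \<zeta> n z)" using \<theta>(3) \<zeta>(3) by simp
    then show "\<xi> n z \<le> 1" by (simp add: \<xi>_def algebra_simps)
    have "0 \<le> \<theta> z * (1 - \<zeta> n z)" using \<theta>(2) \<zeta>(3) by simp
    then show "0 \<le> \<xi> n z" using \<zeta>(2)[of n z] by (simp add: \<xi>_def algebra_simps)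
  qed
  have \<xi>W: "\<xi> n z = 1" if "z \<in> supp \<phi>" for n z using \<theta>(5,6) that by (auto simp: \<xi>_def)
  have \<xi>1: "\<forall>\<^sub>F n in sequentially. \<xi> n z = 1" if "z \<in> U" for z
    using \<zeta>(4)[OF that] by eventually_elim (simp add: \<xi>_def)
  have "(\<lambda>n. LINT z|M. \<xi> n z) \<longlonglongrightarrow> measure M U"
    by (rule test_one_tendsto_measure[OF radon_M \<eta>(4) UO fin \<xi>U \<xi>b \<xi>1])
  moreover have "measure M U - e / (B + 1) < measure M U" using e B by simp
  ultimately have "\<forall>\<^sub>F n in sequentially. measure M U - e / (B + 1) < (LINT z|M. \<xi> n z)"
    by (rule order_tendstoD(1))
  then obtain n where n: "measure M U - e / (B + 1) < (LINT z|M. \<xi> n z)"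
    using eventually_happens' by (metis sequentially_bot)
  have "\<xi> n \<in> below U" using \<xi>U \<xi>b by (auto simp: below_def)
  from L_le_measure[OF this \<eta>(4) UO fin] n
  have 1: "L (\<xi> n) - (LINT z|M. \<xi> n z) < e / (B + 1)" by simp
  have \<xi>O: "test_function \<Omega> (\<xi> n)" by (rule test_function_mono[OF \<xi>U UO])
  note tB = test_function_scale[OF \<xi>O, of B]
  have "0 \<le> B * \<xi> n z - \<phi> z" for z
  proof (cases "z \<in> supp \<phi>")
    case True then show ?thesis using \<xi>W B(1)[of z] by simp
  next
    case False from not_in_suppD[OF this] show ?thesis using \<xi>b B(2) by simp
  qed
  from integral_le_L[OF test_function_diff[OF tB \<phi>] this]
  have "(LINT z|M. B * \<xi> n z - \<phi> z) \<le> B * L (\<xi> n) - L \<phi>"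
    using L_diff[OF tB \<phi>] L_scale[OF \<xi>O] by simp
  moreover have "(LINT z|M. B * \<xi> n z - \<phi> z) = B * (LINT z|M. \<xi> n z) - (LINT z|M. \<phi> z)"
    using radon_on_integrable_test[OF radon_M \<xi>O] radon_on_integrable_test[OF radon_M \<phi>] by simp
  ultimately have "L \<phi> \<le> (LINT z|M. \<phi> z) + B * (L (\<xi> n) - (LINT z|M. \<xi> n z))"
    by (simp add: algebra_simps)
  also have "B * (L (\<xi> n) - (LINT z|M. \<xi> n z)) \<le> B * (e / (B + 1))"
    using 1 B(2) by (intro mult_left_mono) auto
  also have "\<dots> \<le> e" using e B(2) by (simp add: field_simps)
  finally show "L \<phi> \<le> (LINT z|M. \<phi> z) + e" by simp
qed

theorem integral_eq_L:
  assumes \<phi>: "test_function \<Omega> \<phi>" shows "(LINT z|M. \<phi> z) = L \<phi>"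
  using L_le_integral[OF \<phi>] L_le_integral[OF test_function_scale[OF \<phi>, of "-1"]] L_scale[OF \<phi>, of "-1"]
  by simp

end

theorem Riesz_test_functions:
  assumes "positive_functional \<Omega> L"
  obtains M where "radon_on \<Omega> M" "\<And>\<phi>. test_function \<Omega> \<phi> \<Longrightarrow> (LINT z|M. \<phi> z) = L \<phi>"
  using positive_functional.radon_M[OF assms] positive_functional.integral_eq_L[OF assms] that by blast

section \<open>Circle means\<close>

text \<open>Normalized angle as a probability measure on the line, so that circle means are
  integrals to which Fubini's theorem and dominated convergence apply.\<close>

definition circ :: "real measure" where
  "circ = density lborel (\<lambda>t. ennreal (indicator {0..2*pi} t / (2*pi)))"

text \<open>A negative radius describes the same circle, starting at the opposite point: the mean with radius
  \<open>- \<rho>\<close> is the adjoint of the mean with radius \<open>\<rho>\<close> under translation invariant integration.\<close>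

definition cmean :: "(complex \<Rightarrow> 'b::{banach, second_countable_topology}) \<Rightarrow> complex \<Rightarrow> real \<Rightarrow> 'b" where
  "cmean f z \<rho> = (LINT t|circ. f (z + rcis \<rho> t))"

lemma sets_circ [measurable_cong, simp]: "sets circ = sets borel"
  and space_circ [simp]: "space circ = UNIV"
  by (simp_all add: circ_def)

lemma nn_integral_circ:
  assumes [measurable]: "f \<in> borel_measurable borel"
  shows "(\<integral>\<^sup>+t. f t \<partial>circ) = (\<integral>\<^sup>+t\<in>{0..2*pi}. f t \<partial>lborel) / ennreal (2*pi)"
proof -
  have inv: "inverse (ennreal (2*pi)) = ennreal (1 / (2*pi))"
    by (subst inverse_ennreal) (auto simp: inverse_eq_divide)
  have "(\<integral>\<^sup>+t. f t \<partial>circ) = (\<integral>\<^sup>+t. ennreal (indicator {0..2*pi} t / (2*pi)) * f t \<partial>lborel)"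
    unfolding circ_def by (rule nn_integral_density) auto
  also have "\<dots> = (\<integral>\<^sup>+t. (f t * indicator {0..2*pi} t) / ennreal (2*pi) \<partial>lborel)"
    by (intro nn_integral_cong) (unfold divide_ennreal_def inv, auto simp: indicator_def mult.commute)
  also have "\<dots> = (\<integral>\<^sup>+t\<in>{0..2*pi}. f t \<partial>lborel) / ennreal (2*pi)"
    by (rule nn_integral_divide) auto
  finally show ?thesis .
qed

lemma emeasure_circ: "emeasure circ UNIV = 1"
proof -
  have "emeasure circ UNIV = (\<integral>\<^sup>+t. 1 \<partial>circ)" by simp
  also have "\<dots> = ennreal (2*pi) / ennreal (2*pi)" by (subst nn_integral_circ) auto
  finally show ?thesis by (simp add: divide_ennreal)
qed

interpretation circ: finite_measure circ
  by standard (simp add: emeasure_circ)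

lemma measure_circ [simp]: "measure circ UNIV = 1"
  by (simp add: measure_def emeasure_circ)

lemma integral_circ:
  fixes f :: "real \<Rightarrow> 'b::{banach, second_countable_topology}"
  assumes [measurable]: "f \<in> borel_measurable borel"
  shows "(LINT t|circ. f t) = (LINT t:{0..2*pi}|lborel. f t) /\<^sub>R (2*pi)"
proof -
  have "(LINT t|circ. f t) = (LINT t|lborel. (indicator {0..2*pi} t / (2*pi)) *\<^sub>R f t)"
    unfolding circ_def by (rule integral_density) auto
  also have "\<dots> = (LINT t|lborel. inverse (2*pi) *\<^sub>R (indicator {0..2*pi} t *\<^sub>R f t))"
  proof (intro Bochner_Integration.integral_cong refl)
    fix t show "(indicator {0..2*pi} t / (2*pi)) *\<^sub>R f t = inverse (2*pi) *\<^sub>R (indicator {0..2*pi} t *\<^sub>R f t)"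
      unfolding scaleR_scaleR by (simp only: divide_inverse mult.commute)
  qed
  finally show ?thesis by (simp only: set_lebesgue_integral_def integral_scaleR_right)
qed

lemma rcis_measurable [measurable]: "rcis \<rho> \<in> borel_measurable borel"
  unfolding rcis_def by (intro borel_measurable_continuous_onI continuous_intros)

lemma continuous_on_rcis [continuous_intros]:
  "continuous_on A f \<Longrightarrow> continuous_on A g \<Longrightarrow> continuous_on A (\<lambda>x. rcis (f x) (g x))"
  unfolding rcis_def by (intro continuous_intros)

lemma circle_in_sphere: "z + rcis \<rho> t \<in> sphere z \<bar>\<rho>\<bar>"
  by (simp add: dist_norm norm_mult rcis_def)

lemma integrable_circ_bounded:
  fixes f :: "real \<Rightarrow> 'b::{banach, second_countable_topology}"
  assumes "f \<in> borel_measurable borel" "\<And>t. norm (f t) \<le> B"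
  shows "integrable circ f"
  using assms by (intro circ.integrable_const_bound[of _ B]) auto

lemma continuous_circle:
  fixes f :: "complex \<Rightarrow> 'b::{banach, second_countable_topology}"
  assumes "continuous_on (sphere z \<bar>\<rho>\<bar>) f"
  shows "continuous_on UNIV (\<lambda>t. f (z + rcis \<rho> t))" "integrable circ (\<lambda>t. f (z + rcis \<rho> t))"
proof -
  show c: "continuous_on UNIV (\<lambda>t. f (z + rcis \<rho> t))"
    by (rule continuous_on_compose2[OF assms]) (use circle_in_sphere in \<open>auto intro!: continuous_intros\<close>)
  have "bounded (f ` sphere z \<bar>\<rho>\<bar>)"
    by (intro compact_imp_bounded compact_continuous_image assms) simp
  then obtain B where "\<forall>w\<in>sphere z \<bar>\<rho>\<bar>. norm (f w) \<le> B" unfolding bounded_iff by blast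
  then show "integrable circ (\<lambda>t. f (z + rcis \<rho> t))"
    using circle_in_sphere by (intro integrable_circ_bounded[of _ B] borel_measurable_continuous_onI c) blast
qed

lemma cmean_const [simp]: "cmean (\<lambda>_. c) z \<rho> = c"
  by (simp add: cmean_def)

lemma cmean_mono:
  fixes f g :: "complex \<Rightarrow> real"
  assumes "continuous_on (sphere z \<bar>\<rho>\<bar>) f" "continuous_on (sphere z \<bar>\<rho>\<bar>) g"
    and "\<And>w. w \<in> sphere z \<bar>\<rho>\<bar> \<Longrightarrow> f w \<le> g w"
  shows "cmean f z \<rho> \<le> cmean g z \<rho>"
  unfolding cmean_def using continuous_circle(2)[OF assms(1)] continuous_circle(2)[OF assms(2)]
  by (rule integral_mono) (rule assms(3)[OF circle_in_sphere])

lemma cmean_cong: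
  assumes "\<And>w. w \<in> sphere z \<bar>\<rho>\<bar> \<Longrightarrow> f w = g w"
  shows "cmean f z \<rho> = cmean g z \<rho>"
  unfolding cmean_def by (intro Bochner_Integration.integral_cong refl assms circle_in_sphere)

lemma cmean_add:
  assumes "continuous_on (sphere z \<bar>\<rho>\<bar>) f" "continuous_on (sphere z \<bar>\<rho>\<bar>) g"
  shows "cmean (\<lambda>w. f w + g w) z \<rho> = cmean f z \<rho> + cmean g z \<rho>"
  unfolding cmean_def using continuous_circle(2)[OF assms(1)] continuous_circle(2)[OF assms(2)]
  by (rule Bochner_Integration.integral_add)

lemma cmean_diff:
  assumes "continuous_on (sphere z \<bar>\<rho>\<bar>) f" "continuous_on (sphere z \<bar>\<rho>\<bar>) g"
  shows "cmean (\<lambda>w. f w - g w) z \<rho> = cmean f z \<rho> - cmean g z \<rho>"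
  unfolding cmean_def using continuous_circle(2)[OF assms(1)] continuous_circle(2)[OF assms(2)]
  by (rule Bochner_Integration.integral_diff)

lemma cmean_mult_left:
  fixes f :: "complex \<Rightarrow> 'b::{banach, second_countable_topology, real_normed_algebra}"
  shows "continuous_on (sphere z \<bar>\<rho>\<bar>) f \<Longrightarrow> cmean (\<lambda>w. c * f w) z \<rho> = c * cmean f z \<rho>"
  unfolding cmean_def by (rule Bochner_Integration.integral_mult_right) (rule continuous_circle(2))

lemma cmean_bounded_linear:
  assumes "bounded_linear h" "continuous_on (sphere z \<bar>\<rho>\<bar>) f"
  shows "cmean (\<lambda>w. h (f w)) z \<rho> = h (cmean f z \<rho>)"
  unfolding cmean_def by (rule integral_bounded_linear[OF assms(1) continuous_circle(2)[OF assms(2)]])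

lemma norm_cmean_le: "norm (cmean f z \<rho>) \<le> cmean (\<lambda>w. norm (f w)) z \<rho>"
  unfolding cmean_def by (rule integral_norm_bound)

lemma cmean_minus_radius: "cmean f z (-\<rho>) = cmean (\<lambda>w. f (2 * z - w)) z \<rho>"
  unfolding cmean_def by (intro Bochner_Integration.integral_cong) (auto simp: rcis_def)

text \<open>Cauchy's integral formula for positive radius; the reflection of the plane about
  \<open>z\<close> reduces negative radii to it.\<close>

lemma mean_value_holomorphic:
  assumes "f holomorphic_on S" "cball z \<bar>\<rho>\<bar> \<subseteq> S"
  shows "cmean f z \<rho> = f z"
proof -
  have pos: "cmean f z \<rho> = f z" if "\<rho> > 0" and hol: "f holomorphic_on cball z \<rho>" for f \<rho>
  proof -
    have cont: "continuous_on (sphere z \<bar>\<rho>\<bar>) f"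
      using hol that(1) by (auto intro: continuous_on_subset[OF holomorphic_on_imp_continuous_on])
    note c = continuous_circle(1)[OF cont]
    have "((\<lambda>u. f u / (u - z)) has_contour_integral (2 * of_real pi * \<i> * f z)) (circlepath z \<rho>)"
      using Cauchy_integral_circlepath_simple[OF hol, of z] \<open>\<rho> > 0\<close> by simp
    then have "((\<lambda>t. f (z + of_real \<rho> * cis t) / (z + of_real \<rho> * cis t - z) * of_real \<rho> * \<i> * cis t)
       has_integral (2 * of_real pi * \<i> * f z)) {0..2*pi}"
      unfolding circlepath_def by (subst (asm) has_contour_integral_part_circlepath_iff) (auto simp: cis_conv_exp)
    then have "((\<lambda>t. \<i> * f (z + rcis \<rho> t)) has_integral (2 * of_real pi * \<i> * f z)) {0..2*pi}"
      using \<open>\<rho> > 0\<close> by (elim has_integral_eq[rotated]) (simp add: rcis_def)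
    from has_integral_mult_right[OF this, of "-\<i>"]
    have hi: "((\<lambda>t. f (z + rcis \<rho> t)) has_integral (2 * of_real pi * f z)) {0..2*pi}"
      by (simp add: algebra_simps)
    have "set_integrable lborel {0..2*pi} (\<lambda>t. f (z + rcis \<rho> t))"
      by (rule borel_integrable_atLeastAtMost') (rule continuous_on_subset[OF c subset_UNIV])
    then have "(LINT t:{0..2*pi}|lborel. f (z + rcis \<rho> t)) = 2 * of_real pi * f z"
      using set_borel_integral_eq_integral(2) integral_unique[OF hi] by metis
    then show ?thesis
      unfolding cmean_def by (subst integral_circ[OF borel_measurable_continuous_onI[OF c]])
        (simp add: scaleR_conv_of_real field_simps)
  qed
  have hol: "f holomorphic_on cball z \<bar>\<rho>\<bar>" using assms holomorphic_on_subset by blast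
  consider "\<rho> > 0" | "\<rho> = 0" | "\<rho> < 0" by linarith
  then show ?thesis
  proof cases
    case 1 then show ?thesis using pos hol by simp
  next
    case 2 then show ?thesis by (simp add: cmean_def)
  next
    case 3
    have "(\<lambda>w. f (2 * z - w)) holomorphic_on cball z (-\<rho>)"
    proof (rule holomorphic_on_compose_gen[of "\<lambda>w. 2 * z - w" _ f "cball z \<bar>\<rho>\<bar>", unfolded o_def])
      show "(\<lambda>w. 2 * z - w) ` cball z (- \<rho>) \<subseteq> cball z \<bar>\<rho>\<bar>"
        using 3 by (auto simp: dist_norm norm_minus_commute)
    qed (use hol in \<open>auto intro!: holomorphic_intros\<close>)
    with 3 show ?thesis using pos[of "-\<rho>" "\<lambda>w. f (2 * z - w)"] cmean_minus_radius[of f z "-\<rho>"] by simp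
  qed
qed

lemma integral_circ_cis: "(LINT t|circ. cis t) = 0" and integral_circ_cis2: "(LINT t|circ. cis t * cis t) = 0"
proof -
  have "(\<lambda>z::complex. z) holomorphic_on UNIV" "(\<lambda>z::complex. z * z) holomorphic_on UNIV"
    by (intro holomorphic_intros)+
  from mean_value_holomorphic[OF this(1), of 0 1] mean_value_holomorphic[OF this(2), of 0 1]
  show "(LINT t|circ. cis t) = 0" "(LINT t|circ. cis t * cis t) = 0"
    by (simp_all add: cmean_def rcis_def)
qed

text \<open>All values come from the mean value property at 0 of the entire functions
  \<open>z\<close> and \<open>z * z\<close>. The second makes the integrals of the two squares
  equal, and their sum is 1.\<close>

lemma circ_trig:
  "integrable circ cos" "integrable circ sin" "(LINT t|circ. cos t) = 0" "(LINT t|circ. sin t) = 0"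
  "integrable circ (\<lambda>t. cos t * cos t)" "(LINT t|circ. cos t * cos t) = 1/2"
  "integrable circ (\<lambda>t. cos t * sin t)" "(LINT t|circ. cos t * sin t) = 0"
  "integrable circ (\<lambda>t. sin t * sin t)" "(LINT t|circ. sin t * sin t) = 1/2"
proof -
  have tr: "\<bar>cos t * cos t\<bar> \<le> 1" "\<bar>cos t * sin t\<bar> \<le> 1" "\<bar>sin t * sin t\<bar> \<le> 1" for t :: real
    unfolding abs_mult by (intro mult_le_one; simp)+
  have I1: "integrable circ cos" "integrable circ sin"
    by (auto intro!: integrable_circ_bounded[where B=1] borel_measurable_continuous_onI continuous_intros)
  have I2: "integrable circ (\<lambda>t. cos t * cos t)" "integrable circ (\<lambda>t. cos t * sin t)" "integrable circ (\<lambda>t. sin t * sin t)"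
    by (rule integrable_circ_bounded[where B=1], intro borel_measurable_continuous_onI continuous_intros,
        unfold real_norm_def, rule tr)+
  note I = I1 I2
  show "integrable circ cos" "integrable circ sin" "integrable circ (\<lambda>t. cos t * cos t)"
    "integrable circ (\<lambda>t. cos t * sin t)" "integrable circ (\<lambda>t. sin t * sin t)" by (rule I)+
  have ic: "integrable circ cis" "integrable circ (\<lambda>t. cis t * cis t)"
    by (auto intro!: integrable_circ_bounded[where B=1] borel_measurable_continuous_onI continuous_intros
        simp: norm_mult)
  have "(LINT t|circ. Re (cis t)) = 0" "(LINT t|circ. Im (cis t)) = 0"
    using integral_Re[OF ic(1)] integral_Im[OF ic(1)] integral_circ_cis by auto
  then show "(LINT t|circ. cos t) = 0" "(LINT t|circ. sin t) = 0" by simp_all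
  have "(LINT t|circ. Re (cis t * cis t)) = 0" "(LINT t|circ. Im (cis t * cis t)) = 0"
    using integral_Re[OF ic(2)] integral_Im[OF ic(2)] integral_circ_cis2 by auto
  then have *: "(LINT t|circ. cos t * cos t - sin t * sin t) = 0" "(LINT t|circ. 2 * (cos t * sin t)) = 0"
    by (simp_all add: mult_ac)
  have "(LINT t|circ. cos t * cos t + sin t * sin t) = 1"
    by (simp flip: power2_eq_square)
  then have "(LINT t|circ. cos t * cos t) + (LINT t|circ. sin t * sin t) = 1"
    by (simp only: Bochner_Integration.integral_add[OF I2(1) I2(3)])
  moreover have "(LINT t|circ. cos t * cos t) - (LINT t|circ. sin t * sin t) = 0"
    using *(1) by (simp only: Bochner_Integration.integral_diff[OF I2(1) I2(3)])
  ultimately show "(LINT t|circ. cos t * cos t) = 1/2" "(LINT t|circ. sin t * sin t) = 1/2" by linarith+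
  from *(2) I show "(LINT t|circ. cos t * sin t) = 0" by simp
qed

lemma circ_trig_combination:
  "integrable circ (\<lambda>t. a + cos t * b + sin t * c + (cos t * cos t) * d + (cos t * sin t) * e + (sin t * sin t) * f)"
  "(LINT t|circ. a + cos t * b + sin t * c + (cos t * cos t) * d + (cos t * sin t) * e + (sin t * sin t) * f)
    = a + d / 2 + f / 2"
  by (simp_all add: circ_trig)

section \<open>Laplacians of test functions and the expansion of circle means\<close>

lemma dir_deriv_eq_0:
  assumes "z \<notin> supp \<phi>" shows "dir_deriv v \<phi> z = 0"
proof -
  have "(\<phi> has_derivative (\<lambda>_. 0)) (at z)"
  proof (rule has_derivative_transform_within_open)
    show "((\<lambda>_. 0) has_derivative (\<lambda>_. 0)) (at z)" by simp
    show "open (- supp \<phi>)" "z \<in> - supp \<phi>" using assms by auto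
    show "0 = \<phi> x" if "x \<in> - supp \<phi>" for x using not_in_suppD[of x \<phi>] that by simp
  qed
  then show ?thesis unfolding dir_deriv_def using frechet_derivative_at by metis
qed

lemma test_function_dir_deriv:
  assumes "test_function U \<phi>" shows "test_function U (dir_deriv v \<phi>)"
proof (rule test_functionI[OF _ test_functionD(2)[OF assms] test_functionD(3)[OF assms]])
  show "C_k k (dir_deriv v \<phi>)" for k
    using test_functionD(1)[OF assms, of "Suc k"] by (simp add: dir_deriv_def[abs_def])
qed (rule dir_deriv_eq_0)

lemma test_function_laplacian:
  assumes "test_function U \<phi>" shows "test_function U (laplacian \<phi>)"
  unfolding laplacian_def[abs_def] by (intro test_function_add test_function_dir_deriv assms)

lemma dir_deriv_linear:
  assumes "f differentiable (at z)"
  shows "dir_deriv v f z = Re v * dir_deriv 1 f z + Im v * dir_deriv \<i> f z"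
proof -
  have l: "linear (frechet_derivative f (at z))" by (rule linear_frechet_derivative[OF assms])
  have "v = Re v *\<^sub>R 1 + Im v *\<^sub>R \<i>" by (simp add: complex_eq_iff)
  then have "frechet_derivative f (at z) v = frechet_derivative f (at z) (Re v *\<^sub>R 1 + Im v *\<^sub>R \<i>)" by simp
  then show ?thesis unfolding dir_deriv_def linear_add[OF l] linear_scale[OF l] by simp
qed

lemma dir_deriv_add:
  "f differentiable (at z) \<Longrightarrow> g differentiable (at z) \<Longrightarrow>
    dir_deriv v (\<lambda>z. f z + g z) z = dir_deriv v f z + dir_deriv v g z"
  unfolding dir_deriv_def
  by (rule fun_cong[OF frechet_derivative_at[symmetric]])
     (intro has_derivative_add; simp add: frechet_derivative_works[symmetric])

lemma dir_deriv_scale: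
  "f differentiable (at z) \<Longrightarrow> dir_deriv v (\<lambda>z. c * f z) z = c * dir_deriv v f z"
  unfolding dir_deriv_def
  by (rule fun_cong[OF frechet_derivative_at[symmetric]])
     (intro has_derivative_mult_right; simp add: frechet_derivative_works[symmetric])

lemma test_function_differentiable: "test_function U \<phi> \<Longrightarrow> \<phi> differentiable (at z)"
  using test_functionD(1)[of U \<phi> "Suc 0"] by simp

lemma laplacian_add:
  assumes "test_function U f" "test_function U g"
  shows "laplacian (\<lambda>z. f z + g z) z = laplacian f z + laplacian g z"
proof -
  have "dir_deriv v (\<lambda>z. f z + g z) = (\<lambda>z. dir_deriv v f z + dir_deriv v g z)" for v
    using assms test_function_differentiable by (intro ext dir_deriv_add) blast+
  then show ?thesis
    using test_function_differentiable[OF test_function_dir_deriv[OF assms(1)]]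
      test_function_differentiable[OF test_function_dir_deriv[OF assms(2)]]
    by (simp add: laplacian_def dir_deriv_add)
qed

lemma laplacian_scale:
  assumes "test_function U f"
  shows "laplacian (\<lambda>z. c * f z) z = c * laplacian f z"
proof -
  have "dir_deriv v (\<lambda>z. c * f z) = (\<lambda>z. c * dir_deriv v f z)" for v
    using assms test_function_differentiable by (intro ext dir_deriv_scale) blast
  then show ?thesis
    using test_function_differentiable[OF test_function_dir_deriv[OF assms]]
    by (simp add: laplacian_def dir_deriv_scale distrib_left)
qed

lemma uniformly_continuous_compact_support:
  fixes f :: "complex \<Rightarrow> real"
  assumes "continuous_on UNIV f" "compact K" "\<And>z. z \<notin> K \<Longrightarrow> f z = 0"
  shows "uniformly_continuous_on UNIV f"
proof -
  obtain R where R: "\<And>z. z \<in> K \<Longrightarrow> norm z \<le> R" using compact_imp_bounded[OF assms(2)] bounded_iff by metis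
  have "uniformly_continuous_on (cball 0 (R + 1)) f"
    by (intro compact_uniformly_continuous continuous_on_subset[OF assms(1)]) auto
  then show ?thesis
    unfolding uniformly_continuous_on_def
  proof (intro allI impI)
    fix e :: real assume u: "\<forall>e>0. \<exists>d>0. \<forall>x\<in>cball 0 (R + 1). \<forall>x'\<in>cball 0 (R + 1). dist x' x < d \<longrightarrow> dist (f x') (f x) < e"
      and e: "0 < e"
    then obtain d where d: "d > 0" "\<And>x x'. x\<in>cball 0 (R + 1) \<Longrightarrow> x'\<in>cball 0 (R + 1) \<Longrightarrow> dist x' x < d \<Longrightarrow> dist (f x') (f x) < e"
      by blast
    have "dist (f x') (f x) < e" if "dist x' x < min d 1" for x x'
    proof (cases "x \<in> cball 0 (R + 1) \<and> x' \<in> cball 0 (R + 1)")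
      case True then show ?thesis using d(2) that by simp
    next
      case False
      have "norm x' \<le> norm x + dist x' x" "norm x \<le> norm x' + dist x' x"
        using norm_triangle_ineq2[of x' x] norm_triangle_ineq2[of x x'] by (auto simp: dist_norm norm_minus_commute)
      with False that have "norm x > R" "norm x' > R" by auto
      then have "x \<notin> K" "x' \<notin> K" using R by force+
      then show ?thesis using assms(3) e by simp
    qed
    then show "\<exists>d>0. \<forall>x\<in>UNIV. \<forall>x'\<in>UNIV. dist x' x < d \<longrightarrow> dist (f x') (f x) < e"
      using d(1) by (intro exI[of _ "min d 1"]) auto
  qed
qed

lemma test_function_uniformly_continuous: "test_function U \<phi> \<Longrightarrow> uniformly_continuous_on UNIV \<phi>"
  by (rule uniformly_continuous_compact_support[OF test_functionD(4) test_functionD(2)])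
     (auto intro: not_in_suppD)

lemma test_function_deriv_line:
  assumes "test_function U \<phi>"
  shows "((\<lambda>s. \<phi> (z + of_real s * e)) has_real_derivative dir_deriv e \<phi> (z + of_real s * e)) (at s)"
proof -
  have "(\<phi> has_derivative frechet_derivative \<phi> (at (z + of_real s * e))) (at (z + of_real s * e))"
    using test_function_differentiable[OF assms] by (simp add: frechet_derivative_works[symmetric])
  moreover have "((\<lambda>s. z + of_real s * e) has_derivative (\<lambda>h. of_real h * e)) (at s)"
    by (auto intro!: derivative_eq_intros)
  ultimately have "((\<lambda>s. \<phi> (z + of_real s * e)) has_derivative
      (\<lambda>h. frechet_derivative \<phi> (at (z + of_real s * e)) (of_real h * e))) (at s)"
    by (rule has_derivative_compose[rotated])
  moreover have "frechet_derivative \<phi> (at w) (of_real h * e) = dir_deriv e \<phi> w * h" for h w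
    using linear_scale[OF linear_frechet_derivative[OF test_function_differentiable[OF assms]], of w h e]
    by (simp add: dir_deriv_def scaleR_conv_of_real mult.commute)
  ultimately show ?thesis by (simp add: has_field_derivative_def)
qed

text \<open>Uniformity in the centre comes from the uniform continuity of the second derivatives,
  which have compact support. When the quadratic polynomial in the direction \<open>cis t\<close> is
  averaged, linear and mixed terms have mean 0 and the squares mean \<open>1 / 2\<close>, which
  leaves \<open>\<rho>\<^sup>2 / 4\<close> times the Laplacian.\<close>

lemma cmean_taylor:
  assumes \<phi>: "test_function U \<phi>" and "e > 0"
  obtains \<delta> where "\<delta> > 0"
    "\<And>\<rho> z. \<lbrakk>\<rho> \<noteq> 0; \<bar>\<rho>\<bar> < \<delta>\<rbrakk> \<Longrightarrow> \<bar>cmean \<phi> z \<rho> - \<phi> z - \<rho>\<^sup>2 / 4 * laplacian \<phi> z\<bar> \<le> e * \<rho>\<^sup>2"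
proof -
  define D where "D a b = dir_deriv b (dir_deriv a \<phi>)" for a b
  have tD: "test_function U (D a b)" for a b unfolding D_def by (intro test_function_dir_deriv \<phi>)
  \<comment> \<open>Each of the four second derivatives varies by at most \<open>w\<close>, so the
    Taylor remainder is at most \<open>\<rho>\<^sup>2 / 2 * (4 * w)\<close>, half of what is
    allowed.\<close>
  define w where "w = e / 4"
  have w: "w > 0" using assms by (simp add: w_def)
  have "\<exists>d>0. \<forall>x x'. dist x' x < d \<longrightarrow> \<bar>D a b x' - D a b x\<bar> < w" for a b
    using test_function_uniformly_continuous[OF tD[of a b]] w
    unfolding uniformly_continuous_on_def dist_real_def by auto
  then obtain d where d: "\<And>a b. d a b > 0" "\<And>a b x x'. dist x' x < d a b \<Longrightarrow> \<bar>D a b x' - D a b x\<bar> < w"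
    by metis
  define \<delta> where "\<delta> = min (min (d 1 1) (d 1 \<i>)) (min (d \<i> 1) (d \<i> \<i>))"
  have \<delta>: "\<delta> > 0" using d(1) by (simp add: \<delta>_def)
  have "\<bar>cmean \<phi> z \<rho> - \<phi> z - \<rho>\<^sup>2 / 4 * laplacian \<phi> z\<bar> \<le> e * \<rho>\<^sup>2" if \<rho>: "\<rho> \<noteq> 0" "\<bar>\<rho>\<bar> < \<delta>" for \<rho> z
  proof -
    \<comment> \<open>The second derivative at \<open>x\<close> in the direction
      \<open>cis t\<close>. Both mixed derivatives are kept, as their common factor
      \<open>cos t * sin t\<close> has mean 0.\<close>
    define q where "q x t = cos t * cos t * D 1 1 x + cos t * sin t * (D 1 \<i> x + D \<i> 1 x) + sin t * sin t * D \<i> \<i> x" for x t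
    define T where "T t = \<phi> z + \<rho> * (cos t * dir_deriv 1 \<phi> z + sin t * dir_deriv \<i> \<phi> z) + \<rho>\<^sup>2 / 2 * q z t" for t
    have pt: "\<bar>\<phi> (z + rcis \<rho> t) - T t\<bar> \<le> e * \<rho>\<^sup>2" for t
    proof -
      define \<epsilon> where "\<epsilon> = cis t"
      have d1: "dir_deriv \<epsilon> \<phi> x = cos t * dir_deriv 1 \<phi> x + sin t * dir_deriv \<i> \<phi> x" for x
        using dir_deriv_linear[OF test_function_differentiable[OF \<phi>], of \<epsilon> x] by (simp add: \<epsilon>_def)
      have d2: "dir_deriv \<epsilon> (dir_deriv \<epsilon> \<phi>) x = q x t" for x
      proof -
        have "dir_deriv \<epsilon> \<phi> = (\<lambda>x. cos t * dir_deriv 1 \<phi> x + sin t * dir_deriv \<i> \<phi> x)" using d1 by blast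
        then have "dir_deriv b (dir_deriv \<epsilon> \<phi>) x = cos t * D 1 b x + sin t * D \<i> b x" for b
          unfolding D_def
          using test_function_differentiable[OF test_function_scale[OF test_function_dir_deriv[OF \<phi>]]]
            test_function_differentiable[OF test_function_dir_deriv[OF \<phi>]]
          by (simp add: dir_deriv_add dir_deriv_scale)
        then show ?thesis
          using dir_deriv_linear[OF test_function_differentiable[OF test_function_dir_deriv[OF \<phi>, of \<epsilon>]], of \<epsilon> x]
          by (simp add: \<epsilon>_def q_def algebra_simps)
      qed
      define df where "df m s = (if m = 0 then \<phi> (z + of_real s * \<epsilon>) else if m = 1 then dir_deriv \<epsilon> \<phi> (z + of_real s * \<epsilon>)
         else q (z + of_real s * \<epsilon>) t)" for m :: nat and s
      have "\<exists>s. \<bar>s\<bar> \<le> \<bar>\<rho>\<bar> \<and> df 0 \<rho> = (\<Sum>m<2. df m 0 / fact m * \<rho> ^ m) + df 2 s / fact 2 * \<rho> ^ 2"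
      proof (rule Maclaurin_bi_le)
        show "\<forall>m s. m < 2 \<and> \<bar>s\<bar> \<le> \<bar>\<rho>\<bar> \<longrightarrow> (df m has_real_derivative df (Suc m) s) (at s)"
        proof (intro allI impI)
          fix m :: nat and s :: real assume "m < 2 \<and> \<bar>s\<bar> \<le> \<bar>\<rho>\<bar>"
          then consider "m = 0" | "m = 1" by linarith
          then show "(df m has_real_derivative df (Suc m) s) (at s)"
          proof cases
            case 1
            with test_function_deriv_line[OF \<phi>, of z \<epsilon> s] show ?thesis by (simp add: df_def[abs_def])
          next
            case 2
            with test_function_deriv_line[OF test_function_dir_deriv[OF \<phi>], of \<epsilon> z \<epsilon> s] show ?thesis
              by (simp add: df_def[abs_def] d2)
          qed
        qed
      qed simp
      then obtain s where s: "\<bar>s\<bar> \<le> \<bar>\<rho>\<bar>" "\<phi> (z + of_real \<rho> * \<epsilon>) = \<phi> z + \<rho> * dir_deriv \<epsilon> \<phi> z + \<rho>\<^sup>2 / 2 * q (z + of_real s * \<epsilon>) t"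
        by (auto simp: df_def numeral_2_eq_2 mult_ac)
      have "\<phi> (z + rcis \<rho> t) - T t = \<rho>\<^sup>2 / 2 * (q (z + of_real s * \<epsilon>) t - q z t)"
        using s(2) unfolding T_def d1[symmetric] by (simp add: rcis_def \<epsilon>_def algebra_simps)
      moreover have "\<bar>q (z + of_real s * \<epsilon>) t - q z t\<bar> \<le> 4 * w"
      proof -
        define x where "x = z + of_real s * \<epsilon>"
        have dx: "dist x z < \<delta>" using s(1) \<rho>(2) by (simp add: x_def dist_norm norm_mult \<epsilon>_def)
        have dd: "\<bar>D a b x - D a b z\<bar> \<le> w" if "a = 1 \<or> a = \<i>" "b = 1 \<or> b = \<i>" for a b
          using d(2)[of x z a b] dx that unfolding \<delta>_def by fastforce
        have bd: "\<bar>c * d'\<bar> \<le> w" if "\<bar>c\<bar> \<le> 1" "\<bar>d'\<bar> \<le> w" for c d'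
          using mult_mono[OF that] by (simp add: abs_mult)
        have tr: "\<bar>cos t * cos t\<bar> \<le> 1" "\<bar>cos t * sin t\<bar> \<le> 1" "\<bar>sin t * sin t\<bar> \<le> 1"
          unfolding abs_mult by (intro mult_le_one; simp)+
        have "q x t - q z t = cos t * cos t * (D 1 1 x - D 1 1 z) + cos t * sin t * (D 1 \<i> x - D 1 \<i> z)
           + cos t * sin t * (D \<i> 1 x - D \<i> 1 z) + sin t * sin t * (D \<i> \<i> x - D \<i> \<i> z)"
          by (simp add: q_def algebra_simps)
        then show ?thesis unfolding x_def[symmetric]
          using bd[OF tr(1) dd[of 1 1]] bd[OF tr(2) dd[of 1 \<i>]] bd[OF tr(2) dd[of \<i> 1]] bd[OF tr(3) dd[of \<i> \<i>]]
          by (simp add: abs_le_iff)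
      qed
      then have "\<rho>\<^sup>2 / 2 * \<bar>q (z + of_real s * \<epsilon>) t - q z t\<bar> \<le> \<rho>\<^sup>2 / 2 * (4 * w)"
        by (rule mult_left_mono) simp
      ultimately have "\<bar>\<phi> (z + rcis \<rho> t) - T t\<bar> \<le> \<rho>\<^sup>2 / 2 * (4 * w)"
        by (simp only: abs_mult) simp
      also have "\<dots> \<le> e * \<rho>\<^sup>2" using assms(2) by (simp add: w_def)
      finally show ?thesis .
    qed
    note [simp] = circ_trig
    have iT: "integrable circ T" "(LINT t|circ. T t) = \<phi> z + \<rho>\<^sup>2 / 4 * laplacian \<phi> z"
    proof -
      have "T = (\<lambda>t. \<phi> z + cos t * (\<rho> * dir_deriv 1 \<phi> z) + sin t * (\<rho> * dir_deriv \<i> \<phi> z)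
        + (cos t * cos t) * (\<rho>\<^sup>2 / 2 * D 1 1 z) + (cos t * sin t) * (\<rho>\<^sup>2 / 2 * (D 1 \<i> z + D \<i> 1 z))
        + (sin t * sin t) * (\<rho>\<^sup>2 / 2 * D \<i> \<i> z))"
        by (auto simp: T_def q_def fun_eq_iff algebra_simps)
      then show "integrable circ T" "(LINT t|circ. T t) = \<phi> z + \<rho>\<^sup>2 / 4 * laplacian \<phi> z"
        by (simp_all only: circ_trig_combination) (simp add: laplacian_def D_def algebra_simps)
    qed
    have i\<phi>: "integrable circ (\<lambda>t. \<phi> (z + rcis \<rho> t))"
      by (intro continuous_circle continuous_on_subset[OF test_functionD(4)[OF \<phi>]]) auto
    have "cmean \<phi> z \<rho> - \<phi> z - \<rho>\<^sup>2 / 4 * laplacian \<phi> z = (LINT t|circ. \<phi> (z + rcis \<rho> t) - T t)"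
      using iT i\<phi> by (simp add: cmean_def)
    also have "\<bar>\<dots>\<bar> \<le> (LINT t|circ. \<bar>\<phi> (z + rcis \<rho> t) - T t\<bar>)"
      by (rule integral_abs_bound)
    also have "\<dots> \<le> (LINT t|circ. e * \<rho>\<^sup>2)"
      using iT i\<phi> pt by (intro integral_mono) auto
    finally show ?thesis by simp
  qed
  with \<delta> that show thesis by blast
qed

text \<open>Fubini and translation invariance: for each angle the plane is shifted by
  \<open>rcis \<rho> t\<close>. Boundedness of \<open>v\<close> and the bounded support of
  \<open>\<psi>\<close>, which a shift enlarges by at most \<open>\<bar>\<rho>\<bar>\<close>, give
  integrability on the product.\<close>

lemma cmean_transfer:
  fixes v \<psi> :: "complex \<Rightarrow> real"
  assumes [measurable]: "v \<in> borel_measurable borel" "\<psi> \<in> borel_measurable borel"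
    and b: "\<And>z. \<bar>v z\<bar> \<le> B" "\<And>z. \<bar>\<psi> z\<bar> \<le> C" and K: "bounded K" "\<And>z. z \<notin> K \<Longrightarrow> \<psi> z = 0"
  shows "(LINT z|lborel. v z * cmean \<psi> z (-\<rho>)) = (LINT z|lborel. cmean v z \<rho> * \<psi> z)"
proof -
  interpret P: pair_sigma_finite lborel circ by standard
  obtain R where R: "\<And>z. z \<in> K \<Longrightarrow> norm z \<le> R" using K(1) bounded_iff by metis
  have B: "B \<ge> 0" "C \<ge> 0" using b[of 0] by auto
  have m [measurable]: "(\<lambda>(z,t). z + rcis \<rho> t) \<in> borel_measurable (lborel \<Otimes>\<^sub>M circ)"
    "(\<lambda>(z,t). z - rcis \<rho> t) \<in> borel_measurable (lborel \<Otimes>\<^sub>M circ)"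
    by measurable
  have fin: "emeasure (lborel \<Otimes>\<^sub>M circ) (cball (0::complex) S \<times> UNIV) < \<infinity>" for S :: real
    using emeasure_bounded_finite[of "cball (0::complex) S"]
    by (subst circ.emeasure_pair_measure_Times) (auto simp: emeasure_circ)
  have out: "\<psi> (z - rcis \<rho> t) = 0" if "norm z > R + \<bar>\<rho>\<bar>" for z t
  proof -
    have "norm (z - rcis \<rho> t) > R" using that norm_triangle_ineq2[of z "rcis \<rho> t"] by (simp add: norm_mult rcis_def)
    then show ?thesis using K(2) R by force
  qed
  have i1: "integrable (lborel \<Otimes>\<^sub>M circ) (\<lambda>(z,t). v z * \<psi> (z - rcis \<rho> t))"
  proof (rule integrableI_bounded_set[OF _ _ fin[of "R + \<bar>\<rho>\<bar>"], where B="B * C"])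
    show "AE x in lborel \<Otimes>\<^sub>M circ. x \<in> cball 0 (R + \<bar>\<rho>\<bar>) \<times> UNIV \<longrightarrow> norm (case x of (z, t) \<Rightarrow> v z * \<psi> (z - rcis \<rho> t)) \<le> B * C"
      using b B by (intro AE_I2) (auto simp: abs_mult intro!: mult_mono)
    show "AE x in lborel \<Otimes>\<^sub>M circ. x \<notin> cball 0 (R + \<bar>\<rho>\<bar>) \<times> UNIV \<longrightarrow> (case x of (z, t) \<Rightarrow> v z * \<psi> (z - rcis \<rho> t)) = 0"
      using out by (intro AE_I2) (auto, meson linorder_not_le out)
  qed auto
  have i2: "integrable (lborel \<Otimes>\<^sub>M circ) (\<lambda>(z,t). v (z + rcis \<rho> t) * \<psi> z)"
  proof (rule integrableI_bounded_set[OF _ _ fin[of R], where B="B * C"])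
    show "AE x in lborel \<Otimes>\<^sub>M circ. x \<in> cball 0 R \<times> UNIV \<longrightarrow> norm (case x of (z, t) \<Rightarrow> v (z + rcis \<rho> t) * \<psi> z) \<le> B * C"
      using b B by (intro AE_I2) (auto simp: abs_mult intro!: mult_mono)
    show "AE x in lborel \<Otimes>\<^sub>M circ. x \<notin> cball 0 R \<times> UNIV \<longrightarrow> (case x of (z, t) \<Rightarrow> v (z + rcis \<rho> t) * \<psi> z) = 0"
      using K(2) R by (intro AE_I2) force
  qed auto
  have "(LINT z|lborel. v z * cmean \<psi> z (-\<rho>)) = (LINT z|lborel. LINT t|circ. v z * \<psi> (z - rcis \<rho> t))"
    unfolding cmean_def by (simp add: rcis_def)
  also have "\<dots> = (LINT t|circ. LINT z|lborel. v z * \<psi> (z - rcis \<rho> t))"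
    using P.Fubini_integral[OF i1] by simp
  also have "\<dots> = (LINT t|circ. LINT z|lborel. v (z + rcis \<rho> t) * \<psi> z)"
  proof (rule Bochner_Integration.integral_cong[OF refl])
    fix t :: real
    have "(LINT z|lborel. v z * \<psi> (z - rcis \<rho> t)) = (LINT z|distr lborel borel ((+) (rcis \<rho> t)). v z * \<psi> (z - rcis \<rho> t))"
      by (simp only: lborel_distr_plus)
    also have "\<dots> = (LINT z|lborel. v (z + rcis \<rho> t) * \<psi> z)"
      by (subst integral_distr) (auto simp: add.commute)
    finally show "(LINT z|lborel. v z * \<psi> (z - rcis \<rho> t)) = (LINT z|lborel. v (z + rcis \<rho> t) * \<psi> z)" .
  qed
  also have "\<dots> = (LINT z|lborel. LINT t|circ. v (z + rcis \<rho> t) * \<psi> z)"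
    using P.Fubini_integral[OF i2] by simp
  also have "\<dots> = (LINT z|lborel. cmean v z \<rho> * \<psi> z)"
    unfolding cmean_def by simp
  finally show ?thesis .
qed

lemma cmean_measurable [measurable]:
  fixes f :: "complex \<Rightarrow> real"
  assumes [measurable]: "f \<in> borel_measurable borel"
  shows "(\<lambda>z. cmean f z \<rho>) \<in> borel_measurable borel"
  unfolding cmean_def by (rule circ.borel_measurable_lebesgue_integral) measurable

lemma abs_cmean_le:
  fixes f :: "complex \<Rightarrow> real"
  assumes "f \<in> borel_measurable borel" "\<And>z. \<bar>f z\<bar> \<le> B"
  shows "\<bar>cmean f z \<rho>\<bar> \<le> B"
proof -
  have [measurable]: "f \<in> borel_measurable borel" by fact
  have i: "integrable circ (\<lambda>t. f (z + rcis \<rho> t))"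
    by (rule integrable_circ_bounded[of _ B]) (use assms in auto)
  have "\<bar>cmean f z \<rho>\<bar> \<le> (LINT t|circ. \<bar>f (z + rcis \<rho> t)\<bar>)"
    unfolding cmean_def by (rule integral_abs_bound)
  also have "\<dots> \<le> (LINT t|circ. B)" using i assms(2) by (intro integral_mono) auto
  finally show ?thesis by simp
qed

lemma lborel_integrable_bounded_support:
  fixes f :: "complex \<Rightarrow> real"
  assumes "f \<in> borel_measurable borel" "\<And>z. \<bar>f z\<bar> \<le> B" "\<And>z. norm z > R \<Longrightarrow> f z = 0"
  shows "integrable lborel f"
proof (rule integrableI_bounded_set[of "cball 0 R"])
  show "emeasure lborel (cball (0::complex) R) < \<infinity>" by (rule emeasure_bounded_finite) simp
qed (use assms in auto)

section \<open>The Laplacian of a bounded continuous subharmonic function\<close>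

text \<open>Test functions are too small a class for the level formula: a smooth cutoff of
  \<open>cmod (f z) powr p\<close> is in general only continuous.\<close>

definition cc :: "complex set \<Rightarrow> (complex \<Rightarrow> real) \<Rightarrow> bool" where
  "cc \<Omega> \<psi> \<longleftrightarrow> continuous_on UNIV \<psi> \<and> (\<exists>K. compact K \<and> K \<subseteq> \<Omega> \<and> (\<forall>z. z \<notin> K \<longrightarrow> \<psi> z = 0))"

lemma cc_test: assumes "test_function \<Omega> \<phi>" shows "cc \<Omega> \<phi>"
  unfolding cc_def using test_functionD[OF assms] not_in_suppD[of _ \<phi>] by metis

lemma cc_combine:
  assumes "cc \<Omega> f" "cc \<Omega> g" "continuous_on UNIV (\<lambda>z. h (f z) (g z))" "h 0 0 = 0"
  shows "cc \<Omega> (\<lambda>z. h (f z) (g z))"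
proof -
  obtain K L where "compact K" "K \<subseteq> \<Omega>" "\<forall>z. z \<notin> K \<longrightarrow> f z = 0" "compact L" "L \<subseteq> \<Omega>" "\<forall>z. z \<notin> L \<longrightarrow> g z = 0"
    using assms(1,2) unfolding cc_def by blast
  then show ?thesis using assms(3,4) unfolding cc_def by (intro conjI exI[of _ "K \<union> L"]) auto
qed

lemma cc_cont: "cc \<Omega> f \<Longrightarrow> continuous_on UNIV f" by (simp add: cc_def)

lemma cc_measurable: "cc \<Omega> f \<Longrightarrow> f \<in> borel_measurable borel"
  by (rule borel_measurable_continuous_onI[OF cc_cont])

lemma cc_add: "cc \<Omega> f \<Longrightarrow> cc \<Omega> g \<Longrightarrow> cc \<Omega> (\<lambda>z. f z + g z)"
  by (rule cc_combine[where h="(+)"]) (auto intro: continuous_intros cc_cont)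

lemma cc_diff: "cc \<Omega> f \<Longrightarrow> cc \<Omega> g \<Longrightarrow> cc \<Omega> (\<lambda>z. f z - g z)"
  by (rule cc_combine[where h="(-)"]) (auto intro: continuous_intros cc_cont)

lemma cc_scale: "cc \<Omega> f \<Longrightarrow> cc \<Omega> (\<lambda>z. c * f z)"
  by (rule cc_combine[where h="\<lambda>x y. c * x" and g=f]) (auto intro: continuous_intros cc_cont)

lemma cc_bounded:
  assumes "cc \<Omega> f" obtains B R where "\<And>z. \<bar>f z\<bar> \<le> B" "\<And>z. norm z > R \<Longrightarrow> f z = 0" "B \<ge> 0" "R \<ge> 0"
proof -
  obtain K where K: "compact K" "\<And>z. z \<notin> K \<Longrightarrow> f z = 0" using assms unfolding cc_def by blast
  have "compact (f ` K)"
    by (rule compact_continuous_image[OF continuous_on_subset[OF cc_cont[OF assms] subset_UNIV] K(1)])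
  from compact_imp_bounded[OF this] obtain B where B: "\<forall>x\<in>f ` K. norm x \<le> B" unfolding bounded_iff by blast
  obtain R where R: "\<forall>z\<in>K. norm z \<le> R" using compact_imp_bounded[OF K(1)] unfolding bounded_iff by blast
  show thesis
  proof (rule that[of "max B 0" "max R 0"])
    show "\<bar>f z\<bar> \<le> max B 0" for z using B K(2)[of z] by (cases "z \<in> K") auto
    show "f z = 0" if "norm z > max R 0" for z using R K(2)[of z] that by force
  qed auto
qed

lemma cc_radon_integrable:
  assumes "radon_on \<Omega> M" "cc \<Omega> f" shows "integrable M f"
proof -
  obtain B R where B: "\<And>z. \<bar>f z\<bar> \<le> B" by (rule cc_bounded[OF assms(2)]) blast
  obtain K where K: "compact K" "K \<subseteq> \<Omega>" "\<And>z. z \<notin> K \<Longrightarrow> f z = 0" using assms(2) unfolding cc_def by blast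
  show ?thesis
    by (rule radon_on_integrable[OF assms(1) cc_measurable[OF assms(2)] K(1,2)]) (use B K(3) in auto)
qed

lemma cc_eventually_inside:
  assumes "open \<Omega>" "compact K" "K \<subseteq> \<Omega>"
  obtains \<delta> where "\<delta> > 0" "\<And>z \<rho>. z \<in> K \<Longrightarrow> \<rho> \<le> \<delta> \<Longrightarrow> cball z \<rho> \<subseteq> \<Omega>"
proof -
  obtain e where e: "e > 0" "(\<Union>x\<in>K. cball x e) \<subseteq> \<Omega>"
    using compact_subset_open_imp_cball_epsilon_subset[OF assms(2,1,3)] by blast
  show thesis
  proof (rule that[OF e(1)])
    fix z \<rho> assume "z \<in> K" "\<rho> \<le> e"
    then have "cball z \<rho> \<subseteq> cball z e" "cball z e \<subseteq> \<Omega>" using e(2) by (auto simp: subset_cball)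
    then show "cball z \<rho> \<subseteq> \<Omega>" by (rule order_trans)
  qed
qed

locale bounded_subharmonic =
  fixes \<Omega> :: "complex set" and v :: "complex \<Rightarrow> real" and B :: real
  assumes op: "open \<Omega>" and cont: "continuous_on \<Omega> v" and bd: "\<And>z. z \<in> \<Omega> \<Longrightarrow> \<bar>v z\<bar> \<le> B" and B0: "B \<ge> 0"
    and submean: "\<And>z \<rho>. \<lbrakk>z \<in> \<Omega>; \<rho> > 0; cball z \<rho> \<subseteq> \<Omega>\<rbrakk> \<Longrightarrow> v z \<le> cmean v z \<rho>"
begin

text \<open>Extension by 0 gives a bounded Borel function on the plane, to which
  \<open>cmean_transfer\<close> applies. Means of small radius about points of a compact subset of
  \<Omega> do not see the extension.\<close>

definition v0 :: "complex \<Rightarrow> real" where "v0 z = indicator \<Omega> z * v z"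

lemma v0_measurable [measurable]: "v0 \<in> borel_measurable borel"
proof -
  have "(\<lambda>z. indicator \<Omega> z *\<^sub>R v z) \<in> borel_measurable borel"
    using op cont by (intro borel_measurable_continuous_on_indicator) auto
  then show ?thesis by (simp add: v0_def[abs_def])
qed

lemma v0_bd: "\<bar>v0 z\<bar> \<le> B" using bd B0 by (auto simp: v0_def indicator_def)

text \<open>By Taylor's formula \<open>4 / \<rho>\<^sup>2\<close> times (mean minus value) tends to the Laplacian, so \<open>J \<rho>\<close> tends to the
  distributional Laplacian of \<open>v\<close>; moving the mean onto \<open>v\<close> shows that it is positive.\<close>

definition J :: "real \<Rightarrow> (complex \<Rightarrow> real) \<Rightarrow> real" where
  "J \<rho> \<psi> = 4 / \<rho>\<^sup>2 * (LINT z|lborel. v0 z * (cmean \<psi> z (-\<rho>) - \<psi> z))"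

lemma integrable_v0_mult:
  assumes "f \<in> borel_measurable borel" "\<And>z. \<bar>f z\<bar> \<le> C" "\<And>z. norm z > R \<Longrightarrow> f z = 0"
  shows "integrable lborel (\<lambda>z. v0 z * f z)"
proof (rule lborel_integrable_bounded_support[of _ "B * C" R])
  have [measurable]: "f \<in> borel_measurable borel" by fact
  show "(\<lambda>z. v0 z * f z) \<in> borel_measurable borel" by measurable
  show "\<bar>v0 z * f z\<bar> \<le> B * C" for z using mult_mono[OF v0_bd assms(2)] B0 by (simp add: abs_mult)
qed (simp add: assms(3))

lemma cmean_far:
  assumes "\<And>z. norm z > R \<Longrightarrow> f z = 0" "norm z > R + \<bar>\<rho>\<bar>" shows "cmean f z \<rho> = 0"
proof -
  have "f (z + rcis \<rho> t) = 0" for t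
  proof (rule assms(1))
    have "norm z \<le> norm (z + rcis \<rho> t) + norm (rcis \<rho> t)"
      using norm_triangle_ineq4[of "z + rcis \<rho> t" "rcis \<rho> t"] by simp
    then show "R < norm (z + rcis \<rho> t)" using assms(2) by (simp add: norm_mult rcis_def)
  qed
  then show ?thesis by (simp add: cmean_def)
qed

lemma J_integrable:
  assumes "cc \<Omega> \<psi>"
  shows "integrable lborel (\<lambda>z. v0 z * cmean \<psi> z (-\<rho>))" "integrable lborel (\<lambda>z. v0 z * \<psi> z)"
    "integrable lborel (\<lambda>z. cmean v0 z \<rho> * \<psi> z)"
proof -
  obtain C R where C: "\<And>z. \<bar>\<psi> z\<bar> \<le> C" "\<And>z. norm z > R \<Longrightarrow> \<psi> z = 0" "C \<ge> 0" "R \<ge> 0"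
    by (rule cc_bounded[OF assms]) blast
  have [measurable]: "\<psi> \<in> borel_measurable borel" by (rule cc_measurable[OF assms])
  show "integrable lborel (\<lambda>z. v0 z * cmean \<psi> z (-\<rho>))"
  proof (rule integrable_v0_mult[of _ C "R + \<bar>\<rho>\<bar>"])
    show "cmean \<psi> z (-\<rho>) = 0" if "norm z > R + \<bar>\<rho>\<bar>" for z
      using cmean_far[of R \<psi> "-\<rho>" z] C(2) that by simp
    show "\<bar>cmean \<psi> z (-\<rho>)\<bar> \<le> C" for z by (rule abs_cmean_le[OF _ C(1)]) measurable
  qed measurable
  show "integrable lborel (\<lambda>z. v0 z * \<psi> z)"
    by (rule integrable_v0_mult[of _ C R]) (use C in auto)
  show "integrable lborel (\<lambda>z. cmean v0 z \<rho> * \<psi> z)"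
  proof (rule lborel_integrable_bounded_support[of _ "B * C" R])
    show "\<bar>cmean v0 z \<rho> * \<psi> z\<bar> \<le> B * C" for z
      using mult_mono[OF abs_cmean_le[OF v0_measurable v0_bd, of z \<rho>] C(1)[of z]] B0 by (simp add: abs_mult)
  qed (use C in auto)
qed

lemma J_alt:
  assumes "cc \<Omega> \<psi>" shows "J \<rho> \<psi> = 4 / \<rho>\<^sup>2 * (LINT z|lborel. (cmean v0 z \<rho> - v0 z) * \<psi> z)"
proof -
  obtain C R where C: "\<And>z. \<bar>\<psi> z\<bar> \<le> C" "\<And>z. norm z > R \<Longrightarrow> \<psi> z = 0" "C \<ge> 0" "R \<ge> 0"
    by (rule cc_bounded[OF assms]) blast
  have "(LINT z|lborel. v0 z * (cmean \<psi> z (-\<rho>) - \<psi> z)) = (LINT z|lborel. v0 z * cmean \<psi> z (-\<rho>)) - (LINT z|lborel. v0 z * \<psi> z)"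
    using J_integrable[OF assms] by (simp add: right_diff_distrib)
  also have "(LINT z|lborel. v0 z * cmean \<psi> z (-\<rho>)) = (LINT z|lborel. cmean v0 z \<rho> * \<psi> z)"
    by (rule cmean_transfer[of _ _ B C "cball 0 R"]) (use v0_bd C cc_measurable[OF assms] in auto)
  also have "\<dots> - (LINT z|lborel. v0 z * \<psi> z) = (LINT z|lborel. (cmean v0 z \<rho> - v0 z) * \<psi> z)"
    using J_integrable[OF assms] by (simp add: left_diff_distrib)
  finally show ?thesis by (simp add: J_def)
qed

lemma J_add: assumes "cc \<Omega> f" "cc \<Omega> g" shows "J \<rho> (\<lambda>z. f z + g z) = J \<rho> f + J \<rho> g"
  unfolding J_alt[OF assms(1)] J_alt[OF assms(2)] J_alt[OF cc_add[OF assms]]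
  using J_integrable[OF assms(1)] J_integrable[OF assms(2)] by (simp add: algebra_simps)

lemma J_scale: assumes "cc \<Omega> f" shows "J \<rho> (\<lambda>z. c * f z) = c * J \<rho> f"
proof -
  have "(LINT z|lborel. (cmean v0 z \<rho> - v0 z) * (c * f z)) = (LINT z|lborel. c * ((cmean v0 z \<rho> - v0 z) * f z))"
    by (simp add: mult_ac)
  then show ?thesis unfolding J_alt[OF assms] J_alt[OF cc_scale[OF assms]] by simp
qed

lemma J_diff: assumes "cc \<Omega> f" "cc \<Omega> g" shows "J \<rho> (\<lambda>z. f z - g z) = J \<rho> f - J \<rho> g"
  using J_add[OF assms(1) cc_scale[OF assms(2), of "-1"]] J_scale[OF assms(2), of \<rho> "-1"] by simp

lemma cmean_v0: "cball z \<rho> \<subseteq> \<Omega> \<Longrightarrow> \<rho> \<ge> 0 \<Longrightarrow> cmean v0 z \<rho> = cmean v z \<rho>"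
  by (rule cmean_cong) (auto simp: v0_def indicator_def)

lemma J_nonneg:
  assumes "cc \<Omega> \<psi>" "\<And>z. \<psi> z \<ge> 0" "\<rho> > 0" "\<And>z. \<psi> z \<noteq> 0 \<Longrightarrow> z \<in> \<Omega> \<and> cball z \<rho> \<subseteq> \<Omega>"
  shows "J \<rho> \<psi> \<ge> 0"
proof -
  have "0 \<le> (cmean v0 z \<rho> - v0 z) * \<psi> z" for z
  proof (cases "\<psi> z = 0")
    case False
    then have z: "z \<in> \<Omega>" "cball z \<rho> \<subseteq> \<Omega>" using assms(4) by auto
    then have "v0 z \<le> cmean v0 z \<rho>" using submean[OF z(1) assms(3) z(2)] assms(3) by (simp add: cmean_v0 v0_def)
    then show ?thesis using assms(2) by simp
  qed simp
  then have "0 \<le> (LINT z|lborel. (cmean v0 z \<rho> - v0 z) * \<psi> z)" by (rule Bochner_Integration.integral_nonneg)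
  then show ?thesis unfolding J_alt[OF assms(1)] by (rule mult_nonneg_nonneg[rotated]) simp
qed

lemma J_test_tendsto:
  assumes "test_function \<Omega> \<phi>"
  shows "((\<lambda>\<rho>. J \<rho> \<phi>) \<longlongrightarrow> (LINT z|lborel. v0 z * laplacian \<phi> z)) (at_right 0)"
proof (rule tendstoI)
  fix e :: real assume e: "e > 0"
  note c = cc_test[OF assms]
  obtain C R where C: "\<And>z. \<bar>\<phi> z\<bar> \<le> C" "\<And>z. norm z > R \<Longrightarrow> \<phi> z = 0" "C \<ge> 0" "R \<ge> 0"
    by (rule cc_bounded[OF c]) blast
  have cL: "cc \<Omega> (laplacian \<phi>)" by (rule cc_test[OF test_function_laplacian[OF assms]])
  have L0: "laplacian \<phi> z = 0" if "norm z > R" for z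
  proof -
    have "supp \<phi> \<subseteq> cball 0 R" using C(2) by (intro closure_minimal) (auto simp: not_less[symmetric])
    then have "z \<notin> supp \<phi>" using that by auto
    moreover have "z \<notin> supp (dir_deriv w \<phi>)" for w
    proof -
      have "supp (dir_deriv w \<phi>) \<subseteq> supp \<phi>"
        by (intro closure_minimal) (use dir_deriv_eq_0 in auto)
      then show ?thesis using \<open>z \<notin> supp \<phi>\<close> by blast
    qed
    ultimately show ?thesis by (simp add: laplacian_def dir_deriv_eq_0)
  qed
  \<comment> \<open>For radii below 1 the mean of \<open>\<phi>\<close> lives in the ball of radius
    \<open>R + 1\<close>. There the error is at most \<open>4 * B * w\<close> pointwise, and
    \<open>w\<close> is chosen to make its integral at most \<open>e / 2\<close>.\<close>
  define V where "V = measure lborel (cball (0::complex) (R + 1))"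
  define w where "w = e / (8 * (B + 1) * (V + 1))"
  have V: "V \<ge> 0" by (simp add: V_def)
  have w: "w > 0" using e V B0 by (simp add: w_def)
  obtain \<delta> where \<delta>: "\<delta> > 0" "\<And>\<rho> z. \<lbrakk>\<rho> \<noteq> 0; \<bar>\<rho>\<bar> < \<delta>\<rbrakk> \<Longrightarrow> \<bar>cmean \<phi> z \<rho> - \<phi> z - \<rho>\<^sup>2 / 4 * laplacian \<phi> z\<bar> \<le> w * \<rho>\<^sup>2"
    by (rule cmean_taylor[OF assms w]) blast
  have "dist (J \<rho> \<phi>) (LINT z|lborel. v0 z * laplacian \<phi> z) < e" if \<rho>: "0 < \<rho>" "\<rho> < min \<delta> 1" for \<rho>
  proof -
    define g where "g z = v0 z * (4 / \<rho>\<^sup>2 * (cmean \<phi> z (-\<rho>) - \<phi> z - \<rho>\<^sup>2 / 4 * laplacian \<phi> z))" for z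
    have geq: "g = (\<lambda>z. 4 / \<rho>\<^sup>2 * (v0 z * cmean \<phi> z (-\<rho>)) - 4 / \<rho>\<^sup>2 * (v0 z * \<phi> z) - v0 z * laplacian \<phi> z)"
      using \<rho> by (auto simp: g_def fun_eq_iff field_simps)
    have ig: "integrable lborel g"
      unfolding geq using J_integrable[OF c] J_integrable(2)[OF cL] by simp
    have "J \<rho> \<phi> = 4 / \<rho>\<^sup>2 * (LINT z|lborel. v0 z * cmean \<phi> z (-\<rho>)) - 4 / \<rho>\<^sup>2 * (LINT z|lborel. v0 z * \<phi> z)"
      unfolding J_def right_diff_distrib Bochner_Integration.integral_diff[OF J_integrable(1)[OF c] J_integrable(2)[OF c]] ..
    then have "J \<rho> \<phi> - (LINT z|lborel. v0 z * laplacian \<phi> z) = (LINT z|lborel. g z)"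
      unfolding geq using J_integrable[OF c] J_integrable(2)[OF cL] by simp
    moreover have "\<bar>LINT z|lborel. g z\<bar> \<le> (LINT z|lborel. 4 * B * w * indicator (cball (0::complex) (R + 1)) z)"
    proof -
      have "\<bar>LINT z|lborel. g z\<bar> \<le> (LINT z|lborel. \<bar>g z\<bar>)" by (rule integral_abs_bound)
      also have "\<dots> \<le> (LINT z|lborel. 4 * B * w * indicator (cball (0::complex) (R + 1)) z)"
      proof (rule integral_mono)
        show "integrable lborel (\<lambda>z. 4 * B * w * indicator (cball (0::complex) (R + 1)) z)"
          using emeasure_bounded_finite[of "cball (0::complex) (R+1)"] by (intro integrable_mult_right) auto
        fix z :: complex
        show "\<bar>g z\<bar> \<le> 4 * B * w * indicator (cball 0 (R + 1)) z"
        proof (cases "z \<in> cball 0 (R + 1)")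
          case True
          have "\<bar>cmean \<phi> z (-\<rho>) - \<phi> z - \<rho>\<^sup>2 / 4 * laplacian \<phi> z\<bar> \<le> w * \<rho>\<^sup>2"
            using \<delta>(2)[of "-\<rho>" z] \<rho> by simp
          then have "4 / \<rho>\<^sup>2 * \<bar>cmean \<phi> z (-\<rho>) - \<phi> z - \<rho>\<^sup>2 / 4 * laplacian \<phi> z\<bar> \<le> 4 / \<rho>\<^sup>2 * (w * \<rho>\<^sup>2)"
            by (rule mult_left_mono) simp
          moreover have "\<bar>4 / \<rho>\<^sup>2 * x\<bar> = 4 / \<rho>\<^sup>2 * \<bar>x\<bar>" for x by (simp add: abs_mult)
          ultimately have "\<bar>4 / \<rho>\<^sup>2 * (cmean \<phi> z (-\<rho>) - \<phi> z - \<rho>\<^sup>2 / 4 * laplacian \<phi> z)\<bar> \<le> 4 / \<rho>\<^sup>2 * (w * \<rho>\<^sup>2)"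
            by (simp only:)
          also have "\<dots> = 4 * w" using \<rho> by simp
          finally have "\<bar>4 / \<rho>\<^sup>2 * (cmean \<phi> z (-\<rho>) - \<phi> z - \<rho>\<^sup>2 / 4 * laplacian \<phi> z)\<bar> \<le> 4 * w" .
          from mult_mono[OF v0_bd[of z] this] B0 w
          have "\<bar>g z\<bar> \<le> B * (4 * w)" by (simp only: g_def abs_mult) simp
          with True show ?thesis by simp
        next
          case False
          then have "norm z > R + 1" by simp
          then have "cmean \<phi> z (-\<rho>) = 0" "\<phi> z = 0" "laplacian \<phi> z = 0"
            using cmean_far[of R \<phi> "-\<rho>" z] C(2) L0 \<rho> by auto
          then show ?thesis using False by (simp add: g_def)
        qed
      qed (use ig in auto)
      finally show ?thesis .
    qed
    moreover have "(LINT z|lborel. 4 * B * w * indicator (cball (0::complex) (R + 1)) z) = 4 * B * w * V"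
      using emeasure_bounded_finite[of "cball (0::complex) (R+1)"] by (simp add: V_def)
    moreover have "4 * B * w * V < e"
    proof -
      have "4 * B * w * V \<le> 4 * w * ((B + 1) * (V + 1))"
        using w B0 V by (simp add: algebra_simps)
      also have "\<dots> = e / 2"
      proof -
        have "B + 1 \<noteq> 0" "V + 1 \<noteq> 0" using B0 V by auto
        then show ?thesis unfolding w_def by (simp add: divide_simps)
      qed
      finally show ?thesis using e by simp
    qed
    ultimately show ?thesis unfolding dist_real_def by linarith
  qed
  then show "\<forall>\<^sub>F \<rho> in at_right 0. dist (J \<rho> \<phi>) (LINT z|lborel. v0 z * laplacian \<phi> z) < e"
    using \<delta>(1) by (auto simp: eventually_at_right_field intro!: exI[of _ "min \<delta> 1"])
qed

lemma J_eventually_nonneg: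
  assumes "cc \<Omega> \<psi>" "\<And>z. \<psi> z \<ge> 0" shows "\<forall>\<^sub>F \<rho> in at_right 0. J \<rho> \<psi> \<ge> 0"
proof -
  obtain K where K: "compact K" "K \<subseteq> \<Omega>" "\<And>z. z \<notin> K \<Longrightarrow> \<psi> z = 0" using assms(1) unfolding cc_def by blast
  obtain \<delta> where "\<delta> > 0" "\<And>z \<rho>. z \<in> K \<Longrightarrow> \<rho> \<le> \<delta> \<Longrightarrow> cball z \<rho> \<subseteq> \<Omega>"
    by (rule cc_eventually_inside[OF op K(1,2)]) blast
  then have "J \<rho> \<psi> \<ge> 0" if "0 < \<rho>" "\<rho> < \<delta>" for \<rho>
    using that K by (intro J_nonneg assms) (metis less_imp_le subsetD)+
  then show ?thesis using \<open>\<delta> > 0\<close> by (auto simp: eventually_at_right_field)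
qed

lemma laplacian_integral_nonneg:
  assumes "test_function \<Omega> \<phi>" "\<And>z. \<phi> z \<ge> 0" shows "0 \<le> (LINT z|lborel. v0 z * laplacian \<phi> z)"
  by (rule tendsto_lowerbound[OF J_test_tendsto[OF assms(1)] J_eventually_nonneg[OF cc_test[OF assms(1)] assms(2)]]) simp

lemma integrable_v0_test: "test_function \<Omega> \<phi> \<Longrightarrow> integrable lborel (\<lambda>z. v0 z * \<phi> z)"
  by (rule J_integrable(2)[OF cc_test])

lemma positive_functional:
  assumes "\<kappa> > 0"
  shows "positive_functional \<Omega> (\<lambda>\<phi>. \<kappa> * (LINT z|lborel. v0 z * laplacian \<phi> z))"
proof
  fix f g assume fg: "test_function \<Omega> f" "test_function \<Omega> g"
  show "\<kappa> * (LINT z|lborel. v0 z * laplacian (\<lambda>z. f z + g z) z) =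
    \<kappa> * (LINT z|lborel. v0 z * laplacian f z) + \<kappa> * (LINT z|lborel. v0 z * laplacian g z)"
    using integrable_v0_test[OF test_function_laplacian[OF fg(1)]] integrable_v0_test[OF test_function_laplacian[OF fg(2)]]
    by (simp add: laplacian_add[OF fg] distrib_left)
next
  fix c f assume f: "test_function \<Omega> f"
  have "(LINT z|lborel. v0 z * laplacian (\<lambda>z. c * f z) z) = (LINT z|lborel. c * (v0 z * laplacian f z))"
    by (simp add: laplacian_scale[OF f] mult_ac)
  then show "\<kappa> * (LINT z|lborel. v0 z * laplacian (\<lambda>z. c * f z) z) = c * (\<kappa> * (LINT z|lborel. v0 z * laplacian f z))"
    by simp
qed (use op laplacian_integral_nonneg assms in auto)

definition riesz :: "real \<Rightarrow> complex measure" where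
  "riesz \<kappa> = (SOME M. radon_on \<Omega> M \<and> (\<forall>\<phi>. test_function \<Omega> \<phi> \<longrightarrow> (LINT z|M. \<phi> z) = \<kappa> * (LINT z|lborel. v0 z * laplacian \<phi> z)))"

lemma riesz:
  assumes "\<kappa> > 0"
  shows "radon_on \<Omega> (riesz \<kappa>)"
    and "test_function \<Omega> \<phi> \<Longrightarrow> (LINT z|riesz \<kappa>. \<phi> z) = \<kappa> * (LINT z|lborel. v0 z * laplacian \<phi> z)"
proof -
  have "\<exists>M. radon_on \<Omega> M \<and> (\<forall>\<phi>. test_function \<Omega> \<phi> \<longrightarrow> (LINT z|M. \<phi> z) = \<kappa> * (LINT z|lborel. v0 z * laplacian \<phi> z))"
    by (rule Riesz_test_functions[OF positive_functional[OF assms]]) blast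
  from someI_ex[OF this] show "radon_on \<Omega> (riesz \<kappa>)"
    and "test_function \<Omega> \<phi> \<Longrightarrow> (LINT z|riesz \<kappa>. \<phi> z) = \<kappa> * (LINT z|lborel. v0 z * laplacian \<phi> z)"
    unfolding riesz_def by blast+
qed

text \<open>Convergence is known for test functions only. The difference between
  \<open>\<psi>\<close> and a suitable test function lies between \<open>- e * \<eta>\<close> and
  \<open>e * \<eta>\<close> for a fixed cutoff \<open>\<eta>\<close>. Eventual positivity of
  \<open>J\<close> transfers this to \<open>J\<close>, and \<open>J \<rho> \<eta>\<close> stays
  bounded because it converges.\<close>

lemma J_tendsto:
  assumes \<kappa>: "\<kappa> > 0" and \<psi>: "cc \<Omega> \<psi>"
  shows "((\<lambda>\<rho>. \<kappa> * J \<rho> \<psi>) \<longlongrightarrow> (LINT z|riesz \<kappa>. \<psi> z)) (at_right 0)"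
proof (rule tendstoI)
  fix e0 :: real assume e0: "e0 > 0"
  let ?I = "\<lambda>\<psi>. LINT z|riesz \<kappa>. \<psi> z"
  note R = riesz(1)[OF \<kappa>]
  obtain K where K: "compact K" "K \<subseteq> \<Omega>" "\<And>z. z \<notin> K \<Longrightarrow> \<psi> z = 0" using \<psi> unfolding cc_def by blast
  obtain \<eta> V where \<eta>: "test_function \<Omega> \<eta>" "\<And>z. 0 \<le> \<eta> z" "\<And>z. \<eta> z \<le> 1"
    "open V" "K \<subseteq> V" "\<And>z. z \<in> V \<Longrightarrow> \<eta> z = 1"
    using smooth_Urysohn[OF K(1) op K(2)] by blast
  define A where "A = ?I \<eta>"
  have A: "A \<ge> 0" unfolding A_def by (rule Bochner_Integration.integral_nonneg) (rule \<eta>(2))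
  \<comment> \<open>The errors add up to \<open>e * (A + 1) + e + e * A\<close>, that is
    \<open>e * (2 * A + 2)\<close>.\<close>
  define e where "e = e0 / (2 * A + 3)"
  have e: "e > 0" "e * (2 * A + 2) < e0" using e0 A by (auto simp: e_def field_simps)
  obtain p where p: "real_polynomial_function p" "\<And>z. z \<in> supp \<eta> \<Longrightarrow> \<bar>\<psi> z - p z\<bar> < e"
    using Stone_Weierstrass_real_polynomial_function[OF test_functionD(2)[OF \<eta>(1)] continuous_on_subset[OF cc_cont[OF \<psi>] subset_UNIV] e(1)]
    by blast
  define \<phi> where "\<phi> z = \<eta> z * p z" for z
  have \<phi>: "test_function \<Omega> \<phi>" unfolding \<phi>_def
    by (rule test_function_mult_smooth[OF \<eta>(1) C_k_real_polynomial[OF p(1)]])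
  have close: "\<bar>\<psi> z - \<phi> z\<bar> \<le> e * \<eta> z" for z
  proof -
    have "\<psi> z - \<phi> z = \<eta> z * (\<psi> z - p z)"
    proof (cases "z \<in> K")
      case True then show ?thesis using \<eta>(5,6) by (auto simp: \<phi>_def)
    next
      case False then show ?thesis using K(3) by (simp add: \<phi>_def)
    qed
    moreover have "\<bar>\<eta> z * (\<psi> z - p z)\<bar> \<le> \<eta> z * e"
    proof (cases "z \<in> supp \<eta>")
      case True
      then show ?thesis unfolding abs_mult using p(2)[of z] \<eta>(2)[of z] by (simp add: mult_left_mono)
    next
      case False
      from not_in_suppD[OF this] show ?thesis by simp
    qed
    ultimately show ?thesis by (simp add: mult.commute)
  qed
  note c\<phi> = cc_test[OF \<phi>] and c\<eta> = cc_test[OF \<eta>(1)]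
  note d = cc_diff[OF \<psi> c\<phi>] and s = cc_scale[OF c\<eta>, of e]
  have iI: "integrable (riesz \<kappa>) \<psi>" "integrable (riesz \<kappa>) \<phi>" "integrable (riesz \<kappa>) \<eta>"
    by (intro cc_radon_integrable[OF R] \<psi> c\<phi> c\<eta>)+
  have I: "\<bar>?I \<psi> - ?I \<phi>\<bar> \<le> e * A"
  proof -
    have "\<bar>?I (\<lambda>z. \<psi> z - \<phi> z)\<bar> \<le> ?I (\<lambda>z. \<bar>\<psi> z - \<phi> z\<bar>)" by (rule integral_abs_bound)
    also have "\<dots> \<le> ?I (\<lambda>z. e * \<eta> z)" using iI by (intro integral_mono close) auto
    finally show ?thesis using iI by (simp add: A_def)
  qed
  have pm: "0 \<le> e * \<eta> z - (\<psi> z - \<phi> z)" "0 \<le> e * \<eta> z + (\<psi> z - \<phi> z)" for z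
    using close[of z] by linarith+
  have "\<forall>\<^sub>F \<rho> in at_right 0. J \<rho> (\<lambda>z. e * \<eta> z - (\<psi> z - \<phi> z)) \<ge> 0"
    by (rule J_eventually_nonneg[OF cc_diff[OF s d] pm(1)])
  moreover have "\<forall>\<^sub>F \<rho> in at_right 0. J \<rho> (\<lambda>z. e * \<eta> z + (\<psi> z - \<phi> z)) \<ge> 0"
    by (rule J_eventually_nonneg[OF cc_add[OF s d] pm(2)])
  moreover have "\<forall>\<^sub>F \<rho> in at_right 0. dist (\<kappa> * J \<rho> \<phi>) (?I \<phi>) < e"
    using tendsto_mult_left[OF J_test_tendsto[OF \<phi>], of \<kappa>] e(1) unfolding riesz(2)[OF \<kappa> \<phi>] by (rule tendstoD)
  moreover have "\<forall>\<^sub>F \<rho> in at_right 0. dist (\<kappa> * J \<rho> \<eta>) A < 1"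
    using tendsto_mult_left[OF J_test_tendsto[OF \<eta>(1)], of \<kappa>] zero_less_one unfolding A_def riesz(2)[OF \<kappa> \<eta>(1)] by (rule tendstoD)
  ultimately show "\<forall>\<^sub>F \<rho> in at_right 0. dist (\<kappa> * J \<rho> \<psi>) (?I \<psi>) < e0"
  proof eventually_elim
    case (elim \<rho>)
    have "\<bar>J \<rho> \<psi> - J \<rho> \<phi>\<bar> \<le> e * J \<rho> \<eta>"
      using elim(1,2) J_diff[OF s d] J_add[OF s d] J_diff[OF \<psi> c\<phi>] J_scale[OF c\<eta>] by simp
    then have "\<kappa> * \<bar>J \<rho> \<psi> - J \<rho> \<phi>\<bar> \<le> e * (\<kappa> * J \<rho> \<eta>)"
      using mult_left_mono[of _ _ \<kappa>] \<kappa> by (simp add: mult.left_commute)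
    also have "\<dots> \<le> e * (A + 1)" using elim(4) e(1) by (intro mult_left_mono) (auto simp: dist_real_def)
    finally have "\<bar>\<kappa> * J \<rho> \<psi> - \<kappa> * J \<rho> \<phi>\<bar> \<le> e * (A + 1)"
      using \<kappa> by (simp add: abs_mult flip: right_diff_distrib)
    then have "\<bar>\<kappa> * J \<rho> \<psi> - ?I \<psi>\<bar> < e * (A + 1) + e + e * A"
      using I elim(3) unfolding dist_real_def by linarith
    also have "\<dots> = e * (2 * A + 2)" by (simp add: algebra_simps)
    finally show ?case using e(2) by (simp add: dist_real_def)
  qed
qed

end

section \<open>The measures of an exhaustion function\<close>

lemma represents_ddc_unique:
  assumes "open \<Omega>" "represents_ddc \<kappa> \<Omega> v M" "represents_ddc \<kappa> \<Omega> v N" shows "M = N"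
  using assms by (intro radon_on_unique[OF assms(1)]) (auto simp: represents_ddc_def radon_on_def)

lemma ddc_eqI: "open \<Omega> \<Longrightarrow> represents_ddc \<kappa> \<Omega> v M \<Longrightarrow> ddc \<kappa> \<Omega> v = M"
  unfolding ddc_def using represents_ddc_unique by blast

lemma laplacian_eq_0: assumes "z \<notin> supp \<phi>" shows "laplacian \<phi> z = 0"
proof -
  have "supp (dir_deriv w \<phi>) \<subseteq> supp \<phi>" for w
    by (intro closure_minimal) (use dir_deriv_eq_0 in auto)
  then have "z \<notin> supp (dir_deriv w \<phi>)" for w using assms by blast
  then show ?thesis by (simp add: laplacian_def dir_deriv_eq_0)
qed

text \<open>The masses near the support of \<open>\<psi>\<close> are eventually bounded because the
  integrals of one cutoff \<open>\<eta>\<close> converge. Polynomial approximation multiplied by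
  \<open>\<eta>\<close> then leads from test functions to continuous ones.\<close>

lemma radon_weak_convergence:
  assumes op: "open \<Omega>" and R: "\<forall>\<^sub>F n in F. radon_on \<Omega> (M n)" "radon_on \<Omega> N"
    and conv: "\<And>\<phi>. test_function \<Omega> \<phi> \<Longrightarrow> ((\<lambda>n. LINT z|M n. \<phi> z) \<longlongrightarrow> (LINT z|N. \<phi> z)) F"
    and \<psi>: "cc \<Omega> \<psi>"
  shows "((\<lambda>n. LINT z|M n. \<psi> z) \<longlongrightarrow> (LINT z|N. \<psi> z)) F"
proof (rule tendstoI)
  fix e0 :: real assume e0: "e0 > 0"
  obtain K where K: "compact K" "K \<subseteq> \<Omega>" "\<And>z. z \<notin> K \<Longrightarrow> \<psi> z = 0" using \<psi> unfolding cc_def by blast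
  obtain \<eta> V where \<eta>: "test_function \<Omega> \<eta>" "\<And>z. 0 \<le> \<eta> z" "\<And>z. \<eta> z \<le> 1"
    "open V" "K \<subseteq> V" "\<And>z. z \<in> V \<Longrightarrow> \<eta> z = 1"
    using smooth_Urysohn[OF K(1) op K(2)] by blast
  define A where "A = (LINT z|N. \<eta> z)"
  have A: "A \<ge> 0" unfolding A_def by (rule Bochner_Integration.integral_nonneg) (rule \<eta>(2))
  define e where "e = e0 / (2 * A + 3)"
  have e: "e > 0" "e * (2 * A + 2) < e0" using e0 A by (auto simp: e_def field_simps)
  obtain p where p: "real_polynomial_function p" "\<And>z. z \<in> supp \<eta> \<Longrightarrow> \<bar>\<psi> z - p z\<bar> < e"
    using Stone_Weierstrass_real_polynomial_function[OF test_functionD(2)[OF \<eta>(1)] continuous_on_subset[OF cc_cont[OF \<psi>] subset_UNIV] e(1)]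
    by blast
  define \<phi> where "\<phi> z = \<eta> z * p z" for z
  have \<phi>: "test_function \<Omega> \<phi>" unfolding \<phi>_def
    by (rule test_function_mult_smooth[OF \<eta>(1) C_k_real_polynomial[OF p(1)]])
  have close: "\<bar>\<psi> z - \<phi> z\<bar> \<le> e * \<eta> z" for z
  proof -
    have "\<psi> z - \<phi> z = \<eta> z * (\<psi> z - p z)"
    proof (cases "z \<in> K")
      case True then show ?thesis using \<eta>(5,6) by (auto simp: \<phi>_def)
    next
      case False then show ?thesis using K(3) by (simp add: \<phi>_def)
    qed
    moreover have "\<bar>\<eta> z * (\<psi> z - p z)\<bar> \<le> \<eta> z * e"
    proof (cases "z \<in> supp \<eta>")
      case True
      then show ?thesis unfolding abs_mult using p(2)[of z] \<eta>(2)[of z] by (simp add: mult_left_mono)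
    next
      case False
      from not_in_suppD[OF this] show ?thesis by simp
    qed
    ultimately show ?thesis by (simp add: mult.commute)
  qed
  have I: "\<bar>(LINT z|P. \<psi> z) - (LINT z|P. \<phi> z)\<bar> \<le> e * (LINT z|P. \<eta> z)" if "radon_on \<Omega> P" for P
  proof -
    have iI: "integrable P \<psi>" "integrable P \<phi>" "integrable P \<eta>"
      by (intro cc_radon_integrable[OF that] \<psi> cc_test[OF \<phi>] cc_test[OF \<eta>(1)])+
    have "\<bar>LINT z|P. \<psi> z - \<phi> z\<bar> \<le> (LINT z|P. \<bar>\<psi> z - \<phi> z\<bar>)" by (rule integral_abs_bound)
    also have "\<dots> \<le> (LINT z|P. e * \<eta> z)" using iI by (intro integral_mono close) auto
    finally show ?thesis using iI by simp
  qed
  have "\<forall>\<^sub>F n in F. dist (LINT z|M n. \<phi> z) (LINT z|N. \<phi> z) < e"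
    using conv[OF \<phi>] e(1) by (rule tendstoD)
  moreover have "\<forall>\<^sub>F n in F. dist (LINT z|M n. \<eta> z) A < 1"
    using conv[OF \<eta>(1)] zero_less_one unfolding A_def by (rule tendstoD)
  ultimately show "\<forall>\<^sub>F n in F. dist (LINT z|M n. \<psi> z) (LINT z|N. \<psi> z) < e0"
    using R(1)
  proof eventually_elim
    case (elim n)
    have "e * (LINT z|M n. \<eta> z) \<le> e * (A + 1)"
      using elim(2) e(1) by (intro mult_left_mono) (auto simp: dist_real_def)
    then have "\<bar>(LINT z|M n. \<psi> z) - (LINT z|N. \<psi> z)\<bar> < e * (A + 1) + e + e * A"
      using I[OF elim(3)] I[OF R(2)] elim(1) unfolding dist_real_def A_def by linarith
    also have "\<dots> = e * (2 * A + 2)" by (simp add: algebra_simps)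
    finally show ?case using e(2) by (simp add: dist_real_def)
  qed
qed

section \<open>Truncations of the exhaustion function\<close>

locale subharmonic_exhaustion =
  fixes \<kappa> :: real and \<Omega> :: "complex set" and u :: "complex \<Rightarrow> ereal"
  assumes \<kappa>: "\<kappa> > 0" and op: "open \<Omega>" and conn: "connected \<Omega>"
    and neg: "\<And>z. z \<in> \<Omega> \<Longrightarrow> u z < 0" and cont: "continuous_on \<Omega> u"
    and sub: "subharmonic_on u \<Omega>" and exh: "exhaustion \<Omega> u"
begin

text \<open>On \<Omega> the maximum is finite, since \<open>u\<close> is negative there. Truncations
  are bounded, so the Riesz measure of each is available before anything is known about the
  integrability of \<open>u\<close>.\<close>

definition vr :: "real \<Rightarrow> complex \<Rightarrow> real" where "vr r z = real_of_ereal (max (u z) (ereal r))"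

lemma vr_ereal: "z \<in> \<Omega> \<Longrightarrow> ereal (vr r z) = max (u z) (ereal r)"
  using neg[of z] by (cases "u z") (auto simp: vr_def max_def)

lemma vr_ge: "z \<in> \<Omega> \<Longrightarrow> r \<le> vr r z"
  using vr_ereal[of z r] by (metis ereal_less_eq(3) max.cobounded2)

lemma vr_le: "z \<in> \<Omega> \<Longrightarrow> r < 0 \<Longrightarrow> vr r z < 0"
  using vr_ereal[of z r] neg[of z] by (metis ereal_less(5) max_less_iff_conj less_ereal.simps(1) zero_ereal_def)

lemma vr_mono: assumes "z \<in> \<Omega>" "r \<le> s" shows "vr r z \<le> vr s z"
proof -
  have "ereal (vr r z) \<le> ereal (vr s z)" unfolding vr_ereal[OF assms(1)] using assms(2) by (intro max.mono) auto
  then show ?thesis by simp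
qed

lemma vr_diff: assumes "z \<in> \<Omega>" "r \<le> s" shows "vr s z \<le> vr r z + (s - r)"
proof -
  have "ereal (vr s z) \<le> ereal (vr r z + (s - r))"
    unfolding vr_ereal[OF assms(1)] plus_ereal.simps(1)[symmetric] vr_ereal[OF assms(1)]
    using assms(2) neg[OF assms(1)] by (cases "u z") (auto simp: max_def)
  then show ?thesis by simp
qed

lemma vr_eq: "u z > ereal r \<Longrightarrow> z \<in> \<Omega> \<Longrightarrow> vr r z = real_of_ereal (u z)"
  by (auto simp: vr_def max_def)

lemma vr_eq_below: "u z \<le> ereal r \<Longrightarrow> vr r z = r"
  by (auto simp: vr_def max_def)

lemma cont_vr: "continuous_on \<Omega> (vr r)"
proof -
  have "continuous_on \<Omega> (\<lambda>z. max (u z) (ereal r))"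
    by (intro continuous_on_max cont continuous_on_const)
  then have "continuous_on \<Omega> (\<lambda>z. ereal (vr r z))"
    by (rule continuous_on_cong[THEN iffD1, rotated 2]) (auto simp: vr_ereal)
  then show ?thesis by (simp add: continuous_on_iff_real o_def)
qed

text \<open>Values in \<open>ennreal\<close> allow the submean inequality to be used where
  \<open>u\<close> is -\<infinity>.\<close>

definition g :: "complex \<Rightarrow> ennreal" where "g z = e2ennreal (- u z)"

lemma cont_g: "continuous_on \<Omega> g"
  unfolding g_def
  by (rule continuous_on_compose2[OF continuous_on_e2ennreal[of UNIV]])
     (auto intro!: continuous_on_compose2[OF continuous_uminus_ereal[of UNIV] cont])

text \<open>As \<open>u\<close> is negative, the positive part in \<open>circle_mean\<close>
  vanishes, and the submean inequality for \<open>u\<close> is this one with signs reversed. If the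
  integral is infinite, the centre must be a pole.\<close>

lemma g_supermean:
  assumes "z \<in> \<Omega>" "\<rho> > 0" "cball z \<rho> \<subseteq> \<Omega>"
  shows "(\<integral>\<^sup>+t. g (z + rcis \<rho> t) \<partial>circ) \<le> g z"
proof -
  have inO: "z + rcis \<rho> t \<in> \<Omega>" for t
    using circle_in_sphere[of z \<rho> t] assms by (auto simp: subset_iff)
  have "continuous_on UNIV (\<lambda>t. g (z + rcis \<rho> t))"
    by (rule continuous_on_compose2[OF cont_g]) (use inO in \<open>auto intro!: continuous_intros\<close>)
  then have m: "(\<lambda>t. g (z + rcis \<rho> t)) \<in> borel_measurable borel"
    by (rule borel_measurable_continuous_onI)
  define G where "G = (\<integral>\<^sup>+t\<in>{0..2*pi}. g (z + rcis \<rho> t) \<partial>lborel)"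
  have "e2ennreal (u (z + rcis \<rho> t)) = 0" for t
    using neg[OF inO[of t]] by (intro e2ennreal_neg) simp
  then have cm: "circle_mean u z \<rho> = (- enn2ereal G) / ereal (2*pi)"
    by (simp add: circle_mean_def G_def g_def zero_ennreal.rep_eq)
  have le: "u z \<le> (- enn2ereal G) / ereal (2*pi)"
    using sub assms unfolding subharmonic_on_def cm[symmetric] by blast
  have "G / ennreal (2*pi) \<le> g z"
  proof (cases G)
    case (real x)
    then have "u z \<le> ereal (- x / (2*pi))" using le by (simp add: enn2ereal_ennreal)
    then have "ereal (x / (2*pi)) \<le> - u z"
      by (metis ereal_minus_le_minus ereal_uminus_uminus minus_divide_left uminus_ereal.simps(1))
    then have "e2ennreal (ereal (x / (2*pi))) \<le> g z" unfolding g_def by (rule e2ennreal_mono)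
    then show ?thesis using real by (simp add: divide_ennreal)
  next
    case top
    then have "u z \<le> - \<infinity>" using le by simp
    then show ?thesis by (simp add: g_def)
  qed
  then show ?thesis unfolding nn_integral_circ[OF m] G_def .
qed

lemma vr_g: "z \<in> \<Omega> \<Longrightarrow> r < 0 \<Longrightarrow> ennreal (- vr r z) = min (g z) (ennreal (- r))"
  using neg[of z] by (cases "u z") (auto simp: vr_def g_def max_def min_def ennreal_le_iff top_unique)

text \<open>The submean property passes to the maximum with a constant. Where \<open>r\<close> is
  the larger one at the centre, \<open>vr r \<ge> r\<close> on the circle suffices; elsewhere
  \<open>vr r\<close> equals \<open>u\<close> at the centre and dominates it on the circle.\<close>

lemma bounded_subharmonic:
  assumes r: "r < 0" shows "bounded_subharmonic \<Omega> (vr r) (- r)"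
proof
  show "\<bar>vr r z\<bar> \<le> - r" if "z \<in> \<Omega>" for z using vr_ge[OF that, of r] vr_le[OF that r] by simp
  fix z \<rho> assume z: "z \<in> \<Omega>" "\<rho> > 0" "cball z \<rho> \<subseteq> \<Omega>"
  have inO: "z + rcis \<rho> t \<in> \<Omega>" for t
    using circle_in_sphere[of z \<rho> t] z by (auto simp: subset_iff)
  have sph: "continuous_on (sphere z \<bar>\<rho>\<bar>) (vr r)"
    by (rule continuous_on_subset[OF cont_vr]) (use z in \<open>auto simp: subset_iff\<close>)
  show "vr r z \<le> cmean (vr r) z \<rho>"
  proof (cases "u z \<le> ereal r")
    case True
    have "cmean (\<lambda>_. r) z \<rho> \<le> cmean (vr r) z \<rho>"
      by (rule cmean_mono) (use sph z vr_ge in \<open>auto simp: subset_iff\<close>)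
    then show ?thesis using vr_eq_below[OF True] by simp
  next
    case False
    have "continuous_on (sphere z \<bar>\<rho>\<bar>) (\<lambda>w. - vr r w)" by (intro continuous_intros sph)
    from continuous_circle(2)[OF this]
    have "ennreal (LINT t|circ. - vr r (z + rcis \<rho> t)) = (\<integral>\<^sup>+t. ennreal (- vr r (z + rcis \<rho> t)) \<partial>circ)"
      using vr_le[OF inO r] by (intro nn_integral_eq_integral[symmetric]) (auto simp: less_imp_le)
    also have "\<dots> \<le> (\<integral>\<^sup>+t. g (z + rcis \<rho> t) \<partial>circ)"
      by (intro nn_integral_mono) (simp add: vr_g[OF inO r])
    also have "\<dots> \<le> g z" by (rule g_supermean[OF z])
    also have "g z = ennreal (- vr r z)"
      using False neg[OF z(1)] z(1) by (cases "u z") (auto simp: vr_def g_def max_def)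
    finally have "(LINT t|circ. - vr r (z + rcis \<rho> t)) \<le> - vr r z"
      using vr_le[OF z(1) r] by (subst (asm) ennreal_le_iff) auto
    then show ?thesis by (simp add: cmean_def)
  qed
qed (use op cont_vr r in auto)

abbreviation v0 :: "real \<Rightarrow> complex \<Rightarrow> real" where "v0 r \<equiv> bounded_subharmonic.v0 \<Omega> (vr r)"

lemma v0_eq: assumes "r < 0" shows "v0 r z = indicator \<Omega> z * vr r z"
  by (rule bounded_subharmonic.v0_def[OF bounded_subharmonic[OF assms]])

definition M :: "real \<Rightarrow> complex measure" where "M r = bounded_subharmonic.riesz \<Omega> (vr r) \<kappa>"

lemma radon_M: "r < 0 \<Longrightarrow> radon_on \<Omega> (M r)"
  unfolding M_def by (rule bounded_subharmonic.riesz(1)[OF bounded_subharmonic \<kappa>])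

lemma integral_M:
  "r < 0 \<Longrightarrow> test_function \<Omega> \<phi> \<Longrightarrow> (LINT z|M r. \<phi> z) = \<kappa> * (LINT z|lborel. v0 r z * laplacian \<phi> z)"
  unfolding M_def by (rule bounded_subharmonic.riesz(2)[OF bounded_subharmonic \<kappa>])

lemma ddc_max: assumes "r < 0" shows "ddc \<kappa> \<Omega> (\<lambda>z. max (u z) (ereal r)) = M r"
proof (rule ddc_eqI[OF op])
  show "represents_ddc \<kappa> \<Omega> (\<lambda>z. max (u z) (ereal r)) (M r)"
    using radon_M[OF assms] integral_M[OF assms]
    by (auto simp: represents_ddc_def radon_on_def set_lebesgue_integral_def v0_eq[OF assms] vr_def mult.assoc)
qed

lemma integrable_v0: "r < 0 \<Longrightarrow> cc \<Omega> \<psi> \<Longrightarrow> integrable lborel (\<lambda>z. v0 r z * \<psi> z)"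
  by (rule bounded_subharmonic.J_integrable(2)[OF bounded_subharmonic])

lemma compact_sublevel: assumes "s < 0" shows "compact {z\<in>\<Omega>. u z \<le> ereal s}"
proof -
  let ?C = "closure (sublevel \<Omega> u (s/2))"
  have C: "compact ?C" "?C \<subseteq> \<Omega>" using exh assms unfolding exhaustion_def by auto
  have "{z\<in>\<Omega>. u z \<le> ereal s} \<subseteq> sublevel \<Omega> u (s/2)"
    using assms unfolding sublevel_def by (auto intro: order_le_less_trans)
  then have sub: "{z\<in>\<Omega>. u z \<le> ereal s} \<subseteq> ?C" using closure_subset by blast
  have "closedin (top_of_set ?C) (?C \<inter> u -` {..ereal s})"
    by (rule continuous_closedin_preimage[OF continuous_on_subset[OF cont C(2)]]) simp
  moreover have "?C \<inter> u -` {..ereal s} = {z\<in>\<Omega>. u z \<le> ereal s}" using sub C(2) by auto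
  ultimately show ?thesis using closedin_compact[OF C(1)] by simp
qed

lemma open_superlevel: "open {z\<in>\<Omega>. u z > c}" and open_sublevel: "open {z\<in>\<Omega>. u z < c}"
proof -
  have "{z\<in>\<Omega>. u z > c} = \<Omega> \<inter> u -` {c<..}" "{z\<in>\<Omega>. u z < c} = \<Omega> \<inter> u -` {..<c}" by auto
  then show "open {z\<in>\<Omega>. u z > c}" "open {z\<in>\<Omega>. u z < c}"
    using continuous_open_preimage[OF cont op] by auto
qed

end

text \<open>A nonnegative continuous function with mean 0 vanishes almost everywhere on the circle,
  which an open arc of positive values forbids. The lemma shows that averaging a bump at
  \<open>a\<close> produces positive values at distance \<open>\<rho>\<close> from
  \<open>a\<close>.\<close>

lemma cmean_pos_direction:
  fixes f :: "complex \<Rightarrow> real"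
  assumes "continuous_on UNIV f" "\<And>z. f z \<ge> 0" "norm w = 1" "\<rho> \<noteq> 0" "f (z + of_real \<rho> * w) > 0"
  shows "cmean f z \<rho> > 0"
proof (rule ccontr)
  assume neg: "\<not> cmean f z \<rho> > 0"
  define h where "h t = f (z + rcis \<rho> t)" for t
  have c: "continuous_on UNIV h" "integrable circ h"
    unfolding h_def by (intro continuous_circle continuous_on_subset[OF assms(1)]; simp)+
  have "0 \<le> (LINT t|circ. h t)"
    by (rule Bochner_Integration.integral_nonneg) (simp add: h_def assms(2))
  then have "(LINT t|circ. h t) = 0"
    using neg unfolding cmean_def h_def[symmetric] by linarith
  moreover have "AE t in circ. 0 \<le> h t" by (simp add: h_def assms(2))
  ultimately have "AE t in circ. h t = 0"
    using integral_nonneg_eq_0_iff_AE[OF c(2)] by blast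
  then have ae: "AE t in lborel. t \<in> {0..2*pi} \<longrightarrow> h t = 0"
    unfolding circ_def by (subst (asm) AE_density) (auto simp: indicator_def elim!: eventually_mono)
  obtain t0 where t0: "w = cis t0" "0 \<le> t0" "t0 < 2*pi"
    using complex_norm_eq_1_exp[of w] assms(3) Arg2pi_ge_0[of w] Arg2pi_lt_2pi[of w] Arg2pi_eq[of w]
    by (metis cis_conv_exp mult.commute mult_1 norm_eq_zero of_real_1 zero_neq_one)
  have "h t0 > 0" using assms(5) by (simp add: h_def rcis_def t0)
  then have "open {t. h t > 0}" "t0 \<in> {t. h t > 0}"
    by (auto intro!: open_Collect_less c(1) continuous_on_const)
  then obtain e where e: "e > 0" "ball t0 e \<subseteq> {t. h t > 0}" by (meson openE)
  \<comment> \<open>The angle \<open>t0\<close> may be the left end 0 of the period, so the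
    neighbourhood is cut down to the open interval and a point to the right of \<open>t0\<close>
    witnesses that it is not empty.\<close>
  define S where "S = ball t0 e \<inter> {0<..<2*pi}"
  have "open S" unfolding S_def by auto
  moreover have "t0 + min (e/2) ((2*pi - t0)/2) \<in> S"
    using e(1) t0 by (auto simp: S_def dist_real_def min_def field_simps)
  ultimately have "\<not> negligible S" using open_not_negligible by blast
  moreover have "negligible S"
  proof -
    have "{t. t \<in> {0..2*pi} \<and> h t \<noteq> 0} = {0..2*pi} - {t. h t = 0}" by auto
    moreover have "closed {t. h t = 0}" by (intro closed_Collect_eq c(1) continuous_on_const)
    ultimately have "{t. t \<in> {0..2*pi} \<and> h t \<noteq> 0} \<in> sets lborel" by auto
    then have "{t. t \<in> {0..2*pi} \<and> h t \<noteq> 0} \<in> null_sets lborel"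
      using ae by (subst AE_iff_null_sets) (auto elim!: eventually_mono)
    then have "{t. t \<in> {0..2*pi} \<and> h t \<noteq> 0} \<in> null_sets lebesgue" by (rule null_sets_completionI)
    then have "negligible {t. t \<in> {0..2*pi} \<and> h t \<noteq> 0}" by (simp add: negligible_iff_null_sets)
    moreover have "S \<subseteq> {t. t \<in> {0..2*pi} \<and> h t \<noteq> 0}" using e(2) by (auto simp: S_def)
    ultimately show ?thesis by (rule negligible_subset)
  qed
  ultimately show False by blast
qed

section \<open>Local integrability of the exhaustion function\<close>

context subharmonic_exhaustion begin

text \<open>Local integrability of \<open>u\<close> near \<open>a\<close>, expressed as a bound on
  the truncations that is uniform in \<open>r\<close>. Every integral involved is finite, and the
  second differences \<open>J\<close> apply to it.\<close>

definition loc_int :: "complex \<Rightarrow> bool" where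
  "loc_int a \<longleftrightarrow> a \<in> \<Omega> \<and> (\<exists>e>0. \<exists>C. \<forall>r<0. \<forall>\<phi>. test_function \<Omega> \<phi> \<longrightarrow> supp \<phi> \<subseteq> ball a e \<longrightarrow> (\<forall>z. 0 \<le> \<phi> z \<and> \<phi> z \<le> 1) \<longrightarrow>
     (LINT z|lborel. - v0 r z * \<phi> z) \<le> C)"

lemma loc_intI:
  assumes "a \<in> \<Omega>" "e > 0"
    and "\<And>r \<phi>. r < 0 \<Longrightarrow> test_function \<Omega> \<phi> \<Longrightarrow> supp \<phi> \<subseteq> ball a e \<Longrightarrow> \<forall>z. 0 \<le> \<phi> z \<and> \<phi> z \<le> 1 \<Longrightarrow>
      (LINT z|lborel. - v0 r z * \<phi> z) \<le> C"
  shows "loc_int a"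
  unfolding loc_int_def using assms by blast

lemma v0_nonpos: assumes "r < 0" shows "v0 r z \<le> 0"
  unfolding v0_eq[OF assms] using vr_le[of z r] assms by (auto simp: indicator_def less_imp_le)

lemma v0_bound: assumes "r < 0" shows "\<bar>v0 r z\<bar> \<le> - r"
  by (rule bounded_subharmonic.v0_bd[OF bounded_subharmonic[OF assms]])

lemma v0_borel [measurable]: assumes "r < 0" shows "v0 r \<in> borel_measurable borel"
  by (rule bounded_subharmonic.v0_measurable[OF bounded_subharmonic[OF assms]])

lemma loc_int_open:
  assumes "loc_int a" shows "\<exists>e>0. ball a e \<subseteq> {b. loc_int b}"
proof -
  obtain e C where e: "e > 0" and a: "a \<in> \<Omega>" and C: "\<And>r \<phi>. r < 0 \<Longrightarrow> test_function \<Omega> \<phi> \<Longrightarrow> supp \<phi> \<subseteq> ball a e \<Longrightarrow> (\<forall>z. 0 \<le> \<phi> z \<and> \<phi> z \<le> 1) \<Longrightarrow>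
     (LINT z|lborel. - v0 r z * \<phi> z) \<le> C"
    using assms unfolding loc_int_def by blast
  obtain e' where e': "e' > 0" "ball a e' \<subseteq> \<Omega>" using op a by (meson openE)
  have "loc_int b" if b: "b \<in> ball a (min e e' / 2)" for b
  proof -
    have "ball b (e/2) \<subseteq> ball a e"
    proof
      fix x assume "x \<in> ball b (e/2)"
      then show "x \<in> ball a e" using b dist_triangle[of a x b] by auto
    qed
    moreover have "b \<in> \<Omega>" using b e e' by (auto simp: subset_iff)
    ultimately show ?thesis using e by (intro loc_intI[of b "e/2" C] C) auto
  qed
  then show ?thesis using e e'(1) by (intro exI[of _ "min e e' / 2"]) auto
qed

text \<open>Let \<open>\<rho>\<close> be the distance. Positivity of \<open>J \<rho> \<eta>\<close>
  for a bump \<open>\<eta>\<close> at \<open>a\<close> says that averaging \<open>\<eta>\<close>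
  over circles of radius \<open>\<rho>\<close> does not increase its integral against
  \<open>- v0 r\<close>. The averaged bump \<open>h\<close> is positive near \<open>b\<close>, so a
  bound near \<open>a\<close> yields one near \<open>b\<close>, with no dependence on
  \<open>r\<close>.\<close>

lemma loc_int_propagate:
  assumes a: "loc_int a" and b: "b \<noteq> a" and sub: "cball a (3 * dist a b) \<subseteq> \<Omega>"
  shows "loc_int b"
proof -
  define \<rho> where "\<rho> = dist a b"
  have \<rho>: "\<rho> > 0" using b by (simp add: \<rho>_def)
  obtain e C where e: "e > 0" and aO: "a \<in> \<Omega>" and C: "\<And>r \<phi>. r < 0 \<Longrightarrow> test_function \<Omega> \<phi> \<Longrightarrow> supp \<phi> \<subseteq> ball a e \<Longrightarrow> (\<forall>z. 0 \<le> \<phi> z \<and> \<phi> z \<le> 1) \<Longrightarrow>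
     (LINT z|lborel. - v0 r z * \<phi> z) \<le> C"
    using a unfolding loc_int_def by blast
  \<comment> \<open>The radius is at most \<open>\<rho>\<close>, so circles of radius
    \<open>\<rho>\<close> about points of \<open>U\<close> stay inside the disc about
    \<open>a\<close> that is assumed to lie in \<Omega>.\<close>
  define U where "U = ball a (min e \<rho>)"
  have UO: "U \<subseteq> \<Omega>"
  proof
    fix x assume "x \<in> U"
    then have "dist a x < dist a b" by (simp add: U_def \<rho>_def)
    then have "dist a x \<le> 3 * dist a b" using zero_le_dist[of a b] by linarith
    then have "x \<in> cball a (3 * dist a b)" by simp
    then show "x \<in> \<Omega>" using sub by blast
  qed
  have aU: "compact {a}" "open U" "{a} \<subseteq> U" using e \<rho> by (auto simp: U_def)
  obtain \<eta> V where \<eta>: "test_function U \<eta>" "\<And>z. 0 \<le> \<eta> z" "\<And>z. \<eta> z \<le> 1"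
    "open V" "{a} \<subseteq> V" "\<And>z. z \<in> V \<Longrightarrow> \<eta> z = 1"
    using smooth_Urysohn[OF aU] by blast
  have \<eta>O: "test_function \<Omega> \<eta>" by (rule test_function_mono[OF \<eta>(1) UO])
  note c = cc_test[OF \<eta>O]
  define h where "h z = cmean \<eta> z (-\<rho>)" for z
  have sup: "supp \<eta> \<subseteq> ball a e" using test_functionD(3)[OF \<eta>(1)] by (auto simp: U_def)
  have h_pos: "h b > 0"
    unfolding h_def
  proof (rule cmean_pos_direction[of _ "(b - a) / of_real \<rho>"])
    show "continuous_on UNIV \<eta>" by (rule cc_cont[OF c])
    show "0 < \<eta> (b + of_real (-\<rho>) * ((b - a) / of_real \<rho>))" using \<rho> \<eta>(5,6) by simp
    show "norm ((b - a) / of_real \<rho>) = 1" using \<rho> by (simp add: \<rho>_def dist_norm norm_divide norm_minus_commute)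
  qed (use \<eta>(2) \<rho> in auto)
  have h_le: "(LINT z|lborel. - v0 r z * h z) \<le> C" if r: "r < 0" for r
  proof -
    interpret b: bounded_subharmonic \<Omega> "vr r" "-r" by (rule bounded_subharmonic[OF r])
    have "b.J \<rho> \<eta> \<ge> 0"
    proof (rule b.J_nonneg[OF c \<eta>(2) \<rho>])
      fix z assume "\<eta> z \<noteq> 0"
      then have "z \<in> U" using test_functionD(3)[OF \<eta>(1)] not_in_suppD[of z \<eta>] by blast
      have "cball z \<rho> \<subseteq> cball a (3 * dist a b)"
      proof
        fix x assume "x \<in> cball z \<rho>"
        then have "dist z x \<le> dist a b" "dist a z < dist a b" using \<open>z \<in> U\<close> by (simp_all add: U_def \<rho>_def)
        then have "dist a x \<le> 3 * dist a b" using dist_triangle[of a x z] zero_le_dist[of a b] by linarith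
        then show "x \<in> cball a (3 * dist a b)" by simp
      qed
      then show "z \<in> \<Omega> \<and> cball z \<rho> \<subseteq> \<Omega>" using sub UO \<open>z \<in> U\<close> by blast
    qed
    then have "0 \<le> (LINT z|lborel. v0 r z * (h z - \<eta> z))"
      using \<rho> unfolding b.J_def h_def by (simp add: zero_le_mult_iff zero_le_divide_iff)
    also have "\<dots> = (LINT z|lborel. v0 r z * h z) - (LINT z|lborel. v0 r z * \<eta> z)"
      using b.J_integrable(1)[OF c, of \<rho>] b.J_integrable(2)[OF c] by (simp add: h_def right_diff_distrib)
    finally show ?thesis using C[OF r \<eta>O sup] \<eta>(2,3) by simp
  qed
  define m where "m = h b / 2"
  have m: "m > 0" using h_pos by (simp add: m_def)
  have "continuous_on UNIV h"
  proof -
    have "uniformly_continuous_on UNIV \<eta>" by (rule test_function_uniformly_continuous[OF \<eta>(1)])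
    then have uc: "\<exists>d>0. \<forall>x x'. dist x' x < d \<longrightarrow> dist (\<eta> x') (\<eta> x) < e" if "e > 0" for e
      using that unfolding uniformly_continuous_on_def by simp
    show ?thesis unfolding continuous_on_iff
    proof (intro ballI allI impI)
      fix x :: complex and e :: real assume "e > 0"
      then obtain d where d: "d > 0" "\<And>x x'. dist x' x < d \<Longrightarrow> dist (\<eta> x') (\<eta> x) < e/2"
        using uc[of "e/2"] by auto
      have "dist (h x') (h x) < e" if "dist x' x < d" for x'
      proof -
        have i: "integrable circ (\<lambda>t. \<eta> (y + rcis (-\<rho>) t))" for y
          by (intro continuous_circle continuous_on_subset[OF cc_cont[OF c]]) simp
        have "\<bar>h x' - h x\<bar> = \<bar>LINT t|circ. \<eta> (x' + rcis (-\<rho>) t) - \<eta> (x + rcis (-\<rho>) t)\<bar>"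
          using i by (simp add: h_def cmean_def)
        also have "\<dots> \<le> (LINT t|circ. \<bar>\<eta> (x' + rcis (-\<rho>) t) - \<eta> (x + rcis (-\<rho>) t)\<bar>)"
          by (rule integral_abs_bound)
        also have "\<dots> \<le> (LINT t|circ. e/2)"
          using i d(2)[of "x' + rcis (-\<rho>) t" "x + rcis (-\<rho>) t" for t] that
          by (intro integral_mono) (auto simp: dist_real_def less_imp_le)
        finally show ?thesis using \<open>e > 0\<close> by (simp add: dist_real_def)
      qed
      then show "\<exists>d>0. \<forall>x'\<in>UNIV. dist x' x < d \<longrightarrow> dist (h x') (h x) < e" using d(1) by blast
    qed
  qed
  then have "open {z. m < h z}" by (intro open_Collect_less continuous_on_const)
  moreover have "b \<in> {z. m < h z}" using h_pos by (simp add: m_def)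
  ultimately obtain d where d: "d > 0" "ball b d \<subseteq> {z. m < h z}" by (meson openE)
  have hnn: "h z \<ge> 0" for z unfolding h_def cmean_def by (rule Bochner_Integration.integral_nonneg) (rule \<eta>(2))
  show ?thesis
  proof (rule loc_intI[of b d "C / m"])
    show "b \<in> \<Omega>" using sub \<rho> by (auto simp: subset_iff \<rho>_def)
    fix r :: real and \<phi> assume r: "r < 0" and \<phi>: "test_function \<Omega> \<phi>" "supp \<phi> \<subseteq> ball b d" "\<forall>z. 0 \<le> \<phi> z \<and> \<phi> z \<le> 1"
    interpret b: bounded_subharmonic \<Omega> "vr r" "-r" by (rule bounded_subharmonic[OF r])
    have "\<phi> z \<le> h z / m" for z
    proof (cases "z \<in> supp \<phi>")
      case True
      then have "m \<le> h z" using \<phi>(2) d(2) by (auto intro: less_imp_le)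
      then have "1 \<le> h z / m" using m by simp
      then show ?thesis using \<phi>(3) order_trans by blast
    next
      case False
      from not_in_suppD[OF this] show ?thesis using hnn m by simp
    qed
    then have "- v0 r z * \<phi> z \<le> - v0 r z * (h z / m)" for z
      using v0_nonpos[OF r, of z] by (intro mult_left_mono) auto
    then have "(LINT z|lborel. - v0 r z * \<phi> z) \<le> (LINT z|lborel. - v0 r z * (h z / m))"
      using b.J_integrable(1)[OF c, of \<rho>] integrable_v0[OF r cc_test[OF \<phi>(1)]]
      by (intro integral_mono) (auto simp: h_def)
    also have "\<dots> = (LINT z|lborel. - v0 r z * h z) / m" by simp
    also have "\<dots> \<le> C / m" using h_le[OF r] m by (intro divide_right_mono) auto
    finally show "(LINT z|lborel. - v0 r z * \<phi> z) \<le> C / m" .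
  qed (use d in auto)
qed

lemma loc_int_nonempty: "\<exists>a. loc_int a"
proof -
  obtain a where a: "a \<in> \<Omega>" "u a \<noteq> -\<infinity>" using sub unfolding subharmonic_on_def by blast
  obtain c :: real where c: "ereal c < u a" using a(2) by (metis ereal_dense2 ereal_less_PInfty less_ereal.simps(1) ereal_bot ereal_infty_less(2) less_PInf_Ex_of_nat linorder_not_less ereal_less_eq(2))
  have "open {z\<in>\<Omega>. u z > ereal c}" "a \<in> {z\<in>\<Omega>. u z > ereal c}" using open_superlevel a c by auto
  then obtain e where e: "e > 0" "ball a e \<subseteq> {z\<in>\<Omega>. u z > ereal c}" by (meson openE)
  have "loc_int a"
  proof (rule loc_intI[OF a(1) e(1)])
    fix r :: real and \<phi> assume r: "r < 0" and \<phi>: "test_function \<Omega> \<phi>" "supp \<phi> \<subseteq> ball a e" "\<forall>z. 0 \<le> \<phi> z \<and> \<phi> z \<le> 1"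
    show "(LINT z|lborel. - v0 r z * \<phi> z) \<le> (LINT z|lborel. \<bar>c\<bar> * indicator (ball a e) z)"
    proof (rule integral_mono)
      show "integrable lborel (\<lambda>z. - v0 r z * \<phi> z)" using integrable_v0[OF r cc_test[OF \<phi>(1)]] by simp
      show "integrable lborel (\<lambda>z. \<bar>c\<bar> * indicator (ball a e) z)"
        using emeasure_bounded_finite[of "ball a e"] by (intro integrable_mult_right) auto
      fix z
      show "- v0 r z * \<phi> z \<le> \<bar>c\<bar> * indicator (ball a e) z"
      proof (cases "z \<in> ball a e")
        case True
        then have z: "z \<in> \<Omega>" "u z > ereal c" using e(2) by auto
        have "ereal c \<le> ereal (vr r z)" using z unfolding vr_ereal[OF z(1)] by (simp add: less_imp_le max.coboundedI1)
        then have "- v0 r z \<le> \<bar>c\<bar>" using z(1) by (simp add: v0_eq[OF r])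
        then have "- v0 r z * \<phi> z \<le> \<bar>c\<bar> * 1" using \<phi>(3) by (intro mult_mono) auto
        then show ?thesis using True by simp
      next
        case False
        then have "z \<notin> supp \<phi>" using \<phi>(2) by blast
        from not_in_suppD[OF this] show ?thesis by simp
      qed
    qed
  qed
  then show ?thesis ..
qed

text \<open>Connectedness: the set of such points is open, and by propagation so is its complement
  in \<Omega>. It contains a point because \<open>u\<close> is not identically -\<infinity>.\<close>

lemma loc_int_all: assumes "a \<in> \<Omega>" shows "loc_int a"
proof -
  let ?E = "{b. loc_int b}"
  have E1: "open ?E"
    unfolding open_contains_ball using loc_int_open by blast
  have E2: "open (\<Omega> - ?E)"
    unfolding open_contains_ball
  proof
    fix b assume b: "b \<in> \<Omega> - ?E"
    then obtain e where e: "e > 0" "ball b e \<subseteq> \<Omega>" using op by (meson DiffD1 openE)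
    \<comment> \<open>For \<open>x\<close> within \<open>e / 5\<close> of \<open>b\<close>, the disc
      required by the propagation from \<open>x\<close> to \<open>b\<close> has radius below
      \<open>3 * e / 5\<close> and stays in \<open>ball b e\<close>.\<close>
    have "x \<in> \<Omega> - ?E" if x: "x \<in> ball b (e/5)" for x
    proof -
      have "\<not> loc_int x"
      proof
        assume lx: "loc_int x"
        have ne: "b \<noteq> x" using lx b by auto
        have "cball x (3 * dist x b) \<subseteq> \<Omega>"
        proof
          fix y assume "y \<in> cball x (3 * dist x b)"
          then have "dist b y < e" using x dist_triangle[of b y x] e(1) by (auto simp: dist_commute)
          then show "y \<in> \<Omega>" using e(2) by auto
        qed
        from loc_int_propagate[OF lx ne this] show False using b by auto
      qed
      moreover have "x \<in> \<Omega>" using x e by (auto simp: subset_iff)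
      ultimately show ?thesis by simp
    qed
    then show "\<exists>e>0. ball b e \<subseteq> \<Omega> - ?E" using e(1) by (intro exI[of _ "e/5"]) auto
  qed
  have "?E \<inter> \<Omega> = {} \<or> (\<Omega> - ?E) \<inter> \<Omega> = {}"
    by (rule connectedD[OF conn E1 E2]) auto
  moreover obtain b where "loc_int b" using loc_int_nonempty by blast
  moreover from this have "b \<in> \<Omega>" by (simp add: loc_int_def)
  ultimately show ?thesis using assms by blast
qed

lemma uniform_bound_compact:
  assumes K: "compact K" "K \<subseteq> \<Omega>"
  obtains C where "\<And>r. r < 0 \<Longrightarrow> (LINT z|lborel. - v0 r z * indicator K z) \<le> C"
proof -
  have "\<forall>a\<in>K. \<exists>d>0. cball a d \<subseteq> \<Omega> \<and> (\<exists>C. \<forall>r<0. (LINT z|lborel. - v0 r z * indicator (ball a d) z) \<le> C)"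
  proof
    fix a assume "a \<in> K"
    then have "loc_int a" using loc_int_all K by blast
    then obtain e C where e: "e > 0" and aO: "a \<in> \<Omega>" and C: "\<And>r \<phi>. r < 0 \<Longrightarrow> test_function \<Omega> \<phi> \<Longrightarrow> supp \<phi> \<subseteq> ball a e \<Longrightarrow> (\<forall>z. 0 \<le> \<phi> z \<and> \<phi> z \<le> 1) \<Longrightarrow>
       (LINT z|lborel. - v0 r z * \<phi> z) \<le> C"
      unfolding loc_int_def by blast
    obtain e' where e': "e' > 0" "ball a e' \<subseteq> \<Omega>" using op aO by (meson openE)
    define d where "d = min e e' / 2"
    have d: "d > 0" "cball a d \<subseteq> ball a (min e e')" using e e' by (auto simp: d_def)
    obtain \<eta> V where \<eta>: "test_function (ball a (min e e')) \<eta>" "\<And>z. 0 \<le> \<eta> z" "\<And>z. \<eta> z \<le> 1"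
      "open V" "cball a d \<subseteq> V" "\<And>z. z \<in> V \<Longrightarrow> \<eta> z = 1"
      using smooth_Urysohn[OF compact_cball open_ball d(2)] by blast
    have bs: "ball a (min e e') \<subseteq> \<Omega>" "ball a (min e e') \<subseteq> ball a e" using e'(2) by auto
    have \<eta>O: "test_function \<Omega> \<eta>" by (rule test_function_mono[OF \<eta>(1) bs(1)])
    have "(LINT z|lborel. - v0 r z * indicator (ball a d) z) \<le> C" if r: "r < 0" for r
    proof -
      have "(LINT z|lborel. - v0 r z * indicator (ball a d) z) \<le> (LINT z|lborel. - v0 r z * \<eta> z)"
      proof (rule integral_mono)
        show "integrable lborel (\<lambda>z. - v0 r z * indicator (ball a d) z)"
        proof (rule lborel_integrable_bounded_support[of _ "-r" "norm a + d"])
          show "(\<lambda>z. - v0 r z * indicator (ball a d) z) \<in> borel_measurable borel"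
            by (intro borel_measurable_times borel_measurable_uminus v0_borel[OF r] borel_measurable_indicator) simp
          show "\<bar>- v0 r z * indicator (ball a d) z\<bar> \<le> - r" for z using v0_bound[OF r, of z] r by (auto simp: indicator_def)
          show "- v0 r z * indicator (ball a d) z = 0" if "norm a + d < norm z" for z
            using that norm_triangle_ineq2[of z a] by (auto simp: indicator_def dist_norm norm_minus_commute)
        qed
        show "integrable lborel (\<lambda>z. - v0 r z * \<eta> z)" using integrable_v0[OF r cc_test[OF \<eta>O]] by simp
        show "- v0 r z * indicator (ball a d) z \<le> - v0 r z * \<eta> z" for z
          using v0_nonpos[OF r, of z] \<eta>(2,5,6) by (intro mult_left_mono) (auto simp: indicator_def subset_iff)
      qed
      also have "\<dots> \<le> C"
        using \<eta>(2,3) by (intro C[OF r \<eta>O order_trans[OF test_functionD(3)[OF \<eta>(1)] bs(2)]]) auto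
      finally show ?thesis .
    qed
    then show "\<exists>d>0. cball a d \<subseteq> \<Omega> \<and> (\<exists>C. \<forall>r<0. (LINT z|lborel. - v0 r z * indicator (ball a d) z) \<le> C)"
      using d bs by blast
  qed
  then obtain d where d: "\<And>a. a \<in> K \<Longrightarrow> d a > 0 \<and> (\<exists>C. \<forall>r<0. (LINT z|lborel. - v0 r z * indicator (ball a (d a)) z) \<le> C)"
    by metis
  then obtain C where C: "\<And>a r. a \<in> K \<Longrightarrow> r < 0 \<Longrightarrow> (LINT z|lborel. - v0 r z * indicator (ball a (d a)) z) \<le> C a"
    by metis
  obtain F where F: "F \<subseteq> K" "finite F" "K \<subseteq> (\<Union>a\<in>F. ball a (d a))"
  proof (rule compactE_image[OF K(1), of K "\<lambda>a. ball a (d a)"])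
    show "K \<subseteq> (\<Union>a\<in>K. ball a (d a))" using d by force
  qed auto
  show thesis
  proof (rule that[of "\<Sum>a\<in>F. C a"])
    fix r :: real assume r: "r < 0"
    obtain R where R: "\<forall>z\<in>K. norm z \<le> R" using compact_imp_bounded[OF K(1)] unfolding bounded_iff by blast
    have ii: "integrable lborel (\<lambda>z. - v0 r z * indicator A z)" if A: "A \<in> sets borel" "\<And>z. z \<in> A \<Longrightarrow> norm z \<le> S" for A S
    proof (rule lborel_integrable_bounded_support[of _ "-r" S])
      show "(\<lambda>z. - v0 r z * indicator A z) \<in> borel_measurable borel"
        by (intro borel_measurable_times borel_measurable_uminus v0_borel[OF r] borel_measurable_indicator A(1))
      show "\<bar>- v0 r z * indicator A z\<bar> \<le> - r" for z using v0_bound[OF r, of z] r by (auto simp: indicator_def)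
      show "- v0 r z * indicator A z = 0" if "norm z > S" for z using A(2)[of z] that by (auto simp: indicator_def)
    qed
    have ib: "integrable lborel (\<lambda>z. - v0 r z * indicator (ball a (d a)) z)" for a
    proof (rule ii[of _ "norm a + d a"])
      show "norm z \<le> norm a + d a" if "z \<in> ball a (d a)" for z
        using that norm_triangle_ineq2[of z a] by (auto simp: dist_norm norm_minus_commute)
    qed simp
    have "(LINT z|lborel. - v0 r z * indicator K z) \<le> (LINT z|lborel. (\<Sum>a\<in>F. - v0 r z * indicator (ball a (d a)) z))"
    proof (rule integral_mono)
      show "integrable lborel (\<lambda>z. - v0 r z * indicator K z)" using ii[of K R] R K(1) by (auto intro: borel_compact)
      show "integrable lborel (\<lambda>z. \<Sum>a\<in>F. - v0 r z * indicator (ball a (d a)) z)" by (intro Bochner_Integration.integrable_sum ib)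
      fix z
      show "- v0 r z * indicator K z \<le> (\<Sum>a\<in>F. - v0 r z * indicator (ball a (d a)) z)"
      proof (cases "z \<in> K")
        case True
        then obtain a where a: "a \<in> F" "z \<in> ball a (d a)" using F(3) by blast
        have "- v0 r z * indicator (ball a (d a)) z \<le> (\<Sum>a\<in>F. - v0 r z * indicator (ball a (d a)) z)"
          using v0_nonpos[OF r, of z] by (intro member_le_sum[OF a(1) _ F(2)]) (auto simp: indicator_def)
        then show ?thesis using a True by simp
      qed (use v0_nonpos[OF r, of z] in \<open>auto intro!: sum_nonneg simp: indicator_def\<close>)
    qed
    also have "\<dots> = (\<Sum>a\<in>F. LINT z|lborel. - v0 r z * indicator (ball a (d a)) z)"
      by (intro Bochner_Integration.integral_sum ib)
    also have "\<dots> \<le> (\<Sum>a\<in>F. C a)" using C[OF _ r] F(1) by (intro sum_mono) blast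
    finally show "(LINT z|lborel. - v0 r z * indicator K z) \<le> (\<Sum>a\<in>F. C a)" .
  qed
qed

end

text \<open>Stated as a sum because a setwise difference is meaningless where both values are
  infinite. The setwise sum is made into a measure and compared with \<open>M\<close> on relatively
  compact open sets.\<close>

lemma radon_on_unique_add:
  assumes op: "open \<Omega>" and R: "radon_on \<Omega> M" "radon_on \<Omega> A" "radon_on \<Omega> B"
    and eq: "\<And>\<phi>. test_function \<Omega> \<phi> \<Longrightarrow> (LINT z|M. \<phi> z) = (LINT z|A. \<phi> z) + (LINT z|B. \<phi> z)"
    and X: "X \<in> sets M"
  shows "emeasure M X = emeasure A X + emeasure B X"
proof -
  let ?E = "{U. open U \<and> (\<exists>K. compact K \<and> U \<subseteq> K \<and> K \<subseteq> \<Omega>)}"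
  note gen = restrict_borel_eq_sigma_sets[OF op]
  have sets: "sets A = sets M" "sets B = sets M" "sets M = sigma_sets \<Omega> ?E"
    using R gen(1) by (simp_all add: radon_on_def)
  have sp: "space M = \<Omega>" by (rule radon_on_space[OF R(1)])
  define S where "S = measure_of \<Omega> (sets M) (\<lambda>X. emeasure A X + emeasure B X)"
  have sa: "sigma_algebra \<Omega> (sets M)" using sets.sigma_algebra_axioms[of M] sp by simp
  have setsS: "sets S = sets M" unfolding S_def by (rule sigma_algebra.sets_measure_of_eq[OF sa])
  have emS: "emeasure S X = emeasure A X + emeasure B X" if "X \<in> sets M" for X
    unfolding S_def
  proof (rule emeasure_measure_of_sigma[OF sa _ _ that])
    show "positive (sets M) (\<lambda>X. emeasure A X + emeasure B X)" by (simp add: positive_def)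
    show "countably_additive (sets M) (\<lambda>X. emeasure A X + emeasure B X)"
    proof (rule countably_additiveI)
      fix F :: "nat \<Rightarrow> complex set" assume F: "range F \<subseteq> sets M" "disjoint_family F"
      have "(\<Sum>i. emeasure A (F i) + emeasure B (F i)) = (\<Sum>i. emeasure A (F i)) + (\<Sum>i. emeasure B (F i))"
        by (rule suminf_add[symmetric]) auto
      also have "\<dots> = emeasure A (\<Union>(range F)) + emeasure B (\<Union>(range F))"
        using F sets by (simp add: suminf_emeasure)
      finally show "(\<Sum>i. emeasure A (F i) + emeasure B (F i)) = emeasure A (\<Union>(range F)) + emeasure B (\<Union>(range F))" .
    qed
  qed
  from gen(2) obtain C :: "nat \<Rightarrow> complex set" where C0: "range C \<subseteq> ?E \<and> \<Union>(range C) = \<Omega>"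
    by (rule exE)
  note C = conjunct1[OF C0] conjunct2[OF C0]
  have fin: "emeasure P U < \<infinity>" if "U \<in> ?E" "radon_on \<Omega> P" for U P
  proof -
    from that(1) obtain K where K: "compact K" "U \<subseteq> K" "K \<subseteq> \<Omega>" by blast
    have "emeasure P U \<le> emeasure P K"
      using radon_on_sets[OF that(2) borel_compact[OF K(1)] K(3)] K by (intro emeasure_mono) auto
    also have "\<dots> < \<infinity>" using K that(2) by (simp add: radon_on_def)
    finally show ?thesis .
  qed
  have "M = S"
  proof (rule measure_eqI_generator_eq)
    show "Int_stable ?E" unfolding Int_stable_def by blast
    show "?E \<subseteq> Pow \<Omega>" by blast
    show "sets M = sigma_sets \<Omega> ?E" by (rule sets(3))
    show "sets S = sigma_sets \<Omega> ?E" using setsS sets(3) by simp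
    show "range C \<subseteq> ?E" "\<Union>(range C) = \<Omega>" using C by auto
    show "emeasure M (C i) \<noteq> \<infinity>" for i
    proof -
      have "C i \<in> ?E" using C(1) by blast
      from fin[OF this R(1)] show ?thesis by simp
    qed
    fix U assume U: "U \<in> ?E"
    then have Uo: "open U" "U \<subseteq> \<Omega>" by blast+
    obtain \<eta> where \<eta>: "\<And>n::nat. test_function U (\<eta> n)" "\<And>n z. 0 \<le> \<eta> n z" "\<And>n z. \<eta> n z \<le> 1"
      "\<And>z. z \<in> U \<Longrightarrow> \<forall>\<^sub>F n in sequentially. \<eta> n z = 1"
      using open_compact_exhaustion_test[OF Uo(1)] by blast
    note T = test_one_tendsto_measure[OF _ Uo fin[OF U] \<eta>]
    have "(LINT z|M. \<eta> n z) = (LINT z|A. \<eta> n z) + (LINT z|B. \<eta> n z)" for n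
      by (rule eq[OF test_function_mono[OF \<eta>(1) Uo(2)]])
    then have "(\<lambda>n. LINT z|M. \<eta> n z) \<longlonglongrightarrow> measure A U + measure B U"
      using tendsto_add[OF T[OF R(2,2)] T[OF R(3,3)]] by simp
    from LIMSEQ_unique[OF T[OF R(1) R(1)] this]
    have "measure M U = measure A U + measure B U" .
    moreover have "U \<in> sets M" using U sets(3) by (auto intro: sigma_sets.Basic)
    moreover have "emeasure P U = ennreal (measure P U)" if "radon_on \<Omega> P" for P
      by (rule emeasure_eq_ennreal_measure) (use fin[OF U that] in simp)
    ultimately show "emeasure M U = emeasure S U" using R by (simp add: emS ennreal_plus)
  qed
  then show ?thesis using emS[OF X] by simp
qed

lemma radon_on_density:
  assumes R: "radon_on \<Omega> N" and X: "X \<in> sets borel"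
  shows "radon_on \<Omega> (density N (indicator X))"
    and "integrable N f \<Longrightarrow> (LINT z|density N (indicator X). f z) = (LINT z|N. indicator X z * (f z :: real))"
proof -
  have m: "(indicator X :: complex \<Rightarrow> ennreal) \<in> borel_measurable N" "(indicator X :: complex \<Rightarrow> real) \<in> borel_measurable N"
  proof -
    have "(indicator X :: complex \<Rightarrow> real) \<in> borel_measurable borel" using X by (rule borel_measurable_indicator)
    then show r: "(indicator X :: complex \<Rightarrow> real) \<in> borel_measurable N" by (rule radon_on_measurable[OF R])
    have "(\<lambda>z. ennreal (indicator X z)) \<in> borel_measurable N" using r by measurable
    then show "(indicator X :: complex \<Rightarrow> ennreal) \<in> borel_measurable N" by (simp add: ennreal_indicator)
  qed
  show "radon_on \<Omega> (density N (indicator X))"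
    unfolding radon_on_def
  proof (intro conjI allI impI)
    show "sets (density N (indicator X)) = sets (restrict_space borel \<Omega>)" using R by (simp add: radon_on_def)
    fix K assume K: "compact K \<and> K \<subseteq> \<Omega>"
    then have KN: "K \<in> sets N" using radon_on_sets[OF R borel_compact] by blast
    have "emeasure (density N (indicator X)) K = (\<integral>\<^sup>+z. indicator X z * indicator K z \<partial>N)"
      by (rule emeasure_density[OF m(1) KN])
    also have "\<dots> \<le> (\<integral>\<^sup>+z. indicator K z \<partial>N)" by (intro nn_integral_mono) (auto simp: indicator_def)
    also have "\<dots> < \<infinity>" using K R KN by (simp add: radon_on_def)
    finally show "emeasure (density N (indicator X)) K < \<infinity>" .
  qed
  show "(LINT z|density N (indicator X). f z) = (LINT z|N. indicator X z * f z)" if "integrable N f"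
  proof -
    have "density N (indicator X) = density N (\<lambda>z. ennreal (indicator X z))" by (simp add: ennreal_indicator)
    then show ?thesis using that m(2) by (simp add: integral_density)
  qed
qed

section \<open>The measure of the exhaustion function compared with those of its truncations\<close>

context subharmonic_exhaustion begin

text \<open>At a pole the value is 0, the convention of \<open>real_of_ereal\<close>; by
  \<open>pole_null\<close> the poles do not affect Lebesgue integrals.\<close>

definition uu :: "complex \<Rightarrow> real" where "uu z = indicator \<Omega> z * real_of_ereal (u z)"

lemma uu_borel [measurable]: "uu \<in> borel_measurable borel"
proof -
  have "u \<in> borel_measurable (restrict_space borel \<Omega>)"
    by (rule borel_measurable_continuous_on_restrict[OF cont])
  then have "(\<lambda>z. u z * indicator \<Omega> z) \<in> borel_measurable borel"
    using op by (subst (asm) borel_measurable_restrict_space_iff_ereal) auto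
  then have "(\<lambda>z. real_of_ereal (u z * indicator \<Omega> z)) \<in> borel_measurable borel" by measurable
  moreover have "(\<lambda>z. real_of_ereal (u z * indicator \<Omega> z)) = uu" by (auto simp: uu_def indicator_def)
  ultimately show ?thesis by simp
qed

text \<open>Levels tending to -\<infinity>, shifted by one because a truncation level has to be
  negative.\<close>

abbreviation rn :: "nat \<Rightarrow> real" where "rn n \<equiv> - real (Suc n)"

lemma v0_rn_bound: "\<bar>v0 (rn n) z\<bar> \<le> real (Suc n)"
  using v0_bound[of "rn n" z] by simp

lemma uu_le_v0: "z \<in> \<Omega> \<Longrightarrow> u z \<noteq> -\<infinity> \<Longrightarrow> r < 0 \<Longrightarrow> \<bar>v0 r z\<bar> \<le> \<bar>uu z\<bar>"
  using neg[of z] by (cases "u z") (auto simp: v0_eq uu_def vr_def max_def)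

text \<open>On the poles the truncation equals its level, whose modulus grows beyond all bounds,
  while the integrals over \<open>K\<close> are bounded uniformly in the level.\<close>

lemma pole_null: assumes K: "compact K" "K \<subseteq> \<Omega>" shows "AE z in lborel. z \<in> K \<longrightarrow> u z \<noteq> -\<infinity>"
proof -
  define S where "S = K \<inter> u -` {..-\<infinity>}"
  have "closedin (top_of_set K) S"
    unfolding S_def by (rule continuous_closedin_preimage[OF continuous_on_subset[OF cont K(2)]]) simp
  then have S: "compact S" using closedin_compact[OF K(1)] by blast
  obtain C where C: "\<And>r. r < 0 \<Longrightarrow> (LINT z|lborel. - v0 r z * indicator K z) \<le> C"
    by (rule uniform_bound_compact[OF K]) blast
  have fin: "emeasure lborel S < \<infinity>" using compact_imp_bounded[OF S] by (rule emeasure_bounded_finite)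
  have KO: "emeasure lborel K < \<infinity>" using compact_imp_bounded[OF K(1)] by (rule emeasure_bounded_finite)
  have bS: "S \<in> sets borel" "K \<in> sets borel" using S K(1) borel_compact by auto
  have "real (Suc n) * measure lborel S \<le> C" for n
  proof -
    have "real (Suc n) * measure lborel S = (LINT z|lborel. real (Suc n) * indicator S z)"
      using fin bS by simp
    also have "\<dots> \<le> (LINT z|lborel. - v0 (rn n) z * indicator K z)"
    proof (rule integral_mono)
      show "integrable lborel (\<lambda>z. real (Suc n) * indicator S z)" using fin bS by (intro integrable_mult_right) auto
      show "integrable lborel (\<lambda>z. - v0 (rn n) z * indicator K z)"
      proof (rule integrableI_bounded_set[OF _ _ KO, where B="real (Suc n)"])
        show "(\<lambda>z. - v0 (rn n) z * indicator K z) \<in> borel_measurable lborel"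
          using borel_measurable_times[OF borel_measurable_uminus[OF v0_borel[of "rn n"]] borel_measurable_indicator[OF bS(2)]] by simp
        show "AE z in lborel. z \<in> K \<longrightarrow> norm (- v0 (rn n) z * indicator K z) \<le> real (Suc n)"
          by (intro AE_I2) (simp add: v0_rn_bound del: of_nat_Suc)
      qed (use bS in auto)
      fix z
      show "real (Suc n) * indicator S z \<le> - v0 (rn n) z * indicator K z"
      proof (cases "z \<in> S")
        case True
        then have "u z \<le> ereal (rn n)" "z \<in> \<Omega>" "z \<in> K" using K(2) by (auto simp: S_def)
        then show ?thesis using True vr_eq_below[of z "rn n"] by (simp add: v0_eq)
      next
        case False then show ?thesis using v0_nonpos[of "rn n" z] by (simp add: indicator_def)
      qed
    qed
    also have "\<dots> \<le> C" by (rule C) simp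
    finally show ?thesis .
  qed
  then have "measure lborel S = 0"
  proof (rule_tac ccontr)
    assume *: "\<And>n. real (Suc n) * measure lborel S \<le> C" and "measure lborel S \<noteq> 0"
    then have p: "measure lborel S > 0" by (simp add: less_le)
    obtain n :: nat where "C / measure lborel S < real n" using reals_Archimedean2 by blast
    then have "C < real n * measure lborel S" using p by (simp add: field_simps)
    also have "\<dots> \<le> real (Suc n) * measure lborel S" by (intro mult_right_mono) auto
    finally show False using *[of n] by simp
  qed
  then have "S \<in> null_sets lborel" using fin bS by (simp add: null_sets_def emeasure_eq_ennreal_measure less_top[symmetric])
  from AE_not_in[OF this] show ?thesis by (rule eventually_mono) (auto simp: S_def)
qed

text \<open>Fatou's lemma along the levels \<open>rn n\<close>: off the poles the truncations are
  eventually equal to \<open>u\<close>.\<close>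

lemma integrable_uu_K: assumes K: "compact K" "K \<subseteq> \<Omega>" shows "integrable lborel (\<lambda>z. \<bar>uu z\<bar> * indicator K z)"
proof -
  obtain C where C: "\<And>r. r < 0 \<Longrightarrow> (LINT z|lborel. - v0 r z * indicator K z) \<le> C"
    by (rule uniform_bound_compact[OF K]) blast
  have KO: "emeasure lborel K < \<infinity>" using compact_imp_bounded[OF K(1)] by (rule emeasure_bounded_finite)
  have bK: "K \<in> sets borel" using K(1) borel_compact by auto
  define f where "f n z = - v0 (rn n) z * indicator K z" for n z
  have fb: "f n \<in> borel_measurable borel" for n
    unfolding f_def[abs_def]
    using borel_measurable_times[OF borel_measurable_uminus[OF v0_borel[of "rn n"]] borel_measurable_indicator[OF bK]] by simp
  have fnn: "0 \<le> f n z" for n z using v0_nonpos[of "rn n" z] by (simp add: f_def indicator_def)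
  have fi: "integrable lborel (f n)" for n
  proof (rule integrableI_bounded_set[OF _ _ KO, where B="real (Suc n)"])
    show "AE z in lborel. z \<in> K \<longrightarrow> norm (f n z) \<le> real (Suc n)"
      by (intro AE_I2) (simp add: f_def v0_rn_bound del: of_nat_Suc)
  qed (use bK fb in \<open>auto simp: f_def\<close>)
  have "(\<integral>\<^sup>+z. ennreal (\<bar>uu z\<bar> * indicator K z) \<partial>lborel) \<le> (\<integral>\<^sup>+z. liminf (\<lambda>n. ennreal (f n z)) \<partial>lborel)"
  proof (rule nn_integral_mono_AE)
    show "AE z in lborel. ennreal (\<bar>uu z\<bar> * indicator K z) \<le> liminf (\<lambda>n. ennreal (f n z))"
      using pole_null[OF K]
    proof eventually_elim
      case (elim z)
      show ?case
      proof (cases "z \<in> K")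
        case True
        then have z: "z \<in> \<Omega>" "u z \<noteq> -\<infinity>" using K elim by auto
        then obtain x where x: "u z = ereal x" "x < 0" using neg[OF z(1)] by (cases "u z") auto
        obtain m :: nat where m: "- x < real m" using reals_Archimedean2 by blast
        have "\<forall>\<^sub>F n in sequentially. ennreal (f n z) = ennreal (\<bar>uu z\<bar> * indicator K z)"
          using eventually_ge_at_top[of m]
        proof eventually_elim
          case (elim n)
          then have "vr (rn n) z = x" using m x by (simp add: vr_def max_def)
          then show ?case using True z x by (simp add: f_def v0_eq uu_def)
        qed
        then have "(\<lambda>n. ennreal (f n z)) \<longlonglongrightarrow> ennreal (\<bar>uu z\<bar> * indicator K z)" by (rule tendsto_eventually)
        then show ?thesis using lim_imp_Liminf[OF sequentially_bot] by (metis order_refl)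
      qed simp
    qed
  qed
  also have "\<dots> \<le> liminf (\<lambda>n. \<integral>\<^sup>+z. ennreal (f n z) \<partial>lborel)"
    using fb by (intro nn_integral_liminf) auto
  also have "\<dots> \<le> liminf (\<lambda>n. ennreal C)"
  proof (rule Liminf_mono, rule always_eventually, rule allI)
    fix n
    have "(\<integral>\<^sup>+z. ennreal (f n z) \<partial>lborel) = ennreal (LINT z|lborel. f n z)"
      using fnn by (intro nn_integral_eq_integral[OF fi]) auto
    also have "\<dots> \<le> ennreal C" using C[of "rn n"] by (intro ennreal_leI) (simp add: f_def)
    finally show "(\<integral>\<^sup>+z. ennreal (f n z) \<partial>lborel) \<le> ennreal C" .
  qed
  also have "\<dots> < \<infinity>" by (simp add: Liminf_const)
  finally have fin: "(\<integral>\<^sup>+z. ennreal (\<bar>uu z\<bar> * indicator K z) \<partial>lborel) < \<infinity>" .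
  have "(\<lambda>z. \<bar>uu z\<bar> * indicator K z) \<in> borel_measurable borel"
    by (intro borel_measurable_times borel_measurable_abs uu_borel borel_measurable_indicator bK)
  then show ?thesis using fin by (intro integrableI_nonneg) auto
qed

lemma v0_tendsto_uu:
  assumes h: "cc \<Omega> h"
  shows "integrable lborel (\<lambda>z. uu z * h z)"
    and "(\<lambda>n. LINT z|lborel. v0 (rn n) z * h z) \<longlonglongrightarrow> (LINT z|lborel. uu z * h z)"
proof -
  obtain B R where B: "\<And>z. \<bar>h z\<bar> \<le> B" "B \<ge> 0" by (rule cc_bounded[OF h]) blast
  obtain K where K: "compact K" "K \<subseteq> \<Omega>" "\<And>z. z \<notin> K \<Longrightarrow> h z = 0" using h unfolding cc_def by blast
  have [measurable]: "h \<in> borel_measurable borel" by (rule cc_measurable[OF h])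
  have w: "integrable lborel (\<lambda>z. B * (\<bar>uu z\<bar> * indicator K z))"
    by (intro integrable_mult_right integrable_uu_K K(1,2))
  show "integrable lborel (\<lambda>z. uu z * h z)"
  proof (rule Bochner_Integration.integrable_bound[OF w])
    show "AE z in lborel. norm (uu z * h z) \<le> norm (B * (\<bar>uu z\<bar> * indicator K z))"
    proof (rule AE_I2)
      fix z show "norm (uu z * h z) \<le> norm (B * (\<bar>uu z\<bar> * indicator K z))"
        using B K(3)[of z] mult_left_mono[OF B(1)[of z], of "\<bar>uu z\<bar>"] by (cases "z \<in> K") (auto simp: abs_mult mult.commute)
    qed
  qed measurable
  show "(\<lambda>n. LINT z|lborel. v0 (rn n) z * h z) \<longlonglongrightarrow> (LINT z|lborel. uu z * h z)"
  proof (rule integral_dominated_convergence[OF _ _ w])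
    show "(\<lambda>z. v0 (rn n) z * h z) \<in> borel_measurable lborel" for n
      using borel_measurable_times[OF v0_borel[of "rn n"] cc_measurable[OF h]] by simp
    show "AE z in lborel. (\<lambda>n. v0 (rn n) z * h z) \<longlonglongrightarrow> uu z * h z"
      using pole_null[OF K(1,2)]
    proof eventually_elim
      case (elim z)
      show ?case
      proof (cases "z \<in> K")
        case True
        then have z: "z \<in> \<Omega>" "u z \<noteq> -\<infinity>" using K elim by auto
        then obtain x where x: "u z = ereal x" "x < 0" using neg[OF z(1)] by (cases "u z") auto
        obtain m :: nat where m: "- x < real m" using reals_Archimedean2 by blast
        have "\<forall>\<^sub>F n in sequentially. v0 (rn n) z * h z = uu z * h z"
          using eventually_ge_at_top[of m]
        proof eventually_elim
          case (elim n)
          then have "vr (rn n) z = x" using m x by (simp add: vr_def max_def)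
          then show ?case using z x by (simp add: v0_eq uu_def)
        qed
        then show ?thesis by (rule tendsto_eventually)
      qed (simp add: K(3))
    qed
    show "AE z in lborel. norm (v0 (rn n) z * h z) \<le> B * (\<bar>uu z\<bar> * indicator K z)" for n
      using pole_null[OF K(1,2)]
    proof eventually_elim
      case (elim z)
      show ?case
      proof (cases "z \<in> K")
        case True
        then have "\<bar>v0 (rn n) z\<bar> \<le> \<bar>uu z\<bar>" using elim K(2) by (intro uu_le_v0) auto
        from mult_mono[OF this B(1)[of z]] show ?thesis using True by (simp add: abs_mult mult.commute)
      qed (simp add: K(3))
    qed
  qed measurable
qed

lemma positive_functional_u: "positive_functional \<Omega> (\<lambda>\<phi>. \<kappa> * (LINT z|lborel. uu z * laplacian \<phi> z))"
proof
  fix f g assume fg: "test_function \<Omega> f" "test_function \<Omega> g"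
  note i = v0_tendsto_uu(1)[OF cc_test[OF test_function_laplacian]]
  show "\<kappa> * (LINT z|lborel. uu z * laplacian (\<lambda>z. f z + g z) z) =
    \<kappa> * (LINT z|lborel. uu z * laplacian f z) + \<kappa> * (LINT z|lborel. uu z * laplacian g z)"
    using i[OF fg(1)] i[OF fg(2)] by (simp add: laplacian_add[OF fg] distrib_left)
next
  fix c f assume f: "test_function \<Omega> f"
  have "(LINT z|lborel. uu z * laplacian (\<lambda>z. c * f z) z) = (LINT z|lborel. c * (uu z * laplacian f z))"
    by (simp add: laplacian_scale[OF f] mult_ac)
  then show "\<kappa> * (LINT z|lborel. uu z * laplacian (\<lambda>z. c * f z) z) = c * (\<kappa> * (LINT z|lborel. uu z * laplacian f z))"
    by simp
next
  fix f assume f: "test_function \<Omega> f" "\<And>z. 0 \<le> f z"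
  have "0 \<le> (LINT z|lborel. v0 (rn n) z * laplacian f z)" for n
    by (rule bounded_subharmonic.laplacian_integral_nonneg[OF bounded_subharmonic f]) simp
  then have "0 \<le> (LINT z|lborel. uu z * laplacian f z)"
    by (intro LIMSEQ_le_const[OF v0_tendsto_uu(2)[OF cc_test[OF test_function_laplacian[OF f(1)]]]]) auto
  then show "0 \<le> \<kappa> * (LINT z|lborel. uu z * laplacian f z)" using \<kappa> by simp
qed (rule op)

definition N :: "complex measure" where
  "N = (SOME M. radon_on \<Omega> M \<and> (\<forall>\<phi>. test_function \<Omega> \<phi> \<longrightarrow> (LINT z|M. \<phi> z) = \<kappa> * (LINT z|lborel. uu z * laplacian \<phi> z)))"

lemma radon_N: "radon_on \<Omega> N"
  and integral_N: "test_function \<Omega> \<phi> \<Longrightarrow> (LINT z|N. \<phi> z) = \<kappa> * (LINT z|lborel. uu z * laplacian \<phi> z)"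
proof -
  have "\<exists>M. radon_on \<Omega> M \<and> (\<forall>\<phi>. test_function \<Omega> \<phi> \<longrightarrow> (LINT z|M. \<phi> z) = \<kappa> * (LINT z|lborel. uu z * laplacian \<phi> z))"
    by (rule Riesz_test_functions[OF positive_functional_u]) blast
  from someI_ex[OF this] show "radon_on \<Omega> N"
    and "test_function \<Omega> \<phi> \<Longrightarrow> (LINT z|N. \<phi> z) = \<kappa> * (LINT z|lborel. uu z * laplacian \<phi> z)"
    unfolding N_def by blast+
qed

lemma ddc_u: "ddc \<kappa> \<Omega> u = N"
proof (rule ddc_eqI[OF op])
  show "represents_ddc \<kappa> \<Omega> u N"
    using radon_N integral_N
    by (auto simp: represents_ddc_def radon_on_def set_lebesgue_integral_def uu_def mult.assoc)
qed

lemma M_tendsto_N: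
  assumes "cc \<Omega> \<psi>" shows "(\<lambda>n. LINT z|M (rn n). \<psi> z) \<longlonglongrightarrow> (LINT z|N. \<psi> z)"
proof (rule radon_weak_convergence[OF op _ radon_N _ assms])
  show "\<forall>\<^sub>F n in sequentially. radon_on \<Omega> (M (rn n))" by (simp add: radon_M)
  show "(\<lambda>n. LINT z|M (rn n). \<phi> z) \<longlonglongrightarrow> (LINT z|N. \<phi> z)" if "test_function \<Omega> \<phi>" for \<phi>
    using tendsto_mult_left[OF v0_tendsto_uu(2)[OF cc_test[OF test_function_laplacian[OF that]]], of \<kappa>]
    by (simp add: integral_M[OF _ that] integral_N[OF that])
qed

lemma M_eq_N_superlevel:
  assumes s: "s < 0" and \<phi>: "test_function {z\<in>\<Omega>. u z > ereal s} \<phi>"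
  shows "(LINT z|M s. \<phi> z) = (LINT z|N. \<phi> z)"
proof -
  have \<phi>O: "test_function \<Omega> \<phi>" by (rule test_function_mono[OF \<phi>]) auto
  have "v0 s z * laplacian \<phi> z = uu z * laplacian \<phi> z" for z
  proof (cases "z \<in> supp \<phi>")
    case True
    then have "z \<in> \<Omega>" "u z > ereal s" using test_functionD(3)[OF \<phi>] by auto
    then show ?thesis using vr_eq[of s z] by (simp add: v0_eq[OF s] uu_def)
  next
    case False
    then show ?thesis by (simp add: laplacian_eq_0)
  qed
  then show ?thesis by (simp only: integral_M[OF s \<phi>O] integral_N[OF \<phi>O])
qed

lemma superlevel_borel [measurable]: "{z\<in>\<Omega>. u z \<ge> ereal r} \<in> sets borel"
proof -
  have "{z\<in>\<Omega>. u z \<ge> ereal r} = \<Omega> - {z\<in>\<Omega>. u z < ereal r}" by auto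
  then show ?thesis using op open_sublevel by auto
qed

text \<open>For \<open>s\<close> strictly below \<open>r\<close> the closed condition
  \<open>u \<ge> r\<close> defines a subset of the open set where \<open>u > s\<close>, and on the
  latter \<open>M s\<close> and \<open>N\<close> agree. Exhausting it by cutoffs gives the
  inequality.\<close>

lemma N_superlevel_le_M_below:
  assumes s: "s < r" "r < 0" and \<phi>: "test_function \<Omega> \<phi>" "\<And>z. 0 \<le> \<phi> z"
  shows "(LINT z|N. indicator {z\<in>\<Omega>. u z \<ge> ereal r} z * \<phi> z) \<le> (LINT z|M s. \<phi> z)"
proof -
  let ?U = "{z\<in>\<Omega>. u z > ereal s}"
  have s0: "s < 0" using s by simp
  have U: "open ?U" "?U \<subseteq> \<Omega>" using open_superlevel by auto
  obtain \<eta> where \<eta>: "\<And>n::nat. test_function ?U (\<eta> n)" "\<And>n z. 0 \<le> \<eta> n z" "\<And>n z. \<eta> n z \<le> 1"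
    "\<And>z. z \<in> ?U \<Longrightarrow> \<forall>\<^sub>F n in sequentially. \<eta> n z = 1"
    using open_compact_exhaustion_test[OF U(1)] by blast
  have t: "test_function ?U (\<lambda>z. \<eta> n z * \<phi> z)" for n
    by (rule test_function_mult_smooth[OF \<eta>(1) test_functionD(1)[OF \<phi>(1)]])
  have i\<phi>: "integrable N \<phi>" by (rule radon_on_integrable_test[OF radon_N \<phi>(1)])
  have U1: "?U \<in> sets borel" using U(1) by simp
  have iU: "integrable N (\<lambda>z. indicator X z * \<phi> z)" if "X \<in> sets borel" for X
  proof (rule Bochner_Integration.integrable_bound[OF i\<phi>])
    show "(\<lambda>z. indicator X z * \<phi> z) \<in> borel_measurable N"
      by (intro radon_on_measurable[OF radon_N] borel_measurable_times borel_measurable_indicator that test_function_measurable[OF \<phi>(1)])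
  qed (auto simp: indicator_def)
  have "(\<lambda>n. LINT z|N. \<eta> n z * \<phi> z) \<longlonglongrightarrow> (LINT z|N. indicator ?U z * \<phi> z)"
  proof (rule integral_dominated_convergence[OF _ _ i\<phi>])
    show "(\<lambda>z. indicator ?U z * \<phi> z) \<in> borel_measurable N" using iU[OF U1] by auto
    show "(\<lambda>z. \<eta> n z * \<phi> z) \<in> borel_measurable N" for n
      by (rule radon_on_measurable[OF radon_N test_function_measurable[OF t]])
    show "AE z in N. (\<lambda>n. \<eta> n z * \<phi> z) \<longlonglongrightarrow> indicator ?U z * \<phi> z"
    proof (rule AE_I2)
      fix z show "(\<lambda>n. \<eta> n z * \<phi> z) \<longlonglongrightarrow> indicator ?U z * \<phi> z"
      proof (cases "z \<in> ?U")
        case True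
        have "\<forall>\<^sub>F n in sequentially. \<eta> n z * \<phi> z = indicator ?U z * \<phi> z"
          using \<eta>(4)[OF True] by eventually_elim (use True in simp)
        then show ?thesis by (rule tendsto_eventually)
      next
        case False
        then have "\<eta> n z = 0" for n using test_functionD(3)[OF \<eta>(1)[of n]] not_in_suppD[of z "\<eta> n"] by blast
        then show ?thesis using False by simp
      qed
    qed
    show "AE z in N. norm (\<eta> n z * \<phi> z) \<le> \<phi> z" for n
      using \<eta>(2,3) \<phi>(2) by (intro AE_I2) (simp add: abs_mult mult_left_le_one_le)
  qed
  moreover have "(LINT z|N. \<eta> n z * \<phi> z) \<le> (LINT z|M s. \<phi> z)" for n
  proof -
    have "(LINT z|N. \<eta> n z * \<phi> z) = (LINT z|M s. \<eta> n z * \<phi> z)"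
      by (rule M_eq_N_superlevel[OF s0 t, symmetric])
    also have "\<dots> \<le> (LINT z|M s. \<phi> z)"
      using radon_on_integrable_test[OF radon_M[OF s0] \<phi>(1)] radon_on_integrable_test[OF radon_M[OF s0] test_function_mono[OF t U(2)]]
        \<eta>(2,3) \<phi>(2) by (intro integral_mono) (auto simp: mult_left_le_one_le)
    finally show ?thesis .
  qed
  ultimately have "(LINT z|N. indicator ?U z * \<phi> z) \<le> (LINT z|M s. \<phi> z)"
    by (intro LIMSEQ_le_const2) auto
  moreover have "(LINT z|N. indicator {z\<in>\<Omega>. u z \<ge> ereal r} z * \<phi> z) \<le> (LINT z|N. indicator ?U z * \<phi> z)"
  proof (rule integral_mono[OF iU[OF superlevel_borel] iU[OF U1]])
    fix z
    have "ereal s < u z" if "ereal r \<le> u z" for z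
      by (rule order_less_le_trans[OF _ that]) (use s in simp)
    then have "indicator {z\<in>\<Omega>. u z \<ge> ereal r} z \<le> (indicator ?U z :: real)"
      by (auto simp: indicator_def)
    then show "indicator {z\<in>\<Omega>. u z \<ge> ereal r} z * \<phi> z \<le> indicator ?U z * \<phi> z" using \<phi>(2) by (rule mult_right_mono)
  qed
  ultimately show ?thesis by simp
qed

text \<open>Truncations at two levels differ by at most the difference of the levels, uniformly on
  \<Omega>.\<close>

lemma M_left_continuous:
  assumes r: "r < 0" and \<phi>: "test_function \<Omega> \<phi>"
  shows "((\<lambda>s. LINT z|M s. \<phi> z) \<longlongrightarrow> (LINT z|M r. \<phi> z)) (at_left r)"
proof (rule LIM_zero_cancel, rule Lim_null_comparison)
  note c = cc_test[OF test_function_laplacian[OF \<phi>]]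
  obtain B R where B: "\<And>z. \<bar>laplacian \<phi> z\<bar> \<le> B" "\<And>z. norm z > R \<Longrightarrow> laplacian \<phi> z = 0" by (rule cc_bounded[OF c]) blast
  have il: "integrable lborel (\<lambda>z. \<bar>laplacian \<phi> z\<bar>)"
    by (intro integrable_abs lborel_integrable_bounded_support[OF cc_measurable[OF c] B])
  define A where "A = (LINT z|lborel. \<bar>laplacian \<phi> z\<bar>)"
  show "\<forall>\<^sub>F s in at_left r. norm ((LINT z|M s. \<phi> z) - (LINT z|M r. \<phi> z)) \<le> \<kappa> * ((r - s) * A)"
    unfolding eventually_at_left_field
  proof (intro exI[of _ "r - 1"] conjI allI impI)
    fix s assume s: "r - 1 < s" "s < r"
    then have s0: "s < 0" using r by simp
    have i: "integrable lborel (\<lambda>z. v0 s z * laplacian \<phi> z)" "integrable lborel (\<lambda>z. v0 r z * laplacian \<phi> z)"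
      using integrable_v0[OF s0 c] integrable_v0[OF r c] by auto
    have "\<bar>(LINT z|lborel. v0 s z * laplacian \<phi> z - v0 r z * laplacian \<phi> z)\<bar> \<le> (LINT z|lborel. \<bar>v0 s z * laplacian \<phi> z - v0 r z * laplacian \<phi> z\<bar>)"
      by (rule integral_abs_bound)
    also have "\<dots> \<le> (LINT z|lborel. (r - s) * \<bar>laplacian \<phi> z\<bar>)"
    proof (rule integral_mono)
      fix z
      have "\<bar>v0 s z - v0 r z\<bar> \<le> r - s"
        using vr_mono[of z s r] vr_diff[of z s r] s by (auto simp: v0_eq[OF s0] v0_eq[OF r] indicator_def)
      from mult_right_mono[OF this abs_ge_zero[of "laplacian \<phi> z"]]
      show "\<bar>v0 s z * laplacian \<phi> z - v0 r z * laplacian \<phi> z\<bar> \<le> (r - s) * \<bar>laplacian \<phi> z\<bar>"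
        by (simp add: abs_mult flip: left_diff_distrib)
    qed (use i il in auto)
    finally have "\<bar>(LINT z|lborel. v0 s z * laplacian \<phi> z) - (LINT z|lborel. v0 r z * laplacian \<phi> z)\<bar> \<le> (r - s) * A"
      using i by (simp add: A_def)
    then have "\<kappa> * \<bar>(LINT z|lborel. v0 s z * laplacian \<phi> z) - (LINT z|lborel. v0 r z * laplacian \<phi> z)\<bar> \<le> \<kappa> * ((r - s) * A)"
      using \<kappa> by (intro mult_left_mono) auto
    moreover have "\<bar>\<kappa> * a - \<kappa> * b\<bar> = \<kappa> * \<bar>a - b\<bar>" for a b :: real
      using \<kappa> by (simp add: abs_mult flip: right_diff_distrib)
    ultimately show "norm ((LINT z|M s. \<phi> z) - (LINT z|M r. \<phi> z)) \<le> \<kappa> * ((r - s) * A)"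
      unfolding integral_M[OF s0 \<phi>] integral_M[OF r \<phi>] real_norm_def by simp
  qed simp
  have "((\<lambda>s. \<kappa> * ((r - s) * A)) \<longlongrightarrow> \<kappa> * ((r - r) * A)) (at_left r)" by (intro tendsto_intros)
  then show "((\<lambda>s. \<kappa> * ((r - s) * A)) \<longlongrightarrow> 0) (at_left r)" by simp
qed

text \<open>This is the positivity of the level measure. On the level set itself \<open>M r\<close>
  cannot be compared with \<open>N\<close> locally, so the bound is taken from lower levels and
  carried over by left continuity.\<close>

lemma N_superlevel_le_M:
  assumes r: "r < 0" and \<phi>: "test_function \<Omega> \<phi>" "\<And>z. 0 \<le> \<phi> z"
  shows "(LINT z|N. indicator {z\<in>\<Omega>. u z \<ge> ereal r} z * \<phi> z) \<le> (LINT z|M r. \<phi> z)"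
proof (rule tendsto_lowerbound[OF M_left_continuous[OF r \<phi>(1)]])
  show "\<forall>\<^sub>F s in at_left r. (LINT z|N. indicator {z\<in>\<Omega>. u z \<ge> ereal r} z * \<phi> z) \<le> (LINT z|M s. \<phi> z)"
    unfolding eventually_at_left_field using N_superlevel_le_M_below[OF _ r \<phi>] by (intro exI[of _ "r - 1"]) auto
qed simp

end

section \<open>The level formula\<close>

lemma powr_above_tangent:
  fixes a x p :: real
  assumes "a > 0" "x \<ge> 0" "p \<ge> 1"
  shows "a powr p + p * a powr (p - 1) * (x - a) \<le> x powr p"
proof (cases "x = 0")
  case True
  have "a powr (p - 1) * a = a powr p" using assms by (simp add: powr_mult_base mult.commute)
  then have "a powr p + p * a powr (p - 1) * (x - a) = (1 - p) * a powr p"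
    using True by (simp add: algebra_simps)
  then show ?thesis using assms True by (simp add: mult_nonpos_nonneg)
next
  case False
  have "p * a powr (p - 1) * (x - a) \<le> x powr p - a powr p"
  proof (rule convex_on_imp_above_tangent)
    show "convex_on {0<..} (\<lambda>x::real. x powr p)"
      by (rule convex_on_realI[of _ _ "\<lambda>x. p * x powr (p - 1)"])
         (use assms in \<open>auto intro!: derivative_eq_intros mult_left_mono powr_mono2\<close>)
    show "((\<lambda>x. x powr p) has_real_derivative p * a powr (p - 1)) (at a within {0<..})"
      using assms(1) by (auto intro!: derivative_eq_intros)
  qed (use assms False in \<open>auto simp: connected_Ioi interior_open\<close>)
  then show ?thesis by simp
qed

text \<open>Jensen's inequality, by integrating the tangent to \<open>x powr p\<close> at
  \<open>cmod (f z)\<close> and using the mean value property of \<open>f\<close>.\<close>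

lemma cmean_powr_holomorphic:
  assumes f: "f holomorphic_on S" and S: "cball z \<bar>\<rho>\<bar> \<subseteq> S" and p: "p \<ge> 1"
  shows "cmod (f z) powr p \<le> cmean (\<lambda>w. cmod (f w) powr p) z \<rho>"
proof (cases "f z = 0")
  case True
  then show ?thesis unfolding cmean_def using p by (simp add: Bochner_Integration.integral_nonneg)
next
  case False
  define a where "a = cmod (f z)"
  have a: "a > 0" using False by (simp add: a_def)
  have c: "continuous_on (sphere z \<bar>\<rho>\<bar>) f"
    by (rule continuous_on_subset[OF holomorphic_on_imp_continuous_on[OF f]]) (use S in auto)
  have cn: "continuous_on (sphere z \<bar>\<rho>\<bar>) (\<lambda>w. cmod (f w))" by (intro continuous_intros c)
  have cp: "continuous_on (sphere z \<bar>\<rho>\<bar>) (\<lambda>w. cmod (f w) powr p)" using p by (intro continuous_on_powr' cn continuous_on_const) auto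
  have "a = cmod (cmean f z \<rho>)" using mean_value_holomorphic[OF f S] by (simp add: a_def)
  also have "\<dots> \<le> cmean (\<lambda>w. cmod (f w)) z \<rho>" by (rule norm_cmean_le)
  finally have 1: "a \<le> cmean (\<lambda>w. cmod (f w)) z \<rho>" .
  have "a powr p \<le> a powr p + p * a powr (p - 1) * (cmean (\<lambda>w. cmod (f w)) z \<rho> - a)"
    using 1 p by simp
  also have "\<dots> = cmean (\<lambda>w. a powr p + p * a powr (p - 1) * (cmod (f w) - a)) z \<rho>"
    using cn by (simp add: cmean_add cmean_diff cmean_mult_left continuous_intros)
  also have "\<dots> \<le> cmean (\<lambda>w. cmod (f w) powr p) z \<rho>"
    using powr_above_tangent[OF a _ p] by (intro cmean_mono cp continuous_intros cn) auto
  finally show ?thesis by (simp add: a_def)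
qed

text \<open>One cutoff \<open>\<eta>\<close> serves all \<open>e\<close>, so the integral of the
  error against any Radon measure is at most \<open>e\<close> times a fixed number.\<close>

lemma cc_approx:
  assumes op: "open \<Omega>" and \<psi>: "cc \<Omega> \<psi>"
  obtains \<eta> where "test_function \<Omega> \<eta>" "\<And>z. 0 \<le> \<eta> z"
    "\<And>e. e > 0 \<Longrightarrow> \<exists>\<phi>. test_function \<Omega> \<phi> \<and> (\<forall>z. \<bar>\<psi> z - \<phi> z\<bar> \<le> e * \<eta> z)"
proof -
  obtain K where K: "compact K" "K \<subseteq> \<Omega>" "\<And>z. z \<notin> K \<Longrightarrow> \<psi> z = 0" using \<psi> unfolding cc_def by blast
  obtain \<eta> V where \<eta>: "test_function \<Omega> \<eta>" "\<And>z. 0 \<le> \<eta> z" "\<And>z. \<eta> z \<le> 1"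
    "open V" "K \<subseteq> V" "\<And>z. z \<in> V \<Longrightarrow> \<eta> z = 1"
    using smooth_Urysohn[OF K(1) op K(2)] by blast
  have "\<exists>\<phi>. test_function \<Omega> \<phi> \<and> (\<forall>z. \<bar>\<psi> z - \<phi> z\<bar> \<le> e * \<eta> z)" if e: "e > 0" for e
  proof -
    obtain p where p: "real_polynomial_function p" "\<And>z. z \<in> supp \<eta> \<Longrightarrow> \<bar>\<psi> z - p z\<bar> < e"
      using Stone_Weierstrass_real_polynomial_function[OF test_functionD(2)[OF \<eta>(1)] continuous_on_subset[OF cc_cont[OF \<psi>] subset_UNIV] e]
      by blast
    have "\<bar>\<psi> z - \<eta> z * p z\<bar> \<le> e * \<eta> z" for z
    proof -
      have "\<psi> z - \<eta> z * p z = \<eta> z * (\<psi> z - p z)"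
      proof (cases "z \<in> K")
        case True then show ?thesis using \<eta>(5,6) by auto
      next
        case False then show ?thesis using K(3) by simp
      qed
      moreover have "\<bar>\<eta> z * (\<psi> z - p z)\<bar> \<le> \<eta> z * e"
      proof (cases "z \<in> supp \<eta>")
        case True
        then show ?thesis unfolding abs_mult using p(2)[of z] \<eta>(2)[of z] by (simp add: mult_left_mono)
      next
        case False
        from not_in_suppD[OF this] show ?thesis by simp
      qed
      ultimately show ?thesis by (simp add: mult.commute)
    qed
    then show ?thesis
      using test_function_mult_smooth[OF \<eta>(1) C_k_real_polynomial[OF p(1)]] by blast
  qed
  with \<eta>(1,2) that show thesis by blast
qed

lemma cc_approx_seq:
  assumes op: "open \<Omega>" and \<psi>: "cc \<Omega> \<psi>"
  obtains \<phi> :: "nat \<Rightarrow> complex \<Rightarrow> real" where "\<And>k. test_function \<Omega> (\<phi> k)"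
    "\<And>P. radon_on \<Omega> P \<Longrightarrow> (\<lambda>k. LINT z|P. \<phi> k z) \<longlonglongrightarrow> (LINT z|P. \<psi> z)"
proof -
  obtain \<eta> where \<eta>: "test_function \<Omega> \<eta>" "\<And>z. 0 \<le> \<eta> z"
    and ap: "\<And>e. e > 0 \<Longrightarrow> \<exists>\<phi>. test_function \<Omega> \<phi> \<and> (\<forall>z. \<bar>\<psi> z - \<phi> z\<bar> \<le> e * \<eta> z)"
    by (rule cc_approx[OF assms]) blast
  have "\<exists>\<phi>. test_function \<Omega> \<phi> \<and> (\<forall>z. \<bar>\<psi> z - \<phi> z\<bar> \<le> inverse (real (Suc k)) * \<eta> z)" for k
    by (rule ap) simp
  then obtain \<phi> where \<phi>: "\<And>k. test_function \<Omega> (\<phi> k)" "\<And>k z. \<bar>\<psi> z - \<phi> k z\<bar> \<le> inverse (real (Suc k)) * \<eta> z"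
    by metis
  show thesis
  proof (rule that[OF \<phi>(1)])
    fix P assume P: "radon_on \<Omega> P"
    show "(\<lambda>k. LINT z|P. \<phi> k z) \<longlonglongrightarrow> (LINT z|P. \<psi> z)"
    proof (rule LIM_zero_cancel, rule Lim_null_comparison)
      show "\<forall>\<^sub>F k in sequentially. norm ((LINT z|P. \<phi> k z) - (LINT z|P. \<psi> z)) \<le> inverse (real (Suc k)) * (LINT z|P. \<eta> z)"
      proof (rule always_eventually, rule allI)
        fix k
        have iI: "integrable P \<psi>" "integrable P (\<phi> k)" "integrable P \<eta>"
          by (intro cc_radon_integrable[OF P] \<psi> cc_test[OF \<phi>(1)] cc_test[OF \<eta>(1)])+
        have "\<bar>LINT z|P. \<psi> z - \<phi> k z\<bar> \<le> (LINT z|P. \<bar>\<psi> z - \<phi> k z\<bar>)" by (rule integral_abs_bound)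
        also have "\<dots> \<le> (LINT z|P. inverse (real (Suc k)) * \<eta> z)" using iI by (intro integral_mono \<phi>(2)) auto
        finally show "norm ((LINT z|P. \<phi> k z) - (LINT z|P. \<psi> z)) \<le> inverse (real (Suc k)) * (LINT z|P. \<eta> z)"
          using iI by (simp add: abs_minus_commute del: of_nat_Suc)
      qed
      show "(\<lambda>k. inverse (real (Suc k)) * (LINT z|P. \<eta> z)) \<longlonglongrightarrow> 0"
        using tendsto_mult_right[OF LIMSEQ_inverse_real_of_nat, of "LINT z|P. \<eta> z"] by simp
    qed
  qed
qed

text \<open>The threshold is uniform on compact sets because \<open>J\<close> at a given radius
  involves all points of a compact set at once. The sign of the radius is that of the mean in
  \<open>J\<close>.\<close>

definition submean_loc :: "complex set \<Rightarrow> (complex \<Rightarrow> real) \<Rightarrow> bool" where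
  "submean_loc \<Omega> w \<longleftrightarrow> (\<forall>K. compact K \<and> K \<subseteq> \<Omega> \<longrightarrow> (\<exists>\<delta>>0. \<forall>z\<in>K. \<forall>\<rho>. 0 < \<rho> \<and> \<rho> < \<delta> \<longrightarrow> w z \<le> cmean w z (-\<rho>)))"

lemma submean_loc_powr:
  assumes "open \<Omega>" "f holomorphic_on \<Omega>" "p \<ge> 1" shows "submean_loc \<Omega> (\<lambda>z. cmod (f z) powr p)"
  unfolding submean_loc_def
proof (intro allI impI)
  fix K assume K: "compact K \<and> K \<subseteq> \<Omega>"
  obtain \<delta> where "\<delta> > 0" "\<And>z \<rho>. z \<in> K \<Longrightarrow> \<rho> \<le> \<delta> \<Longrightarrow> cball z \<rho> \<subseteq> \<Omega>"
    using cc_eventually_inside[OF assms(1)] K by blast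
  then show "\<exists>\<delta>>0. \<forall>z\<in>K. \<forall>\<rho>. 0 < \<rho> \<and> \<rho> < \<delta> \<longrightarrow> cmod (f z) powr p \<le> cmean (\<lambda>z. cmod (f z) powr p) z (-\<rho>)"
    using cmean_powr_holomorphic[OF assms(2) _ assms(3)] by (intro exI[of _ \<delta>]) auto
qed

lemma cmean_Re_holomorphic:
  assumes "f holomorphic_on S" "cball z \<bar>\<rho>\<bar> \<subseteq> S"
  shows "cmean (\<lambda>w. Re (f w)) z \<rho> = Re (f z)"
proof -
  have "continuous_on (sphere z \<bar>\<rho>\<bar>) f"
    by (rule continuous_on_subset[OF holomorphic_on_imp_continuous_on[OF assms(1)]]) (use assms(2) in auto)
  from cmean_bounded_linear[OF bounded_linear_Re this] show ?thesis using mean_value_holomorphic[OF assms] by simp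
qed

lemma submean_loc_Re:
  assumes "open \<Omega>" "f holomorphic_on \<Omega>" shows "submean_loc \<Omega> (\<lambda>z. Re (f z))"
  unfolding submean_loc_def
proof (intro allI impI)
  fix K assume K: "compact K \<and> K \<subseteq> \<Omega>"
  obtain \<delta> where "\<delta> > 0" "\<And>z \<rho>. z \<in> K \<Longrightarrow> \<rho> \<le> \<delta> \<Longrightarrow> cball z \<rho> \<subseteq> \<Omega>"
    using cc_eventually_inside[OF assms(1)] K by blast
  then show "\<exists>\<delta>>0. \<forall>z\<in>K. \<forall>\<rho>. 0 < \<rho> \<and> \<rho> < \<delta> \<longrightarrow> Re (f z) \<le> cmean (\<lambda>z. Re (f z)) z (-\<rho>)"
    using cmean_Re_holomorphic[OF assms(2)] by (intro exI[of _ \<delta>]) auto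
qed

lemma radon_on_integrable_indicator:
  assumes P: "radon_on \<Omega> P" and X: "X \<in> sets borel" and f: "integrable P f"
  shows "integrable P (\<lambda>z. indicator X z * f z :: real)"
proof (rule Bochner_Integration.integrable_bound[OF f])
  show "(\<lambda>z. indicator X z * f z) \<in> borel_measurable P"
    using radon_on_measurable[OF P borel_measurable_indicator[OF X]] f by measurable
qed (auto simp: indicator_def)

section \<open>The level measure and the level formula\<close>

context subharmonic_exhaustion begin

abbreviation superl :: "real \<Rightarrow> complex set" where "superl r \<equiv> {z\<in>\<Omega>. u z \<ge> ereal r}"

lemma positive_functional_L:
  assumes r: "r < 0"
  shows "positive_functional \<Omega> (\<lambda>\<phi>. (LINT z|M r. \<phi> z) - (LINT z|N. indicator (superl r) z * \<phi> z))"
proof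
  note ind = radon_on_integrable_indicator[OF radon_N superlevel_borel[of r] radon_on_integrable_test[OF radon_N]]
  note iM = radon_on_integrable_test[OF radon_M[OF r]]
  fix f g assume fg: "test_function \<Omega> f" "test_function \<Omega> g"
  show "(LINT z|M r. f z + g z) - (LINT z|N. indicator (superl r) z * (f z + g z)) =
    (LINT z|M r. f z) - (LINT z|N. indicator (superl r) z * f z) + ((LINT z|M r. g z) - (LINT z|N. indicator (superl r) z * g z))"
    using ind[OF fg(1)] ind[OF fg(2)] iM[OF fg(1)] iM[OF fg(2)] by (simp add: distrib_left)
next
  fix c :: real and f assume f: "test_function \<Omega> f"
  have "(LINT z|N. indicator (superl r) z * (c * f z)) = (LINT z|N. c * (indicator (superl r) z * f z))"
    by (simp add: mult_ac)
  then show "(LINT z|M r. c * f z) - (LINT z|N. indicator (superl r) z * (c * f z)) =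
      c * ((LINT z|M r. f z) - (LINT z|N. indicator (superl r) z * f z))"
    by (simp add: right_diff_distrib)
qed (use N_superlevel_le_M[OF r] op in auto)

text \<open>\<open>L r\<close> is the level measure constructed as a Radon measure. Starting from it avoids having to prove that
  the difference in \<open>MA_level_measure\<close> is one of nested measures; the two agree by
  \<open>MA_level_measure_eq\<close>.\<close>

definition L :: "real \<Rightarrow> complex measure" where
  "L r = (SOME P. radon_on \<Omega> P \<and> (\<forall>\<phi>. test_function \<Omega> \<phi> \<longrightarrow>
     (LINT z|P. \<phi> z) = (LINT z|M r. \<phi> z) - (LINT z|N. indicator (superl r) z * \<phi> z)))"

lemma
  assumes r: "r < 0"
  shows radon_L: "radon_on \<Omega> (L r)"
    and integral_L: "test_function \<Omega> \<phi> \<Longrightarrow> (LINT z|L r. \<phi> z) = (LINT z|M r. \<phi> z) - (LINT z|N. indicator (superl r) z * \<phi> z)"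
proof -
  have "\<exists>P. radon_on \<Omega> P \<and> (\<forall>\<phi>. test_function \<Omega> \<phi> \<longrightarrow>
     (LINT z|P. \<phi> z) = (LINT z|M r. \<phi> z) - (LINT z|N. indicator (superl r) z * \<phi> z))"
    by (rule Riesz_test_functions[OF positive_functional_L[OF r]]) blast
  from someI_ex[OF this] show "radon_on \<Omega> (L r)"
    and "test_function \<Omega> \<phi> \<Longrightarrow> (LINT z|L r. \<phi> z) = (LINT z|M r. \<phi> z) - (LINT z|N. indicator (superl r) z * \<phi> z)"
    unfolding L_def by blast+
qed

text \<open>For test functions this defines \<open>L r\<close>. An approximating sequence that does
  not depend on the measure carries it to continuous functions for all three measures at
  once.\<close>

lemma integral_M_split:
  assumes r: "r < 0" and \<psi>: "cc \<Omega> \<psi>"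
  shows "(LINT z|M r. \<psi> z) = (LINT z|L r. \<psi> z) + (LINT z|N. indicator (superl r) z * \<psi> z)"
proof -
  obtain \<phi> :: "nat \<Rightarrow> complex \<Rightarrow> real" where t: "\<And>k. test_function \<Omega> (\<phi> k)"
    and lim: "\<And>P. radon_on \<Omega> P \<Longrightarrow> (\<lambda>k. LINT z|P. \<phi> k z) \<longlonglongrightarrow> (LINT z|P. \<psi> z)"
    by (rule cc_approx_seq[OF op \<psi>]) blast
  note D = radon_on_density[OF radon_N superlevel_borel[of r]]
  have "(LINT z|M r. \<phi> k z) = (LINT z|L r. \<phi> k z) + (LINT z|density N (indicator (superl r)). \<phi> k z)" for k
    using integral_L[OF r t] D(2)[OF radon_on_integrable_test[OF radon_N t]] by simp
  then have "(\<lambda>k. LINT z|M r. \<phi> k z) \<longlonglongrightarrow> (LINT z|L r. \<psi> z) + (LINT z|density N (indicator (superl r)). \<psi> z)"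
    using tendsto_add[OF lim[OF radon_L[OF r]] lim[OF D(1)]] by simp
  from LIMSEQ_unique[OF lim[OF radon_M[OF r]] this] show ?thesis
    using D(2)[OF cc_radon_integrable[OF radon_N \<psi>]] by simp
qed

text \<open>\<open>diff_measure\<close> subtracts values set by set, and \<open>M r\<close> is the
  sum of \<open>L r\<close> and \<open>?D\<close>. The subtraction returns \<open>L r\<close>
  because the finite mass of \<open>N\<close> makes the values of \<open>?D\<close> finite.\<close>

lemma MA_level_measure_eq:
  assumes r: "r < 0" and fin: "emeasure N \<Omega> < \<infinity>"
  shows "MA_level_measure \<kappa> \<Omega> u r = L r"
proof -
  let ?D = "density N (indicator (superl r))"
  note D = radon_on_density[OF radon_N superlevel_borel[of r]]
  have sets: "sets (L r) = sets (M r)" "sets ?D = sets (M r)" "space (L r) = space (M r)"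
    using radon_L[OF r] radon_M[OF r] D(1) radon_on_space[OF radon_L[OF r]] radon_on_space[OF radon_M[OF r]]
    by (simp_all add: radon_on_def)
  have "emeasure (M r) X - emeasure ?D X = emeasure (L r) X" if X: "X \<in> sets (M r)" for X
  proof -
    have eq: "emeasure (M r) X = emeasure (L r) X + emeasure ?D X"
    proof (rule radon_on_unique_add[OF op radon_M[OF r] radon_L[OF r] D(1) _ X])
      fix \<phi> assume t: "test_function \<Omega> \<phi>"
      show "(LINT z|M r. \<phi> z) = (LINT z|L r. \<phi> z) + (LINT z|?D. \<phi> z)"
        using integral_L[OF r t] D(2)[OF radon_on_integrable_test[OF radon_N t]] by simp
    qed
    have XN: "X \<in> sets N" using X radon_M[OF r] radon_N by (simp add: radon_on_def)
    have "emeasure ?D X \<le> emeasure ?D (space ?D)" by (rule emeasure_space)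
    also have "\<dots> = (\<integral>\<^sup>+z. indicator (superl r) z * indicator (space N) z \<partial>N)"
    proof -
      have "(\<lambda>z. ennreal (indicator (superl r) z)) \<in> borel_measurable N"
        by (intro measurable_compose[OF radon_on_measurable[OF radon_N borel_measurable_indicator[OF superlevel_borel]] measurable_ennreal])
      then show ?thesis by (subst emeasure_density) (auto simp: ennreal_indicator)
    qed
    also have "\<dots> \<le> (\<integral>\<^sup>+z. indicator (space N) z \<partial>N)" by (intro nn_integral_mono) (auto simp: indicator_def)
    also have "\<dots> = emeasure N (space N)" by (rule nn_integral_indicator[OF sets.top])
    also have "\<dots> < \<infinity>" using fin radon_on_space[OF radon_N] by simp
    finally have "emeasure ?D X \<noteq> \<infinity>" by simp
    then show ?thesis unfolding eq by simp
  qed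
  then have "measure_of (space (M r)) (sets (M r)) (\<lambda>X. emeasure (M r) X - emeasure ?D X) = measure_of (space (M r)) (sets (M r)) (emeasure (L r))"
    by (intro measure_of_eq sets.space_closed) (auto simp: sets.sigma_sets_eq)
  also have "\<dots> = L r" using measure_of_of_measure[of "L r"] sets by simp
  finally have "diff_measure (M r) ?D = L r" unfolding diff_measure_def .
  moreover have "\<Omega> - sublevel \<Omega> u r = superl r" by (auto simp: sublevel_def)
  ultimately show ?thesis unfolding MA_level_measure_def ddc_max[OF r] ddc_u by simp
qed

text \<open>Both constants 1 and -1 have the submean property, so the integral has both
  signs.\<close>

lemma integral_laplacian_0:
  assumes "test_function \<Omega> \<phi>" "\<And>z. 0 \<le> \<phi> z"
  shows "(LINT z|lborel. indicator \<Omega> z * laplacian \<phi> z) = 0"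
proof -
  interpret c1: bounded_subharmonic \<Omega> "\<lambda>_. 1" 1 by standard (use op in auto)
  interpret c2: bounded_subharmonic \<Omega> "\<lambda>_. -1" 1 by standard (use op in auto)
  show ?thesis
    using c1.laplacian_integral_nonneg[OF assms] c2.laplacian_integral_nonneg[OF assms]
    by (simp add: c1.v0_def c2.v0_def)
qed

text \<open>Below the level the truncation is constant and \<open>M r\<close> has no mass; above it
  \<open>M r\<close> agrees with \<open>N\<close>, which has been subtracted.\<close>

lemma AE_L_level:
  assumes r: "r < 0" shows "AE z in L r. z \<in> level \<Omega> u r"
proof -
  have 1: "emeasure (L r) {z\<in>\<Omega>. u z < ereal r} = 0"
  proof (rule radon_on_null_open[OF radon_L[OF r] open_sublevel])
    fix \<phi> assume t: "test_function {z\<in>\<Omega>. u z < ereal r} \<phi>" and nn: "\<And>z. 0 \<le> \<phi> z"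
    have tO: "test_function \<Omega> \<phi>" by (rule test_function_mono[OF t]) auto
    have "v0 r z * laplacian \<phi> z = r * (indicator \<Omega> z * laplacian \<phi> z)" for z
    proof (cases "z \<in> supp \<phi>")
      case True
      then have "z \<in> \<Omega>" "u z \<le> ereal r" using test_functionD(3)[OF t] by auto
      then show ?thesis using vr_eq_below[of z r] by (simp add: v0_eq[OF r])
    qed (simp add: laplacian_eq_0)
    then have "(LINT z|M r. \<phi> z) = \<kappa> * (LINT z|lborel. r * (indicator \<Omega> z * laplacian \<phi> z))"
      by (simp only: integral_M[OF r tO])
    also have "\<dots> = 0" using integral_laplacian_0[OF tO nn] by simp
    finally have "(LINT z|M r. \<phi> z) = 0" .
    moreover have "0 \<le> (LINT z|N. indicator (superl r) z * \<phi> z)"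
      by (rule Bochner_Integration.integral_nonneg) (use nn in simp)
    ultimately show "(LINT z|L r. \<phi> z) \<le> 0" using integral_L[OF r tO] by simp
  qed auto
  have 2: "emeasure (L r) {z\<in>\<Omega>. u z > ereal r} = 0"
  proof (rule radon_on_null_open[OF radon_L[OF r] open_superlevel])
    fix \<phi> assume t: "test_function {z\<in>\<Omega>. u z > ereal r} \<phi>" and nn: "\<And>z. 0 \<le> \<phi> z"
    have tO: "test_function \<Omega> \<phi>" by (rule test_function_mono[OF t]) auto
    have eq: "indicator (superl r) z * \<phi> z = \<phi> z" for z
    proof (cases "z \<in> supp \<phi>")
      case True
      then have "z \<in> superl r" using test_functionD(3)[OF t] by auto
      then show ?thesis by simp
    next
      case False from not_in_suppD[OF this] show ?thesis by simp
    qed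
    show "(LINT z|L r. \<phi> z) \<le> 0"
      unfolding integral_L[OF r tO] M_eq_N_superlevel[OF r t] eq by simp
  qed auto
  have s: "{z\<in>\<Omega>. u z < ereal r} \<in> sets (L r)" "{z\<in>\<Omega>. u z > ereal r} \<in> sets (L r)"
    using open_sublevel open_superlevel by (auto intro!: radon_on_sets[OF radon_L[OF r]])
  have "AE z in L r. z \<notin> {z\<in>\<Omega>. u z < ereal r}" "AE z in L r. z \<notin> {z\<in>\<Omega>. u z > ereal r}"
    by (rule AE_not_in[OF null_setsI[OF 1 s(1)]], rule AE_not_in[OF null_setsI[OF 2 s(2)]])
  then show ?thesis
    using AE_space[of "L r"] unfolding radon_on_space[OF radon_L[OF r]]
    by eventually_elim (auto simp: level_def not_less order.antisym)
qed

text \<open>Real integrals rather than \<open>nn_integral\<close>, because the level formula is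
  applied to harmonic functions and their negatives.\<close>

definition level_int :: "(complex \<Rightarrow> real) \<Rightarrow> real \<Rightarrow> real" where
  "level_int w r = (LINT z|L r. indicator (level \<Omega> u r) z * w z)"
definition sub_int :: "(complex \<Rightarrow> real) \<Rightarrow> real \<Rightarrow> real" where
  "sub_int w r = (LINT z|N. indicator (sublevel \<Omega> u r) z * w z)"

lemma level_borel: "level \<Omega> u r \<in> sets borel" and sublevel_borel: "sublevel \<Omega> u r \<in> sets borel"
proof -
  have "level \<Omega> u r = superl r - {z\<in>\<Omega>. u z > ereal r}" by (auto simp: level_def)
  then show "level \<Omega> u r \<in> sets borel" using superlevel_borel open_superlevel by auto
  show "sublevel \<Omega> u r \<in> sets borel" unfolding sublevel_def using open_sublevel by auto
qed

lemma cutoff: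
  fixes w :: "complex \<Rightarrow> real"
  assumes w: "continuous_on \<Omega> w" and s: "s < 0"
  obtains \<psi> V where "cc \<Omega> \<psi>" "open V" "{z\<in>\<Omega>. u z \<le> ereal s} \<subseteq> V" "\<And>z. z \<in> V \<Longrightarrow> \<psi> z = w z"
proof -
  obtain \<eta> V where \<eta>: "test_function \<Omega> \<eta>" "\<And>z. 0 \<le> \<eta> z" "\<And>z. \<eta> z \<le> 1"
    "open V" "{z\<in>\<Omega>. u z \<le> ereal s} \<subseteq> V" "\<And>z. z \<in> V \<Longrightarrow> \<eta> z = 1"
    using smooth_Urysohn[OF compact_sublevel[OF s] op] by blast
  have "continuous_on (\<Omega> \<union> - supp \<eta>) (\<lambda>z. \<eta> z * w z)"
  proof (rule continuous_on_open_Un)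
    show "continuous_on \<Omega> (\<lambda>z. \<eta> z * w z)"
      by (intro continuous_on_mult w continuous_on_subset[OF test_functionD(4)[OF \<eta>(1)]]) auto
    have "\<eta> z * w z = 0" if "z \<in> - supp \<eta>" for z using not_in_suppD[of z \<eta>] that by simp
    then have "continuous_on (- supp \<eta>) (\<lambda>z. \<eta> z * w z) \<longleftrightarrow> continuous_on (- supp \<eta>) (\<lambda>z. 0 :: real)"
      by (intro continuous_on_cong refl) simp
    then show "continuous_on (- supp \<eta>) (\<lambda>z. \<eta> z * w z)" by simp
  qed (use op in auto)
  moreover have "\<Omega> \<union> - supp \<eta> = UNIV" using test_functionD(3)[OF \<eta>(1)] by blast
  ultimately have "continuous_on UNIV (\<lambda>z. \<eta> z * w z)" by simp
  moreover have "\<eta> z * w z = 0" if "z \<notin> supp \<eta>" for z using not_in_suppD[OF that] by simp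
  ultimately have "cc \<Omega> (\<lambda>z. \<eta> z * w z)"
    unfolding cc_def using test_functionD(2,3)[OF \<eta>(1)] by blast
  then show thesis using \<eta>(4-6) that[of "\<lambda>z. \<eta> z * w z" V] by simp
qed

lemma level_integrable:
  fixes w :: "complex \<Rightarrow> real"
  assumes w: "continuous_on \<Omega> w" and r: "r < 0"
  shows "integrable (L r) (\<lambda>z. indicator (level \<Omega> u r) z * w z)" "integrable N (\<lambda>z. indicator (sublevel \<Omega> u r) z * w z)"
proof -
  obtain \<psi> V where \<psi>: "cc \<Omega> \<psi>" "open V" "{z\<in>\<Omega>. u z \<le> ereal r} \<subseteq> V" "\<And>z. z \<in> V \<Longrightarrow> \<psi> z = w z"
    by (rule cutoff[OF w r]) blast
  have eq: "\<psi> z = w z" if "z \<in> \<Omega>" "u z \<le> ereal r" for z using that \<psi>(3,4) by blast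
  have "(\<lambda>z. indicator (level \<Omega> u r) z * w z) = (\<lambda>z. indicator (level \<Omega> u r) z * \<psi> z)"
    by (intro ext) (auto simp: level_def indicator_def eq)
  then show "integrable (L r) (\<lambda>z. indicator (level \<Omega> u r) z * w z)"
    using radon_on_integrable_indicator[OF radon_L[OF r] level_borel cc_radon_integrable[OF radon_L[OF r] \<psi>(1)]] by metis
  have "(\<lambda>z. indicator (sublevel \<Omega> u r) z * w z) = (\<lambda>z. indicator (sublevel \<Omega> u r) z * \<psi> z)"
    by (intro ext) (auto simp: sublevel_def indicator_def less_imp_le eq)
  then show "integrable N (\<lambda>z. indicator (sublevel \<Omega> u r) z * w z)"
    using radon_on_integrable_indicator[OF radon_N sublevel_borel cc_radon_integrable[OF radon_N \<psi>(1)]] by metis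
qed

text \<open>The measure \<open>M r\<close> is \<open>L r\<close> plus \<open>N\<close> where
  \<open>u \<ge> r\<close>, so subtracting all of \<open>N\<close> leaves the level integral minus
  the integral over \<open>u < r\<close>. Only the values of \<open>\<psi>\<close> where
  \<open>u \<le> r\<close> enter, which is why \<open>w\<close> may be cut off.\<close>

lemma level_int_minus_sub_int:
  assumes r: "r < 0" and \<psi>: "cc \<Omega> \<psi>" and eq: "\<And>z. z \<in> \<Omega> \<Longrightarrow> u z \<le> ereal r \<Longrightarrow> \<psi> z = w z"
  shows "level_int w r - sub_int w r = (LINT z|M r. \<psi> z) - (LINT z|N. \<psi> z)"
proof -
  have "(LINT z|L r. \<psi> z) = level_int w r"
    unfolding level_int_def
  proof (rule integral_cong_AE)
    show "\<psi> \<in> borel_measurable (L r)" by (rule radon_on_measurable[OF radon_L[OF r] cc_measurable[OF \<psi>]])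
    have "(\<lambda>z. indicator (level \<Omega> u r) z * w z) = (\<lambda>z. indicator (level \<Omega> u r) z * \<psi> z)"
      using eq by (auto simp: level_def indicator_def)
    then show "(\<lambda>z. indicator (level \<Omega> u r) z * w z) \<in> borel_measurable (L r)"
      using radon_on_measurable[OF radon_L[OF r] borel_measurable_times[OF borel_measurable_indicator[OF level_borel] cc_measurable[OF \<psi>]]]
      by metis
    show "AE z in L r. \<psi> z = indicator (level \<Omega> u r) z * w z"
      using AE_L_level[OF r] by eventually_elim (use eq in \<open>auto simp: level_def indicator_def\<close>)
  qed
  moreover have "(LINT z|N. \<psi> z) = (LINT z|N. indicator (superl r) z * \<psi> z) + sub_int w r"
  proof -
    have "sub_int w r = (LINT z|N. indicator (sublevel \<Omega> u r) z * \<psi> z)"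
      unfolding sub_int_def using eq by (intro Bochner_Integration.integral_cong) (auto simp: sublevel_def indicator_def less_imp_le)
    moreover have "(LINT z|N. \<psi> z) = (LINT z|N. indicator (superl r) z * \<psi> z + indicator (sublevel \<Omega> u r) z * \<psi> z)"
      by (intro Bochner_Integration.integral_cong) (auto simp: sublevel_def indicator_def radon_on_space[OF radon_N] not_le)
    ultimately show ?thesis
      using radon_on_integrable_indicator[OF radon_N superlevel_borel cc_radon_integrable[OF radon_N \<psi>]]
        radon_on_integrable_indicator[OF radon_N sublevel_borel cc_radon_integrable[OF radon_N \<psi>]] by simp
  qed
  ultimately show ?thesis using integral_M_split[OF r \<psi>] by simp
qed

text \<open>The truncations at \<open>r\<close> and \<open>s\<close> differ only where
  \<open>u \<le> s\<close>. Near that set the cutoff \<open>\<psi>\<close> coincides with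
  \<open>w\<close> and so has nonnegative second differences for small radii. This orders the two
  \<open>J\<close>, and hence their limits.\<close>

lemma M_integral_mono:
  assumes rs: "r \<le> s" "s < 0" and \<psi>: "cc \<Omega> \<psi>" and V: "open V" "{z\<in>\<Omega>. u z \<le> ereal s} \<subseteq> V" "\<And>z. z \<in> V \<Longrightarrow> \<psi> z = w z"
    and sm: "submean_loc \<Omega> w"
  shows "(LINT z|M r. \<psi> z) \<le> (LINT z|M s. \<psi> z)"
proof -
  have r: "r < 0" using rs by simp
  interpret br: bounded_subharmonic \<Omega> "vr r" "-r" by (rule bounded_subharmonic[OF r])
  interpret bs: bounded_subharmonic \<Omega> "vr s" "-s" by (rule bounded_subharmonic[OF rs(2)])
  let ?K = "{z\<in>\<Omega>. u z \<le> ereal s}"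
  have K: "compact ?K" "?K \<subseteq> \<Omega>" "?K \<subseteq> V" using compact_sublevel[OF rs(2)] V by auto
  obtain \<delta>1 where \<delta>1: "\<delta>1 > 0" "\<And>z \<rho>. z \<in> ?K \<Longrightarrow> \<rho> \<le> \<delta>1 \<Longrightarrow> cball z \<rho> \<subseteq> V"
    by (rule cc_eventually_inside[OF V(1) K(1,3)]) blast
  have "\<exists>\<delta>>0. \<forall>z\<in>?K. \<forall>\<rho>. 0 < \<rho> \<and> \<rho> < \<delta> \<longrightarrow> w z \<le> cmean w z (-\<rho>)"
    using sm[unfolded submean_loc_def, rule_format, OF conjI[OF K(1,2)]] .
  then obtain \<delta>2 where \<delta>2: "\<delta>2 > 0" "\<And>z \<rho>. z \<in> ?K \<Longrightarrow> 0 < \<rho> \<Longrightarrow> \<rho> < \<delta>2 \<Longrightarrow> w z \<le> cmean w z (-\<rho>)"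
    by metis
  have le: "\<kappa> * br.J \<rho> \<psi> \<le> \<kappa> * bs.J \<rho> \<psi>" if \<rho>: "0 < \<rho>" "\<rho> < min \<delta>1 \<delta>2" for \<rho>
  proof -
    have "(LINT z|lborel. v0 r z * (cmean \<psi> z (-\<rho>) - \<psi> z)) \<le> (LINT z|lborel. v0 s z * (cmean \<psi> z (-\<rho>) - \<psi> z))"
    proof (rule integral_mono)
      show "integrable lborel (\<lambda>z. v0 r z * (cmean \<psi> z (-\<rho>) - \<psi> z))"
        using br.J_integrable[OF \<psi>] by (simp add: right_diff_distrib)
      show "integrable lborel (\<lambda>z. v0 s z * (cmean \<psi> z (-\<rho>) - \<psi> z))"
        using bs.J_integrable[OF \<psi>] by (simp add: right_diff_distrib)
      fix z
      show "v0 r z * (cmean \<psi> z (-\<rho>) - \<psi> z) \<le> v0 s z * (cmean \<psi> z (-\<rho>) - \<psi> z)"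
      proof (cases "z \<in> ?K")
        case True
        have cb: "cball z \<rho> \<subseteq> V" using \<delta>1(2)[OF True, of \<rho>] \<rho> by simp
        have "cmean \<psi> z (-\<rho>) = cmean w z (-\<rho>)"
          by (rule cmean_cong) (use cb V(3) \<rho> in \<open>auto simp: subset_iff\<close>)
        moreover have "\<psi> z = w z" using V(3) K(3) True by blast
        ultimately have "0 \<le> cmean \<psi> z (-\<rho>) - \<psi> z" using \<delta>2(2)[OF True, of \<rho>] \<rho> by simp
        moreover have "v0 r z \<le> v0 s z" using True vr_mono[of z r s] rs by (simp add: v0_eq[OF r] v0_eq[OF rs(2)])
        ultimately show ?thesis by (rule mult_right_mono[rotated])
      next
        case False
        have "v0 r z = v0 s z"
        proof (cases "z \<in> \<Omega>")
          case True
          then have s: "ereal s < u z" using False by auto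
          have "ereal r < u z" by (rule order_le_less_trans[OF _ s]) (use rs in simp)
          then show ?thesis using True s vr_eq[of r z] vr_eq[of s z] by (simp add: v0_eq[OF r] v0_eq[OF rs(2)])
        qed (simp add: v0_eq[OF r] v0_eq[OF rs(2)])
        then show ?thesis by simp
      qed
    qed
    then have "br.J \<rho> \<psi> \<le> bs.J \<rho> \<psi>" unfolding br.J_def bs.J_def by (rule mult_left_mono) simp
    then show ?thesis using \<kappa> by simp
  qed
  have ev: "\<forall>\<^sub>F \<rho> in at_right 0. \<kappa> * br.J \<rho> \<psi> \<le> \<kappa> * bs.J \<rho> \<psi>"
    using le \<delta>1(1) \<delta>2(1) unfolding eventually_at_right_field by (intro exI[of _ "min \<delta>1 \<delta>2"]) auto
  show ?thesis
    unfolding M_def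
    by (rule tendsto_le[OF _ bs.J_tendsto[OF \<kappa> \<psi>] br.J_tendsto[OF \<kappa> \<psi>] ev]) simp
qed

text \<open>One cutoff made for the level \<open>s\<close> serves every lower level, so both claims
  reduce to the monotonicity in \<open>t\<close> of the integral of \<open>\<psi>\<close> against
  \<open>M t\<close>. The first compares it with the limit \<open>N\<close> as \<open>t\<close>
  tends to -\<infinity>.\<close>

lemma level_formula:
  assumes rs: "r \<le> s" "s < 0" and w: "continuous_on \<Omega> w" "submean_loc \<Omega> w"
  shows "sub_int w r \<le> level_int w r" "level_int w r - sub_int w r \<le> level_int w s - sub_int w s"
proof -
  have r: "r < 0" using rs by simp
  obtain \<psi> V where \<psi>: "cc \<Omega> \<psi>" "open V" "{z\<in>\<Omega>. u z \<le> ereal s} \<subseteq> V" "\<And>z. z \<in> V \<Longrightarrow> \<psi> z = w z"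
    by (rule cutoff[OF w(1) rs(2)]) blast
  have sub: "{z\<in>\<Omega>. u z \<le> ereal t} \<subseteq> V" if "t \<le> s" for t
  proof -
    have "{z\<in>\<Omega>. u z \<le> ereal t} \<subseteq> {z\<in>\<Omega>. u z \<le> ereal s}" using that by (auto intro: order_trans)
    then show ?thesis using \<psi>(3) by blast
  qed
  have eq: "level_int w t - sub_int w t = (LINT z|M t. \<psi> z) - (LINT z|N. \<psi> z)" if "t \<le> s" for t
    by (rule level_int_minus_sub_int[OF _ \<psi>(1)]) (use that rs sub[OF that] \<psi>(4) in auto)
  have mono: "(LINT z|M a. \<psi> z) \<le> (LINT z|M b. \<psi> z)" if "a \<le> b" "b \<le> s" for a b
    by (rule M_integral_mono[OF that(1) _ \<psi>(1,2) sub[OF that(2)] \<psi>(4) w(2)]) (use that rs in auto)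
  show "level_int w r - sub_int w r \<le> level_int w s - sub_int w s" using mono[OF rs(1)] eq[OF rs(1)] eq[of s] by simp
  have "(LINT z|N. \<psi> z) \<le> (LINT z|M r. \<psi> z)"
  proof (rule tendsto_upperbound[OF M_tendsto_N[OF \<psi>(1)]])
    obtain m :: nat where m: "- r < real m" using reals_Archimedean2 by blast
    show "\<forall>\<^sub>F n in sequentially. (LINT z|M (rn n). \<psi> z) \<le> (LINT z|M r. \<psi> z)"
      using eventually_ge_at_top[of m] by eventually_elim (use m rs in \<open>auto intro!: mono\<close>)
  qed simp
  then show "sub_int w r \<le> level_int w r" using eq[OF rs(1)] by simp
qed

lemma level_formula_harmonic:
  assumes "r < 0" "f holomorphic_on \<Omega>" shows "level_int (\<lambda>z. Re (f z)) r = sub_int (\<lambda>z. Re (f z)) r"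
proof (rule antisym)
  have c: "continuous_on \<Omega> (\<lambda>z. Re (g z))" if "g holomorphic_on \<Omega>" for g
    using holomorphic_on_imp_continuous_on[OF that] by (intro continuous_intros)
  show "sub_int (\<lambda>z. Re (f z)) r \<le> level_int (\<lambda>z. Re (f z)) r"
    by (rule level_formula(1)[OF order_refl assms(1) c[OF assms(2)] submean_loc_Re[OF op assms(2)]])
  have h: "(\<lambda>z. - f z) holomorphic_on \<Omega>" using assms(2) by (intro holomorphic_intros)
  from level_formula(1)[OF order_refl assms(1) c[OF h] submean_loc_Re[OF op h]]
  show "level_int (\<lambda>z. Re (f z)) r \<le> sub_int (\<lambda>z. Re (f z)) r"
    by (simp add: level_int_def sub_int_def)
qed

end

section \<open>Harmonic functions on the disc\<close>

text \<open>The automorphism of the disc that takes 0 to \<open>a\<close>; it reduces comparisons at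
  \<open>a\<close> to circle means about 0.\<close>

definition moebius :: "complex \<Rightarrow> complex \<Rightarrow> complex" where
  "moebius a z = (z + a) / (1 + cnj a * z)"

lemma moebius_denominator: assumes "norm a < 1" "norm z \<le> 1" shows "1 + cnj a * z \<noteq> 0"
proof
  assume "1 + cnj a * z = 0"
  then have "cnj a * z = -1" by (simp add: add_eq_0_iff)
  then have "norm a * norm z = 1" by (metis norm_minus_cancel norm_mult norm_one complex_mod_cnj)
  moreover have "norm a * norm z \<le> norm a * 1" using assms by (intro mult_left_mono) auto
  ultimately show False using assms by simp
qed

lemma moebius_norm_identity:
  assumes "norm a < 1" "norm z \<le> 1"
  shows "1 - (norm (moebius a z))\<^sup>2 = (1 - (norm a)\<^sup>2) * (1 - (norm z)\<^sup>2) / (norm (1 + cnj a * z))\<^sup>2"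
proof -
  have d: "norm (1 + cnj a * z) \<noteq> 0" using moebius_denominator[OF assms] by simp
  have "(norm (1 + cnj a * z))\<^sup>2 - (norm (z + a))\<^sup>2 = (1 - (norm a)\<^sup>2) * (1 - (norm z)\<^sup>2)"
    unfolding cmod_power2 by (simp add: algebra_simps power2_eq_square)
  then show ?thesis using d by (simp add: moebius_def norm_divide power_divide field_simps)
qed

lemma moebius_norm_le: assumes "norm a < 1" "norm z \<le> 1" shows "norm (moebius a z) \<le> 1"
proof -
  have "(norm a)\<^sup>2 \<le> 1" "(norm z)\<^sup>2 \<le> 1" using assms by (auto simp: abs_square_le_1)
  then have "0 \<le> 1 - (norm (moebius a z))\<^sup>2" unfolding moebius_norm_identity[OF assms] by simp
  then show ?thesis by (simp add: abs_square_le_1)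
qed

lemma moebius_norm_less: assumes "norm a < 1" "norm z < 1" shows "norm (moebius a z) < 1"
proof -
  have "(norm a)\<^sup>2 < 1" "(norm z)\<^sup>2 < 1" using assms by (auto simp: abs_square_less_1)
  then have "0 < 1 - (norm (moebius a z))\<^sup>2"
    using moebius_norm_identity[OF assms(1), of z] moebius_denominator[OF assms(1), of z] assms(2) by simp
  then show ?thesis by (simp add: abs_square_less_1)
qed

lemma moebius_norm_eq: assumes "norm a < 1" "norm z = 1" shows "norm (moebius a z) = 1"
proof (rule power2_eq_imp_eq)
  show "(norm (moebius a z))\<^sup>2 = 1\<^sup>2" using moebius_norm_identity[OF assms(1), of z] assms(2) by simp
qed auto

lemma moebius_0: "moebius a 0 = a" and moebius_neg: "moebius (-a) a = 0"
  by (simp_all add: moebius_def)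

lemma moebius_inverse:
  assumes "norm a < 1" "norm z < 1" shows "moebius (-a) (moebius a z) = z"
proof -
  have d: "1 + cnj a * z \<noteq> 0" using moebius_denominator[of a z] assms by simp
  have "(norm a)\<^sup>2 < 1" using assms by (auto simp: abs_square_less_1)
  then have "norm (a * cnj a) < 1" by (simp add: norm_mult power2_eq_square)
  then have n: "1 - a * cnj a \<noteq> 0" by (metis diff_0_right eq_iff_diff_eq_0 less_irrefl norm_one)
  have 1: "moebius a z + - a = z * (1 - a * cnj a) / (1 + cnj a * z)"
    using d by (simp add: moebius_def field_simps)
  have 2: "1 + cnj (-a) * moebius a z = (1 - a * cnj a) / (1 + cnj a * z)"
    using d by (simp add: moebius_def field_simps)
  show ?thesis unfolding moebius_def[of "-a"] 1 2 using d n by simp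
qed

lemma moebius_holomorphic: "norm a < 1 \<Longrightarrow> moebius a holomorphic_on cball 0 1"
  unfolding moebius_def[abs_def] using moebius_denominator[of a] by (intro holomorphic_intros) auto

lemma moebius_compose_holomorphic:
  assumes "F holomorphic_on cball 0 1" "norm a < 1" shows "(\<lambda>z. F (moebius a z)) holomorphic_on cball 0 1"
proof -
  have "moebius a ` cball 0 1 \<subseteq> cball 0 1" using moebius_norm_le[OF assms(2)] by auto
  from holomorphic_on_compose_gen[OF moebius_holomorphic[OF assms(2)] assms(1) this]
  show ?thesis by (simp add: o_def)
qed

lemma disc_mean_Re:
  assumes "E holomorphic_on cball 0 1" "norm a < 1"
  shows "cmean (\<lambda>z. Re (E (moebius a z))) 0 1 = Re (E a)"
  using cmean_Re_holomorphic[OF moebius_compose_holomorphic[OF assms], of 0 1] by (simp add: moebius_0)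

lemma continuous_on_sphere_holomorphic:
  "F holomorphic_on cball 0 1 \<Longrightarrow> continuous_on (sphere (0::complex) \<bar>1\<bar>) F"
  by (rule continuous_on_subset[OF holomorphic_on_imp_continuous_on]) auto

text \<open>The automorphism plays the part of the Poisson kernel: after composition with it
  \<open>a\<close> becomes the centre and the unit circle is preserved, so the submean inequality
  for \<open>F\<close> meets the mean value property for \<open>E\<close>.\<close>

lemma disc_dominate:
  assumes F: "F holomorphic_on cball 0 1" and E: "E holomorphic_on cball 0 1" and p: "p \<ge> 1"
    and le: "\<And>z. norm z = 1 \<Longrightarrow> cmod (F z) powr p \<le> Re (E z)" and a: "norm a < 1"
  shows "cmod (F a) powr p \<le> Re (E a)"
proof -
  note Fh = moebius_compose_holomorphic[OF F a] and Eh = moebius_compose_holomorphic[OF E a]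
  have "cmod (F a) powr p \<le> cmean (\<lambda>z. cmod (F (moebius a z)) powr p) 0 1"
    using cmean_powr_holomorphic[OF Fh, of 0 1 p] p by (simp add: moebius_0)
  also have "\<dots> \<le> cmean (\<lambda>z. Re (E (moebius a z))) 0 1"
  proof (rule cmean_mono)
    show "continuous_on (sphere 0 \<bar>1\<bar>) (\<lambda>z. cmod (F (moebius a z)) powr p)"
      using p by (intro continuous_on_powr' continuous_on_norm continuous_on_sphere_holomorphic[OF Fh] continuous_on_const) auto
    show "continuous_on (sphere 0 \<bar>1\<bar>) (\<lambda>z. Re (E (moebius a z)))"
      by (intro continuous_on_Re continuous_on_sphere_holomorphic[OF Eh])
  qed (use le moebius_norm_eq[OF a] in auto)
  also have "\<dots> = Re (E a)" by (rule disc_mean_Re[OF E a])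
  finally show ?thesis .
qed

lemma disc_dominate_Re:
  assumes F: "F holomorphic_on cball 0 1" and E: "E holomorphic_on cball 0 1"
    and le: "\<And>z. norm z = 1 \<Longrightarrow> Re (F z) \<le> Re (E z)" and a: "norm a < 1"
  shows "Re (F a) \<le> Re (E a)"
proof -
  note Fh = moebius_compose_holomorphic[OF F a] and Eh = moebius_compose_holomorphic[OF E a]
  have "cmean (\<lambda>z. Re (F (moebius a z))) 0 1 \<le> cmean (\<lambda>z. Re (E (moebius a z))) 0 1"
  proof (rule cmean_mono)
    show "continuous_on (sphere 0 \<bar>1\<bar>) (\<lambda>z. Re (F (moebius a z)))" "continuous_on (sphere 0 \<bar>1\<bar>) (\<lambda>z. Re (E (moebius a z)))"
      by (intro continuous_on_Re continuous_on_sphere_holomorphic Fh Eh)+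
  qed (use le moebius_norm_eq[OF a] in auto)
  then show ?thesis unfolding disc_mean_Re[OF E a] disc_mean_Re[OF F a] .
qed

text \<open>The Cayley transform \<open>(w - E 0) / (w + E 0)\<close> maps the right half-plane to
  the disc and the real number \<open>E 0\<close> to 0. The Schwarz lemma bounds its composition
  with \<open>E\<close>, and solving for \<open>E z\<close> gives the formula.\<close>

lemma Schwarz_quotient:
  assumes E: "E holomorphic_on ball 0 1" and pos: "\<And>z. norm z < 1 \<Longrightarrow> Re (E z) > 0" and im: "Im (E 0) = 0"
    and z: "norm z < 1"
  obtains b where "norm b \<le> norm z" "b \<noteq> 1" "E z = E 0 * (1 + b) / (1 - b)"
proof -
  have ne: "E z + E 0 \<noteq> 0" if "norm z < 1" for z
    using pos[OF that] pos[of 0] by (metis add_pos_pos less_irrefl norm_zero plus_complex.sel(1) zero_complex.sel(1) zero_less_one)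
  define B where "B z = (E z - E 0) / (E z + E 0)" for z
  have "B holomorphic_on ball 0 1"
    unfolding B_def[abs_def] using ne by (intro holomorphic_intros E) auto
  moreover have "norm (B z) < 1" if "norm z < 1" for z
  proof -
    have "(cmod (E z - E 0))\<^sup>2 < (cmod (E z + E 0))\<^sup>2"
      unfolding cmod_power2 using im pos[OF that] pos[of 0] by (simp add: power2_eq_square algebra_simps)
    then have "cmod (E z - E 0) < cmod (E z + E 0)" by (rule power_less_imp_less_base) simp
    then show ?thesis using ne[OF that] by (simp add: B_def norm_divide)
  qed
  ultimately have Bz: "norm (B z) \<le> norm z" using Schwarz_Lemma(1)[of B z] z by (simp add: B_def)
  have B1: "B z \<noteq> 1" using Bz z by auto
  have E0: "E 0 \<noteq> 0" using pos[of 0] by auto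
  have "E z * (1 - B z) = E 0 * (1 + B z)" using ne[OF z] by (simp add: B_def field_simps)
  then have "E z = E 0 * (1 + B z) / (1 - B z)" using B1 by (simp add: field_simps)
  then show thesis using that Bz B1 by blast
qed

text \<open>The formula of \<open>Schwarz_quotient\<close> reduces both bounds to the sizes of
  \<open>1 + b\<close> and \<open>1 - b\<close> for \<open>norm b \<le> s\<close>. The upper bound
  is for the modulus, as normal families require.\<close>

lemma Harnack:
  assumes E: "E holomorphic_on ball 0 1" and pos: "\<And>z. norm z < 1 \<Longrightarrow> Re (E z) > 0" and im: "Im (E 0) = 0"
    and z: "norm z \<le> s" "s < 1"
  shows "cmod (E z) \<le> (1 + s) / (1 - s) * Re (E 0)" "(1 - s) / (1 + s) * Re (E 0) \<le> Re (E z)"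
proof -
  have z1: "norm z < 1" using z by simp
  obtain b where b: "norm b \<le> norm z" "b \<noteq> 1" "E z = E 0 * (1 + b) / (1 - b)"
    by (rule Schwarz_quotient[OF E pos im z1]) blast
  have bs: "norm b \<le> s" using b z by simp
  have s0: "0 \<le> s" using z norm_ge_zero order_trans by blast
  have E0: "E 0 = of_real (Re (E 0))" using im by (simp add: complex_eq_iff)
  have p0: "Re (E 0) > 0" using pos[of 0] by simp
  have l: "1 - s \<le> norm (1 - b)" using norm_triangle_ineq2[of 1 b] bs by simp
  have "norm (1 + b) \<le> 1 + s" using norm_triangle_ineq[of 1 b] bs by simp
  then have "norm (1 + b) / norm (1 - b) \<le> (1 + s) / (1 - s)"
    using l z(2) s0 by (intro frac_le) auto
  moreover have "cmod (E z) = Re (E 0) * (norm (1 + b) / norm (1 - b))"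
    unfolding b(3) using p0 by (subst E0) (simp add: norm_mult norm_divide)
  ultimately have "cmod (E z) \<le> Re (E 0) * ((1 + s) / (1 - s))"
    using mult_left_mono[of _ _ "Re (E 0)"] p0 by (simp only: less_imp_le)
  then show "cmod (E z) \<le> (1 + s) / (1 - s) * Re (E 0)" by (simp only: mult.commute)
  have d: "(norm (1 - b))\<^sup>2 > 0" using b(2) by simp
  have Rq: "Re ((1 + b) / (1 - b)) = (1 - (norm b)\<^sup>2) / (norm (1 - b))\<^sup>2"
    unfolding Re_divide' cmod_power2 using d by (simp add: Re_divide cmod_power2 power2_eq_square algebra_simps)
  have "(1 - s) / (1 + s) \<le> (1 - norm b) / (1 + norm b)"
    using bs s0 z(2) by (intro frac_le) (auto intro: add_pos_nonneg)
  also have "\<dots> = (1 - (norm b)\<^sup>2) / (1 + norm b)\<^sup>2"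
  proof -
    have "1 + norm b > 0" by (simp add: add_pos_nonneg)
    moreover have "1 - (norm b)\<^sup>2 = (1 - norm b) * (1 + norm b)" by (simp add: power2_eq_square algebra_simps)
    ultimately show ?thesis by (simp only: power2_eq_square[of "1 + norm b"]) simp
  qed
  also have "\<dots> \<le> (1 - (norm b)\<^sup>2) / (norm (1 - b))\<^sup>2"
  proof (rule divide_left_mono)
    have "norm (1 - b) \<le> 1 + norm b" using norm_triangle_ineq4[of 1 b] by simp
    then show "(norm (1 - b))\<^sup>2 \<le> (1 + norm b)\<^sup>2" by (intro power_mono) auto
    have "norm b < 1" using bs z(2) by simp
    then show "0 \<le> 1 - (norm b)\<^sup>2" by (simp add: abs_square_le_1)
    have "0 < 1 + norm b" by (simp add: add_pos_nonneg)
    then have "0 < (1 + norm b)\<^sup>2" by (rule zero_less_power)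
    then show "0 < (1 + norm b)\<^sup>2 * (norm (1 - b))\<^sup>2" using d by (rule mult_pos_pos)
  qed
  finally have "(1 - s) / (1 + s) * Re (E 0) \<le> Re ((1 + b) / (1 - b)) * Re (E 0)"
    unfolding Rq using p0 by (intro mult_right_mono) auto
  also have "\<dots> = Re (E z)"
  proof -
    have Ez: "E z = of_real (Re (E 0)) * ((1 + b) / (1 - b))" using b(3) E0 by simp
    show ?thesis unfolding Ez by (subst times_complex.sel(1)) simp
  qed
  finally show "(1 - s) / (1 + s) * Re (E 0) \<le> Re (E z)" .
qed

section \<open>Trigonometric polynomials and approximate boundary value problems\<close>

text \<open>The rule \<open>cong\<close> disregards values off the unit circle, where conjugation is
  inversion. This lets every real polynomial in the coordinates be rewritten as the real part of a
  complex polynomial.\<close>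

inductive trig :: "(complex \<Rightarrow> real) \<Rightarrow> bool" where
  mono: "trig (\<lambda>z. Re (c * z ^ k))"
| add: "trig f \<Longrightarrow> trig g \<Longrightarrow> trig (\<lambda>z. f z + g z)"
| cong: "trig f \<Longrightarrow> (\<And>z. norm z = 1 \<Longrightarrow> f z = g z) \<Longrightarrow> trig g"

text \<open>The identity \<open>Re a * Re b = Re (a * b / 2) + Re (cnj a * b / 2)\<close> and
  \<open>cnj z * z = 1\<close> turn the product into a sum of two monomials. By symmetry
  \<open>j \<le> k\<close>, so no negative power arises.\<close>

lemma trig_mult_mono: "trig (\<lambda>z. Re (c * z ^ j) * Re (d * z ^ k))"
proof (induction j k arbitrary: c d rule: linorder_wlog)
  case (le j k)
  have "trig (\<lambda>z. Re (c * d / 2 * z ^ (j + k)) + Re (cnj c * d / 2 * z ^ (k - j)))"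
    by (intro trig.intros)
  then show ?case
  proof (rule trig.cong)
    fix z :: complex assume z: "norm z = 1"
    have zz: "cnj z * z = 1" using z complex_norm_square[of z] by (simp add: mult.commute)
    have "cnj z ^ j * z ^ k = (cnj z * z) ^ j * z ^ (k - j)"
      using le by (simp add: power_mult_distrib mult.assoc flip: power_add)
    then have e: "cnj z ^ j * z ^ k = z ^ (k - j)" using zz by simp
    have "Re a * Re b = Re (a * b / 2) + Re (cnj a * b / 2)" for a b
      by (simp add: field_simps)
    from this[of "c * z ^ j" "d * z ^ k"]
    have "Re (c * z ^ j) * Re (d * z ^ k) = Re (c * d / 2 * (z ^ j * z ^ k)) + Re (cnj c * d / 2 * (cnj z ^ j * z ^ k))"
      by (simp add: mult_ac)
    then show "Re (c * d / 2 * z ^ (j + k)) + Re (cnj c * d / 2 * z ^ (k - j)) = Re (c * z ^ j) * Re (d * z ^ k)"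
      by (simp add: e power_add)
  qed
next
  case (sym j k)
  from sym[of d c] show ?case by (simp add: mult.commute)
qed

lemma trig_mult: "trig f \<Longrightarrow> trig g \<Longrightarrow> trig (\<lambda>z. f z * g z)"
proof (induction f rule: trig.induct)
  case (mono c k)
  from mono show ?case
  proof (induction g rule: trig.induct)
    case (mono d j) show ?case by (rule trig_mult_mono)
  next
    case (add f g)
    then have "trig (\<lambda>z. Re (c * z ^ k) * f z + Re (c * z ^ k) * g z)" by (intro trig.add)
    then show ?case by (simp add: distrib_left)
  next
    case (cong f g)
    from cong.IH show ?case by (rule trig.cong) (simp add: cong.hyps)
  qed
next
  case (add f1 f2)
  then have "trig (\<lambda>z. f1 z * g z + f2 z * g z)" by (intro trig.add)
  then show ?case by (simp add: distrib_right)
next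
  case (cong f1 f2)
  from cong.IH[OF cong.prems] show ?case by (rule trig.cong) (simp add: cong.hyps)
qed

lemma trig_polynomial: "real_polynomial_function P \<Longrightarrow> trig P"
proof (induction rule: real_polynomial_function.induct)
  case (linear f)
  have "trig (\<lambda>z. Re (Complex (f 1) (- f \<i>) * z ^ 1))" by (rule trig.mono)
  then show ?case
  proof (rule trig.cong)
    fix z
    interpret bounded_linear f by fact
    have "z = Re z *\<^sub>R 1 + Im z *\<^sub>R \<i>" by (simp add: complex_eq_iff)
    then have "f z = f (Re z *\<^sub>R 1 + Im z *\<^sub>R \<i>)" by (rule arg_cong)
    also have "\<dots> = Re z * f 1 + Im z * f \<i>" unfolding add scaleR by simp
    finally show "Re (Complex (f 1) (- f \<i>) * z ^ 1) = f z" by simp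
  qed
next
  case (const c)
  have "trig (\<lambda>z. Re (of_real c * z ^ 0))" by (rule trig.mono)
  then show ?case by simp
qed (auto intro: trig.add trig_mult)

lemma trig_entire: "trig f \<Longrightarrow> \<exists>Q. Q holomorphic_on UNIV \<and> (\<forall>z. norm z = 1 \<longrightarrow> f z = Re (Q z))"
proof (induction rule: trig.induct)
  case (mono c k)
  have "(\<lambda>z. c * z ^ k) holomorphic_on UNIV" by (intro holomorphic_intros)
  then show ?case by blast
next
  case (add f g)
  then obtain P Q where "P holomorphic_on UNIV" "\<forall>z. norm z = 1 \<longrightarrow> f z = Re (P z)"
    "Q holomorphic_on UNIV" "\<forall>z. norm z = 1 \<longrightarrow> g z = Re (Q z)" by blast
  then show ?case by (intro exI[of _ "\<lambda>z. P z + Q z"]) (auto intro: holomorphic_intros)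
qed auto

text \<open>An approximate Dirichlet problem whose solution \<open>Re Q\<close> is harmonic on the
  whole plane. The shift by \<open>e / 2\<close> makes the approximation one-sided, as majorants
  require.\<close>

lemma circle_approximation:
  fixes g :: "complex \<Rightarrow> real"
  assumes "continuous_on (sphere 0 1) g" "e > 0"
  obtains Q where "Q holomorphic_on UNIV" "\<And>z. norm z = 1 \<Longrightarrow> g z \<le> Re (Q z) \<and> Re (Q z) \<le> g z + e"
proof -
  obtain P where P: "real_polynomial_function P" "\<And>z. z \<in> sphere 0 1 \<Longrightarrow> \<bar>g z - P z\<bar> < e / 2"
    using Stone_Weierstrass_real_polynomial_function[OF compact_sphere assms(1), of "e/2"] assms(2) by auto
  have "real_polynomial_function (\<lambda>z. P z + e / 2)" by (intro real_polynomial_function.intros(3) real_polynomial_function.intros(2) P(1))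
  from trig_entire[OF trig_polynomial[OF this]]
  obtain Q where Q: "Q holomorphic_on UNIV" "\<And>z. norm z = 1 \<Longrightarrow> P z + e / 2 = Re (Q z)" by blast
  show thesis
  proof (rule that[OF Q(1)])
    fix z :: complex assume z: "norm z = 1"
    then have "\<bar>g z - P z\<bar> < e / 2" using P(2)[of z] by simp
    then show "g z \<le> Re (Q z) \<and> Re (Q z) \<le> g z + e" unfolding Q(2)[OF z, symmetric] abs_less_iff by linarith
  qed
qed

section \<open>Mean squares over circles and dilations\<close>

lemma integral_circ_cis_power: "(LINT t|circ. cis t ^ n) = of_bool (n = 0)"
proof -
  have "(\<lambda>z::complex. z ^ n) holomorphic_on UNIV" by (intro holomorphic_intros)
  from mean_value_holomorphic[OF this, of 0 1] show ?thesis by (cases n) (simp_all add: cmean_def rcis_def)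
qed

lemma integrable_circ_cis: "integrable circ (\<lambda>t. cis t ^ i * cnj (cis t) ^ j)"
  by (rule integrable_circ_bounded[where B=1])
     (auto intro!: borel_measurable_continuous_onI continuous_intros simp: norm_mult norm_power)

lemma integral_circ_orthogonal: "(LINT t|circ. cis t ^ i * cnj (cis t) ^ j) = of_bool (i = j)"
proof (induction i j rule: linorder_wlog)
  case (le i j)
  have one: "cis t * cnj (cis t) = 1" for t by (simp add: cis_cnj cis_mult)
  have "cis t ^ i * cnj (cis t) ^ j = cnj (cis t ^ (j - i))" for t
  proof -
    have "cis t ^ i * cnj (cis t) ^ j = (cis t * cnj (cis t)) ^ i * cnj (cis t) ^ (j - i)"
      using le by (simp add: power_mult_distrib mult.assoc flip: power_add)
    then show ?thesis by (simp only: one power_one mult_1 complex_cnj_power)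
  qed
  then have "(LINT t|circ. cis t ^ i * cnj (cis t) ^ j) = (LINT t|circ. cnj (cis t ^ (j - i)))" by (simp only:)
 also have "\<dots> = cnj (LINT t|circ. cis t ^ (j - i))"
    by (rule integral_bounded_linear[OF bounded_linear_cnj integrable_circ_cis[of _ 0, simplified]])
  also have "\<dots> = of_bool (i = j)" using le by (simp add: integral_circ_cis_power)
  finally show ?case .
next
  case (sym i j)
  have "(LINT t|circ. cis t ^ i * cnj (cis t) ^ j) = (LINT t|circ. cnj (cis t ^ j * cnj (cis t) ^ i))"
    by (simp add: mult.commute)
  also have "\<dots> = cnj (LINT t|circ. cis t ^ j * cnj (cis t) ^ i)"
    by (rule integral_bounded_linear[OF bounded_linear_cnj integrable_circ_cis])
  also have "\<dots> = of_bool (i = j)" using sym by auto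
  finally show ?case .
qed

lemma Parseval_polynomial:
  "cmean (\<lambda>z. (cmod (\<Sum>n<N. c n * z ^ n))\<^sup>2) 0 \<rho> = (\<Sum>n<N. (cmod (c n))\<^sup>2 * \<rho> ^ (2 * n))"
proof -
  define d where "d n = c n * of_real \<rho> ^ n" for n
  note i = integrable_circ_cis
  have "of_real (cmean (\<lambda>z. (cmod (\<Sum>n<N. c n * z ^ n))\<^sup>2) 0 \<rho>) = (LINT t|circ. complex_of_real ((cmod (\<Sum>n<N. c n * rcis \<rho> t ^ n))\<^sup>2))"
    unfolding cmean_def by (simp only: add_0 integral_complex_of_real)
  also have "\<dots> = (LINT t|circ. (\<Sum>i<N. \<Sum>j<N. d i * cnj (d j) * (cis t ^ i * cnj (cis t) ^ j)))"
  proof (rule Bochner_Integration.integral_cong[OF refl])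
    fix t
    have "(\<Sum>n<N. c n * rcis \<rho> t ^ n) = (\<Sum>n<N. d n * cis t ^ n)"
      by (simp add: d_def rcis_def power_mult_distrib mult_ac)
    then have "complex_of_real ((cmod (\<Sum>n<N. c n * rcis \<rho> t ^ n))\<^sup>2) = (\<Sum>n<N. d n * cis t ^ n) * cnj (\<Sum>n<N. d n * cis t ^ n)"
      by (simp only: complex_norm_square)
    also have "\<dots> = (\<Sum>i<N. \<Sum>j<N. d i * cnj (d j) * (cis t ^ i * cnj (cis t) ^ j))"
      unfolding cnj_sum sum_product by (simp add: mult_ac)
    finally show "complex_of_real ((cmod (\<Sum>n<N. c n * rcis \<rho> t ^ n))\<^sup>2) = (\<Sum>i<N. \<Sum>j<N. d i * cnj (d j) * (cis t ^ i * cnj (cis t) ^ j))" .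
  qed
  also have "\<dots> = (\<Sum>i<N. \<Sum>j<N. d i * cnj (d j) * of_bool (i = j))"
    using i by (simp add: Bochner_Integration.integral_sum Bochner_Integration.integrable_sum integral_circ_orthogonal)
  also have "\<dots> = (\<Sum>i<N. d i * cnj (d i))" by (intro sum.cong refl) (simp add: if_distrib of_bool_def sum.delta cong: if_cong)
  also have "\<dots> = of_real (\<Sum>n<N. (cmod (c n))\<^sup>2 * \<rho> ^ (2 * n))"
  proof -
    have "(cmod (d n))\<^sup>2 = (cmod (c n))\<^sup>2 * \<rho> ^ (2 * n)" for n
    proof -
      have "(\<bar>\<rho>\<bar> ^ n)\<^sup>2 = \<rho> ^ (2 * n)" by (metis power2_abs power_mult mult.commute)
      then show ?thesis by (simp add: d_def norm_mult norm_power power_mult_distrib)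
    qed
    then show ?thesis by (simp only: complex_norm_square[symmetric] of_real_sum)
  qed
  finally show ?thesis using of_real_eq_iff by blast
qed

text \<open>On the circle the partial sums are bounded by the series of absolute values at radius
  \<open>\<rho>\<close>, so the polynomial identity passes to the limit by dominated
  convergence.\<close>

lemma Parseval:
  assumes conv: "\<And>z. norm z < 1 \<Longrightarrow> (\<lambda>n. c n * z ^ n) sums f z" and \<rho>: "0 < \<rho>" "\<rho> < 1"
  shows "(\<lambda>n. (cmod (c n))\<^sup>2 * \<rho> ^ (2 * n)) sums cmean (\<lambda>z. (cmod (f z))\<^sup>2) 0 \<rho>"
proof -
  define \<rho>' where "\<rho>' = (\<rho> + 1) / 2"
  have \<rho>': "\<rho> < \<rho>'" "\<rho>' < 1" using \<rho> by (auto simp: \<rho>'_def)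
  have "summable (\<lambda>n. c n * of_real \<rho>' ^ n)" using conv[of "of_real \<rho>'"] \<rho> \<rho>' by (auto simp: sums_iff)
  then have su: "summable (\<lambda>n. norm (c n * of_real \<rho> ^ n))"
    by (rule powser_insidea) (use \<rho> \<rho>' in auto)
  define A where "A = (\<Sum>n. norm (c n * of_real \<rho> ^ n))"
  have nrm: "norm (rcis \<rho> t) = \<rho>" for t using \<rho> by (simp add: rcis_def norm_mult)
  have bd: "norm (\<Sum>n<N. c n * rcis \<rho> t ^ n) \<le> A" for N t
  proof -
    have "norm (\<Sum>n<N. c n * rcis \<rho> t ^ n) \<le> (\<Sum>n<N. norm (c n * rcis \<rho> t ^ n))" by (rule norm_sum)
    also have "\<dots> = (\<Sum>n<N. norm (c n * of_real \<rho> ^ n))" using \<rho> by (simp add: norm_mult norm_power nrm)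
    also have "\<dots> \<le> A" unfolding A_def by (rule sum_le_suminf[OF su]) auto
    finally show ?thesis .
  qed
  have lim: "(\<lambda>N. \<Sum>n<N. c n * rcis \<rho> t ^ n) \<longlonglongrightarrow> f (rcis \<rho> t)" for t
    using conv[of "rcis \<rho> t"] nrm \<rho> by (simp add: sums_def)
  have meas: "(\<lambda>t. \<Sum>n<N. c n * rcis \<rho> t ^ n) \<in> borel_measurable borel" for N
    by (intro borel_measurable_continuous_onI continuous_intros)
  have measf: "(\<lambda>t. f (rcis \<rho> t)) \<in> borel_measurable borel"
    by (rule borel_measurable_LIMSEQ_metric[OF meas lim])
  have "(\<lambda>N. LINT t|circ. (cmod (\<Sum>n<N. c n * rcis \<rho> t ^ n))\<^sup>2) \<longlonglongrightarrow> (LINT t|circ. (cmod (f (rcis \<rho> t)))\<^sup>2)"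
  proof (rule integral_dominated_convergence[where w="\<lambda>_. A\<^sup>2"])
    show "AE t in circ. (\<lambda>N. (cmod (\<Sum>n<N. c n * rcis \<rho> t ^ n))\<^sup>2) \<longlonglongrightarrow> (cmod (f (rcis \<rho> t)))\<^sup>2"
      by (intro AE_I2 tendsto_intros lim)
    show "AE t in circ. norm ((cmod (\<Sum>n<N. c n * rcis \<rho> t ^ n))\<^sup>2) \<le> A\<^sup>2" for N
      using bd by (intro AE_I2) (simp add: power_mono)
  qed (use meas measf in auto)
  then show ?thesis
    unfolding sums_def Parseval_polynomial[symmetric] cmean_def by simp
qed

text \<open>By Parseval the coefficients \<open>a n\<close> are square summable, and those of the
  difference are \<open>a n * (1 - s ^ n)\<close>. The tail beyond \<open>N\<close> is small for all
  \<open>s\<close> at once, and the head is at most \<open>(1 - s ^ N)\<^sup>2 * S\<close>. One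
  \<open>s\<close> works for every \<open>\<rho>\<close> because
  \<open>\<rho> ^ (2 * n) \<le> 1\<close>.\<close>

lemma H2_dilation:
  assumes k: "k holomorphic_on ball 0 1" and S: "\<And>\<rho>. 0 < \<rho> \<Longrightarrow> \<rho> < 1 \<Longrightarrow> cmean (\<lambda>z. (cmod (k z))\<^sup>2) 0 \<rho> \<le> S" and e: "e > 0"
  obtains s where "0 < s" "s < 1" "\<And>\<rho>. 0 < \<rho> \<Longrightarrow> \<rho> < 1 \<Longrightarrow> cmean (\<lambda>z. (cmod (k z - k (of_real s * z)))\<^sup>2) 0 \<rho> \<le> e"
proof -
  define a where "a n = (deriv ^^ n) k 0 / fact n" for n
  have conv: "(\<lambda>n. a n * z ^ n) sums k z" if "norm z < 1" for z
    using holomorphic_power_series[OF k, of z] that by (simp add: a_def)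
  have fin: "(\<Sum>n<N. (cmod (a n))\<^sup>2) \<le> S" for N
  proof (rule tendsto_upperbound)
    show "((\<lambda>\<rho>. \<Sum>n<N. (cmod (a n))\<^sup>2 * \<rho> ^ (2 * n)) \<longlongrightarrow> (\<Sum>n<N. (cmod (a n))\<^sup>2)) (at_left 1)"
      by (rule tendsto_eq_intros refl | simp)+
    have "(\<Sum>n<N. (cmod (a n))\<^sup>2 * \<rho> ^ (2 * n)) \<le> S" if \<rho>: "0 < \<rho>" "\<rho> < 1" for \<rho>
    proof -
      note P = Parseval[OF conv \<rho>]
      have "(\<Sum>n<N. (cmod (a n))\<^sup>2 * \<rho> ^ (2 * n)) \<le> (\<Sum>n. (cmod (a n))\<^sup>2 * \<rho> ^ (2 * n))"
        by (rule sum_le_suminf[OF sums_summable[OF P]]) (use \<rho> in auto)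
      also have "\<dots> = cmean (\<lambda>z. (cmod (k z))\<^sup>2) 0 \<rho>" using sums_unique[OF P] by simp
      also have "\<dots> \<le> S" by (rule S[OF \<rho>])
      finally show ?thesis .
    qed
    then show "\<forall>\<^sub>F \<rho> in at_left 1. (\<Sum>n<N. (cmod (a n))\<^sup>2 * \<rho> ^ (2 * n)) \<le> S"
      unfolding eventually_at_left_field by (intro exI[of _ 0]) auto
  qed simp
  have su: "summable (\<lambda>n. (cmod (a n))\<^sup>2)"
    by (rule bounded_imp_summable[of _ S]) (simp, simp only: lessThan_Suc_atMost[symmetric] fin)
  have S0: "0 \<le> S" using fin[of 0] by simp
  obtain N where "\<forall>n\<ge>N. norm (\<Sum>i. (cmod (a (i + n)))\<^sup>2) < e / 2"
    using suminf_exist_split[OF half_gt_zero[OF e] su] by blast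
  then have "norm (\<Sum>i. (cmod (a (i + N)))\<^sup>2) < e / 2" by blast
  then have N: "(\<Sum>n. (cmod (a (n + N)))\<^sup>2) < e / 2" unfolding real_norm_def by linarith
  have "((\<lambda>s::real. (1 - s ^ N)\<^sup>2 * S) \<longlongrightarrow> (1 - 1 ^ N)\<^sup>2 * S) (at_left 1)" by (intro tendsto_intros)
  then have "\<forall>\<^sub>F s in at_left (1::real). (1 - s ^ N)\<^sup>2 * S < e / 2"
    using e by (intro order_tendstoD(2)[where y="(1 - 1 ^ N)\<^sup>2 * S"]) auto
  moreover have "\<forall>\<^sub>F s in at_left (1::real). 0 < s \<and> s < 1"
    unfolding eventually_at_left_field by (intro exI[of _ 0]) auto
  ultimately have "\<forall>\<^sub>F s in at_left (1::real). (1 - s ^ N)\<^sup>2 * S < e / 2 \<and> 0 < s \<and> s < 1"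
    by eventually_elim auto
  then obtain s where s: "(1 - s ^ N)\<^sup>2 * S < e / 2" "0 < s" "s < 1"
    using eventually_happens'[OF trivial_limit_at_left_real] by blast
  show thesis
  proof (rule that[OF s(2,3)])
    fix \<rho> :: real assume \<rho>: "0 < \<rho>" "\<rho> < 1"
    define b where "b n = a n * of_real (1 - s ^ n)" for n
    have convb: "(\<lambda>n. b n * z ^ n) sums (k z - k (of_real s * z))" if z: "norm z < 1" for z
    proof -
      have "norm (of_real s * z) < 1" using z s mult_strict_mono[of s 1 "norm z" 1] by (simp add: norm_mult)
      from sums_diff[OF conv[OF z] conv[OF this]] show ?thesis
        by (simp add: b_def algebra_simps power_mult_distrib)
    qed
    note P = Parseval[OF convb \<rho>]
    have s1: "0 \<le> 1 - s ^ n" "1 - s ^ n \<le> 1" for n using s by (auto simp: power_le_one)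
    have bb: "(cmod (b n))\<^sup>2 * \<rho> ^ (2 * n) \<le> (cmod (a n))\<^sup>2 * (1 - s ^ n)\<^sup>2" for n
    proof -
      have "(cmod (b n))\<^sup>2 = (cmod (a n))\<^sup>2 * (1 - s ^ n)\<^sup>2"
        unfolding b_def norm_mult norm_of_real by (simp add: power_mult_distrib)
      moreover have "(cmod (b n))\<^sup>2 * \<rho> ^ (2 * n) \<le> (cmod (b n))\<^sup>2 * 1"
        using \<rho> by (intro mult_left_mono power_le_one) auto
      ultimately show ?thesis by simp
    qed
    have su2: "summable (\<lambda>n. (cmod (a n))\<^sup>2 * (1 - s ^ n)\<^sup>2)"
    proof (rule summable_comparison_test'[OF su])
      show "norm ((cmod (a n))\<^sup>2 * (1 - s ^ n)\<^sup>2) \<le> (cmod (a n))\<^sup>2" for n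
        using s1[of n] by (simp add: mult_left_le abs_square_le_1)
    qed
    have "cmean (\<lambda>z. (cmod (k z - k (of_real s * z)))\<^sup>2) 0 \<rho> = (\<Sum>n. (cmod (b n))\<^sup>2 * \<rho> ^ (2 * n))"
      by (rule sums_unique[OF P])
    also have "\<dots> \<le> (\<Sum>n. (cmod (a n))\<^sup>2 * (1 - s ^ n)\<^sup>2)"
      by (rule suminf_le[OF bb sums_summable[OF P] su2])
    also have "\<dots> = (\<Sum>n. (cmod (a (n + N)))\<^sup>2 * (1 - s ^ (n + N))\<^sup>2) + (\<Sum>n<N. (cmod (a n))\<^sup>2 * (1 - s ^ n)\<^sup>2)"
      by (rule suminf_split_initial_segment[OF su2])
    also have "(\<Sum>n. (cmod (a (n + N)))\<^sup>2 * (1 - s ^ (n + N))\<^sup>2) \<le> (\<Sum>n. (cmod (a (n + N)))\<^sup>2)"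
    proof (rule suminf_le)
      show "(cmod (a (n + N)))\<^sup>2 * (1 - s ^ (n + N))\<^sup>2 \<le> (cmod (a (n + N)))\<^sup>2" for n
        using s1[of "n + N"] by (simp add: mult_left_le abs_square_le_1)
    qed (use su su2 in \<open>auto simp: summable_iff_shift[of "\<lambda>n. (cmod (a n))\<^sup>2"] summable_iff_shift[of "\<lambda>n. (cmod (a n))\<^sup>2 * (1 - s ^ n)\<^sup>2"]\<close>)
    also have "(\<Sum>n<N. (cmod (a n))\<^sup>2 * (1 - s ^ n)\<^sup>2) \<le> (\<Sum>n<N. (cmod (a n))\<^sup>2 * (1 - s ^ N)\<^sup>2)"
    proof (intro sum_mono mult_left_mono power_mono)
      fix n assume "n \<in> {..<N}"
      then show "1 - s ^ n \<le> 1 - s ^ N" using s power_decreasing[of n N s] by simp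
    qed (use s1 in auto)
    also have "(\<Sum>n<N. (cmod (a n))\<^sup>2 * (1 - s ^ N)\<^sup>2) = (1 - s ^ N)\<^sup>2 * (\<Sum>n<N. (cmod (a n))\<^sup>2)"
      by (simp add: sum_distrib_left mult.commute)
    also have "\<dots> \<le> (1 - s ^ N)\<^sup>2 * S" using fin by (intro mult_left_mono) auto
    finally show "cmean (\<lambda>z. (cmod (k z - k (of_real s * z)))\<^sup>2) 0 \<rho> \<le> e" using N s(1) by simp
  qed
qed

section \<open>Approximation of the Riemann map from outside\<close>

lemma Riemann_map_normalized:
  assumes "open S" "simply_connected S" "bounded S" "a \<in> S"
  obtains f g where "f holomorphic_on S" "g holomorphic_on ball 0 1"
    "\<And>z. z \<in> S \<Longrightarrow> norm (f z) < 1 \<and> g (f z) = z"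
    "\<And>w. norm w < 1 \<Longrightarrow> g w \<in> S \<and> f (g w) = w" "f a = 0"
proof -
  have "S \<noteq> UNIV" using assms(3) not_bounded_UNIV by auto
  moreover have "S \<noteq> {}" using assms(4) by auto
  ultimately obtain f g where f: "f holomorphic_on S" and g: "g holomorphic_on ball 0 1"
    and fg: "\<forall>z \<in> S. f z \<in> ball 0 1 \<and> g (f z) = z" and gf: "\<forall>z \<in> ball 0 1. g z \<in> S \<and> f (g z) = z"
    using Riemann_mapping_theorem[of S] assms(1,2) by blast
  define b where "b = f a"
  have b: "norm b < 1" "norm (-b) < 1" using fg assms(4) by (auto simp: b_def)
  have mh: "moebius c holomorphic_on ball 0 1" if "norm c < 1" for c
    using moebius_holomorphic[OF that] by (rule holomorphic_on_subset) auto
  have mb: "moebius c ` ball 0 1 \<subseteq> ball 0 1" if "norm c < 1" for c using moebius_norm_less[OF that] by auto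
  show thesis
  proof (rule that[of "moebius (-b) \<circ> f" "g \<circ> moebius b"])
    show "moebius (- b) \<circ> f holomorphic_on S"
      by (rule holomorphic_on_compose_gen[OF f mh[OF b(2)]]) (use fg in auto)
    show "g \<circ> moebius b holomorphic_on ball 0 1"
      by (rule holomorphic_on_compose_gen[OF mh[OF b(1)] g mb[OF b(1)]])
    show "(moebius (- b) \<circ> f) a = 0" using moebius_neg[of b] by (simp add: b_def)
    show "norm ((moebius (- b) \<circ> f) z) < 1 \<and> (g \<circ> moebius b) ((moebius (- b) \<circ> f) z) = z" if "z \<in> S" for z
      using fg that moebius_norm_less[OF b(2), of "f z"] moebius_inverse[OF b(2), of "f z"] by auto
    show "(g \<circ> moebius b) w \<in> S \<and> (moebius (- b) \<circ> f) ((g \<circ> moebius b) w) = w" if "norm w < 1" for w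
      using gf that moebius_norm_less[OF b(1), of w] moebius_inverse[OF b(1), of w] by auto
  qed
qed

text \<open>Filling the holes of a connected neighbourhood of \<open>K\<close> makes it simply
  connected. The filled sets still shrink to \<open>K\<close>: a point outside \<open>K\<close> is
  joined to a distant point by a path in the connected set \<open>- K\<close>, which small
  neighbourhoods of \<open>K\<close> do not reach.\<close>

lemma filled_neighbourhoods:
  fixes K :: "complex set"
  assumes K: "compact K" "connected K" "K \<noteq> {}" and out: "connected (- K)"
  obtains W :: "nat \<Rightarrow> complex set" where
    "\<And>n. open (W n)" "\<And>n. simply_connected (W n)" "\<And>n. K \<subseteq> W n" "bounded (\<Union>n. W n)"
    "\<And>z. z \<notin> K \<Longrightarrow> \<exists>e>0. \<exists>N. \<forall>n\<ge>N. W n \<inter> ball z e = {}"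
proof -
  define U where "U n = (\<Union>x\<in>K. ball x (1 / real (Suc n)))" for n
  define W where "W n = - outside (U n)" for n
  have KU: "K \<subseteq> U n" for n by (auto simp: U_def intro!: bexI)
  have Uo: "open (U n)" for n unfolding U_def by auto
  obtain R where R: "\<And>x. x \<in> K \<Longrightarrow> norm x \<le> R" using compact_imp_bounded[OF K(1)] unfolding bounded_iff by blast
  have UR: "U n \<subseteq> cball 0 (R + 1)" for n
  proof
    fix y assume "y \<in> U n"
    then obtain x where x: "x \<in> K" "dist x y < 1 / real (Suc n)" by (auto simp: U_def)
    have "1 / real (Suc n) \<le> 1" by simp
    then have "dist x y < 1" using x(2) by linarith
    then show "y \<in> cball 0 (R + 1)" using R[OF x(1)] norm_triangle_ineq2[of y x] by (simp add: dist_norm norm_minus_commute)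
  qed
  then have Ub: "bounded (U n)" for n by (rule bounded_subset[OF bounded_cball])
  have Uc: "connected (U n)" for n
  proof -
    have "U n = \<Union> ((\<lambda>x. K \<union> ball x (1 / real (Suc n))) ` K)" (is "_ = ?R")
    proof
      show "U n \<subseteq> ?R" unfolding U_def by blast
      show "?R \<subseteq> U n" using KU[of n] unfolding U_def by blast
    qed
    also have "connected \<dots>"
    proof (rule connected_Union)
      fix S assume "S \<in> (\<lambda>x. K \<union> ball x (1 / real (Suc n))) ` K"
      then obtain x where x: "x \<in> K" "S = K \<union> ball x (1 / real (Suc n))" by blast
      have "x \<in> K \<inter> ball x (1 / real (Suc n))" using x by simp
      then show "connected S" unfolding x(2) by (intro connected_Un K(2)) auto
    qed (use K(3) in auto)
    finally show ?thesis .
  qed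
  have oc: "connected (outside (U n))" for n by (rule connected_outside[OF Ub]) simp
  have cob: "- cball 0 (R + 1) \<subseteq> outside (U n)" for n by (rule outside_subset_convex[OF convex_cball UR])
  have one: "outside (U n) \<noteq> {}" for n
  proof -
    have "of_real (\<bar>R\<bar> + 2) \<in> - cball (0::complex) (R + 1)" by (simp del: of_real_add)
    then show ?thesis using cob[of n] by blast
  qed
  have comp: "outside (U n) \<in> components (- U n)" for n
    using oc one by (simp add: outside_in_components)
  have Wo: "open (W n)" for n
    unfolding W_def by (rule open_Compl[OF closed_components[OF closed_Compl[OF Uo] comp]])
  have Wb: "W n \<subseteq> cball 0 (R + 1)" for n using cob[of n] by (auto simp: W_def)
  have KW: "K \<subseteq> W n" for n using KU[of n] outside_no_overlap[of "U n"] unfolding W_def by blast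
  have Wsc: "simply_connected (W n)" for n
  proof (subst simply_connected_iff_simple)
    show "bounded (W n)" by (rule bounded_subset[OF bounded_cball Wb])
    have "connected (W n)" unfolding W_def by (rule component_complement_connected[OF Uc comp])
    then show "connected (W n) \<and> connected (- W n)" using oc by (simp add: W_def)
  qed (rule Wo)
  have ex: "\<exists>e>0. \<exists>N. \<forall>n\<ge>N. W n \<inter> ball z e = {}" if z: "z \<notin> K" for z
  proof -
    have oK: "open (- K)" using compact_imp_closed[OF K(1)] by auto
    define y where "y = complex_of_real (\<bar>R\<bar> + 2)"
    have yn: "norm y = \<bar>R\<bar> + 2" unfolding y_def norm_of_real by simp
    have y: "y \<in> - cball 0 (R + 1)" using yn by simp
    have yK: "y \<in> - K" using R yn by force
    have "path_connected (- K)" using connected_open_path_connected[OF oK out] .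
    then obtain p where p: "path p" "path_image p \<subseteq> - K" "pathstart p = y" "pathfinish p = z"
      using yK z unfolding path_connected_def by blast
    obtain e where e: "e > 0" "cball z e \<subseteq> - K" using oK z open_contains_cball by (metis ComplI)
    \<comment> \<open>The path together with a disc about \<open>z\<close> is compact and connected
      and avoids \<open>K\<close>. Once \<open>U n\<close> misses it, it lies in a single component
      of the complement, the one containing the distant point \<open>y\<close>.\<close>
    define P where "P = path_image p \<union> cball z e"
    have Pc: "compact P" unfolding P_def by (intro compact_Un compact_path_image p(1) compact_cball)
    have PK: "P \<subseteq> - K" using p(2) e(2) by (auto simp: P_def)
    have zP: "z \<in> path_image p" using pathfinish_in_path_image[of p] p(4) by simp
    have Pconn: "connected P" unfolding P_def
      by (rule connected_Un[OF connected_path_image[OF p(1)]]) (use zP e(1) in auto)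
    obtain d where d: "d > 0" "(\<Union>x\<in>P. ball x d) \<subseteq> - K"
      using compact_subset_open_imp_ball_epsilon_subset[OF Pc oK PK] by blast
    obtain N where N: "1 / real (Suc N) < d" using d(1) nat_approx_posE by blast
    have "W n \<inter> ball z e = {}" if n: "n \<ge> N" for n
    proof -
      have "P \<inter> U n = {}"
      proof (rule ccontr)
        assume "P \<inter> U n \<noteq> {}"
        then obtain q x where qx: "q \<in> P" "x \<in> K" "dist x q < 1 / real (Suc n)" by (auto simp: U_def)
        have "1 / real (Suc n) \<le> 1 / real (Suc N)" using n by (simp add: frac_le)
        then have "x \<in> ball q d" using qx(3) N by (simp add: dist_commute)
        then show False using d(2) qx(1,2) by blast
      qed
      then have PU: "P \<subseteq> - U n" by blast
      have "P \<subseteq> outside (U n)"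
      proof
        fix x assume x: "x \<in> P"
        have "y \<in> P" using pathstart_in_path_image[of p] p(3) by (simp add: P_def)
        then have "connected_component (- U n) y x"
          unfolding connected_component_def using Pconn PU x by blast
        moreover have "y \<in> outside (U n)" using cob y by blast
        ultimately show "x \<in> outside (U n)" by (rule outside_same_component)
      qed
      moreover have "ball z e \<subseteq> P" by (auto simp: P_def)
      ultimately show ?thesis by (auto simp: W_def)
    qed
    then show ?thesis using e(1) by blast
  qed
  show thesis
    by (rule that[of W, OF Wo Wsc KW _ ex]) (use Wb in \<open>auto intro: bounded_subset[OF bounded_cball]\<close>)
qed

text \<open>\<open>\<theta>\<close> is, up to a rotation, a Riemann map of a simply connected neighbourhood of \<open>closure \<Omega>\<close>. If all their
  derivatives at 0 stayed away from that of \<open>\<phi>\<close>, a limit of the inverse maps would be a map into \<open>\<Omega>\<close>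
  contradicting the Schwarz lemma.\<close>

lemma outer_approximation:
  assumes sp: "simple_path c" "pathfinish c = pathstart c" and \<Omega>: "\<Omega> = inside (path_image c)" and 0: "0 \<in> \<Omega>"
    and \<phi>: "\<phi> holomorphic_on \<Omega>" and \<psi>: "\<psi> holomorphic_on ball 0 1"
    and \<phi>\<psi>: "\<And>z. z \<in> \<Omega> \<Longrightarrow> norm (\<phi> z) < 1 \<and> \<psi> (\<phi> z) = z" "\<And>w. norm w < 1 \<Longrightarrow> \<psi> w \<in> \<Omega> \<and> \<phi> (\<psi> w) = w" "\<phi> 0 = 0"
    and e: "e > 0"
  obtains \<theta> where "\<theta> holomorphic_on \<Omega>" "continuous_on (closure \<Omega>) \<theta>" "\<And>z. z \<in> closure \<Omega> \<Longrightarrow> norm (\<theta> z) < 1"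
    "\<theta> 0 = 0" "Re (deriv (\<lambda>w. \<theta> (\<psi> w)) 0) > 1 - e"
proof -
  let ?C = "path_image c"
  have J: "open \<Omega>" "connected \<Omega>" "bounded \<Omega>" "connected (outside ?C)" "open (outside ?C)"
    "inside ?C \<union> outside ?C = - ?C" "inside ?C \<inter> outside ?C = {}" "frontier (inside ?C) = ?C" "frontier (outside ?C) = ?C"
    using Jordan_inside_outside[OF sp] by (auto simp: \<Omega>)
  define K where "K = closure \<Omega>"
  have K: "K = \<Omega> \<union> ?C" unfolding K_def closure_Un_frontier \<Omega> J(8) ..
  have mK: "- K = outside ?C" unfolding K \<Omega> using J(6,7) by blast
  \<comment> \<open>The limit map \<open>h\<close> constructed below is only known to have values in
    \<open>K\<close>; being open it has values in \<open>interior K\<close>. That this is no larger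
    than \<Omega> holds because the curve is the frontier of its outside too.\<close>
  have intK: "interior K = \<Omega>"
  proof -
    have "- interior K = closure (outside ?C)" by (simp add: closure_complement[symmetric] mK[symmetric])
    also have "\<dots> = outside ?C \<union> ?C" unfolding closure_Un_frontier J(9) ..
    finally show ?thesis using J(6,7) unfolding \<Omega> by blast
  qed
  have Kc: "compact K" unfolding K_def using J(3) by (simp add: compact_closure)
  have Kcon: "connected K" unfolding K_def by (rule connected_imp_connected_closure[OF J(2)])
  have 0: "0 \<in> K" "0 \<in> \<Omega>" using 0 closure_subset by (auto simp: K_def)
  have \<psi>0: "\<psi> 0 = 0" using \<phi>\<psi>(1)[OF 0(2)] \<phi>\<psi>(3) by simp
  obtain W :: "nat \<Rightarrow> complex set" where W: "\<And>n. open (W n)" "\<And>n. simply_connected (W n)" "\<And>n. K \<subseteq> W n" "bounded (\<Union>n. W n)"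
    "\<And>z. z \<notin> K \<Longrightarrow> \<exists>e>0. \<exists>N. \<forall>n\<ge>N. W n \<inter> ball z e = {}"
  proof (rule filled_neighbourhoods[OF Kc Kcon])
    show "K \<noteq> {}" "connected (- K)" using 0 J(4) mK by auto
    fix W :: "nat \<Rightarrow> complex set"
    assume a: "\<And>n. open (W n)" "\<And>n. simply_connected (W n)" "\<And>n. K \<subseteq> W n" "bounded (\<Union>n. W n)"
      "\<And>z. z \<notin> K \<Longrightarrow> \<exists>e>0. \<exists>N. \<forall>n\<ge>N. W n \<inter> ball z e = {}"
    show thesis by (rule that[of W, OF a])
  qed
  have "\<exists>f g. f holomorphic_on W n \<and> g holomorphic_on ball 0 1 \<and> (\<forall>z\<in>W n. norm (f z) < 1 \<and> g (f z) = z) \<and>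
     (\<forall>w. norm w < 1 \<longrightarrow> g w \<in> W n \<and> f (g w) = w) \<and> f 0 = 0" for n
  proof -
    have b: "bounded (W n)" by (rule bounded_subset[OF W(4)]) blast
    have z: "0 \<in> W n" using 0(1) W(3)[of n] by blast
    show ?thesis
    proof (rule Riemann_map_normalized[OF W(1,2) b z])
      fix f g
      assume "f holomorphic_on W n" "g holomorphic_on ball 0 1" "\<And>z. z \<in> W n \<Longrightarrow> norm (f z) < 1 \<and> g (f z) = z"
        "\<And>w. norm w < 1 \<Longrightarrow> g w \<in> W n \<and> f (g w) = w" "f 0 = 0"
      then show ?thesis by (intro exI[of _ f] exI[of _ g]) simp
    qed
  qed
  then obtain f g where f: "\<And>n. f n holomorphic_on W n" and g: "\<And>n. g n holomorphic_on ball 0 1"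
    and fg: "\<And>n z. z \<in> W n \<Longrightarrow> norm (f n z) < 1 \<and> g n (f n z) = z"
    and gf: "\<And>n w. norm w < 1 \<Longrightarrow> g n w \<in> W n \<and> f n (g n w) = w" and f0: "\<And>n. f n 0 = 0"
    by metis
  have W0: "0 \<in> W n" for n using 0(1) W(3) by blast
  have OW: "\<Omega> \<subseteq> W n" for n using W(3)[of n] closure_subset by (auto simp: K_def)
  define d where "d n = deriv (f n) 0 * deriv \<psi> 0" for n
  have df: "(f n has_field_derivative deriv (f n) 0) (at 0)" for n
    by (rule holomorphic_derivI[OF f W(1) W0])
  have d\<psi>: "(\<psi> has_field_derivative deriv \<psi> 0) (at 0)"
    by (rule holomorphic_derivI[OF \<psi>]) auto
  have d\<phi>: "(\<phi> has_field_derivative deriv \<phi> 0) (at 0)"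
    by (rule holomorphic_derivI[OF \<phi> J(1) 0(2)])
  have dg: "(g n has_field_derivative deriv (g n) 0) (at 0)" for n
    by (rule holomorphic_derivI[OF g]) auto
  have g0: "g n 0 = 0" for n using fg[OF W0, of n] f0 by simp
  have dfg: "deriv (f n) 0 * deriv (g n) 0 = 1" for n
  proof -
    have "((f n \<circ> g n) has_field_derivative deriv (f n) 0 * deriv (g n) 0) (at 0)"
      using DERIV_chain[of "f n" _ "g n" 0, OF _ dg] df g0 by simp
    then have "((\<lambda>w. w) has_field_derivative deriv (f n) 0 * deriv (g n) 0) (at 0)"
      by (rule has_field_derivative_transform_within_open[of _ _ _ "ball 0 1"]) (use gf in auto)
    then show ?thesis using DERIV_unique[OF _ DERIV_ident] by blast
  qed
  have d\<phi>\<psi>: "deriv \<phi> 0 * deriv \<psi> 0 = 1"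
  proof -
    have "((\<phi> \<circ> \<psi>) has_field_derivative deriv \<phi> 0 * deriv \<psi> 0) (at 0)"
      using DERIV_chain[of \<phi> _ \<psi> 0, OF _ d\<psi>] d\<phi> \<psi>0 by simp
    then have "((\<lambda>w. w) has_field_derivative deriv \<phi> 0 * deriv \<psi> 0) (at 0)"
      by (rule has_field_derivative_transform_within_open[of _ _ _ "ball 0 1"]) (use \<phi>\<psi> in auto)
    then show ?thesis using DERIV_unique[OF _ DERIV_ident] by blast
  qed
  have "\<exists>n. norm (d n) > 1 - e"
  proof (rule ccontr)
    assume "\<not> ?thesis"
    then have le: "norm (d n) \<le> 1 - e" for n by (simp add: not_less)
    obtain B where B: "\<And>n z. z \<in> W n \<Longrightarrow> norm z \<le> B" using W(4) unfolding bounded_iff by blast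
    obtain h r where h: "h holomorphic_on ball 0 1" "strict_mono (r :: nat \<Rightarrow> nat)"
      "\<And>x. x \<in> ball 0 1 \<Longrightarrow> (\<lambda>n. g (r n) x) \<longlonglongrightarrow> h x"
      "\<And>L. \<lbrakk>compact L; L \<subseteq> ball 0 1\<rbrakk> \<Longrightarrow> uniform_limit L (g \<circ> r) h sequentially"
    proof (rule Montel[of "ball 0 1" "range g" g])
      show "\<exists>B'. \<forall>k\<in>range g. \<forall>z\<in>L. norm (k z) \<le> B'" if L: "compact L" "L \<subseteq> ball 0 1" for L
      proof (intro exI[of _ B] ballI)
        fix k z assume "k \<in> range g" "z \<in> L"
        then obtain n where "k = g n" "norm z < 1" using L(2) by auto
        then show "norm (k z) \<le> B" using B gf by blast
      qed
    qed (use g in auto)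
    have "(\<lambda>n. (deriv ^^ 1) (g (r n)) 0) \<longlonglongrightarrow> (deriv ^^ 1) h 0"
    proof (rule higher_deriv_complex_uniform_limit[where A="ball 0 (1/2)"])
      have "uniform_limit (cball 0 (1/2)) (g \<circ> r) h sequentially" by (rule h(4)) auto
      then show "uniform_limit (ball 0 (1/2)) (\<lambda>n. g (r n)) h sequentially"
        unfolding o_def by (rule uniform_limit_on_subset) auto
      show "\<forall>\<^sub>F n in sequentially. g (r n) holomorphic_on ball 0 (1/2)"
        by (intro always_eventually allI holomorphic_on_subset[OF g]) auto
    qed auto
    then have lim: "(\<lambda>n. norm (deriv (g (r n)) 0)) \<longlonglongrightarrow> norm (deriv h 0)" by (simp add: tendsto_norm)
    have p\<psi>: "norm (deriv \<psi> 0) > 0" using d\<phi>\<psi> by auto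
    have ge: "norm (deriv \<psi> 0) \<le> (1 - e) * norm (deriv (g n) 0)" for n
    proof -
      have "deriv \<psi> 0 = d n * deriv (g n) 0" using dfg[of n] by (simp add: d_def mult_ac)
      then have "norm (deriv \<psi> 0) = norm (d n) * norm (deriv (g n) 0)" by (simp add: norm_mult)
      also have "\<dots> \<le> (1 - e) * norm (deriv (g n) 0)" by (rule mult_right_mono[OF le]) simp
      finally show ?thesis .
    qed
    have "norm (deriv \<psi> 0) \<le> (1 - e) * norm (deriv h 0)"
      by (rule LIMSEQ_le_const[OF tendsto_mult_left[OF lim]]) (use ge in auto)
    then have hpos: "norm (deriv h 0) > 0" and hgt: "norm (deriv \<psi> 0) < norm (deriv h 0)"
    proof -
      assume a: "norm (deriv \<psi> 0) \<le> (1 - e) * norm (deriv h 0)"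
      show p: "norm (deriv h 0) > 0"
      proof (rule ccontr)
        assume "\<not> ?thesis"
        then have "deriv h 0 = 0" by simp
        then show False using a p\<psi> by simp
      qed
      have "(1 - e) * norm (deriv h 0) < 1 * norm (deriv h 0)" using e p by (intro mult_strict_right_mono) auto
      then show "norm (deriv \<psi> 0) < norm (deriv h 0)" using a by simp
    qed
    have hK: "h w \<in> K" if w: "norm w < 1" for w
    proof (rule ccontr)
      assume "h w \<notin> K"
      then obtain e' N where e': "e' > 0" "\<forall>n\<ge>N. W n \<inter> ball (h w) e' = {}" using W(5) by blast
      have "\<forall>\<^sub>F n in sequentially. dist (g (r n) w) (h w) < e'" using h(3)[of w] w e'(1) by (auto intro: tendstoD)
      then obtain M where M: "\<forall>n\<ge>M. dist (g (r n) w) (h w) < e'" unfolding eventually_sequentially by blast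
      define n where "n = max M N"
      have "r n \<ge> N" using seq_suble[OF h(2), of n] by (simp add: n_def)
      moreover have "g (r n) w \<in> W (r n)" using gf[OF w] by blast
      moreover have "g (r n) w \<in> ball (h w) e'" using M by (simp add: n_def dist_commute)
      ultimately show False using e'(2) by blast
    qed
    have nc: "\<not> h constant_on ball 0 1"
    proof
      assume "h constant_on ball 0 1"
      then obtain k where "\<forall>w\<in>ball 0 1. h w = k" unfolding constant_on_def by blast
      then have "(h has_field_derivative 0) (at 0)"
        using has_field_derivative_transform_within_open[of "\<lambda>_. k" 0 0 "ball 0 1" h] by auto
      then show False using hpos DERIV_imp_deriv by force
    qed
    have op: "open (h ` ball 0 1)" by (rule open_mapping_thm[OF h(1)]) (use nc in auto)
    then have hO: "h ` ball 0 1 \<subseteq> \<Omega>"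
    proof -
      have "h ` ball 0 1 \<subseteq> K" using hK by auto
      then show ?thesis using interior_maximal[OF _ op] intK by blast
    qed
    then have hO': "h w \<in> \<Omega>" if "norm w < 1" for w using that by auto
    have h0: "h 0 = 0" using h(3)[of 0] g0 by (simp add: LIMSEQ_const_iff)
    \<comment> \<open>The Schwarz lemma for \<open>\<phi> \<circ> h\<close> gives
      \<open>norm (deriv h 0) \<le> norm (deriv \<psi> 0)\<close>, because
      \<open>deriv \<phi> 0\<close> and \<open>deriv \<psi> 0\<close> are reciprocal. This
      contradicts \<open>hgt\<close>.\<close>
    have hol: "(\<phi> \<circ> h) holomorphic_on ball 0 1" by (rule holomorphic_on_compose_gen[OF h(1) \<phi> hO])
    have "norm (deriv (\<phi> \<circ> h) 0) \<le> 1"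
      by (rule Schwarz_Lemma(2)[OF hol, of 0]) (use hO' \<phi>\<psi> h0 in auto)
    moreover have "deriv (\<phi> \<circ> h) 0 = deriv \<phi> 0 * deriv h 0"
    proof (rule DERIV_imp_deriv)
      have "(h has_field_derivative deriv h 0) (at 0)" by (rule holomorphic_derivI[OF h(1)]) auto
      then show "((\<phi> \<circ> h) has_field_derivative deriv \<phi> 0 * deriv h 0) (at 0)"
        using DERIV_chain[of \<phi> _ h 0] d\<phi> h0 by simp
    qed
    moreover have "norm (deriv \<phi> 0) * norm (deriv \<psi> 0) = 1" using d\<phi>\<psi> by (metis norm_mult norm_one)
    ultimately have le1: "norm (deriv \<phi> 0) * norm (deriv h 0) \<le> norm (deriv \<phi> 0) * norm (deriv \<psi> 0)" by (simp add: norm_mult)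
    have "norm (deriv \<phi> 0) > 0" using d\<phi>\<psi> by auto
    then show False using le1 hgt by simp
  qed
  then obtain n where n: "norm (d n) > 1 - e" by blast
  \<comment> \<open>A rotation that makes the derivative at 0 real and nonnegative, so that the
    bound on its modulus becomes one on its real part. The case \<open>d n = 0\<close> only keeps
    the modulus of \<open>\<alpha>\<close> at 1.\<close>
  define \<alpha> where "\<alpha> = (if d n = 0 then 1 else cnj (d n) / of_real (norm (d n)))"
  have \<alpha>: "norm \<alpha> = 1" by (auto simp: \<alpha>_def norm_divide)
  have \<alpha>d: "\<alpha> * d n = of_real (norm (d n))"
    by (auto simp: \<alpha>_def complex_norm_square[symmetric] power2_eq_square mult.commute[of "cnj _"])
  show thesis
  proof (rule that[of "\<lambda>z. \<alpha> * f n z"])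
    show "(\<lambda>z. \<alpha> * f n z) holomorphic_on \<Omega>" by (intro holomorphic_intros holomorphic_on_subset[OF f OW])
    show "continuous_on (closure \<Omega>) (\<lambda>z. \<alpha> * f n z)"
      using W(3)[of n] unfolding K_def
      by (intro continuous_intros holomorphic_on_imp_continuous_on holomorphic_on_subset[OF f])
    show "norm (\<alpha> * f n z) < 1" if "z \<in> closure \<Omega>" for z
    proof -
      have "z \<in> W n" using that W(3)[of n] by (auto simp: K_def)
      then show ?thesis using fg[of z n] \<alpha> by (simp add: norm_mult)
    qed
    show "\<alpha> * f n 0 = 0" by (simp add: f0)
    have "deriv (\<lambda>w. \<alpha> * f n (\<psi> w)) 0 = \<alpha> * (deriv (f n) 0 * deriv \<psi> 0)"
    proof (rule DERIV_imp_deriv)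
      have "((f n \<circ> \<psi>) has_field_derivative deriv (f n) 0 * deriv \<psi> 0) (at 0)"
        using DERIV_chain[of "f n" _ \<psi> 0, OF _ d\<psi>] df \<psi>0 by simp
      from DERIV_cmult[OF this, of \<alpha>] show "((\<lambda>w. \<alpha> * f n (\<psi> w)) has_field_derivative \<alpha> * (deriv (f n) 0 * deriv \<psi> 0)) (at 0)"
        by (simp add: o_def)
    qed
    then show "Re (deriv (\<lambda>w. \<alpha> * f n (\<psi> w)) 0) > 1 - e" using n \<alpha>d by (simp add: d_def)
  qed
qed

section \<open>Harmonic majorants and level integrals\<close>

text \<open>At each point \<open>w\<close> equals one of two functions with the submean property,
  and both lie below \<open>w\<close> on small circles. The harmonic piece lives on \<open>G\<close>
  only; compactness of the set \<open>T\<close> on which it is used gives one radius for all its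
  points.\<close>

lemma submean_loc_glue:
  fixes w w0 :: "complex \<Rightarrow> real"
  assumes op: "open \<Omega>" and w0: "continuous_on \<Omega> w0" "submean_loc \<Omega> w0" and w: "continuous_on \<Omega> w"
    and G: "open G" "G \<subseteq> \<Omega>" and h: "h holomorphic_on G" and T: "compact T" "T \<subseteq> G"
    and ge: "\<And>z. z \<in> \<Omega> \<Longrightarrow> w0 z \<le> w z" "\<And>z. z \<in> G \<Longrightarrow> Re (h z) \<le> w z"
    and eq: "\<And>z. z \<in> \<Omega> \<Longrightarrow> w z = w0 z \<or> (z \<in> T \<and> w z = Re (h z))"
  shows "submean_loc \<Omega> w"
  unfolding submean_loc_def
proof (intro allI impI)
  fix K assume K: "compact K \<and> K \<subseteq> \<Omega>"
  obtain d0 where d0: "d0 > 0" "\<And>z \<rho>. z \<in> K \<Longrightarrow> \<rho> \<le> d0 \<Longrightarrow> cball z \<rho> \<subseteq> \<Omega>"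
    using cc_eventually_inside[OF op] K by blast
  obtain d1 where d1: "d1 > 0" "\<And>z \<rho>. z \<in> T \<Longrightarrow> \<rho> \<le> d1 \<Longrightarrow> cball z \<rho> \<subseteq> G"
    using cc_eventually_inside[OF G(1) T] by blast
  obtain d2 where d2: "d2 > 0" "\<forall>z\<in>K. \<forall>\<rho>. 0 < \<rho> \<and> \<rho> < d2 \<longrightarrow> w0 z \<le> cmean w0 z (-\<rho>)"
    using w0(2) K unfolding submean_loc_def by blast
  show "\<exists>\<delta>>0. \<forall>z\<in>K. \<forall>\<rho>. 0 < \<rho> \<and> \<rho> < \<delta> \<longrightarrow> w z \<le> cmean w z (-\<rho>)"
  proof (intro exI[of _ "min d0 (min d1 d2)"] conjI ballI allI impI)
    fix z \<rho> assume z: "z \<in> K" and \<rho>: "0 < \<rho> \<and> \<rho> < min d0 (min d1 d2)"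
    have s\<Omega>: "sphere z \<bar>-\<rho>\<bar> \<subseteq> \<Omega>" using d0(2)[OF z, of \<rho>] \<rho> by auto
    note cw = continuous_on_subset[OF w s\<Omega>]
    have z\<Omega>: "z \<in> \<Omega>" using z K by blast
    from eq[OF z\<Omega>] show "w z \<le> cmean w z (-\<rho>)"
    proof
      assume "w z = w0 z"
      also have "\<dots> \<le> cmean w0 z (-\<rho>)" using d2(2) z \<rho> by auto
      also have "\<dots> \<le> cmean w z (-\<rho>)"
        by (rule cmean_mono[OF continuous_on_subset[OF w0(1) s\<Omega>] cw]) (use s\<Omega> ge(1) in blast)
      finally show ?thesis .
    next
      assume zT: "z \<in> T \<and> w z = Re (h z)"
      then have cb: "cball z \<bar>-\<rho>\<bar> \<subseteq> G" using d1(2)[of z \<rho>] \<rho> by auto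
      then have sG: "sphere z \<bar>-\<rho>\<bar> \<subseteq> G" by auto
      have "w z = cmean (\<lambda>z. Re (h z)) z (-\<rho>)" using zT cmean_Re_holomorphic[OF h cb] by simp
      also have "\<dots> \<le> cmean w z (-\<rho>)"
        by (rule cmean_mono[OF continuous_on_Re[OF continuous_on_subset[OF holomorphic_on_imp_continuous_on[OF h] sG]] cw])
           (use sG ge(2) in blast)
      finally show ?thesis .
    qed
  qed (use d0 d1 d2 in auto)
qed

section \<open>Conformal discs and Hardy norms as suprema of level integrals\<close>

locale disc_exhaustion = subharmonic_exhaustion \<kappa> \<Omega> u for \<kappa> \<Omega> u +
  fixes \<phi> \<psi> :: "complex \<Rightarrow> complex" and p :: real
  assumes finite_mass: "finite_MA_mass \<kappa> \<Omega> u" and \<phi>: "\<phi> holomorphic_on \<Omega>" and \<psi>: "\<psi> holomorphic_on ball 0 1"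
    and \<phi>_\<Omega>: "z \<in> \<Omega> \<Longrightarrow> norm (\<phi> z) < 1 \<and> \<psi> (\<phi> z) = z"
    and \<psi>_disc: "norm x < 1 \<Longrightarrow> \<psi> x \<in> \<Omega> \<and> \<phi> (\<psi> x) = x"
    and zero: "0 \<in> \<Omega>" "\<phi> 0 = 0" and p: "1 \<le> p"
begin

abbreviation pw :: "(complex \<Rightarrow> complex) \<Rightarrow> complex \<Rightarrow> real" where
  "pw f \<equiv> (\<lambda>z. cmod (f z) powr p)"

text \<open>A compact exhaustion of \<Omega> by conformal discs, cofinal with the sublevel sets of
  \<open>u\<close> in both directions and adapted to Harnack's inequality.\<close>

definition D :: "real \<Rightarrow> complex set" where "D s = {z\<in>\<Omega>. norm (\<phi> z) \<le> s}"

lemma compact_D: "s < 1 \<Longrightarrow> compact (D s)"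
proof -
  assume s: "s < 1"
  have "D s = \<psi> ` cball 0 s"
  proof
    show "D s \<subseteq> \<psi> ` cball 0 s"
    proof
      fix z assume z: "z \<in> D s"
      then have "z = \<psi> (\<phi> z)" "\<phi> z \<in> cball 0 s" using \<phi>_\<Omega>[of z] by (auto simp: D_def)
      then show "z \<in> \<psi> ` cball 0 s" by (rule image_eqI)
    qed
    show "\<psi> ` cball 0 s \<subseteq> D s" using \<psi>_disc s by (auto simp: D_def)
  qed
  then show ?thesis
    using s by (simp only:) (intro compact_continuous_image compact_cball
      continuous_on_subset[OF holomorphic_on_imp_continuous_on[OF \<psi>]]; auto)
qed

lemma D_borel: "s < 1 \<Longrightarrow> D s \<in> sets borel"
  using compact_D compact_imp_closed borel_closed by blast

lemma compact_in_D:
  assumes K: "compact K" "K \<subseteq> \<Omega>"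
  obtains s where "0 < s" "s < 1" "K \<subseteq> D s"
proof (cases "K = {}")
  case True then show thesis using that[of "1/2"] by simp
next
  case False
  have "continuous_on K (\<lambda>z. norm (\<phi> z))"
    by (intro continuous_on_norm continuous_on_subset[OF holomorphic_on_imp_continuous_on[OF \<phi>] K(2)])
  then obtain z0 where z0: "z0 \<in> K" "\<And>z. z \<in> K \<Longrightarrow> norm (\<phi> z) \<le> norm (\<phi> z0)"
    using continuous_attains_sup[OF K(1) False] by blast
  have "norm (\<phi> z0) < 1" using z0(1) K(2) \<phi>_\<Omega> by blast
  show thesis
  proof (rule that[of "max (norm (\<phi> z0)) (1/2)"])
    show "K \<subseteq> D (max (norm (\<phi> z0)) (1/2))" using z0(2) K(2) by (auto simp: D_def le_max_iff_disj)
  qed (use \<open>norm (\<phi> z0) < 1\<close> in auto)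
qed

lemma D_in_sublevel:
  assumes "s < 1" obtains r where "r < 0" "D s \<subseteq> sublevel \<Omega> u r"
proof (cases "D s = {}")
  case True then show thesis using that[of "-1"] by simp
next
  case False
  have sub: "D s \<subseteq> \<Omega>" by (auto simp: D_def)
  obtain z0 where z0: "z0 \<in> D s" "\<And>z. z \<in> D s \<Longrightarrow> u z \<le> u z0"
    using continuous_attains_sup[OF compact_D[OF assms] False continuous_on_subset[OF cont sub]] by blast
  have "u z0 < ereal 0" using neg[of z0] z0(1) sub by (auto simp: zero_ereal_def)
  then obtain r where r: "u z0 < ereal r" "ereal r < ereal 0" using ereal_dense2 by blast
  show thesis
  proof (rule that[of r])
    show "r < 0" using r(2) by simp
    show "D s \<subseteq> sublevel \<Omega> u r" using sub z0(2) r(1) by (auto simp: sublevel_def intro: order_le_less_trans)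
  qed
qed

lemma sublevel_in_D:
  assumes "r < 0" obtains s where "0 < s" "s < 1" "{z\<in>\<Omega>. u z \<le> ereal r} \<subseteq> D s"
  by (rule compact_in_D[OF compact_sublevel[OF assms]]) auto

sublocale N: finite_measure N
proof
  show "emeasure N (space N) \<noteq> \<infinity>"
    using finite_mass by (simp add: finite_MA_mass_def ddc_u radon_on_space[OF radon_N] less_top)
qed

lemma space_N: "space N = \<Omega>" by (rule radon_on_space[OF radon_N])

abbreviation mass :: real where "mass \<equiv> measure N \<Omega>"

lemma N_fin: "emeasure N \<Omega> < \<infinity>"
  using finite_mass by (simp add: finite_MA_mass_def ddc_u)

lemma level_int_mono:
  assumes "continuous_on \<Omega> v" "continuous_on \<Omega> w" "r < 0" "\<And>z. z \<in> \<Omega> \<Longrightarrow> u z = ereal r \<Longrightarrow> v z \<le> w z"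
  shows "level_int v r \<le> level_int w r"
  unfolding level_int_def using level_integrable(1)[OF assms(1,3)] level_integrable(1)[OF assms(2,3)]
  by (rule integral_mono) (auto simp: indicator_def level_def assms(4))

lemma level_int_add:
  assumes "continuous_on \<Omega> v" "continuous_on \<Omega> w" "r < 0"
  shows "level_int (\<lambda>z. v z + w z) r = level_int v r + level_int w r"
  unfolding level_int_def distrib_left using level_integrable(1)[OF assms(1,3)] level_integrable(1)[OF assms(2,3)]
  by (rule Bochner_Integration.integral_add)

lemma level_int_mult: "level_int (\<lambda>z. c * w z) r = c * level_int w r"
  unfolding level_int_def mult.left_commute[of _ c] by simp

text \<open>A constant is the real part of a holomorphic function, so its level integral is its
  integral over the sublevel set. In particular every level measure has total mass at most
  \<open>mass\<close>.\<close>

lemma level_int_const_le: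
  assumes "r < 0" "0 \<le> c" shows "level_int (\<lambda>z. c) r \<le> c * mass"
proof -
  have "level_int (\<lambda>z. Re (of_real c)) r = sub_int (\<lambda>z. Re (of_real c)) r"
    by (rule level_formula_harmonic[OF assms(1)]) (rule holomorphic_on_const)
  then have "level_int (\<lambda>z. c) r = sub_int (\<lambda>z. c) r" by simp
  also have "\<dots> \<le> (LINT z|N. c)" unfolding sub_int_def
    by (rule integral_mono[OF level_integrable(2)[OF continuous_on_const assms(1)] N.integrable_const])
       (use assms(2) in \<open>auto simp: indicator_def\<close>)
  also have "\<dots> = c * mass" by (simp add: space_N mult.commute)
  finally show ?thesis .
qed

lemma level_int_le_const:
  assumes "continuous_on \<Omega> w" "r < 0" "0 \<le> c" "\<And>z. z \<in> \<Omega> \<Longrightarrow> u z = ereal r \<Longrightarrow> w z \<le> c"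
  shows "level_int w r \<le> c * mass"
  using level_int_mono[OF assms(1) continuous_on_const assms(2,4)] level_int_const_le[OF assms(2,3)] by (rule order_trans)

lemma pw_continuous: "f holomorphic_on S \<Longrightarrow> continuous_on S (pw f)"
  using p by (intro continuous_on_powr' continuous_on_norm holomorphic_on_imp_continuous_on continuous_on_const) auto

lemma level_int_pw_mono:
  assumes f: "f holomorphic_on \<Omega>" and rs: "r \<le> s" "s < 0" shows "level_int (pw f) r \<le> level_int (pw f) s"
proof -
  have r: "r < 0" using rs by simp
  note c = pw_continuous[OF f]
  have "sub_int (pw f) r \<le> sub_int (pw f) s" unfolding sub_int_def
  proof (rule integral_mono[OF level_integrable(2)[OF c r] level_integrable(2)[OF c rs(2)]])
    have "indicator (sublevel \<Omega> u r) z \<le> (indicator (sublevel \<Omega> u s) z :: real)" for z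
    proof -
      have "sublevel \<Omega> u r \<subseteq> sublevel \<Omega> u s" using rs(1) by (auto simp: sublevel_def intro: order_less_le_trans)
      then show ?thesis by (auto simp: indicator_def)
    qed
    then show "indicator (sublevel \<Omega> u r) z * pw f z \<le> indicator (sublevel \<Omega> u s) z * pw f z" for z
      by (rule mult_right_mono) simp
  qed
  then show ?thesis using level_formula(2)[OF rs c submean_loc_powr[OF op f p]] by simp
qed

lemma level_integral_eq:
  assumes f: "f holomorphic_on \<Omega>" and r: "r < 0"
  shows "level_integral \<kappa> \<Omega> u p f r = ennreal (level_int (pw f) r)"
proof -
  have "level_integral \<kappa> \<Omega> u p f r = (\<integral>\<^sup>+z. ennreal (indicator (level \<Omega> u r) z * pw f z) \<partial>L r)"
    unfolding level_integral_def MA_level_measure_eq[OF r N_fin]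
    by (intro nn_integral_cong) (auto simp: indicator_def)
  also have "\<dots> = ennreal (level_int (pw f) r)"
    unfolding level_int_def by (rule nn_integral_eq_integral[OF level_integrable(1)[OF pw_continuous[OF f] r]]) auto
  finally show ?thesis .
qed

text \<open>Level integrals of \<open>pw f\<close> increase with the level. Hence the limit in
  \<open>hardy_norm\<close> exists, possibly infinite, and a bound valid at every level is a bound
  on the norm.\<close>

lemma level_integral_tendsto:
  assumes f: "f holomorphic_on \<Omega>"
  shows "(level_integral \<kappa> \<Omega> u p f \<longlongrightarrow> (SUP r\<in>{..<0}. ennreal (level_int (pw f) r))) (at_left 0)"
proof (rule increasing_tendsto)
  have neg: "\<forall>\<^sub>F r in at_left (0::real). r < 0" unfolding eventually_at_left_field by (intro exI[of _ "-1"]) auto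
  show "\<forall>\<^sub>F r in at_left 0. level_integral \<kappa> \<Omega> u p f r \<le> (SUP r\<in>{..<0}. ennreal (level_int (pw f) r))"
    using neg by eventually_elim (auto simp: level_integral_eq[OF f] intro!: SUP_upper)
  fix x assume "x < (SUP r\<in>{..<0}. ennreal (level_int (pw f) r))"
  then obtain r where r: "r < 0" "x < ennreal (level_int (pw f) r)" unfolding less_SUP_iff by auto
  have "\<forall>\<^sub>F s in at_left (0::real). r < s" using r(1) unfolding eventually_at_left_field by auto
  with neg show "\<forall>\<^sub>F s in at_left 0. x < level_integral \<kappa> \<Omega> u p f s"
  proof eventually_elim
    case (elim s)
    then have "ennreal (level_int (pw f) r) \<le> ennreal (level_int (pw f) s)" by (intro ennreal_leI level_int_pw_mono[OF f]) auto
    then show ?case using r(2) elim(1) by (simp add: level_integral_eq[OF f] order_less_le_trans)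
  qed
qed

lemma hardy_space_bounded:
  assumes "f \<in> hardy_space \<kappa> \<Omega> u p"
  obtains A where "0 \<le> A" "\<And>r. r < 0 \<Longrightarrow> level_int (pw f) r \<le> A"
proof -
  have f: "f holomorphic_on \<Omega>" and fin: "Limsup (at_left 0) (level_integral \<kappa> \<Omega> u p f) < \<infinity>"
    using assms by (auto simp: hardy_space_def)
  define S where "S = (SUP r\<in>{..<0}. ennreal (level_int (pw f) r))"
  have "S < \<infinity>" using fin lim_imp_Limsup[OF trivial_limit_at_left_real level_integral_tendsto[OF f]] by (simp add: S_def)
  then have S: "S = ennreal (enn2real S)" by (simp add: less_top[symmetric])
  show thesis
  proof (rule that[of "enn2real S"])
    fix r :: real assume "r < 0"
    then have "ennreal (level_int (pw f) r) \<le> S" unfolding S_def by (intro SUP_upper) auto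
    then show "level_int (pw f) r \<le> enn2real S" by (subst (asm) S) (simp add: ennreal_le_iff)
  qed simp
qed

lemma hardy_bound:
  assumes f: "f holomorphic_on \<Omega>" and X: "0 \<le> X" "\<And>r. r < 0 \<Longrightarrow> level_int (pw f) r \<le> X"
  shows "f \<in> hardy_space \<kappa> \<Omega> u p" "hardy_norm \<kappa> \<Omega> u p f \<le> X powr (1 / p)"
proof -
  let ?S = "SUP r\<in>{..<0}. ennreal (level_int (pw f) r)"
  have le: "?S \<le> ennreal X" by (intro SUP_least ennreal_leI) (use X(2) in auto)
  then have "?S < \<infinity>" by (simp add: order_le_less_trans)
  then show "f \<in> hardy_space \<kappa> \<Omega> u p"
    using f lim_imp_Limsup[OF trivial_limit_at_left_real level_integral_tendsto[OF f]] by (simp add: hardy_space_def)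
  have "Lim (at_left 0) (level_integral \<kappa> \<Omega> u p f) = ?S"
    by (rule tendsto_Lim[OF trivial_limit_at_left_real level_integral_tendsto[OF f]])
  moreover have "enn2real ?S \<le> X" using enn2real_leI[OF X(1) le] .
  ultimately show "hardy_norm \<kappa> \<Omega> u p f \<le> X powr (1 / p)"
    unfolding hardy_norm_def using p by (simp only:) (intro powr_mono2; simp)
qed

lemma algebra_subset_hardy: "holo_continuous_algebra \<Omega> \<subseteq> hardy_space \<kappa> \<Omega> u p" if bd: "bounded \<Omega>"
proof
  fix f assume "f \<in> holo_continuous_algebra \<Omega>"
  then have f: "f holomorphic_on \<Omega>" "continuous_on (closure \<Omega>) f" by (auto simp: holo_continuous_algebra_def)
  have "bounded (f ` closure \<Omega>)"
    by (intro compact_imp_bounded compact_continuous_image f(2)) (use bd in \<open>simp add: compact_closure\<close>)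
  then obtain B where B: "\<And>z. z \<in> \<Omega> \<Longrightarrow> norm (f z) \<le> B" unfolding bounded_iff using closure_subset by blast
  have B0: "0 \<le> B" using B[OF zero(1)] norm_ge_zero order_trans by blast
  show "f \<in> hardy_space \<kappa> \<Omega> u p"
  proof (rule hardy_bound(1)[OF f(1)])
    show "level_int (pw f) r \<le> B powr p * mass" if "r < 0" for r
      by (rule level_int_le_const[OF pw_continuous[OF f(1)] that]) (use B p in \<open>auto intro!: powr_mono2\<close>)
  qed simp
qed

end

lemma cmean_scale: "cmean f 0 \<rho> = cmean (\<lambda>z. f (of_real \<rho> * z)) 0 1"
  unfolding cmean_def by (simp add: rcis_def)

lemma Montel_disc:
  assumes q: "\<And>n. q n holomorphic_on ball 0 1"
    and B: "\<And>s. 0 < s \<Longrightarrow> s < 1 \<Longrightarrow> \<exists>B. \<forall>n z. norm z \<le> s \<longrightarrow> norm (q n z :: complex) \<le> B"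
  obtains e r where "e holomorphic_on ball 0 1" "strict_mono (r :: nat \<Rightarrow> nat)"
    "\<forall>s<1. uniform_limit (cball 0 s) (\<lambda>n. q (r n)) e sequentially"
proof (rule Montel[of "ball 0 1" "range q" q])
  show "\<exists>B. \<forall>h\<in>range q. \<forall>z\<in>K. norm (h z) \<le> B" if K: "compact K" "K \<subseteq> ball 0 1" for K
  proof (cases "K = {}")
    case False
    obtain z0 where z0: "z0 \<in> K" "\<And>z. z \<in> K \<Longrightarrow> norm z \<le> norm z0"
      using continuous_attains_sup[OF K(1) False continuous_on_norm[OF continuous_on_id]] by auto
    have "norm z0 < 1" using z0(1) K(2) by auto
    then have "0 < max (norm z0) (1/2)" "max (norm z0) (1/2) < 1" by auto
    then obtain B where "\<forall>n z. norm z \<le> max (norm z0) (1/2) \<longrightarrow> norm (q n z) \<le> B" using B by blast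
    then show ?thesis using z0(2) by (intro exI[of _ B]) (auto simp: le_max_iff_disj)
  qed simp
  fix e r
  assume e: "e holomorphic_on ball 0 1" "strict_mono (r :: nat \<Rightarrow> nat)"
    "\<And>K. compact K \<Longrightarrow> K \<subseteq> ball 0 1 \<Longrightarrow> uniform_limit K (q \<circ> r) e sequentially"
  show thesis
  proof (rule that[OF e(1,2)])
    show "\<forall>s<1. uniform_limit (cball 0 s) (\<lambda>n. q (r n)) e sequentially"
    proof (intro allI impI)
      fix s :: real assume "s < 1"
      then have "cball 0 s \<subseteq> ball (0::complex) 1" by auto
      from e(3)[OF compact_cball this] show "uniform_limit (cball 0 s) (\<lambda>n. q (r n)) e sequentially" by (simp add: o_def)
    qed
  qed
qed (use q in auto)

text \<open>Serves the majorants below, which are evaluated at \<open>\<phi> z\<close> divided by a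
  radius that changes with the index.\<close>

lemma uniform_limit_moving:
  fixes q :: "nat \<Rightarrow> complex \<Rightarrow> complex"
  assumes u: "uniform_limit K q e sequentially" and e: "continuous_on K e" and x: "x \<longlonglongrightarrow> a" "\<And>n. x n \<in> K" "a \<in> K"
  shows "(\<lambda>n. q n (x n)) \<longlonglongrightarrow> e a"
proof -
  have 1: "(\<lambda>n. e (x n)) \<longlonglongrightarrow> e a"
    by (rule continuous_on_tendsto_compose[OF e x(1,3)]) (use x(2) in auto)
  have "(\<lambda>n. dist (q n (x n)) (e (x n))) \<longlonglongrightarrow> 0"
  proof (rule tendstoI)
    fix \<epsilon> :: real assume "\<epsilon> > 0"
    from uniform_limitD[OF u this] show "\<forall>\<^sub>F n in sequentially. dist (dist (q n (x n)) (e (x n))) 0 < \<epsilon>"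
      by eventually_elim (use x(2) in simp)
  qed
  then have "(\<lambda>n. q n (x n) - e (x n)) \<longlonglongrightarrow> 0" unfolding dist_norm by (rule tendsto_norm_zero_cancel)
  with 1 show ?thesis by (rule Lim_transform)
qed

section \<open>Harmonic majorants on conformal discs\<close>

context disc_exhaustion begin

lemma psi_0: "\<psi> 0 = 0" using \<phi>_\<Omega>[OF zero(1)] zero(2) by simp

lemma scaled_in_disc: "0 < \<rho> \<Longrightarrow> \<rho> < 1 \<Longrightarrow> norm z \<le> 1 \<Longrightarrow> norm (of_real \<rho> * z :: complex) < 1"
proof -
  assume a: "0 < \<rho>" "\<rho> < 1" "norm z \<le> 1"
  then have "\<rho> * norm z \<le> \<rho> * 1" by (intro mult_left_mono) auto
  moreover have "norm (of_real \<rho> * z) = \<rho> * norm z" using a by (simp add: norm_mult)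
  ultimately show ?thesis using a by linarith
qed

lemma holomorphic_psi:
  assumes "F holomorphic_on \<Omega>" shows "(\<lambda>z. F (\<psi> z)) holomorphic_on ball 0 1"
proof -
  have "\<psi> ` ball 0 1 \<subseteq> \<Omega>" using \<psi>_disc by auto
  from holomorphic_on_compose_gen[OF \<psi> assms this] show ?thesis by (simp add: o_def)
qed

lemma holomorphic_dilated:
  assumes "F holomorphic_on \<Omega>" "0 < \<rho>" "\<rho> < 1" shows "(\<lambda>z. F (\<psi> (of_real \<rho> * z))) holomorphic_on cball 0 1"
proof -
  have "(\<lambda>z. of_real \<rho> * z) ` cball 0 1 \<subseteq> ball (0::complex) 1" using scaled_in_disc[OF assms(2,3)] by auto
  moreover have "(\<lambda>z. of_real \<rho> * z) holomorphic_on cball 0 1" by (intro holomorphic_intros)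
  ultimately show ?thesis using holomorphic_on_compose_gen[OF _ holomorphic_psi[OF assms(1)]] by (simp add: o_def)
qed

text \<open>\<open>Re q\<close> approximates the harmonic function with the values of
  \<open>pw F\<close> on the circle of radius \<open>\<rho>\<close>, rescaled to the unit disc. The
  margin \<open>a\<close> makes it strictly positive and a subtracted imaginary constant makes
  \<open>q 0\<close> real, both for Harnack's inequality.\<close>

lemma majorant_on_circle:
  assumes F: "F holomorphic_on \<Omega>" and \<rho>: "0 < \<rho>" "\<rho> < 1" and a: "a > 0"
  obtains q where "q holomorphic_on UNIV" "Im (q 0) = 0"
    "\<And>z. norm z = 1 \<Longrightarrow> Re (q z) \<le> pw F (\<psi> (of_real \<rho> * z)) + 2 * a"
    "\<And>z. norm z < 1 \<Longrightarrow> pw F (\<psi> (of_real \<rho> * z)) + a \<le> Re (q z)"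
proof -
  note Fd = holomorphic_dilated[OF F \<rho>]
  have "continuous_on (sphere 0 1) (\<lambda>z. pw F (\<psi> (of_real \<rho> * z)) + a)"
    using continuous_on_subset[OF pw_continuous[OF Fd]] by (intro continuous_on_add continuous_on_const) auto
  then obtain Q where Q: "Q holomorphic_on UNIV"
    "\<And>z. norm z = 1 \<Longrightarrow> pw F (\<psi> (of_real \<rho> * z)) + a \<le> Re (Q z) \<and> Re (Q z) \<le> pw F (\<psi> (of_real \<rho> * z)) + a + a"
    using circle_approximation[OF _ a] by blast
  define q where "q z = Q z - \<i> * of_real (Im (Q 0))" for z
  have Rq: "Re (q z) = Re (Q z)" for z by (simp add: q_def)
  have q: "q holomorphic_on UNIV" unfolding q_def[abs_def] by (intro holomorphic_intros Q(1))
  show thesis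
  proof (rule that[OF q])
    show "Im (q 0) = 0" by (simp add: q_def)
    show "Re (q z) \<le> pw F (\<psi> (of_real \<rho> * z)) + 2 * a" if "norm z = 1" for z using Q(2)[OF that] by (simp add: Rq)
    have E: "(\<lambda>z. q z - of_real a) holomorphic_on cball 0 1" by (intro holomorphic_intros holomorphic_on_subset[OF q]) auto
    show "pw F (\<psi> (of_real \<rho> * z)) + a \<le> Re (q z)" if "norm z < 1" for z
      using disc_dominate[OF Fd E p _ that] Q(2) by (simp add: Rq algebra_simps)
  qed
qed

lemma phi_scaled: "z \<in> \<Omega> \<Longrightarrow> 0 < \<rho> \<Longrightarrow> \<psi> (of_real \<rho> * (\<phi> z / of_real \<rho>)) = z"
  using \<phi>_\<Omega>[of z] by simp

lemma phi_norm_scaled: "0 < \<rho> \<Longrightarrow> norm (\<phi> z / of_real \<rho>) = norm (\<phi> z) / \<rho>"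
  by (simp add: norm_divide)

lemma holomorphic_phi_scaled:
  assumes "q holomorphic_on UNIV" shows "(\<lambda>z. q (\<phi> z / of_real \<rho>)) holomorphic_on \<Omega>"
proof -
  have "(\<lambda>z. \<phi> z / of_real \<rho>) holomorphic_on \<Omega>"
  proof (cases "\<rho> = 0")
    case False then show ?thesis by (intro holomorphic_intros \<phi>) auto
  qed simp
  from holomorphic_on_compose_gen[OF this assms] show ?thesis by (simp add: o_def)
qed

lemma continuous_N_measurable:
  assumes "continuous_on \<Omega> (w :: complex \<Rightarrow> 'b :: topological_space)" shows "w \<in> borel_measurable N"
  using borel_measurable_continuous_on_restrict[OF assms] radon_N by (simp add: radon_on_def cong: measurable_cong_sets)

lemma indicator_D_measurable: "s < 1 \<Longrightarrow> (indicator (D s) :: complex \<Rightarrow> real) \<in> borel_measurable N"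
  by (intro borel_measurable_indicator radon_on_sets[OF radon_N D_borel]) (auto simp: D_def)

text \<open>For \<open>t < 1\<close> the sequence starts at \<open>t\<close> and increases to 1, so
  the choice of \<open>t\<close> sets a lower bound for the radii.\<close>

lemma rho_tendsto: "(\<lambda>n. 1 - (1 - t) / real (Suc n)) \<longlonglongrightarrow> 1"
proof -
  have "(\<lambda>n. 1 - (1 - t) * inverse (real (Suc n))) \<longlonglongrightarrow> 1 - (1 - t) * 0"
    by (intro tendsto_intros LIMSEQ_inverse_real_of_nat)
  then show ?thesis by (simp add: divide_inverse)
qed

lemma eventually_in_D:
  assumes "z \<in> \<Omega>" shows "\<forall>\<^sub>F n in sequentially. z \<in> D (1 - (1 - t) / real (Suc n))"
proof -
  have "\<forall>\<^sub>F n in sequentially. norm (\<phi> z) < 1 - (1 - t) / real (Suc n)"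
    using order_tendstoD(1)[OF rho_tendsto] \<phi>_\<Omega>[OF assms] by blast
  then show ?thesis by eventually_elim (use assms in \<open>auto simp: D_def\<close>)
qed

lemma integral_tail:
  fixes w :: "complex \<Rightarrow> real"
  assumes w: "integrable N w" and e: "e > 0"
  obtains s where "0 < s" "s < 1" "(LINT z|N. indicator (- D s) z * w z) < e"
proof -
  define s where "s n = 1 - (1 - 1/2) / real (Suc n)" for n
  have s: "0 < s n" "s n < 1" for n by (auto simp: s_def field_simps)
  have m: "(\<lambda>z. indicator (- D (s n)) z * w z) \<in> borel_measurable N" for n
  proof -
    have "(\<lambda>z. (1 - indicator (D (s n)) z) * w z) \<in> borel_measurable N"
      using indicator_D_measurable[OF s(2)[of n]] w by measurable
    then show ?thesis by (simp add: indicator_compl)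
  qed
  have "(\<lambda>n. LINT z|N. indicator (- D (s n)) z * w z) \<longlonglongrightarrow> (LINT z|N. 0)"
  proof (rule integral_dominated_convergence[where w="\<lambda>z. \<bar>w z\<bar>"])
    show "AE z in N. (\<lambda>n. indicator (- D (s n)) z * w z) \<longlonglongrightarrow> 0"
    proof (rule AE_I2)
      fix z assume "z \<in> space N"
      then have "\<forall>\<^sub>F n in sequentially. z \<in> D (s n)" using eventually_in_D[of z "1/2"] by (simp add: space_N s_def)
      then have "\<forall>\<^sub>F n in sequentially. indicator (- D (s n)) z * w z = 0" by eventually_elim simp
      then show "(\<lambda>n. indicator (- D (s n)) z * w z) \<longlonglongrightarrow> 0" by (rule tendsto_eventually)
    qed
    show "AE z in N. norm (indicator (- D (s n)) z * w z) \<le> \<bar>w z\<bar>" for n by (intro AE_I2) (auto simp: indicator_def)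
  qed (use w m in auto)
  then have "\<forall>\<^sub>F n in sequentially. (LINT z|N. indicator (- D (s n)) z * w z) < e"
    using e by (intro order_tendstoD(2)) auto
  then obtain n where "(LINT z|N. indicator (- D (s n)) z * w z) < e" using eventually_happens by fastforce
  then show thesis using that s by blast
qed

text \<open>The level integral is at most the mass of a harmonic majorant on the sublevel set. On a compact set
  this is controlled by Harnack's inequality and the value at 0, off it by the fixed majorant \<open>Re E\<close>.\<close>

lemma small_level_integral:
  assumes E: "E holomorphic_on \<Omega>" "\<And>z. z \<in> \<Omega> \<Longrightarrow> 0 \<le> Re (E z)" "integrable N (\<lambda>z. Re (E z))" and \<eta>: "\<eta> > 0"
  obtains c where "c > 0"
    "\<forall>F r. F holomorphic_on \<Omega> \<and> (\<forall>z\<in>\<Omega>. pw F z \<le> Re (E z)) \<and>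
       (\<forall>\<rho>. 0 < \<rho> \<and> \<rho> < 1 \<longrightarrow> cmean (\<lambda>z. pw F (\<psi> z)) 0 \<rho> \<le> c) \<and> r < 0 \<longrightarrow> level_int (pw F) r \<le> \<eta>"
proof -
  obtain s where s: "0 < s" "s < 1" and tail: "(LINT z|N. indicator (- D s) z * Re (E z)) < \<eta> / 2"
    by (rule integral_tail[OF E(3) half_gt_zero[OF \<eta>]]) blast
  define s' where "s' = (1 + s) / 2"
  have s': "s < s'" "s' < 1" "0 < s'" using s by (auto simp: s'_def)
  define C where "C = (1 + s') / (1 - s')"
  have C: "0 < C" using s' by (auto simp: C_def)
  have m0: "0 \<le> mass" by simp
  \<comment> \<open>The majorant will be at most \<open>3 * c * C\<close> on \<open>D s\<close> and
    at most \<open>Re E + 2 * c\<close> off it. Integrated against \<open>N\<close>, these bounds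
    cost \<open>c * X\<close> plus the tail of \<open>Re E\<close>.\<close>
  define X where "X = 3 * C * mass + 2 * mass"
  have X: "0 \<le> X" using C m0 by (simp add: X_def)
  define c where "c = \<eta> / 2 / (X + 1)"
  have c: "c > 0" "c * X \<le> \<eta> / 2" using \<eta> X by (auto simp: c_def field_simps)
  show thesis
  proof (rule that[OF c(1)], intro allI impI)
    fix F and r :: real
    assume "F holomorphic_on \<Omega> \<and> (\<forall>z\<in>\<Omega>. pw F z \<le> Re (E z)) \<and>
      (\<forall>\<rho>. 0 < \<rho> \<and> \<rho> < 1 \<longrightarrow> cmean (\<lambda>z. pw F (\<psi> z)) 0 \<rho> \<le> c) \<and> r < 0"
    then have F: "F holomorphic_on \<Omega>" and FE: "\<And>z. z \<in> \<Omega> \<Longrightarrow> pw F z \<le> Re (E z)"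
      and Fc: "\<And>\<rho>. 0 < \<rho> \<Longrightarrow> \<rho> < 1 \<Longrightarrow> cmean (\<lambda>z. pw F (\<psi> z)) 0 \<rho> \<le> c" and r: "r < 0" by simp_all
    obtain s1 where s1: "0 < s1" "s1 < 1" "{z\<in>\<Omega>. u z \<le> ereal r} \<subseteq> D s1" by (rule sublevel_in_D[OF r]) blast
    \<comment> \<open>The first term places the set where \<open>u \<le> r\<close> inside the
      conformal disc on which the majorant is built. The second gives
      \<open>s / \<rho> \<le> s'\<close>, so that rescaling takes \<open>D s\<close> into the disc
      of radius \<open>s'\<close>, where the Harnack constant is \<open>C\<close>.\<close>
    define \<rho> where "\<rho> = max ((1 + s1) / 2) (s / s')"
    have \<rho>: "0 < \<rho>" "\<rho> < 1" "s1 < \<rho>" "s / \<rho> \<le> s'"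
    proof -
      show r0: "0 < \<rho>" using s1 by (auto simp: \<rho>_def less_max_iff_disj)
      show "\<rho> < 1" using s1 s' by (auto simp: \<rho>_def)
      show "s1 < \<rho>" using s1 by (auto simp: \<rho>_def less_max_iff_disj)
      have "s / s' \<le> \<rho>" by (simp add: \<rho>_def)
      then show "s / \<rho> \<le> s'" using r0 s' by (simp add: field_simps)
    qed
    obtain q where q: "q holomorphic_on UNIV" "Im (q 0) = 0"
      "\<And>z. norm z = 1 \<Longrightarrow> Re (q z) \<le> pw F (\<psi> (of_real \<rho> * z)) + 2 * c"
      "\<And>z. norm z < 1 \<Longrightarrow> pw F (\<psi> (of_real \<rho> * z)) + c \<le> Re (q z)"
      by (rule majorant_on_circle[OF F \<rho>(1,2) c(1)]) blast
    define h where "h z = q (\<phi> z / of_real \<rho>)" for z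
    have h: "h holomorphic_on \<Omega>" unfolding h_def[abs_def] by (rule holomorphic_phi_scaled[OF q(1)])
    have hc: "continuous_on \<Omega> (\<lambda>z. Re (h z))" by (intro continuous_on_Re holomorphic_on_imp_continuous_on h)
    have qpos: "Re (q z) > 0" if "norm z < 1" for z
    proof -
      have "0 \<le> pw F (\<psi> (of_real \<rho> * z))" by simp
      then show ?thesis using q(4)[OF that] c(1) by linarith
    qed
    have in_disc: "norm (\<phi> z / of_real \<rho>) < 1" if "z \<in> \<Omega>" "u z \<le> ereal r" for z
      using s1(3) that \<rho>(1,3) by (auto simp: phi_norm_scaled D_def)
    have Fh: "pw F z \<le> Re (h z)" if z: "z \<in> \<Omega>" "u z \<le> ereal r" for z
      using q(4)[OF in_disc[OF z]] phi_scaled[OF z(1) \<rho>(1)] c(1) by (simp add: h_def)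
    \<comment> \<open>On the circle the majorant exceeds \<open>pw F\<close> by at most
      \<open>2 * c\<close>, and \<open>pw F \<le> Re E\<close>; the comparison passes to the
      interior.\<close>
    have hE: "Re (h z) \<le> Re (E z) + 2 * c" if z: "z \<in> \<Omega>" "u z \<le> ereal r" for z
    proof -
      have "Re (q (\<phi> z / of_real \<rho>)) \<le> Re (E (\<psi> (of_real \<rho> * (\<phi> z / of_real \<rho>))) + of_real (2 * c))"
      proof (rule disc_dominate_Re[OF _ _ _ in_disc[OF z]])
        show "q holomorphic_on cball 0 1" by (rule holomorphic_on_subset[OF q(1)]) auto
        show "(\<lambda>z. E (\<psi> (of_real \<rho> * z)) + of_real (2 * c)) holomorphic_on cball 0 1"
          by (intro holomorphic_intros holomorphic_dilated E \<rho>)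
        fix z :: complex assume z1: "norm z = 1"
        then have "\<psi> (of_real \<rho> * z) \<in> \<Omega>" using \<psi>_disc scaled_in_disc[OF \<rho>(1,2), of z] by simp
        from FE[OF this] q(3)[OF z1] show "Re (q z) \<le> Re (E (\<psi> (of_real \<rho> * z)) + of_real (2 * c))" by simp
      qed
      then show ?thesis using phi_scaled[OF z(1) \<rho>(1)] by (simp add: h_def)
    qed
    \<comment> \<open>The value at 0 is the circle mean: at most \<open>c\<close> by hypothesis plus
      \<open>2 * c\<close> from the approximation.\<close>
    have q0: "Re (q 0) \<le> 3 * c"
    proof -
      note Fd = holomorphic_dilated[OF F \<rho>(1,2)]
      have cF: "continuous_on (sphere 0 \<bar>1\<bar>) (\<lambda>z. pw F (\<psi> (of_real \<rho> * z)))"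
        by (rule continuous_on_subset[OF pw_continuous[OF Fd]]) auto
      have "Re (q 0) = cmean (\<lambda>z. Re (q z)) 0 1" using cmean_Re_holomorphic[OF q(1), of 0 1] by simp
      also have "\<dots> \<le> cmean (\<lambda>z. pw F (\<psi> (of_real \<rho> * z)) + 2 * c) 0 1"
      proof (rule cmean_mono)
        show "continuous_on (sphere 0 \<bar>1\<bar>) (\<lambda>z. Re (q z))"
          by (intro continuous_on_Re holomorphic_on_imp_continuous_on holomorphic_on_subset[OF q(1)]) auto
        show "continuous_on (sphere 0 \<bar>1\<bar>) (\<lambda>z. pw F (\<psi> (of_real \<rho> * z)) + 2 * c)" by (intro continuous_on_add cF continuous_on_const)
      qed (use q(3) in auto)
      also have "\<dots> = cmean (\<lambda>z. pw F (\<psi> z)) 0 \<rho> + 2 * c"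
        using cmean_add[OF cF continuous_on_const] by (simp add: cmean_scale[of _ \<rho>])
      finally show ?thesis using Fc[OF \<rho>(1,2)] by linarith
    qed
    have hD: "Re (h z) \<le> 3 * c * C" if z: "z \<in> \<Omega>" "z \<in> D s" for z
    proof -
      have "norm (\<phi> z) / \<rho> \<le> s / \<rho>" using z \<rho>(1) by (intro divide_right_mono) (auto simp: D_def)
      then have "norm (\<phi> z / of_real \<rho>) \<le> s'" using \<rho>(1,4) by (simp add: phi_norm_scaled)
      from Harnack(1)[OF holomorphic_on_subset[OF q(1)] qpos q(2) this s'(2)]
      have "cmod (h z) \<le> C * Re (q 0)" by (simp add: h_def C_def)
      also have "\<dots> \<le> C * (3 * c)" using C q0 by (intro mult_left_mono) auto
      finally show ?thesis using complex_Re_le_cmod[of "h z"] by (simp add: mult_ac)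
    qed
    have i1: "integrable N (\<lambda>z. indicator (- D s) z * Re (E z))"
    proof (rule Bochner_Integration.integrable_bound[OF E(3)])
      have "(\<lambda>z. (1 - indicator (D s) z) * Re (E z)) \<in> borel_measurable N"
        using indicator_D_measurable[OF s(2)] E(3) by measurable
      then show "(\<lambda>z. indicator (- D s) z * Re (E z)) \<in> borel_measurable N" by (simp add: indicator_compl)
    qed (auto simp: indicator_def)
    have i2: "integrable N (\<lambda>z. (3 * c * C + 2 * c) + indicator (- D s) z * Re (E z))"
      by (intro Bochner_Integration.integrable_add i1 N.integrable_const)
    have "level_int (pw F) r \<le> level_int (\<lambda>z. Re (h z)) r"
      by (rule level_int_mono[OF pw_continuous[OF F] hc r]) (rule Fh, auto)
    also have "\<dots> = sub_int (\<lambda>z. Re (h z)) r" by (rule level_formula_harmonic[OF r h])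
    also have "\<dots> \<le> (LINT z|N. (3 * c * C + 2 * c) + indicator (- D s) z * Re (E z))"
      unfolding sub_int_def
    proof (rule integral_mono[OF level_integrable(2)[OF hc r] i2])
      fix z assume "z \<in> space N"
      then have z: "z \<in> \<Omega>" by (simp add: space_N)
      have cc: "0 \<le> 3 * c * C" "0 \<le> 2 * c" using c C by auto
      show "indicator (sublevel \<Omega> u r) z * Re (h z) \<le> (3 * c * C + 2 * c) + indicator (- D s) z * Re (E z)"
      proof (cases "z \<in> sublevel \<Omega> u r")
        case True
        then have "u z \<le> ereal r" by (simp add: sublevel_def less_imp_le)
        note b = hE[OF z this] hD[OF z]
        show ?thesis
        proof (cases "z \<in> D s")
          case zD: True
          have "Re (h z) \<le> 3 * c * C + 2 * c" using b(2)[OF zD] cc by linarith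
          then show ?thesis using True zD by simp
        next
          case zD: False
          have "Re (h z) \<le> 3 * c * C + 2 * c + Re (E z)" using b(1) cc by linarith
          then show ?thesis using True zD by simp
        qed
      next
        case False
        then show ?thesis using cc E(2)[OF z] by (auto simp: indicator_def)
      qed
    qed
    also have "\<dots> = (3 * c * C + 2 * c) * mass + (LINT z|N. indicator (- D s) z * Re (E z))"
      using Bochner_Integration.integral_add[OF N.integrable_const i1, of "3 * c * C + 2 * c"] by (simp add: space_N mult.commute)
    also have "(3 * c * C + 2 * c) * mass = c * X" by (simp add: X_def algebra_simps)
    finally show "level_int (pw F) r \<le> \<eta>" using c(2) tail by linarith
  qed
qed

text \<open>Apply the level formula to \<open>\<bar>f\<bar> powr p\<close> modified inside \<open>\<bar>\<phi>\<bar> < \<rho>\<close> by a harmonic function with almost the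
  same boundary values; lowering it by 3 keeps it below \<open>\<bar>f\<bar> powr p\<close> near \<open>\<bar>\<phi>\<bar> = \<rho>\<close>.\<close>

lemma majorant_mass:
  assumes f: "f holomorphic_on \<Omega>" and A: "\<And>r. r < 0 \<Longrightarrow> level_int (pw f) r \<le> A" and \<rho>: "0 < \<rho>" "\<rho> < 1"
    and q: "q holomorphic_on UNIV" "\<And>z. norm z = 1 \<Longrightarrow> Re (q z) \<le> pw f (\<psi> (of_real \<rho> * z)) + 2"
  defines "G \<equiv> {z\<in>\<Omega>. norm (\<phi> z) < \<rho>}"
  shows "integrable N (\<lambda>z. indicator G z * (Re (q (\<phi> z / of_real \<rho>)) - 3))"
    "(LINT z|N. indicator G z * (Re (q (\<phi> z / of_real \<rho>)) - 3)) \<le> A"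
proof -
  define h where "h z = q (\<phi> z / of_real \<rho>) - 3" for z
  have h: "h holomorphic_on \<Omega>" unfolding h_def[abs_def] by (intro holomorphic_intros holomorphic_phi_scaled[OF q(1)])
  have hc: "continuous_on \<Omega> (\<lambda>z. Re (h z))" by (intro continuous_on_Re holomorphic_on_imp_continuous_on h)
  note fc = pw_continuous[OF f]
  have n\<phi>: "continuous_on \<Omega> (\<lambda>z. norm (\<phi> z))" by (intro continuous_on_norm holomorphic_on_imp_continuous_on \<phi>)
  have G: "open G" "G \<subseteq> \<Omega>"
  proof -
    have "G = \<Omega> \<inter> (\<lambda>z. norm (\<phi> z)) -` {..<\<rho>}" by (auto simp: G_def)
    then show "open G" using continuous_open_preimage[OF n\<phi> op] by simp
  qed (auto simp: G_def)
  have GD: "G \<subseteq> D \<rho>" by (auto simp: G_def D_def)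
  have D\<Omega>: "D \<rho> \<subseteq> \<Omega>" by (auto simp: D_def)
  \<comment> \<open>The set where the harmonic piece takes over. The strict inequality
    \<open>bd\<close> on the boundary circle keeps this compact set inside the open
    \<open>G\<close>, as the gluing lemma requires.\<close>
  define T where "T = {z\<in>D \<rho>. pw f z \<le> Re (h z)}"
  have Tc: "compact T"
  proof -
    have "closed T" unfolding T_def
      by (rule continuous_on_closed_Collect_le[OF continuous_on_subset[OF fc D\<Omega>] continuous_on_subset[OF hc D\<Omega>] compact_imp_closed[OF compact_D[OF \<rho>(2)]]])
    from compact_Int_closed[OF compact_D[OF \<rho>(2)] this] show ?thesis by (rule back_subst) (auto simp: T_def)
  qed
  have bd: "Re (h z) < pw f z" if z: "z \<in> \<Omega>" "norm (\<phi> z) = \<rho>" for z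
  proof -
    have "norm (\<phi> z / of_real \<rho>) = 1" using z(2) \<rho>(1) by (simp add: phi_norm_scaled)
    from q(2)[OF this] show ?thesis using phi_scaled[OF z(1) \<rho>(1)] by (simp add: h_def)
  qed
  have TG: "T \<subseteq> G"
  proof
    fix z assume z: "z \<in> T"
    then have "norm (\<phi> z) \<noteq> \<rho>" using bd[of z] by (auto simp: T_def D_def)
    then show "z \<in> G" using z by (auto simp: T_def D_def G_def)
  qed
  define w where "w z = (if norm (\<phi> z) \<le> \<rho> then max (pw f z) (Re (h z)) else pw f z)" for z
  have wc: "continuous_on \<Omega> w"
    unfolding w_def[abs_def]
  proof (rule continuous_on_cases_le[OF _ _ n\<phi>])
    show "continuous_on {t \<in> \<Omega>. norm (\<phi> t) \<le> \<rho>} (\<lambda>z. max (pw f z) (Re (h z)))"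
      by (intro continuous_on_max continuous_on_subset[OF fc] continuous_on_subset[OF hc]) auto
    show "continuous_on {t \<in> \<Omega>. \<rho> \<le> norm (\<phi> t)} (pw f)" by (rule continuous_on_subset[OF fc]) auto
  qed (use bd in \<open>force simp: max_def\<close>)
  have sub: "submean_loc \<Omega> w"
  proof (rule submean_loc_glue[OF op fc submean_loc_powr[OF op f p] wc G holomorphic_on_subset[OF h G(2)] Tc TG])
    show "pw f z \<le> w z" if "z \<in> \<Omega>" for z by (simp add: w_def)
    show "Re (h z) \<le> w z" if "z \<in> G" for z using that by (simp add: w_def G_def)
    show "w z = pw f z \<or> z \<in> T \<and> w z = Re (h z)" if "z \<in> \<Omega>" for z
      using that by (auto simp: w_def T_def D_def max_def)
  qed
  \<comment> \<open>A level beyond \<open>D \<rho>\<close>: there \<open>w\<close> is the unmodified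
    \<open>pw f\<close>, while the sublevel set contains all of \<open>G\<close>.\<close>
  obtain r where r: "r < 0" "D \<rho> \<subseteq> sublevel \<Omega> u r" by (rule D_in_sublevel[OF \<rho>(2)])
  have Gr: "G \<subseteq> sublevel \<Omega> u r" using GD r(2) by blast
  have i: "integrable N (\<lambda>z. indicator G z * (Re (h z)))"
  proof -
    have "G \<in> sets borel" using G(1) by simp
    from radon_on_integrable_indicator[OF radon_N this level_integrable(2)[OF hc r(1)]]
    moreover have "(\<lambda>z. indicator G z * (indicator (sublevel \<Omega> u r) z * Re (h z))) = (\<lambda>z. indicator G z * Re (h z))"
      using Gr by (auto simp: fun_eq_iff indicator_def)
    ultimately show ?thesis by simp
  qed
  then show "integrable N (\<lambda>z. indicator G z * (Re (q (\<phi> z / of_real \<rho>)) - 3))" by (simp add: h_def)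
  have "(LINT z|N. indicator G z * (Re (h z))) \<le> sub_int w r" unfolding sub_int_def
  proof (rule integral_mono[OF i level_integrable(2)[OF wc r(1)]])
    fix z assume "z \<in> space N"
    show "indicator G z * Re (h z) \<le> indicator (sublevel \<Omega> u r) z * w z"
    proof (cases "z \<in> G")
      case True
      then show ?thesis using Gr by (auto simp: indicator_def w_def G_def)
    next
      case False
      have "0 \<le> w z" by (simp add: w_def le_max_iff_disj)
      then show ?thesis using False by (simp add: indicator_def)
    qed
  qed
  also have "\<dots> \<le> level_int w r" by (rule level_formula(1)[OF order_refl r(1) wc sub])
  also have "\<dots> \<le> level_int (pw f) r"
  proof (rule level_int_mono[OF wc fc r(1)])
    fix z assume "z \<in> \<Omega>" "u z = ereal r"
    then have "z \<notin> D \<rho>" using r(2) by (auto simp: sublevel_def)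
    then show "w z \<le> pw f z" using \<open>z \<in> \<Omega>\<close> by (simp add: w_def D_def)
  qed
  also have "\<dots> \<le> A" by (rule A[OF r(1)])
  finally show "(LINT z|N. indicator G z * (Re (q (\<phi> z / of_real \<rho>)) - 3)) \<le> A" by (simp add: h_def)
qed

end

section \<open>A harmonic majorant of finite mass\<close>

context disc_exhaustion begin

lemma positive_mass_disc:
  assumes "mass > 0" obtains s where "0 < s" "s < 1" "measure N (D s) > 0"
proof -
  have "\<exists>s. 0 < s \<and> s < 1 \<and> measure N (D s) > 0"
  proof (rule ccontr)
    assume "\<not> ?thesis"
    then have z: "measure N (D s) = 0" if "0 < s" "s < 1" for s
      using that measure_nonneg[of N "D s"] by (metis less_eq_real_def)
    define s where "s n = 1 - (1 - 1/2) / real (Suc n)" for n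
    have s: "0 < s n" "s n < 1" for n by (auto simp: s_def field_simps)
    have D: "D (s n) \<in> sets N" for n by (rule radon_on_sets[OF radon_N D_borel[OF s(2)]]) (auto simp: D_def)
    have "D (s n) \<in> null_sets N" for n using D z[OF s, of n] by (simp add: null_sets_def N.emeasure_eq_measure)
    then have "(\<Union>n. D (s n)) \<in> null_sets N" by (intro null_sets_UN)
    then have "measure N (\<Union>n. D (s n)) = 0" by (simp add: null_sets_def measure_def)
    moreover have "(\<Union>n. D (s n)) = \<Omega>"
    proof
      show "(\<Union>n. D (s n)) \<subseteq> \<Omega>" by (auto simp: D_def)
      show "\<Omega> \<subseteq> (\<Union>n. D (s n))"
      proof
        fix z assume "z \<in> \<Omega>"
        then have "\<forall>\<^sub>F n in sequentially. z \<in> D (s n)" unfolding s_def by (rule eventually_in_D)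
        then obtain n where "z \<in> D (s n)" using eventually_happens by fastforce
        then show "z \<in> (\<Union>n. D (s n))" by blast
      qed
    qed
    ultimately show False using assms by simp
  qed
  then show thesis using that by blast
qed

text \<open>The majorants \<open>q n\<close> belong to conformal discs that grow to \<Omega>, and
  \<open>majorant_mass\<close> bounds their \<open>N\<close>-masses by \<open>A + 3 * mass\<close>.
  On a disc \<open>D s0\<close> of positive mass the lower Harnack bound turns this into a bound on
  \<open>Re (q n 0)\<close>, and the upper one makes the \<open>q n\<close> a normal family. Fatou's
  lemma keeps the mass of the limit finite.\<close>

lemma harmonic_majorant:
  assumes f: "f holomorphic_on \<Omega>" and A: "\<And>r. r < 0 \<Longrightarrow> level_int (pw f) r \<le> A" and pos: "mass > 0"
  obtains E where "E holomorphic_on \<Omega>" "\<forall>z\<in>\<Omega>. pw f z + 1 \<le> Re (E z)" "integrable N (\<lambda>z. Re (E z))"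
proof -
  obtain s0 where s0: "0 < s0" "s0 < 1" "measure N (D s0) > 0" by (rule positive_mass_disc[OF pos]) blast
  define s' where "s' = (1 + s0) / 2"
  have s': "s0 < s'" "s' < 1" "0 < s'" using s0 by (auto simp: s'_def)
  \<comment> \<open>All radii are at least \<open>s0 / s'\<close>, so rescaling takes
    \<open>D s0\<close> into the disc of radius \<open>s'\<close> and the Harnack constants do not
    depend on \<open>n\<close>.\<close>
  define \<rho> where "\<rho> n = 1 - (1 - s0 / s') / real (Suc n)" for n
  have t: "0 < s0 / s'" "s0 / s' < 1" using s0 s' by auto
  have \<rho>: "0 < \<rho> n" "\<rho> n < 1" "s0 / s' \<le> \<rho> n" for n
  proof -
    have "(1 - s0 / s') / real (Suc n) \<le> (1 - s0 / s') / 1" using t by (intro divide_left_mono) auto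
    then show "s0 / s' \<le> \<rho> n" by (simp add: \<rho>_def)
    then show "0 < \<rho> n" using t by linarith
    have "0 < (1 - s0 / s') / real (Suc n)" using t by (intro divide_pos_pos) auto
    then show "\<rho> n < 1" by (simp add: \<rho>_def)
  qed
  have \<rho>1: "\<rho> \<longlonglongrightarrow> 1" unfolding \<rho>_def[abs_def] by (rule rho_tendsto)
  have "\<exists>q. q holomorphic_on UNIV \<and> Im (q 0) = 0 \<and> (\<forall>z. norm z = 1 \<longrightarrow> Re (q z) \<le> pw f (\<psi> (of_real (\<rho> n) * z)) + 2 * 1)
    \<and> (\<forall>z. norm z < 1 \<longrightarrow> pw f (\<psi> (of_real (\<rho> n) * z)) + 1 \<le> Re (q z))" for n
    by (rule majorant_on_circle[OF f \<rho>(1,2) zero_less_one]) blast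
  then obtain q where q: "\<And>n. q n holomorphic_on UNIV" "\<And>n. Im (q n 0) = 0"
    "\<And>n z. norm z = 1 \<Longrightarrow> Re (q n z) \<le> pw f (\<psi> (of_real (\<rho> n) * z)) + 2"
    "\<And>n z. norm z < 1 \<Longrightarrow> pw f (\<psi> (of_real (\<rho> n) * z)) + 1 \<le> Re (q n z)"
    by (simp only: mult_1_right) metis
  have qpos: "Re (q n z) > 0" if "norm z < 1" for n z
  proof -
    have "0 \<le> pw f (\<psi> (of_real (\<rho> n) * z))" by simp
    then show ?thesis using q(4)[OF that, of n] by linarith
  qed
  have qh: "q n holomorphic_on ball 0 1" for n by (rule holomorphic_on_subset[OF q(1)]) simp
  define G where "G n = {z\<in>\<Omega>. norm (\<phi> z) < \<rho> n}" for n
  define h where "h n z = q n (\<phi> z / of_real (\<rho> n))" for n z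
  have hpos: "Re (h n z) > 0" if "z \<in> G n" for n z
    unfolding h_def using that \<rho>(1)[of n] by (intro qpos) (simp add: phi_norm_scaled G_def)
  have "A \<ge> 0"
  proof -
    have "0 \<le> level_int (pw f) (-1)" unfolding level_int_def by (rule Bochner_Integration.integral_nonneg) auto
    then show ?thesis using A[of "-1"] by simp
  qed
  have G: "G n \<in> sets borel" "G n \<subseteq> \<Omega>" for n
  proof -
    have "G n = \<Omega> \<inter> (\<lambda>z. norm (\<phi> z)) -` {..<\<rho> n}" by (auto simp: G_def)
    then show "G n \<in> sets borel"
      using continuous_open_preimage[OF continuous_on_norm[OF holomorphic_on_imp_continuous_on[OF \<phi>]] op] by simp
  qed (auto simp: G_def)
  have GN: "G n \<in> sets N" for n by (rule radon_on_sets[OF radon_N G])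
  have mm: "integrable N (\<lambda>z. indicator (G n) z * (Re (h n z) - 3))"
    "(LINT z|N. indicator (G n) z * (Re (h n z) - 3)) \<le> A" for n
    unfolding G_def h_def by (rule majorant_mass[OF f _ \<rho>(1,2) q(1)], rule A, assumption, rule q(3), assumption)+
  have iG: "integrable N (\<lambda>z. indicator (G n) z * (3::real))" for n
    using GN by (intro N.integrable_const_bound[of _ 3]) (auto simp: indicator_def)
  have ih: "integrable N (\<lambda>z. indicator (G n) z * Re (h n z))" and
    hA: "(LINT z|N. indicator (G n) z * Re (h n z)) \<le> A + 3 * mass" for n
  proof -
    have eq: "(\<lambda>z. indicator (G n) z * Re (h n z)) = (\<lambda>z. indicator (G n) z * (Re (h n z) - 3) + indicator (G n) z * 3)"
      by (auto simp: fun_eq_iff algebra_simps)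
    show "integrable N (\<lambda>z. indicator (G n) z * Re (h n z))"
      unfolding eq using mm(1) iG by (rule Bochner_Integration.integrable_add)
    have "(LINT z|N. indicator (G n) z * (3::real)) \<le> (LINT z|N. 3)"
      by (rule integral_mono[OF iG N.integrable_const]) (auto simp: indicator_def)
    also have "\<dots> = 3 * mass" by (simp add: space_N)
    finally show "(LINT z|N. indicator (G n) z * Re (h n z)) \<le> A + 3 * mass"
      unfolding eq Bochner_Integration.integral_add[OF mm(1) iG] using mm(2)[of n] by linarith
  qed
  define B where "B = (A + 3 * mass) / ((1 - s') / (1 + s') * measure N (D s0))"
  have q0: "Re (q n 0) \<le> B" for n
  proof -
    let ?c = "(1 - s') / (1 + s') * Re (q n 0)"
    have DN: "D s0 \<in> sets N" by (rule radon_on_sets[OF radon_N D_borel[OF s0(2)]]) (auto simp: D_def)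
    have "s0 < \<rho> n"
    proof -
      have "s0 * s' < s0 * 1" using s0 s' by (intro mult_strict_left_mono) auto
      then have "s0 < s0 / s'" using s' by (simp add: field_simps)
      then show ?thesis using \<rho>(3)[of n] by linarith
    qed
    then have DG: "D s0 \<subseteq> G n" by (auto simp: D_def G_def)
    have "?c * measure N (D s0) = (LINT z|N. indicator (D s0) z * ?c)"
      using DN by (simp add: sets.Int_space_eq2)
    also have "\<dots> \<le> (LINT z|N. indicator (G n) z * Re (h n z))"
    proof (rule integral_mono[OF _ ih])
      show "integrable N (\<lambda>z. indicator (D s0) z * ?c)"
        using DN by (intro N.integrable_const_bound[of _ "\<bar>?c\<bar>"]) (auto simp: indicator_def)
      fix z assume "z \<in> space N"
      show "indicator (D s0) z * ?c \<le> indicator (G n) z * Re (h n z)"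
      proof (cases "z \<in> D s0")
        case True
        have "norm (\<phi> z) / \<rho> n \<le> s0 / \<rho> n" using True \<rho>(1)[of n] by (intro divide_right_mono) (auto simp: D_def)
        also have "\<dots> \<le> s'" using \<rho>(1,3)[of n] s' by (simp add: field_simps)
        finally have "norm (\<phi> z / of_real (\<rho> n)) \<le> s'" using \<rho>(1)[of n] by (simp add: phi_norm_scaled)
        from Harnack(2)[OF qh qpos q(2) this s'(2)] show ?thesis using True DG by (auto simp: h_def)
      next
        case False then show ?thesis using hpos[of z n] by (auto simp: indicator_def)
      qed
    qed
    also have "\<dots> \<le> A + 3 * mass" by (rule hA)
    finally have "Re (q n 0) * ((1 - s') / (1 + s') * measure N (D s0)) \<le> A + 3 * mass" by (simp add: mult_ac)
    moreover have "0 < (1 - s') / (1 + s') * measure N (D s0)" using s0 s' by simp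
    ultimately show ?thesis unfolding B_def by (intro mult_imp_le_div_pos)
  qed
  have bd: "\<exists>B. \<forall>n z. norm z \<le> s \<longrightarrow> norm (q n z) \<le> B" if s: "0 < s" "s < 1" for s :: real
  proof -
    show ?thesis
    proof (intro exI[of _ "(1 + s) / (1 - s) * B"] allI impI)
      fix n and z :: complex assume "norm z \<le> s"
      from Harnack(1)[OF qh qpos q(2) this s(2)]
      have "norm (q n z) \<le> (1 + s) / (1 - s) * Re (q n 0)" .
      also have "\<dots> \<le> (1 + s) / (1 - s) * B" using s q0 by (intro mult_left_mono) auto
      finally show "norm (q n z) \<le> (1 + s) / (1 - s) * B" .
    qed
  qed
  obtain e k where e: "e holomorphic_on ball 0 1" "strict_mono (k :: nat \<Rightarrow> nat)"
    "\<forall>s<1. uniform_limit (cball 0 s) (\<lambda>n. q (k n)) e sequentially"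
    by (rule Montel_disc[OF qh bd]) blast
  have \<rho>k: "(\<lambda>n. \<rho> (k n)) \<longlonglongrightarrow> 1" using LIMSEQ_subseq_LIMSEQ[OF \<rho>1 e(2)] by (simp add: o_def)
  define E where "E z = e (\<phi> z)" for z
  have E: "E holomorphic_on \<Omega>"
  proof -
    have "\<phi> ` \<Omega> \<subseteq> ball 0 1" using \<phi>_\<Omega> by auto
    from holomorphic_on_compose_gen[OF \<phi> e(1) this] show ?thesis by (simp add: E_def[abs_def] o_def)
  qed
  have lim: "(\<lambda>n. indicator (G (k n)) z * Re (h (k n) z)) \<longlonglongrightarrow> Re (E z)" and ge: "pw f z + 1 \<le> Re (E z)" if z: "z \<in> \<Omega>" for z
  proof -
    define s where "s = (1 + norm (\<phi> z)) / 2"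
    have s: "norm (\<phi> z) < s" "s < 1" "0 < s" using \<phi>_\<Omega>[OF z] by (auto simp: s_def add_pos_nonneg)
    have ec: "continuous_on (cball 0 s) e"
      by (rule continuous_on_subset[OF holomorphic_on_imp_continuous_on[OF e(1)]]) (use s in auto)
    have x0: "(\<lambda>n. \<phi> z / of_real (\<rho> (k n))) \<longlonglongrightarrow> \<phi> z"
      using tendsto_divide[OF tendsto_const tendsto_of_real[OF \<rho>k], of "\<phi> z"] by simp
    have "\<forall>\<^sub>F n in sequentially. norm (\<phi> z / of_real (\<rho> (k n))) < s"
      using order_tendstoD(2)[OF tendsto_norm[OF x0] s(1)] .
    then have ev: "\<forall>\<^sub>F n in sequentially. norm (\<phi> z / of_real (\<rho> (k n))) < s" .
    \<comment> \<open>The rescaled points lie in the disc of uniform convergence only from some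
      index on; replacing the others by \<open>\<phi> z\<close> lets
      \<open>uniform_limit_moving\<close> apply to the whole sequence.\<close>
    define x where "x n = (if norm (\<phi> z / of_real (\<rho> (k n))) < s then \<phi> z / of_real (\<rho> (k n)) else \<phi> z)" for n
    have xe: "\<forall>\<^sub>F n in sequentially. x n = \<phi> z / of_real (\<rho> (k n))" using ev by eventually_elim (simp add: x_def)
    have "x \<longlonglongrightarrow> \<phi> z" using tendsto_cong[OF xe] x0 by simp
    from uniform_limit_moving[OF e(3)[rule_format, OF s(2)] ec this]
    have "(\<lambda>n. q (k n) (x n)) \<longlonglongrightarrow> e (\<phi> z)" using s(1) by (auto simp: x_def)
    then have l: "(\<lambda>n. Re (q (k n) (x n))) \<longlonglongrightarrow> Re (E z)" unfolding E_def by (rule tendsto_Re)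
    have "\<forall>\<^sub>F n in sequentially. Re (q (k n) (x n)) = indicator (G (k n)) z * Re (h (k n) z)"
      using xe ev
    proof eventually_elim
      case (elim n)
      have "norm (\<phi> z) / \<rho> (k n) < s" using elim(2) \<rho>(1)[of "k n"] by (simp add: phi_norm_scaled)
      then have "norm (\<phi> z) / \<rho> (k n) < 1" using s(2) by linarith
      then have "z \<in> G (k n)" using z \<rho>(1)[of "k n"] by (simp add: G_def pos_divide_less_eq)
      then show ?case using elim(1) by (simp add: h_def)
    qed
    from tendsto_cong[OF this] l show "(\<lambda>n. indicator (G (k n)) z * Re (h (k n) z)) \<longlonglongrightarrow> Re (E z)" by simp
    have "(\<lambda>n. q (k n) (\<phi> z)) \<longlonglongrightarrow> e (\<phi> z)"
      by (rule tendsto_uniform_limitI[OF e(3)[rule_format, OF s(2)]]) (use s in auto)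
    then have l2: "(\<lambda>n. Re (q (k n) (\<phi> z))) \<longlonglongrightarrow> Re (E z)" unfolding E_def by (rule tendsto_Re)
    have "continuous_on (ball 0 1) (pw (\<lambda>z. f (\<psi> z)))" by (rule pw_continuous[OF holomorphic_psi[OF f]])
    then have "isCont (pw (\<lambda>z. f (\<psi> z))) (\<phi> z)" using \<phi>_\<Omega>[OF z] by (simp add: continuous_on_eq_continuous_at)
    moreover have "(\<lambda>n. of_real (\<rho> (k n)) * \<phi> z) \<longlonglongrightarrow> \<phi> z"
      using tendsto_mult[OF tendsto_of_real[OF \<rho>k] tendsto_const, of "\<phi> z"] by simp
    ultimately have "(\<lambda>n. pw (\<lambda>z. f (\<psi> z)) (of_real (\<rho> (k n)) * \<phi> z)) \<longlonglongrightarrow> pw (\<lambda>z. f (\<psi> z)) (\<phi> z)"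
      by (rule isCont_tendsto_compose)
    then have l3: "(\<lambda>n. pw f (\<psi> (of_real (\<rho> (k n)) * \<phi> z)) + 1) \<longlonglongrightarrow> pw f z + 1"
      using \<phi>_\<Omega>[OF z] by (auto intro!: tendsto_add)
    show "pw f z + 1 \<le> Re (E z)"
      by (rule LIMSEQ_le[OF l3 l2]) (use q(4) \<phi>_\<Omega>[OF z] in blast)
  qed
  have Em: "(\<lambda>z. Re (E z)) \<in> borel_measurable N"
    by (rule continuous_N_measurable) (intro continuous_on_Re holomorphic_on_imp_continuous_on E)
  have "(\<integral>\<^sup>+z. ennreal (Re (E z)) \<partial>N) = (\<integral>\<^sup>+z. liminf (\<lambda>n. ennreal (indicator (G (k n)) z * Re (h (k n) z))) \<partial>N)"
  proof (rule nn_integral_cong)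
    fix z assume "z \<in> space N"
    then have "z \<in> \<Omega>" by (simp add: space_N)
    from lim_imp_Liminf[OF sequentially_bot tendsto_ennrealI[OF lim[OF this]]]
    show "ennreal (Re (E z)) = liminf (\<lambda>n. ennreal (indicator (G (k n)) z * Re (h (k n) z)))" by simp
  qed
  also have "\<dots> \<le> liminf (\<lambda>n. \<integral>\<^sup>+z. ennreal (indicator (G (k n)) z * Re (h (k n) z)) \<partial>N)"
    by (rule nn_integral_liminf) (use ih in measurable)
  also have "\<dots> \<le> liminf (\<lambda>n. ennreal (A + 3 * mass))"
  proof (rule Liminf_mono[OF always_eventually], rule allI)
    fix n
    have "(\<integral>\<^sup>+z. ennreal (indicator (G (k n)) z * Re (h (k n) z)) \<partial>N) = ennreal (LINT z|N. indicator (G (k n)) z * Re (h (k n) z))"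
      by (rule nn_integral_eq_integral[OF ih]) (use hpos in \<open>auto simp: indicator_def less_imp_le\<close>)
    also have "\<dots> \<le> ennreal (A + 3 * mass)" by (rule ennreal_leI[OF hA])
    finally show "(\<integral>\<^sup>+z. ennreal (indicator (G (k n)) z * Re (h (k n) z)) \<partial>N) \<le> ennreal (A + 3 * mass)" .
  qed
  also have "\<dots> = ennreal (A + 3 * mass)" by (simp add: Liminf_const)
  also have "\<dots> < \<infinity>" by simp
  finally have fin: "(\<integral>\<^sup>+z. ennreal (Re (E z)) \<partial>N) < \<infinity>" .
  have "integrable N (\<lambda>z. Re (E z))"
  proof (rule integrableI_nonneg[OF Em _ fin])
    show "AE z in N. 0 \<le> Re (E z)"
    proof (rule AE_I2)
      fix z assume "z \<in> space N"
      then have "pw f z + 1 \<le> Re (E z)" using ge by (simp add: space_N)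
      moreover have "0 \<le> pw f z" by simp
      ultimately show "0 \<le> Re (E z)" by linarith
    qed
  qed
  then show thesis using E ge that by blast
qed

text \<open>Unlike \<open>\<bar>f \<circ> \<psi>\<bar> powr p\<close>, a function \<open>\<bar>k\<bar>\<^sup>2\<close> with \<open>k\<close> in the Hardy space of exponent 2 is uniformly
  integrable over circles, because \<open>k\<close> is approximated by its dilations.\<close>

lemma square_majorant:
  assumes f: "f holomorphic_on \<Omega>" and E: "E holomorphic_on \<Omega>" "\<And>z. z \<in> \<Omega> \<Longrightarrow> pw f z + 1 \<le> Re (E z)"
  obtains k where "k holomorphic_on ball 0 1"
    "\<forall>z. norm z < 1 \<longrightarrow> pw f (\<psi> z) \<le> (cmod (k z))\<^sup>2 \<and> (cmod (k z))\<^sup>2 \<le> 3 * Re (E (\<psi> z))"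
proof -
  define \<rho> where "\<rho> n = 1 - (1 - 1/2) / real (Suc n)" for n
  have \<rho>: "0 < \<rho> n" "\<rho> n < 1" for n by (auto simp: \<rho>_def field_simps)
  have \<rho>1: "\<rho> \<longlonglongrightarrow> 1" unfolding \<rho>_def[abs_def] by (rule rho_tendsto)
  have ex: "\<exists>Q. Q holomorphic_on UNIV \<and> (\<forall>z. norm z < 1 \<longrightarrow> pw f (\<psi> (of_real (\<rho> n) * z)) \<le> exp (Re (Q z)) \<and>
     exp (Re (Q z)) \<le> 3 * Re (E (\<psi> (of_real (\<rho> n) * z))))" for n
  proof -
    note fd = holomorphic_dilated[OF f \<rho>[of n]] and Ed = holomorphic_dilated[OF E(1) \<rho>[of n]]
    let ?g = "\<lambda>z. pw f (\<psi> (of_real (\<rho> n) * z))"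
    have g1: "0 < 1 + ?g z" for z by (simp add: add_pos_nonneg)
    have "continuous_on (sphere 0 1) ?g" by (rule continuous_on_subset[OF pw_continuous[OF fd]]) auto
    \<comment> \<open>Adding 1 keeps the logarithm finite at zeros of \<open>f\<close>, and is
      absorbed by the margin 1 in the majorant \<open>E\<close>. The approximation error 1 in the
      exponent costs the factor \<open>exp 1\<close>, which is at most 3.\<close>
    then have "continuous_on (sphere 0 1) (\<lambda>z. ln (1 + ?g z))"
      using g1 by (intro continuous_on_ln continuous_on_add continuous_on_const) (auto simp: less_imp_neq[THEN not_sym])
    then obtain Q where Q: "Q holomorphic_on UNIV"
      "\<And>z. norm z = 1 \<Longrightarrow> ln (1 + ?g z) \<le> Re (Q z) \<and> Re (Q z) \<le> ln (1 + ?g z) + 1"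
      using circle_approximation[of _ 1] zero_less_one by blast
    have Qe: "1 + ?g z \<le> exp (Re (Q z))" "exp (Re (Q z)) \<le> 3 * (1 + ?g z)" if "norm z = 1" for z
    proof -
      have "exp (ln (1 + ?g z)) \<le> exp (Re (Q z))" using Q(2)[OF that] by simp
      then show "1 + ?g z \<le> exp (Re (Q z))" using g1[of z] by simp
      have "exp (Re (Q z)) \<le> exp (ln (1 + ?g z) + 1)" using Q(2)[OF that] by simp
      also have "\<dots> = (1 + ?g z) * exp 1" using g1[of z] by (simp add: exp_add)
      also have "\<dots> \<le> (1 + ?g z) * 3" by (intro mult_left_mono exp_le) (use g1[of z] in simp)
      finally show "exp (Re (Q z)) \<le> 3 * (1 + ?g z)" by simp
    qed
    \<comment> \<open>Multiplication by \<open>exp (- Q z / p)\<close> turns the comparison of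
      \<open>pw f\<close> with \<open>exp (Re (Q z))\<close> into the bound 1 for the
      \<open>p\<close>-th power of the modulus of a holomorphic function, which
      \<open>disc_dominate\<close> carries from the circle into the disc.\<close>
    have Fe: "cmod (f (\<psi> (of_real (\<rho> n) * z)) * exp (- Q z / of_real p)) powr p = ?g z * exp (- Re (Q z))" for z
      using p by (simp add: norm_mult powr_mult exp_powr_real Re_divide_of_real)
    have iff: "a * exp (- b) \<le> 1 \<longleftrightarrow> a \<le> exp b" for a b :: real by (simp add: exp_minus field_simps)
    have Qc: "Q holomorphic_on cball 0 1" by (rule holomorphic_on_subset[OF Q(1)]) simp
    show ?thesis
    proof (intro exI[of _ Q] conjI Q(1) allI impI)
      fix z :: complex assume z: "norm z < 1"
      have "cmod (f (\<psi> (of_real (\<rho> n) * z)) * exp (- Q z / of_real p)) powr p \<le> Re 1"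
      proof (rule disc_dominate[OF _ _ p _ z, of "\<lambda>z. f (\<psi> (of_real (\<rho> n) * z)) * exp (- Q z / of_real p)" "\<lambda>_. 1"])
        show "(\<lambda>z. f (\<psi> (of_real (\<rho> n) * z)) * exp (- Q z / of_real p)) holomorphic_on cball 0 1"
          using p by (intro holomorphic_intros fd Qc) auto
        fix w :: complex assume "norm w = 1"
        then have "?g w \<le> exp (Re (Q w))" using Qe(1)[of w] by linarith
        then show "cmod (f (\<psi> (of_real (\<rho> n) * w)) * exp (- Q w / of_real p)) powr p \<le> Re 1"
          unfolding Fe one_complex.sel iff .
      qed (rule holomorphic_on_const)
      then show "?g z \<le> exp (Re (Q z))" unfolding Fe one_complex.sel iff .
      have "cmod (exp (Q z)) powr 1 \<le> Re (3 * E (\<psi> (of_real (\<rho> n) * z)))"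
      proof (rule disc_dominate[OF _ _ order_refl _ z])
        show "(\<lambda>z. exp (Q z)) holomorphic_on cball 0 1" by (intro holomorphic_intros Qc)
        show "(\<lambda>z. 3 * E (\<psi> (of_real (\<rho> n) * z))) holomorphic_on cball 0 1" by (intro holomorphic_intros Ed)
        fix w :: complex assume w: "norm w = 1"
        then have "\<psi> (of_real (\<rho> n) * w) \<in> \<Omega>" using \<psi>_disc scaled_in_disc[OF \<rho>, of w] by simp
        from E(2)[OF this] Qe(2)[OF w] show "cmod (exp (Q w)) powr 1 \<le> Re (3 * E (\<psi> (of_real (\<rho> n) * w)))" by simp
      qed
      then show "exp (Re (Q z)) \<le> 3 * Re (E (\<psi> (of_real (\<rho> n) * z)))" by simp
    qed
  qed
  obtain Q where Q: "\<And>n. Q n holomorphic_on UNIV"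
    "\<And>n z. norm z < 1 \<Longrightarrow> pw f (\<psi> (of_real (\<rho> n) * z)) \<le> exp (Re (Q n z))"
    "\<And>n z. norm z < 1 \<Longrightarrow> exp (Re (Q n z)) \<le> 3 * Re (E (\<psi> (of_real (\<rho> n) * z)))"
    using ex by metis
  \<comment> \<open>A holomorphic square root of \<open>exp (Q n z)\<close>, so that
    \<open>exp (Re (Q n z))\<close> is the square of a modulus and Parseval applies to it.\<close>
  define k where "k n z = exp (Q n z / 2)" for n z
  have k2: "(cmod (k n z))\<^sup>2 = exp (Re (Q n z))" for n z
    by (simp add: k_def exp_double[symmetric])
  have kh: "k n holomorphic_on ball 0 1" for n
    unfolding k_def[abs_def] by (intro holomorphic_intros holomorphic_on_subset[OF Q(1)]) auto
  have Eb: "continuous_on (ball 0 1) (\<lambda>z. Re (E (\<psi> z)))"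
    by (intro continuous_on_Re holomorphic_on_imp_continuous_on holomorphic_psi[OF E(1)])
  have bd: "\<exists>B. \<forall>n z. norm z \<le> s \<longrightarrow> norm (k n z) \<le> B" if s: "0 < s" "s < 1" for s :: real
  proof -
    have "compact ((\<lambda>z. Re (E (\<psi> z))) ` cball 0 s)"
      by (intro compact_continuous_image continuous_on_subset[OF Eb] compact_cball) (use s in auto)
    then have "bounded ((\<lambda>z. Re (E (\<psi> z))) ` cball 0 s)" by (rule compact_imp_bounded)
    then obtain B where "\<forall>x\<in>(\<lambda>z. Re (E (\<psi> z))) ` cball 0 s. norm x \<le> B" unfolding bounded_iff by blast
    then have B: "\<bar>Re (E (\<psi> z))\<bar> \<le> B" if "norm z \<le> s" for z using that by auto
    show ?thesis
    proof (intro exI[of _ "sqrt (3 * B)"] allI impI real_le_rsqrt)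
      fix n and z :: complex assume z: "norm z \<le> s"
      have "\<rho> n * norm z \<le> 1 * norm z" using \<rho>[of n] by (intro mult_right_mono) auto
      then have "norm (of_real (\<rho> n) * z) \<le> s" using z \<rho>[of n] by (simp add: norm_mult)
      from B[OF this] Q(3)[of z n] show "(norm (k n z))\<^sup>2 \<le> 3 * B" using z s(2) by (simp add: k2)
    qed
  qed
  obtain l r where l: "l holomorphic_on ball 0 1" "strict_mono (r :: nat \<Rightarrow> nat)"
    "\<forall>s<1. uniform_limit (cball 0 s) (\<lambda>n. k (r n)) l sequentially"
    by (rule Montel_disc[OF kh bd]) blast
  have \<rho>r: "(\<lambda>n. \<rho> (r n)) \<longlonglongrightarrow> 1" using LIMSEQ_subseq_LIMSEQ[OF \<rho>1 l(2)] by (simp add: o_def)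
  show thesis
  proof (rule that[OF l(1)], intro allI impI)
    fix z :: complex assume z: "norm z < 1"
    have "(\<lambda>n. k (r n) z) \<longlonglongrightarrow> l z"
      by (rule tendsto_uniform_limitI[OF l(3)[rule_format, OF z]]) auto
    then have lk: "(\<lambda>n. (cmod (k (r n) z))\<^sup>2) \<longlonglongrightarrow> (cmod (l z))\<^sup>2" by (intro tendsto_intros)
    have \<rho>z: "(\<lambda>n. of_real (\<rho> (r n)) * z) \<longlonglongrightarrow> z"
      using tendsto_mult[OF tendsto_of_real[OF \<rho>r] tendsto_const, of z] by simp
    have "isCont (pw (\<lambda>z. f (\<psi> z))) z" "isCont (\<lambda>z. Re (E (\<psi> z))) z"
      using pw_continuous[OF holomorphic_psi[OF f]] Eb z by (simp_all add: continuous_on_eq_continuous_at)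
    from isCont_tendsto_compose[OF this(1) \<rho>z] isCont_tendsto_compose[OF this(2) \<rho>z]
    have lf: "(\<lambda>n. pw f (\<psi> (of_real (\<rho> (r n)) * z))) \<longlonglongrightarrow> pw f (\<psi> z)"
      and lE: "(\<lambda>n. 3 * Re (E (\<psi> (of_real (\<rho> (r n)) * z)))) \<longlonglongrightarrow> 3 * Re (E (\<psi> z))" by (auto intro!: tendsto_mult)
    show "pw f (\<psi> z) \<le> (cmod (l z))\<^sup>2 \<and> (cmod (l z))\<^sup>2 \<le> 3 * Re (E (\<psi> z))"
      using LIMSEQ_le[OF lf lk] LIMSEQ_le[OF lk lE] Q(2,3)[OF z] by (simp add: k2)
  qed
qed

end

section \<open>Approximation in the Hardy space\<close>

text \<open>Used for the multiplier \<open>1 / (1 + x)\<close> with \<open>x = d * E z\<close>,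
  whose distance from 1 is the modulus of \<open>x / (1 + x)\<close>. The last estimate bounds a
  square by the real part of a holomorphic function, whose circle means equal its value at
  0.\<close>

lemma one_minus_inverse_bounds:
  fixes x :: complex
  assumes "0 \<le> Re x"
  shows "cmod (1 / (1 + x)) \<le> 1" "cmod (1 - 1 / (1 + x)) \<le> 1" "cmod (1 - 1 / (1 + x)) \<le> cmod x"
    "(cmod (1 - 1 / (1 + x)))\<^sup>2 \<le> Re (1 - 1 / (1 + x))"
proof -
  have n0: "1 + x \<noteq> 0" using assms by (auto simp: complex_eq_iff)
  have "1 \<le> Re (1 + x)" using assms by simp
  then have n1: "1 \<le> cmod (1 + x)" using complex_Re_le_cmod[of "1 + x"] by linarith
  then have n2: "0 < cmod (1 + x)" by linarith
  then show "cmod (1 / (1 + x)) \<le> 1" using n1 by (simp add: norm_divide pos_divide_le_eq)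
  have eq: "1 - 1 / (1 + x) = x / (1 + x)" using n0 by (simp add: field_simps)
  have sq: "(cmod x)\<^sup>2 + Re x = Re (x * cnj (1 + x))" "(cmod x)\<^sup>2 \<le> (cmod (1 + x))\<^sup>2"
    using assms unfolding cmod_power2 by (simp_all add: algebra_simps power2_eq_square)
  then have xx: "cmod x \<le> cmod (1 + x)" by (simp add: power2_le_iff_abs_le)
  then show "cmod (1 - 1 / (1 + x)) \<le> 1" unfolding eq norm_divide using n2 by (simp add: pos_divide_le_eq)
  show "cmod (1 - 1 / (1 + x)) \<le> cmod x"
    unfolding eq norm_divide using n1 by (simp add: divide_le_eq mult_le_cancel_left1)
  have "Re (x / (1 + x)) = Re (x * cnj (1 + x)) / (cmod (1 + x))\<^sup>2" by (simp only: complex_div_cnj[of x] Re_divide_of_real flip: of_real_power)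
  then have "Re (x / (1 + x)) = ((cmod x)\<^sup>2 + Re x) / (cmod (1 + x))\<^sup>2" using sq(1) by simp
  also have "\<dots> \<ge> (cmod x)\<^sup>2 / (cmod (1 + x))\<^sup>2" using assms by (intro divide_right_mono) auto
  finally show "(cmod (1 - 1 / (1 + x)))\<^sup>2 \<le> Re (1 - 1 / (1 + x))" unfolding eq by (simp add: norm_divide power_divide)
qed

text \<open>Plays the part of the Cauchy-Schwarz inequality: means of moduli are bounded through
  means of squares, with \<open>t\<close> free to balance the two terms.\<close>

lemma le_plus_square: fixes x t :: real assumes "t > 0" shows "x \<le> t + x\<^sup>2 / t"
proof -
  have "0 \<le> (x - t / 2)\<^sup>2 + 3 / 4 * t\<^sup>2" by simp
  then have "x * t \<le> t * t + x * x" by (simp add: power2_eq_square algebra_simps)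
  then show ?thesis using assms by (simp add: field_simps power2_eq_square)
qed

lemma norm_sum_square_le: "(cmod (a + b))\<^sup>2 \<le> 2 * (cmod a)\<^sup>2 + 2 * (cmod b)\<^sup>2"
proof -
  have "(cmod (a + b))\<^sup>2 + (cmod (a - b))\<^sup>2 = 2 * (cmod a)\<^sup>2 + 2 * (cmod b)\<^sup>2"
    unfolding cmod_power2 by (simp add: algebra_simps power2_eq_square)
  then show ?thesis using zero_le_power2[of "cmod (a - b)"] by linarith
qed

lemma powr_add_le: fixes x y p :: real assumes "0 \<le> x" "0 \<le> y" "0 \<le> p" shows "(x + y) powr p \<le> 2 powr p * (x powr p + y powr p)"
proof -
  have "(x + y) powr p \<le> (2 * max x y) powr p" using assms by (intro powr_mono2) auto
  also have "\<dots> = 2 powr p * max x y powr p" using assms by (intro powr_mult)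
  also have "max x y powr p \<le> x powr p + y powr p" by (auto simp: max_def)
  finally show ?thesis by simp
qed

context disc_exhaustion begin

lemma sphere_disc: "0 < \<rho> \<Longrightarrow> \<rho> < 1 \<Longrightarrow> sphere 0 \<bar>\<rho>\<bar> \<subseteq> ball (0::complex) 1"
  by auto

text \<open>\<open>F = f / (1 + d * E)\<close> is bounded because \<open>pw f \<le> Re E\<close>.
  For the error, \<open>pw f\<close> is first replaced by \<open>(cmod (k z))\<^sup>2\<close> and
  then \<open>k\<close> by its dilate. The dilation error is small in mean against any factor of
  modulus at most 1. Against the dilate, which is bounded by \<open>M\<close>, the factor
  \<open>1 - 1 / (1 + d * E)\<close> is small in mean, since its mean is governed by
  \<open>d * E 0\<close>.\<close>

lemma bounded_cut:
  assumes f: "f holomorphic_on \<Omega>" and E: "E holomorphic_on \<Omega>" "\<And>z. z \<in> \<Omega> \<Longrightarrow> pw f z + 1 \<le> Re (E z)" and c: "c > 0"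
  obtains F B where "F holomorphic_on \<Omega>" "\<forall>z\<in>\<Omega>. cmod (F z) \<le> B"
    "\<forall>z\<in>\<Omega>. pw (\<lambda>z. f z - F z) z \<le> Re (E z)"
    "\<forall>\<rho>. 0 < \<rho> \<and> \<rho> < 1 \<longrightarrow> cmean (\<lambda>z. pw (\<lambda>z. f z - F z) (\<psi> z)) 0 \<rho> \<le> c"
proof -
  have E1: "1 \<le> Re (E z)" if "z \<in> \<Omega>" for z
  proof -
    have "0 \<le> pw f z" by simp
    then show ?thesis using E(2)[OF that] by linarith
  qed
  obtain k where k: "k holomorphic_on ball 0 1"
    "\<forall>z. norm z < 1 \<longrightarrow> pw f (\<psi> z) \<le> (cmod (k z))\<^sup>2 \<and> (cmod (k z))\<^sup>2 \<le> 3 * Re (E (\<psi> z))"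
    by (rule square_majorant[OF f E]) blast
  have kc: "continuous_on (ball 0 1) k" by (rule holomorphic_on_imp_continuous_on[OF k(1)])
  \<comment> \<open>The final bound has three terms, each at most \<open>c / 4\<close>: twice
    \<open>c / 8\<close> from the dilation, \<open>2 * M\<^sup>2 * t\<close>, and
    \<open>2 * M\<^sup>2 / t * (d * cmod (E 0))\<close>. The last two fix \<open>t\<close> and then
    \<open>d\<close>.\<close>
  have c2: "c / 8 > 0" using c by simp
  obtain s where s: "0 < s" "s < 1"
    "\<And>\<rho>. 0 < \<rho> \<Longrightarrow> \<rho> < 1 \<Longrightarrow> cmean (\<lambda>z. (cmod (k z - k (of_real s * z)))\<^sup>2) 0 \<rho> \<le> c / 8"
  proof (rule H2_dilation[OF k(1) _ c2])
    fix \<rho> :: real assume \<rho>: "0 < \<rho>" "\<rho> < 1"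
    have "cmean (\<lambda>z. (cmod (k z))\<^sup>2) 0 \<rho> \<le> cmean (\<lambda>z. Re (3 * E (\<psi> z))) 0 \<rho>"
    proof (rule cmean_mono)
      show "continuous_on (sphere 0 \<bar>\<rho>\<bar>) (\<lambda>z. (cmod (k z))\<^sup>2)"
        by (intro continuous_intros continuous_on_subset[OF kc sphere_disc[OF \<rho>]])
      show "continuous_on (sphere 0 \<bar>\<rho>\<bar>) (\<lambda>z. Re (3 * E (\<psi> z)))"
        by (intro continuous_intros continuous_on_subset[OF holomorphic_on_imp_continuous_on[OF holomorphic_psi[OF E(1)]] sphere_disc[OF \<rho>]])
      show "(cmod (k w))\<^sup>2 \<le> Re (3 * E (\<psi> w))" if "w \<in> sphere 0 \<bar>\<rho>\<bar>" for w
        using k(2)[rule_format, of w] that \<rho> by simp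
    qed
    also have "\<dots> = Re (3 * E (\<psi> 0))"
      by (rule cmean_Re_holomorphic[of _ "ball 0 1"]) (use \<rho> in \<open>auto intro!: holomorphic_intros holomorphic_psi E(1)\<close>)
    finally show "cmean (\<lambda>z. (cmod (k z))\<^sup>2) 0 \<rho> \<le> Re (3 * E (\<psi> 0))" .
  qed blast
  have "compact (k ` cball 0 s)"
    by (intro compact_continuous_image continuous_on_subset[OF kc] compact_cball) (use s in auto)
  then have "bounded (k ` cball 0 s)" by (rule compact_imp_bounded)
  then obtain M where "\<forall>x\<in>k ` cball 0 s. norm x \<le> M" unfolding bounded_iff by blast
  then have M: "norm (k z) \<le> M" if "norm z \<le> s" for z using that by auto
  have M2: "M\<^sup>2 \<ge> 0" by simp
  define t where "t = c / (8 * (M\<^sup>2 + 1))"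
  have M21: "M\<^sup>2 + 1 > 0" using M2 by linarith
  have t: "t > 0" "2 * M\<^sup>2 * t \<le> c / 4"
  proof -
    show t0: "t > 0" using c M21 by (simp add: t_def)
    have "2 * M\<^sup>2 * t \<le> 2 * (M\<^sup>2 + 1) * t" using t0 by (intro mult_right_mono) auto
    also have "\<dots> = c / 4" using M21 by (simp add: t_def field_simps)
    finally show "2 * M\<^sup>2 * t \<le> c / 4" .
  qed
  define K where "K = (M\<^sup>2 + 1) * (cmod (E 0) + 1)"
  have K: "K > 0" using M21 by (simp add: K_def add_nonneg_pos)
  define d where "d = min 1 (c * t / (8 * K))"
  have d: "d > 0" "d \<le> 1" "2 * M\<^sup>2 / t * (d * cmod (E 0)) \<le> c / 4"
  proof -
    show d0: "d > 0" using c t(1) K by (simp add: d_def)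
    show "d \<le> 1" by (simp add: d_def)
    have "M\<^sup>2 * cmod (E 0) \<le> K" unfolding K_def by (intro mult_mono) auto
    then have "2 * M\<^sup>2 / t * (d * cmod (E 0)) \<le> 2 / t * (d * K)"
      using d0 t(1) by (simp add: field_simps mult_left_mono)
    also have "\<dots> \<le> 2 / t * (c * t / (8 * K) * K)"
      using t(1) K by (intro mult_left_mono mult_right_mono) (auto simp: d_def)
    also have "\<dots> = c / 4" using t(1) K by simp
    finally show "2 * M\<^sup>2 / t * (d * cmod (E 0)) \<le> c / 4" .
  qed
  define O' where "O' z = 1 / (1 + of_real d * E z)" for z
  have dE: "0 \<le> Re (of_real d * E z)" "d \<le> Re (of_real d * E z)" if "z \<in> \<Omega>" for z
  proof -
    have "d * 1 \<le> d * Re (E z)" using d(1) E1[OF that] by (intro mult_left_mono) auto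
    then show "d \<le> Re (of_real d * E z)" "0 \<le> Re (of_real d * E z)" using d(1) by auto
  qed
  have ne: "1 + of_real d * E z \<noteq> 0" if "z \<in> \<Omega>" for z
    using dE(1)[OF that] by (auto simp: complex_eq_iff)
  have Oh: "O' holomorphic_on \<Omega>" unfolding O'_def[abs_def] using ne by (intro holomorphic_intros E(1)) auto
  note Ob = one_minus_inverse_bounds[OF dE(1), folded O'_def]
  define F where "F z = f z * O' z" for z
  have Fh: "F holomorphic_on \<Omega>" unfolding F_def[abs_def] by (intro holomorphic_intros f Oh)
  have diff: "pw (\<lambda>z. f z - F z) z = pw f z * cmod (1 - O' z) powr p" for z
  proof -
    have "f z - F z = f z * (1 - O' z)" by (simp add: F_def algebra_simps)
    then show ?thesis by (simp add: norm_mult powr_mult)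
  qed
  have small: "cmod (1 - O' z) powr p \<le> cmod (1 - O' z)" if "z \<in> \<Omega>" for z
    using powr_mono'[of 1 p "cmod (1 - O' z)"] p Ob(2)[OF that] by simp
  show thesis
  proof (rule that[OF Fh, of "(1 / d) powr (1 / p)"]; intro ballI allI impI)
    fix z assume z: "z \<in> \<Omega>"
    have n1: "1 \<le> cmod (1 + of_real d * E z)"
      using dE(1)[OF z] complex_Re_le_cmod[of "1 + of_real d * E z"] by simp
    then have n2: "0 < cmod (1 + of_real d * E z)" by linarith
    have "pw F z = pw f z / cmod (1 + of_real d * E z) powr p"
      by (simp add: F_def O'_def norm_mult norm_divide powr_divide)
    \<comment> \<open>The modulus of the denominator is at least 1, so its \<open>p\<close>-th power
      is at least the modulus itself.\<close>
    also have "\<dots> \<le> pw f z / cmod (1 + of_real d * E z)"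
    proof (rule divide_left_mono)
      show "cmod (1 + of_real d * E z) \<le> cmod (1 + of_real d * E z) powr p"
        using powr_mono[of 1 p "cmod (1 + of_real d * E z)"] p n1 by simp
    qed (use n2 in auto)
    also have "\<dots> \<le> 1 / d"
    proof -
      have "d * pw f z \<le> d * Re (E z)" using E(2)[OF z] d(1) by (intro mult_left_mono) auto
      also have "\<dots> \<le> cmod (1 + of_real d * E z)" using complex_Re_le_cmod[of "1 + of_real d * E z"] by simp
      finally have "pw f z * d \<le> cmod (1 + of_real d * E z)" by (simp add: mult.commute)
      then show ?thesis using n2 d(1) by (subst pos_divide_le_eq, simp, simp add: pos_le_divide_eq)
    qed
    finally have "pw F z powr (1 / p) \<le> (1 / d) powr (1 / p)" using p by (intro powr_mono2) auto
    then show "cmod (F z) \<le> (1 / d) powr (1 / p)" using p by (simp add: powr_powr)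
    have "cmod (1 - O' z) powr p \<le> 1" using small[OF z] Ob(2)[OF z] by linarith
    then have "pw (\<lambda>z. f z - F z) z \<le> pw f z" unfolding diff by (simp add: mult_left_le)
    then show "pw (\<lambda>z. f z - F z) z \<le> Re (E z)" using E(2)[OF z] by linarith
  next
    fix \<rho> :: real assume "0 < \<rho> \<and> \<rho> < 1"
    then have \<rho>: "0 < \<rho>" "\<rho> < 1" by auto
    note sp = sphere_disc[OF \<rho>]
    define ks where "ks z = k (of_real s * z)" for z
    define W where "W z = 1 - O' (\<psi> z)" for z
    have Wh: "W holomorphic_on ball 0 1" unfolding W_def[abs_def] by (intro holomorphic_intros holomorphic_psi Oh)
    have kss: "(\<lambda>z. k (of_real s * z)) holomorphic_on ball 0 1"
    proof -
      have "(\<lambda>z. of_real s * z) ` ball 0 1 \<subseteq> ball (0::complex) 1" using scaled_in_disc[OF s(1,2)] by (auto simp: less_imp_le)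
      moreover have "(\<lambda>z. of_real s * z) holomorphic_on ball 0 1" by (intro holomorphic_intros)
      ultimately show ?thesis using holomorphic_on_compose_gen[OF _ k(1)] by (simp add: o_def)
    qed
    have c1: "continuous_on (sphere 0 \<bar>\<rho>\<bar>) (\<lambda>z. (cmod (k z - ks z))\<^sup>2)"
      unfolding ks_def by (intro continuous_intros continuous_on_subset[OF kc sp] continuous_on_subset[OF holomorphic_on_imp_continuous_on[OF kss] sp])
    have c3: "continuous_on (sphere 0 \<bar>\<rho>\<bar>) (\<lambda>z. Re (W z))"
      by (intro continuous_intros continuous_on_subset[OF holomorphic_on_imp_continuous_on[OF Wh] sp])
    have "cmean (\<lambda>z. pw (\<lambda>z. f z - F z) (\<psi> z)) 0 \<rho> \<le>
        cmean (\<lambda>z. (2 * (cmod (k z - ks z))\<^sup>2 + 2 * M\<^sup>2 * t) + 2 * M\<^sup>2 / t * Re (W z)) 0 \<rho>"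
    proof (rule cmean_mono)
      show "continuous_on (sphere 0 \<bar>\<rho>\<bar>) (\<lambda>z. pw (\<lambda>z. f z - F z) (\<psi> z))"
        by (rule continuous_on_subset[OF pw_continuous[OF holomorphic_psi[OF holomorphic_on_diff[OF f Fh]]] sp])
      show "continuous_on (sphere 0 \<bar>\<rho>\<bar>) (\<lambda>z. (2 * (cmod (k z - ks z))\<^sup>2 + 2 * M\<^sup>2 * t) + 2 * M\<^sup>2 / t * Re (W z))"
        by (intro continuous_on_add continuous_on_mult continuous_on_const c1 c3)
      fix z :: complex assume "z \<in> sphere 0 \<bar>\<rho>\<bar>"
      then have z: "norm z < 1" "norm z = \<rho>" using \<rho> by auto
      have z\<Omega>: "\<psi> z \<in> \<Omega>" using \<psi>_disc[OF z(1)] by simp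
      have W1: "cmod (W z) \<le> 1" "(cmod (W z))\<^sup>2 \<le> Re (W z)" unfolding W_def using Ob(2,4)[OF z\<Omega>] by simp_all
      have "norm (of_real s * z) \<le> s" using z s(1) by (simp add: norm_mult mult_left_le)
      then have "(cmod (ks z))\<^sup>2 \<le> M\<^sup>2" unfolding ks_def by (intro power_mono M) auto
      moreover have "(cmod (k z))\<^sup>2 \<le> 2 * (cmod (k z - ks z))\<^sup>2 + 2 * (cmod (ks z))\<^sup>2"
        using norm_sum_square_le[of "k z - ks z" "ks z"] by simp
      ultimately have k2: "(cmod (k z))\<^sup>2 \<le> 2 * (cmod (k z - ks z))\<^sup>2 + 2 * M\<^sup>2" by linarith
      have "pw (\<lambda>z. f z - F z) (\<psi> z) \<le> (cmod (k z))\<^sup>2 * cmod (W z)"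
        unfolding diff W_def using small[OF z\<Omega>] k(2)[rule_format, OF z(1)] by (intro mult_mono) auto
      also have "\<dots> \<le> (2 * (cmod (k z - ks z))\<^sup>2 + 2 * M\<^sup>2) * cmod (W z)" by (intro mult_right_mono k2) simp
      also have "\<dots> = 2 * (cmod (k z - ks z))\<^sup>2 * cmod (W z) + 2 * M\<^sup>2 * cmod (W z)" by (simp add: algebra_simps)
      also have "\<dots> \<le> 2 * (cmod (k z - ks z))\<^sup>2 * 1 + 2 * M\<^sup>2 * (t + Re (W z) / t)"
      proof (intro add_mono mult_left_mono W1)
        have "cmod (W z) \<le> t + (cmod (W z))\<^sup>2 / t" by (rule le_plus_square[OF t(1)])
        also have "\<dots> \<le> t + Re (W z) / t" using W1(2) t(1) by (intro add_left_mono divide_right_mono) auto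
        finally show "cmod (W z) \<le> t + Re (W z) / t" .
      qed auto
      also have "\<dots> = (2 * (cmod (k z - ks z))\<^sup>2 + 2 * M\<^sup>2 * t) + 2 * M\<^sup>2 / t * Re (W z)" by (simp add: algebra_simps)
      finally show "pw (\<lambda>z. f z - F z) (\<psi> z) \<le> (2 * (cmod (k z - ks z))\<^sup>2 + 2 * M\<^sup>2 * t) + 2 * M\<^sup>2 / t * Re (W z)" .
    qed
    also have "\<dots> = (2 * cmean (\<lambda>z. (cmod (k z - ks z))\<^sup>2) 0 \<rho> + 2 * M\<^sup>2 * t) + 2 * M\<^sup>2 / t * cmean (\<lambda>z. Re (W z)) 0 \<rho>"
      using c1 c3 by (simp only: cmean_add cmean_mult_left cmean_const continuous_on_add continuous_on_mult continuous_on_const)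
    also have "cmean (\<lambda>z. Re (W z)) 0 \<rho> = Re (W 0)"
      by (rule cmean_Re_holomorphic[OF Wh]) (use \<rho> in auto)
    finally have mean: "cmean (\<lambda>z. pw (\<lambda>z. f z - F z) (\<psi> z)) 0 \<rho> \<le>
      (2 * cmean (\<lambda>z. (cmod (k z - ks z))\<^sup>2) 0 \<rho> + 2 * M\<^sup>2 * t) + 2 * M\<^sup>2 / t * Re (W 0)" .
    have "Re (W 0) \<le> cmod (W 0)" by (rule complex_Re_le_cmod)
    also have "\<dots> \<le> cmod (of_real d * E 0)" unfolding W_def psi_0 by (rule Ob(3)[OF zero(1)])
    also have "\<dots> = d * cmod (E 0)" using d(1) by (simp add: norm_mult)
    finally have "2 * M\<^sup>2 / t * Re (W 0) \<le> 2 * M\<^sup>2 / t * (d * cmod (E 0))" using t(1) by (intro mult_left_mono) auto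
    with mean show "cmean (\<lambda>z. pw (\<lambda>z. f z - F z) (\<psi> z)) 0 \<rho> \<le> c"
      using s(3)[OF \<rho>, folded ks_def] t(2) d(3) c by linarith
  qed
qed

end

context disc_exhaustion begin

text \<open>\<open>T\<close> is close in mean to its dilate. On the smaller disc \<open>T\<close> is
  Lipschitz, so the dilate changes little when \<open>z\<close> is replaced by
  \<open>\<sigma> z\<close>, where \<open>\<sigma>\<close> is
  \<open>\<theta> \<circ> \<psi>\<close>. By the Schwarz lemma the mean square of
  \<open>z - \<sigma> z\<close> is controlled by \<open>1 - Re (deriv \<sigma> 0)\<close>, which
  \<open>outer\<close> makes small.\<close>

lemma bounded_approximation:
  assumes outer: "\<And>e. e > 0 \<Longrightarrow> \<exists>\<theta>. \<theta> holomorphic_on \<Omega> \<and> continuous_on (closure \<Omega>) \<theta> \<and> (\<forall>z\<in>closure \<Omega>. norm (\<theta> z) < 1) \<and>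
      \<theta> 0 = 0 \<and> Re (deriv (\<lambda>w. \<theta> (\<psi> w)) 0) > 1 - e"
    and F: "F holomorphic_on \<Omega>" "\<And>z. z \<in> \<Omega> \<Longrightarrow> cmod (F z) \<le> B" and c: "c > 0"
  obtains g where "g \<in> holo_continuous_algebra \<Omega>" "\<forall>z\<in>\<Omega>. cmod (g z) \<le> B"
    "\<forall>\<rho>. 0 < \<rho> \<and> \<rho> < 1 \<longrightarrow> cmean (\<lambda>z. pw (\<lambda>z. F z - g z) (\<psi> z)) 0 \<rho> \<le> c"
proof -
  have B0: "0 \<le> B" using F(2)[OF zero(1)] norm_ge_zero order_trans by blast
  define T where "T z = F (\<psi> z)" for z
  have T: "T holomorphic_on ball 0 1" unfolding T_def[abs_def] by (rule holomorphic_psi[OF F(1)])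
  have TB: "cmod (T z) \<le> B" if "norm z < 1" for z using F(2) \<psi>_disc[OF that] by (simp add: T_def)
  note Tc = holomorphic_on_imp_continuous_on[OF T]
  \<comment> \<open>Differences of functions bounded by \<open>B\<close> have modulus
    \<open>x \<le> 2 * B\<close>, whence \<open>x powr p \<le> P * x\<close>; the summand 1 keeps
    \<open>P\<close> positive. Below, \<open>t\<close>, \<open>e1\<close> and \<open>e2\<close> each
    allot \<open>c / 4\<close> to one error term.\<close>
  define P where "P = (2 * B) powr (p - 1) + 1"
  have P: "P > 0" by (simp add: P_def add_nonneg_pos)
  define t where "t = c / (4 * P)"
  have t: "t > 0" "P * t = c / 4" using c P by (simp_all add: t_def)
  have e1: "t * c / (8 * P) > 0" using t(1) c P by simp
  obtain s where s: "0 < s" "s < 1"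
    "\<And>\<rho>. 0 < \<rho> \<Longrightarrow> \<rho> < 1 \<Longrightarrow> cmean (\<lambda>z. (cmod (T z - T (of_real s * z)))\<^sup>2) 0 \<rho> \<le> t * c / (8 * P)"
  proof (rule H2_dilation[OF T _ e1])
    fix \<rho> :: real assume \<rho>: "0 < \<rho>" "\<rho> < 1"
    have "cmean (\<lambda>z. (cmod (T z))\<^sup>2) 0 \<rho> \<le> cmean (\<lambda>z. B\<^sup>2) 0 \<rho>"
    proof (rule cmean_mono)
      show "continuous_on (sphere 0 \<bar>\<rho>\<bar>) (\<lambda>z. (cmod (T z))\<^sup>2)"
        by (intro continuous_intros continuous_on_subset[OF Tc sphere_disc[OF \<rho>]])
      show "(cmod (T w))\<^sup>2 \<le> B\<^sup>2" if "w \<in> sphere 0 \<bar>\<rho>\<bar>" for w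
        using TB[of w] that \<rho> by (intro power_mono) auto
    qed (rule continuous_on_const)
    then show "cmean (\<lambda>z. (cmod (T z))\<^sup>2) 0 \<rho> \<le> B\<^sup>2" by simp
  qed blast
  have dT: "deriv T holomorphic_on ball 0 1" by (rule holomorphic_deriv[OF T open_ball])
  have "compact (deriv T ` cball 0 s)"
    by (intro compact_continuous_image continuous_on_subset[OF holomorphic_on_imp_continuous_on[OF dT]] compact_cball) (use s in auto)
  then have "bounded (deriv T ` cball 0 s)" by (rule compact_imp_bounded)
  then obtain \<Lambda> where \<Lambda>: "\<forall>x\<in>deriv T ` cball 0 s. norm x \<le> \<Lambda>" unfolding bounded_iff by blast
  have "norm (deriv T 0) \<le> \<Lambda>" using \<Lambda> s(1) by auto
  then have \<Lambda>0: "0 \<le> \<Lambda>" using norm_ge_zero order_trans by blast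
  have Lip: "norm (T x - T y) \<le> \<Lambda> * norm (x - y)" if "norm x \<le> s" "norm y \<le> s" for x y
  proof (rule field_differentiable_bound[of "cball 0 s"])
    show "(T has_field_derivative deriv T z) (at z within cball 0 s)" if "z \<in> cball 0 s" for z
      by (rule has_field_derivative_at_within[OF holomorphic_derivI[OF T open_ball]]) (use that s in auto)
  qed (use that \<Lambda> in auto)
  have \<Lambda>21: "\<Lambda>\<^sup>2 + 1 > 0" by (simp add: add_nonneg_pos)
  define e2 where "e2 = c * t / (16 * P * (\<Lambda>\<^sup>2 + 1))"
  have e2: "e2 > 0" "P * (4 * \<Lambda>\<^sup>2 * e2 / t) \<le> c / 4"
  proof -
    show e0: "e2 > 0" unfolding e2_def using c t(1) P \<Lambda>21 by simp
    have "P * (4 * \<Lambda>\<^sup>2 * e2 / t) \<le> P * (4 * (\<Lambda>\<^sup>2 + 1) * e2 / t)"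
      using P e0 t(1) by (intro mult_left_mono divide_right_mono mult_right_mono) auto
    also have "\<dots> = c / 4"
    proof -
      have "P * (4 * Y * (c * t / (16 * P * Y)) / t) = c / 4" if "Y > 0" for Y using P t(1) that by (simp add: field_simps)
      from this[OF \<Lambda>21] show ?thesis unfolding e2_def .
    qed
    finally show "P * (4 * \<Lambda>\<^sup>2 * e2 / t) \<le> c / 4" .
  qed
  obtain \<theta> where \<theta>: "\<theta> holomorphic_on \<Omega>" "continuous_on (closure \<Omega>) \<theta>" "\<forall>z\<in>closure \<Omega>. norm (\<theta> z) < 1" "\<theta> 0 = 0"
    "Re (deriv (\<lambda>w. \<theta> (\<psi> w)) 0) > 1 - e2"
    using outer[OF e2(1)] by blast
  have \<theta>\<Omega>: "norm (\<theta> z) < 1" if "z \<in> \<Omega>" for z using \<theta>(3) that closure_subset by blast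
  define \<sigma> where "\<sigma> w = \<theta> (\<psi> w)" for w
  have \<sigma>: "\<sigma> holomorphic_on ball 0 1" unfolding \<sigma>_def[abs_def] by (rule holomorphic_psi[OF \<theta>(1)])
  have \<sigma>0: "\<sigma> 0 = 0" by (simp add: \<sigma>_def psi_0 \<theta>(4))
  have \<sigma>1: "norm (\<sigma> z) < 1" if "norm z < 1" for z using \<theta>\<Omega> \<psi>_disc[OF that] by (simp add: \<sigma>_def)
  have Schwarz: "norm (\<sigma> z) \<le> norm z" if "norm z < 1" for z by (rule Schwarz_Lemma(1)[OF \<sigma> \<sigma>0 \<sigma>1 that])
  \<comment> \<open>The quotient \<open>\<sigma> z / z\<close> with its singularity removed, so that
    the circle mean of its real part is \<open>Re (deriv \<sigma> 0)\<close>.\<close>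
  define \<tau> where "\<tau> z = (if z = 0 then deriv \<sigma> 0 else (\<sigma> z - \<sigma> 0) / (z - 0))" for z
  have \<tau>: "\<tau> holomorphic_on ball 0 1" unfolding \<tau>_def[abs_def] by (rule pole_lemma[OF \<sigma>]) simp
  have ss: "norm (of_real s * z :: complex) < 1" if "norm z < 1" for z
    using scaled_in_disc[OF s(1,2), of z] that by simp
  define g where "g z = T (of_real s * \<theta> z)" for z
  have gh: "g holomorphic_on \<Omega>"
  proof -
    have "(\<lambda>z. of_real s * \<theta> z) ` \<Omega> \<subseteq> ball 0 1" using ss \<theta>\<Omega> by auto
    moreover have "(\<lambda>z. of_real s * \<theta> z) holomorphic_on \<Omega>" by (intro holomorphic_intros \<theta>)
    ultimately show ?thesis using holomorphic_on_compose_gen[OF _ T] by (simp add: g_def[abs_def] o_def)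
  qed
  have gc: "continuous_on (closure \<Omega>) g" unfolding g_def[abs_def]
    by (rule continuous_on_compose2[OF Tc]) (use ss \<theta>(2,3) in \<open>auto intro!: continuous_intros\<close>)
  have gB: "cmod (g z) \<le> B" if "z \<in> \<Omega>" for z unfolding g_def by (intro TB ss \<theta>\<Omega> that)
  show thesis
  proof (rule that[of g])
    show "g \<in> holo_continuous_algebra \<Omega>" using gh gc by (simp add: holo_continuous_algebra_def)
    show "\<forall>z\<in>\<Omega>. cmod (g z) \<le> B" using gB by blast
    show "\<forall>\<rho>. 0 < \<rho> \<and> \<rho> < 1 \<longrightarrow> cmean (\<lambda>z. pw (\<lambda>z. F z - g z) (\<psi> z)) 0 \<rho> \<le> c"
    proof (intro allI impI)
      fix \<rho> :: real assume "0 < \<rho> \<and> \<rho> < 1"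
      then have \<rho>: "0 < \<rho>" "\<rho> < 1" by auto
      note sp = sphere_disc[OF \<rho>]
      define V where "V z = (cmod (T z - T (of_real s * z)))\<^sup>2" for z
      have cV: "continuous_on (sphere 0 \<bar>\<rho>\<bar>) V"
        unfolding V_def[abs_def]
        by (intro continuous_on_power continuous_on_norm continuous_on_diff continuous_on_subset[OF Tc sp]
          continuous_on_compose2[OF Tc, of _ "\<lambda>z. of_real s * z"] continuous_intros) (use ss \<rho> in auto)
      have c\<tau>: "continuous_on (sphere 0 \<bar>\<rho>\<bar>) (\<lambda>z. Re (\<tau> z))"
        by (intro continuous_on_Re continuous_on_subset[OF holomorphic_on_imp_continuous_on[OF \<tau>] sp])
      have "cmean (\<lambda>z. pw (\<lambda>z. F z - g z) (\<psi> z)) 0 \<rho> \<le>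
        cmean (\<lambda>z. (P * t + 2 * P / t * V z) + (4 * P * \<Lambda>\<^sup>2 * \<rho>\<^sup>2 / t) * (1 - Re (\<tau> z))) 0 \<rho>"
      proof (rule cmean_mono)
        show "continuous_on (sphere 0 \<bar>\<rho>\<bar>) (\<lambda>z. pw (\<lambda>z. F z - g z) (\<psi> z))"
          by (rule continuous_on_subset[OF pw_continuous[OF holomorphic_psi[OF holomorphic_on_diff[OF F(1) gh]]] sp])
        show "continuous_on (sphere 0 \<bar>\<rho>\<bar>) (\<lambda>z. (P * t + 2 * P / t * V z) + (4 * P * \<Lambda>\<^sup>2 * \<rho>\<^sup>2 / t) * (1 - Re (\<tau> z)))"
          by (intro continuous_on_add continuous_on_mult continuous_on_diff continuous_on_const cV c\<tau>)
        fix z :: complex assume "z \<in> sphere 0 \<bar>\<rho>\<bar>"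
        then have z: "norm z < 1" "norm z = \<rho>" using \<rho> by auto
        have z\<Omega>: "\<psi> z \<in> \<Omega>" using \<psi>_disc[OF z(1)] by simp
        define x where "x = cmod (F (\<psi> z) - g (\<psi> z))"
        have x0: "0 \<le> x" by (simp add: x_def)
        have x2B: "x \<le> 2 * B"
          using norm_triangle_ineq4[of "F (\<psi> z)" "g (\<psi> z)"] F(2)[OF z\<Omega>] gB[OF z\<Omega>] by (simp add: x_def)
        have "x powr p \<le> P * x"
        proof (cases "x = 0")
          case False
          then have "x powr p = x powr (p - 1) * x" using x0 by (simp add: powr_diff)
          also have "\<dots> \<le> P * x"
          proof (intro mult_right_mono x0)
            have "x powr (p - 1) \<le> (2 * B) powr (p - 1)" using x0 x2B p by (intro powr_mono2) auto
            then show "x powr (p - 1) \<le> P" by (simp add: P_def)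
          qed
          finally show ?thesis .
        qed simp
        also have "\<dots> \<le> P * (t + x\<^sup>2 / t)" using P by (intro mult_left_mono le_plus_square[OF t(1)]) auto
        also have "\<dots> \<le> P * (t + (2 * V z + 2 * (\<Lambda>\<^sup>2 * (2 * \<rho>\<^sup>2 * (1 - Re (\<tau> z))))) / t)"
        proof -
          have zs: "norm (of_real s * z) \<le> s" "norm (of_real s * \<sigma> z) \<le> s"
            using z \<sigma>1[OF z(1)] s(1) by (simp_all add: norm_mult mult_left_le)
          have "norm (T (of_real s * z) - T (of_real s * \<sigma> z)) \<le> \<Lambda> * norm (of_real s * z - of_real s * \<sigma> z)"
            by (rule Lip[OF zs])
          also have "\<dots> = \<Lambda> * (s * norm (z - \<sigma> z))"
            using s(1) by (simp add: norm_mult flip: right_diff_distrib)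
          also have "\<dots> \<le> \<Lambda> * (1 * norm (z - \<sigma> z))" using s \<Lambda>0 by (intro mult_left_mono mult_right_mono) auto
          finally have "(norm (T (of_real s * z) - T (of_real s * \<sigma> z)))\<^sup>2 \<le> (\<Lambda> * norm (z - \<sigma> z))\<^sup>2"
            by (intro power_mono) auto
          moreover have "x\<^sup>2 \<le> 2 * V z + 2 * (norm (T (of_real s * z) - T (of_real s * \<sigma> z)))\<^sup>2"
            using norm_sum_square_le[of "T z - T (of_real s * z)" "T (of_real s * z) - T (of_real s * \<sigma> z)"]
            by (simp add: x_def V_def T_def[of z] g_def \<sigma>_def)
          \<comment> \<open>With \<open>\<sigma> z = z * \<tau> z\<close> and
            \<open>norm (\<sigma> z) \<le> \<rho>\<close>, expanding the square leaves a bound that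
            is linear in \<open>Re (\<tau> z)\<close>, whose mean is known exactly.\<close>
          moreover have "(norm (z - \<sigma> z))\<^sup>2 \<le> 2 * \<rho>\<^sup>2 * (1 - Re (\<tau> z))"
          proof -
            have "z \<noteq> 0" using z \<rho> by auto
            then have st: "\<sigma> z = z * \<tau> z" by (simp add: \<tau>_def \<sigma>0)
            have "(norm (\<sigma> z))\<^sup>2 \<le> \<rho>\<^sup>2" using Schwarz[OF z(1)] z(2) by (intro power_mono) auto
            moreover have "(norm (z - \<sigma> z))\<^sup>2 = (norm z)\<^sup>2 + (norm (\<sigma> z))\<^sup>2 - 2 * ((norm z)\<^sup>2 * Re (\<tau> z))"
              unfolding st cmod_power2 by (simp add: algebra_simps power2_eq_square)
            ultimately show ?thesis unfolding z(2) by (simp add: algebra_simps)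
          qed
          then have "\<Lambda>\<^sup>2 * (norm (z - \<sigma> z))\<^sup>2 \<le> \<Lambda>\<^sup>2 * (2 * \<rho>\<^sup>2 * (1 - Re (\<tau> z)))" by (intro mult_left_mono) auto
          ultimately have "x\<^sup>2 \<le> 2 * V z + 2 * (\<Lambda>\<^sup>2 * (2 * \<rho>\<^sup>2 * (1 - Re (\<tau> z))))" by (simp only: power_mult_distrib)
          then show ?thesis using P t(1) by (intro mult_left_mono add_left_mono divide_right_mono) auto
        qed
        also have "\<dots> = (P * t + 2 * P / t * V z) + (4 * P * \<Lambda>\<^sup>2 * \<rho>\<^sup>2 / t) * (1 - Re (\<tau> z))"
          by (simp add: algebra_simps add_divide_distrib diff_divide_distrib)
        finally show "pw (\<lambda>z. F z - g z) (\<psi> z) \<le> (P * t + 2 * P / t * V z) + (4 * P * \<Lambda>\<^sup>2 * \<rho>\<^sup>2 / t) * (1 - Re (\<tau> z))"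
          by (simp add: x_def)
      qed
      also have "\<dots> = (P * t + 2 * P / t * cmean V 0 \<rho>) + (4 * P * \<Lambda>\<^sup>2 * \<rho>\<^sup>2 / t) * (1 - cmean (\<lambda>z. Re (\<tau> z)) 0 \<rho>)"
        using cV c\<tau> by (simp only: cmean_add cmean_diff cmean_mult_left cmean_const continuous_on_add continuous_on_diff continuous_on_mult continuous_on_const)
      also have "cmean (\<lambda>z. Re (\<tau> z)) 0 \<rho> = Re (\<tau> 0)"
        by (rule cmean_Re_holomorphic[OF \<tau>]) (use \<rho> in auto)
      also have "(4 * P * \<Lambda>\<^sup>2 * \<rho>\<^sup>2 / t) * (1 - Re (\<tau> 0)) \<le> (4 * P * \<Lambda>\<^sup>2 * 1 / t) * e2"
      proof (rule mult_mono)
        have "\<rho>\<^sup>2 \<le> 1" using \<rho> by (simp add: abs_square_le_1)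
        then show "4 * P * \<Lambda>\<^sup>2 * \<rho>\<^sup>2 / t \<le> 4 * P * \<Lambda>\<^sup>2 * 1 / t" using P t(1) by (intro divide_right_mono mult_left_mono) auto
        have "\<tau> 0 = deriv \<sigma> 0" by (simp add: \<tau>_def)
        then show "1 - Re (\<tau> 0) \<le> e2" using \<theta>(5) by (simp add: \<sigma>_def[abs_def])
        have "norm (\<tau> 0) \<le> 1" using Schwarz_Lemma(2)[OF \<sigma> \<sigma>0 \<sigma>1, of 0] by (simp add: \<tau>_def)
        then show "0 \<le> 1 - Re (\<tau> 0)" using complex_Re_le_cmod[of "\<tau> 0"] by linarith
      qed (use P t(1) in auto)
      also have "(4 * P * \<Lambda>\<^sup>2 * 1 / t) * e2 = P * (4 * \<Lambda>\<^sup>2 * e2 / t)" by simp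
      finally have "cmean (\<lambda>z. pw (\<lambda>z. F z - g z) (\<psi> z)) 0 \<rho> \<le> (P * t + 2 * P / t * cmean V 0 \<rho>) + P * (4 * \<Lambda>\<^sup>2 * e2 / t)" by simp
      moreover have "2 * P / t * cmean V 0 \<rho> \<le> 2 * P / t * (t * c / (8 * P))"
        using s(3)[OF \<rho>] P t(1) unfolding V_def by (intro mult_left_mono) auto
      moreover have "2 * P / t * (t * c / (8 * P)) = c / 4" using P t(1) by simp
      ultimately show "cmean (\<lambda>z. pw (\<lambda>z. F z - g z) (\<psi> z)) 0 \<rho> \<le> c" using t(2) e2(2) c by linarith
    qed
  qed
qed

text \<open>The smallness criterion is used with two majorants: \<open>Re E\<close> for
  \<open>f - F\<close>, and the constant \<open>(2 * B) powr p\<close> for \<open>F - g\<close>,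
  where both functions are bounded by \<open>B\<close>. The constant has finite mass because
  \<open>N\<close> has.\<close>

lemma algebra_dense_in_hardy:
  assumes outer: "\<And>e. e > 0 \<Longrightarrow> \<exists>\<theta>. \<theta> holomorphic_on \<Omega> \<and> continuous_on (closure \<Omega>) \<theta> \<and> (\<forall>z\<in>closure \<Omega>. norm (\<theta> z) < 1) \<and>
      \<theta> 0 = 0 \<and> Re (deriv (\<lambda>w. \<theta> (\<psi> w)) 0) > 1 - e"
    and f: "f \<in> hardy_space \<kappa> \<Omega> u p" and \<epsilon>: "\<epsilon> > 0"
  shows "\<exists>g\<in>holo_continuous_algebra \<Omega>. hardy_norm \<kappa> \<Omega> u p (\<lambda>z. f z - g z) < \<epsilon>"
proof (cases "mass > 0")
  case False
  \<comment> \<open>For \<open>N = 0\<close> no disc of positive mass is available to normalize the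
    majorants. But \<open>f\<close> is bounded on each level set and level measures have mass at
    most \<open>mass\<close>, so all level integrals vanish and 0 approximates
    \<open>f\<close>.\<close>
  then have m: "mass = 0" by (simp add: less_le)
  have fh: "f holomorphic_on \<Omega>" using f by (simp add: hardy_space_def)
  have "level_int (pw f) r \<le> 0" if r: "r < 0" for r
  proof -
    let ?K = "{z\<in>\<Omega>. u z \<le> ereal r}"
    have "compact (pw f ` ?K)"
      by (intro compact_continuous_image compact_sublevel[OF r] continuous_on_subset[OF pw_continuous[OF fh]]) auto
    then have "bounded (pw f ` ?K)" by (rule compact_imp_bounded)
    then obtain b where "\<forall>x\<in>pw f ` ?K. norm x \<le> b" unfolding bounded_iff by blast
    then have "pw f z \<le> \<bar>b\<bar>" if "z \<in> \<Omega>" "u z = ereal r" for z using that by force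
    from level_int_le_const[OF pw_continuous[OF fh] r abs_ge_zero this] show ?thesis by (simp add: m)
  qed
  from hardy_bound(2)[OF fh order_refl this] have "hardy_norm \<kappa> \<Omega> u p (\<lambda>z. f z - 0) \<le> 0" by simp
  moreover have "(\<lambda>_. 0) \<in> holo_continuous_algebra \<Omega>" by (simp add: holo_continuous_algebra_def)
  ultimately show ?thesis using \<epsilon> by (intro bexI[of _ "\<lambda>_. 0"]) auto
next
  case True
  have fh: "f holomorphic_on \<Omega>" using f by (simp add: hardy_space_def)
  obtain A where A: "\<And>r. r < 0 \<Longrightarrow> level_int (pw f) r \<le> A" by (rule hardy_space_bounded[OF f]) blast
  obtain E where E: "E holomorphic_on \<Omega>" "\<forall>z\<in>\<Omega>. pw f z + 1 \<le> Re (E z)" "integrable N (\<lambda>z. Re (E z))"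
    by (rule harmonic_majorant[OF fh A True]) blast
  have E0: "0 \<le> Re (E z)" if "z \<in> \<Omega>" for z
  proof -
    have "0 \<le> pw f z" by simp
    then show ?thesis using E(2)[rule_format, OF that] by linarith
  qed
  define X where "X = (\<epsilon> / 2) powr p"
  have X: "X > 0" using \<epsilon> by (simp add: X_def)
  \<comment> \<open>Splitting the difference costs the factor \<open>2 powr p\<close>. With this
    \<open>\<eta>\<close> both parts together give \<open>X\<close>, that is a norm of at most
    \<open>\<epsilon> / 2\<close>.\<close>
  define \<eta> where "\<eta> = X / (2 * 2 powr p)"
  have \<eta>: "\<eta> > 0" "2 powr p * (\<eta> + \<eta>) = X" using X by (simp_all add: \<eta>_def)
  obtain c1 where c1: "c1 > 0"
    "\<forall>F r. F holomorphic_on \<Omega> \<and> (\<forall>z\<in>\<Omega>. pw F z \<le> Re (E z)) \<and>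
       (\<forall>\<rho>. 0 < \<rho> \<and> \<rho> < 1 \<longrightarrow> cmean (\<lambda>z. pw F (\<psi> z)) 0 \<rho> \<le> c1) \<and> r < 0 \<longrightarrow> level_int (pw F) r \<le> \<eta>"
    by (rule small_level_integral[OF E(1) E0 E(3) \<eta>(1)]) blast
  obtain F B where F: "F holomorphic_on \<Omega>" "\<forall>z\<in>\<Omega>. cmod (F z) \<le> B"
    "\<forall>z\<in>\<Omega>. pw (\<lambda>z. f z - F z) z \<le> Re (E z)"
    "\<forall>\<rho>. 0 < \<rho> \<and> \<rho> < 1 \<longrightarrow> cmean (\<lambda>z. pw (\<lambda>z. f z - F z) (\<psi> z)) 0 \<rho> \<le> c1"
    by (rule bounded_cut[OF fh E(1) E(2)[rule_format] c1(1)]) blast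
  have fF: "level_int (pw (\<lambda>z. f z - F z)) r \<le> \<eta>" if "r < 0" for r
    using c1(2) holomorphic_on_diff[OF fh F(1)] F(3,4) that by blast
  let ?b = "complex_of_real ((2 * B) powr p)"
  have b: "0 \<le> Re ?b" by simp
  obtain c2 where c2: "c2 > 0"
    "\<forall>F r. F holomorphic_on \<Omega> \<and> (\<forall>z\<in>\<Omega>. pw F z \<le> Re ?b) \<and>
       (\<forall>\<rho>. 0 < \<rho> \<and> \<rho> < 1 \<longrightarrow> cmean (\<lambda>z. pw F (\<psi> z)) 0 \<rho> \<le> c2) \<and> r < 0 \<longrightarrow> level_int (pw F) r \<le> \<eta>"
    by (rule small_level_integral[OF holomorphic_on_const b N.integrable_const \<eta>(1)]) blast
  obtain g where g: "g \<in> holo_continuous_algebra \<Omega>" "\<forall>z\<in>\<Omega>. cmod (g z) \<le> B"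
    "\<forall>\<rho>. 0 < \<rho> \<and> \<rho> < 1 \<longrightarrow> cmean (\<lambda>z. pw (\<lambda>z. F z - g z) (\<psi> z)) 0 \<rho> \<le> c2"
    by (rule bounded_approximation[OF outer F(1) F(2)[rule_format] c2(1)]) blast
  have gh: "g holomorphic_on \<Omega>" using g(1) by (simp add: holo_continuous_algebra_def)
  have Fg: "level_int (pw (\<lambda>z. F z - g z)) r \<le> \<eta>" if "r < 0" for r
  proof -
    have "pw (\<lambda>z. F z - g z) z \<le> Re ?b" if z: "z \<in> \<Omega>" for z
    proof -
      have "cmod (F z - g z) \<le> 2 * B" using norm_triangle_ineq4[of "F z" "g z"] F(2) g(2) z by force
      then show ?thesis using p by (simp add: powr_mono2)
    qed
    then show ?thesis using c2(2) holomorphic_on_diff[OF F(1) gh] g(3) that by blast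
  qed
  have fgh: "(\<lambda>z. f z - g z) holomorphic_on \<Omega>" by (rule holomorphic_on_diff[OF fh gh])
  have "level_int (pw (\<lambda>z. f z - g z)) r \<le> X" if r: "r < 0" for r
  proof -
    note c1 = pw_continuous[OF holomorphic_on_diff[OF fh F(1)]] and c2 = pw_continuous[OF holomorphic_on_diff[OF F(1) gh]]
    have "level_int (pw (\<lambda>z. f z - g z)) r \<le> level_int (\<lambda>z. 2 powr p * (pw (\<lambda>z. f z - F z) z + pw (\<lambda>z. F z - g z) z)) r"
    proof (rule level_int_mono[OF pw_continuous[OF fgh] _ r])
      show "continuous_on \<Omega> (\<lambda>z. 2 powr p * (pw (\<lambda>z. f z - F z) z + pw (\<lambda>z. F z - g z) z))"
        by (intro continuous_on_mult continuous_on_add continuous_on_const c1 c2)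
      fix z
      have "cmod (f z - g z) \<le> cmod (f z - F z) + cmod (F z - g z)" by (rule norm_diff_triangle_le[OF order_refl order_refl])
      then have "cmod (f z - g z) powr p \<le> (cmod (f z - F z) + cmod (F z - g z)) powr p" using p by (intro powr_mono2) auto
      also have "\<dots> \<le> 2 powr p * (cmod (f z - F z) powr p + cmod (F z - g z) powr p)" using p by (intro powr_add_le) auto
      finally show "pw (\<lambda>z. f z - g z) z \<le> 2 powr p * (pw (\<lambda>z. f z - F z) z + pw (\<lambda>z. F z - g z) z)" .
    qed
    also have "\<dots> = 2 powr p * (level_int (pw (\<lambda>z. f z - F z)) r + level_int (pw (\<lambda>z. F z - g z)) r)"
      using level_int_mult level_int_add[OF c1 c2 r] by simp
    also have "\<dots> \<le> 2 powr p * (\<eta> + \<eta>)" by (intro mult_left_mono add_mono fF Fg r) simp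
    finally show ?thesis using \<eta>(2) by simp
  qed
  from hardy_bound(2)[OF fgh less_imp_le[OF X] this]
  have "hardy_norm \<kappa> \<Omega> u p (\<lambda>z. f z - g z) \<le> X powr (1 / p)" .
  also have "\<dots> = \<epsilon> / 2" using p \<epsilon> by (simp add: X_def powr_powr)
  also have "\<dots> < \<epsilon>" using \<epsilon> by simp
  finally show ?thesis using g(1) by blast
qed

end

theorem theorem4p2:
  fixes \<Omega> :: "complex set" and u :: "complex \<Rightarrow> ereal" and \<kappa> p :: real
  assumes "\<kappa> > 0"
    and "domain_bounded_by_analytic_Jordan_curve \<Omega>" and "0 \<in> \<Omega>"
    and "\<And>z. z \<in> \<Omega> \<Longrightarrow> u z < 0" and "continuous_on \<Omega> u" and "subharmonic_on u \<Omega>"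
    and "exhaustion \<Omega> u" and "finite_MA_mass \<kappa> \<Omega> u"
    and "1 \<le> p"
  shows "holo_continuous_algebra \<Omega> \<subseteq> hardy_space \<kappa> \<Omega> u p \<and>
    (\<forall>f \<in> hardy_space \<kappa> \<Omega> u p. \<forall>\<epsilon>>0. \<exists>g \<in> holo_continuous_algebra \<Omega>.
       hardy_norm \<kappa> \<Omega> u p (\<lambda>z. f z - g z) < \<epsilon>)"
proof -
  obtain V \<Phi> where V: "sphere 0 1 \<subseteq> V" "\<Phi> holomorphic_on V" "inj_on \<Phi> V" and \<Omega>: "open \<Omega>" "connected \<Omega>" "\<Omega> = inside (\<Phi> ` sphere 0 1)"
    using assms(2) unfolding domain_bounded_by_analytic_Jordan_curve_def analytic_Jordan_curve_def by blast
  \<comment> \<open>Composition with the circle path exhibits the curve as a simple closed path, the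
    form in which the Jordan curve theorem describes its inside and outside.\<close>
  define c where "c = \<Phi> \<circ> circlepath 0 1"
  have c: "simple_path c" unfolding c_def
  proof (rule simple_path_continuous_image)
    show "continuous_on (path_image (circlepath 0 1)) \<Phi>"
      using continuous_on_subset[OF holomorphic_on_imp_continuous_on[OF V(2)] V(1)] by simp
    show "inj_on \<Phi> (path_image (circlepath 0 1))" using inj_on_subset[OF V(3,1)] by simp
  qed (simp add: simple_path_circlepath)
  have loop: "pathfinish c = pathstart c" by (simp add: c_def pathfinish_compose pathstart_compose)
  have ci: "\<Omega> = inside (path_image c)" unfolding c_def path_image_compose using \<Omega>(3) by simp
  have bd: "bounded \<Omega>" unfolding ci by (rule bounded_inside[OF bounded_simple_path_image[OF c]])
  have sc: "simply_connected \<Omega>" unfolding ci by (rule simply_connected_inside_simple_path[OF c])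
  obtain \<phi> \<psi> where \<phi>: "\<phi> holomorphic_on \<Omega>" and \<psi>: "\<psi> holomorphic_on ball 0 1"
    and inv: "\<And>z. z \<in> \<Omega> \<Longrightarrow> norm (\<phi> z) < 1 \<and> \<psi> (\<phi> z) = z" "\<And>w. norm w < 1 \<Longrightarrow> \<psi> w \<in> \<Omega> \<and> \<phi> (\<psi> w) = w" "\<phi> 0 = 0"
    by (rule Riemann_map_normalized[OF \<Omega>(1) sc bd assms(3)]) blast
  interpret disc_exhaustion \<kappa> \<Omega> u \<phi> \<psi> p
    by unfold_locales (use assms \<Omega> \<phi> \<psi> inv in auto)
  have outer: "\<exists>\<theta>. \<theta> holomorphic_on \<Omega> \<and> continuous_on (closure \<Omega>) \<theta> \<and> (\<forall>z\<in>closure \<Omega>. norm (\<theta> z) < 1) \<and>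
      \<theta> 0 = 0 \<and> Re (deriv (\<lambda>w. \<theta> (\<psi> w)) 0) > 1 - e" if "e > 0" for e
  proof (rule outer_approximation[OF c loop ci assms(3) \<phi> \<psi> inv that])
    fix \<theta>
    assume "\<theta> holomorphic_on \<Omega>" "continuous_on (closure \<Omega>) \<theta>" "\<And>z. z \<in> closure \<Omega> \<Longrightarrow> norm (\<theta> z) < 1"
      "\<theta> 0 = 0" "Re (deriv (\<lambda>w. \<theta> (\<psi> w)) 0) > 1 - e"
    then show ?thesis by (intro exI[of _ \<theta>]) simp
  qed
  show ?thesis using algebra_subset_hardy[OF bd] algebra_dense_in_hardy[OF outer] by blast
qed

end
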